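(* The quasi-semi-simple $G^F$-conjugacy classes contained in $G^F\sigma$ are parametrised by (i.e. in bijection with) the set of pairs $(\eta,\bar{\mathfrak t})\in\{\pm1\}\times\bar{\mathfrak T}_{C,s}$, $\bar{\mathfrak t}=n_+n_-(n_i,\hat\alpha_i)_{i\in\Lambda}$, subject to the condition that $\eta=-1$ is allowed only if either $n$ is even and $n_->0$, or $n$ is odd and $n_+>0$.
   Context: $p$ is an odd prime, $q$ a power of $p$ with $q>n$, $k$ an algebraic closure of $\mathbb F_q$, $\mathfrak i\in k$ a square root of $-1$. $G=\mathrm{GL}_n(k)$ with Frobenius $F$ raising entries to the $q$-th power, $G^F=\mathrm{GL}_n(q)$. $J_n$ is the antidiagonal matrix of ones; $\sigma(g)=\mathscr Jg^{-t}\mathscr J^{-1}$ ($g^{-t}$ the transpose-inverse) with $\mathscr J=J_n$ for $n$ odd and $\mathscr J=t_0J_n$, $t_0=\mathrm{diag}(1,\dots,1,-1,\dots,-1)$ ($n/2$ ones) for $n$ even. $\bar G=G\sqcup G\sigma$ is $G\rtimes\langle\sigma\rangle$ with $\sigma^2=1$, or for $n$ even possibly $G\rtimes\langle\sigma'\rangle$ with $\sigma'(g)=J_ng^{-t}J_n^{-1}$, $\sigma'^2=1$, in which case $\sigma$ denotes $t_0\sigma'$. $F$ acts on $\bar G$ fixing $\sigma$. An element of $\bar G$ is quasi-semi-simple if its conjugation action on $G$ stabilises a maximal torus and a Borel subgroup containing it. $\hat k$ is the quotient of $k^*$ by the group generated by $a\mapsto a^{-1}$ and $a\mapsto-a$;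 the class of $a$ is $\hat a=\{a,-a,a^{-1},-a^{-1}\}$. $F$ acts on $\hat k$ by $\hat a\mapsto\widehat{a^q}$. The sets $\{\hat1\}$ and $\{\hat{\mathfrak i}\}$ are single $F$-orbits. $\bar{\mathfrak T}_{C,s}$ is the set of data $n_+n_-(n_i,\hat\alpha_i)_{i\in\Lambda}$ where: $\Lambda$ is a possibly empty finite set; $n_+,n_-\ge0$ are integers with $n_+\equiv n\pmod 2$; $n_i$ are positive integers; $\hat\alpha_i\subset\hat k$ are $F$-orbits, pairwise distinct, different from $\{\hat1\}$ and $\{\hat{\mathfrak i}\}$; and $n_++n_-+\sum_{i\in\Lambda}2n_i|\hat\alpha_i|=n$. Two such data are identified if they have the same $n_+$, $n_-$ and there is a bijection of the index sets matching the integers and the orbits. *)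

theory Defs
  imports
    "Jordan_Normal_Form.Matrix"
    "HOL-Computational_Algebra.Polynomial"
    "HOL-Computational_Algebra.Primes"
    "HOL-Algebra.Solvable_Groups"
    "HOL-Analysis.Abstract_Topology"
begin

section \<open>General linear groups\<close>

definition GL :: "nat \<Rightarrow> 'k::field mat monoid" where
  "GL n = units_of (ring_mat TYPE('k) n ())"

definition frob_mat :: "nat \<Rightarrow> 'k::field mat \<Rightarrow> 'k mat" where
  "frob_mat q = map_mat (\<lambda>x. x ^ q)"

definition GL_fixed :: "nat \<Rightarrow> nat \<Rightarrow> 'k::field mat set" where
  "GL_fixed n q = {g \<in> carrier (GL n). frob_mat q g = g}"

definition J_mat :: "nat \<Rightarrow> 'k::field mat" where
  "J_mat n = mat n n (\<lambda>(i, j). if i + j + 1 = n then 1 else 0)"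

definition t0_mat :: "nat \<Rightarrow> 'k::field mat" where
  "t0_mat n = mat n n (\<lambda>(i, j). if i \<noteq> j then 0 else if i < n div 2 then 1 else - 1)"

definition scriptJ_mat :: "nat \<Rightarrow> 'k::field mat" where
  "scriptJ_mat n = (if odd n then J_mat n else t0_mat n * J_mat n)"

definition twisted_inverse_transpose :: "nat \<Rightarrow> 'k::field mat \<Rightarrow> 'k mat \<Rightarrow> 'k mat" where
  "twisted_inverse_transpose n M g = M * transpose_mat (inv\<^bsub>GL n\<^esub> g) * inv\<^bsub>GL n\<^esub> M"

definition sigma_aut :: "nat \<Rightarrow> 'k::field mat \<Rightarrow> 'k mat" where
  "sigma_aut n = twisted_inverse_transpose n (scriptJ_mat n)"

definition sigma'_aut :: "nat \<Rightarrow> 'k::field mat \<Rightarrow> 'k mat" where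
  "sigma'_aut n = twisted_inverse_transpose n (J_mat n)"


section \<open>Extension by an involutive automorphism\<close>

text \<open>For an automorphism \<open>\<tau>\<close> of \<open>G\<close> with \<open>\<tau>\<^sup>2 = 1\<close>, the following is the semidirect product
  of \<open>G\<close> with \<open>\<langle>\<tau>\<rangle>\<close>: the pair \<open>(g, False)\<close> is \<open>g\<close> and \<open>(g, True)\<close> is \<open>g \<tau>\<close>.\<close>

definition semidirect2 :: "('a, 'b) monoid_scheme \<Rightarrow> ('a \<Rightarrow> 'a) \<Rightarrow> ('a \<times> bool) monoid" where
  "semidirect2 G \<tau> =
    \<lparr>carrier = carrier G \<times> UNIV,
     monoid.mult = (\<lambda>(g, a) (h, b). (g \<otimes>\<^bsub>G\<^esub> (if a then \<tau> h else h), a \<noteq> b)),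
     one = (\<one>\<^bsub>G\<^esub>, False)\<rparr>"

definition base :: "'a \<Rightarrow> 'a \<times> bool" where
  "base g = (g, False)"

text \<open>The two admissible choices of the extension, together with the element of it called
  \<open>\<sigma>\<close>: either the extension is by \<open>\<sigma>\<close> itself, or (for even \<open>n\<close>) it is by \<open>\<sigma>'\<close>, and then
  \<open>\<sigma>\<close> stands for the element \<open>t\<^sub>0 \<sigma>'\<close>.\<close>

definition is_extension :: "nat \<Rightarrow> ('k::field mat \<times> bool) monoid \<Rightarrow> 'k mat \<times> bool \<Rightarrow> bool" where
  "is_extension n Gbar s \<longleftrightarrow>
     (Gbar = semidirect2 (GL n) (sigma_aut n) \<and> s = (1\<^sub>m n, True)) \<or>
     (even n \<and> Gbar = semidirect2 (GL n) (sigma'_aut n) \<and> s = (t0_mat n, True))"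


section \<open>Tori and Borel subgroups of the algebraic group\<close>

inductive_set poly_fun :: "nat \<Rightarrow> ('k::field mat \<Rightarrow> 'k) set" for n where
  const: "(\<lambda>_. c) \<in> poly_fun n"
| entry: "i < n \<Longrightarrow> j < n \<Longrightarrow> (\<lambda>g. g $$ (i, j)) \<in> poly_fun n"
| add: "f \<in> poly_fun n \<Longrightarrow> f' \<in> poly_fun n \<Longrightarrow> (\<lambda>g. f g + f' g) \<in> poly_fun n"
| mult: "f \<in> poly_fun n \<Longrightarrow> f' \<in> poly_fun n \<Longrightarrow> (\<lambda>g. f g * f' g) \<in> poly_fun n"

text \<open>Regular functions on the general linear group are polynomials in the matrix entries divided
  by powers of the determinant, so polynomials in the entries suffice to cut out all closed sets.\<close>

definition zariski_open :: "nat \<Rightarrow> 'k::field mat set \<Rightarrow> bool" where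
  "zariski_open n U \<longleftrightarrow>
     (\<exists>S \<subseteq> poly_fun n. U = {g \<in> carrier (GL n). \<exists>f \<in> S. f g \<noteq> 0})"

definition zariski :: "nat \<Rightarrow> 'k::field mat topology" where
  "zariski n = topology (zariski_open n)"

lemma istopology_zariski_open: "istopology (zariski_open n)"
  unfolding istopology_def
proof (intro conjI allI impI)
  fix U V :: "'a mat set" assume "zariski_open n U" "zariski_open n V"
  then obtain S T where S: "S \<subseteq> poly_fun n" "U = {g \<in> carrier (GL n). \<exists>f \<in> S. f g \<noteq> 0}"
    and T: "T \<subseteq> poly_fun n" "V = {g \<in> carrier (GL n). \<exists>f \<in> T. f g \<noteq> 0}"
    unfolding zariski_open_def by blast
  define R where "R = {(\<lambda>g. f g * f' g) | f f'. f \<in> S \<and> f' \<in> T}"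
  have "R \<subseteq> poly_fun n" using S(1) T(1) unfolding R_def by (auto intro: poly_fun.mult)
  moreover have "U \<inter> V = {g \<in> carrier (GL n). \<exists>f \<in> R. f g \<noteq> 0}"
  proof (intro equalityI subsetI)
    fix g assume "g \<in> U \<inter> V"
    then obtain f f' where g: "g \<in> carrier (GL n)" and f: "f \<in> S" "f' \<in> T"
      and ne: "f g * f' g \<noteq> 0"
      unfolding S(2) T(2) by auto
    have "(\<lambda>g. f g * f' g) \<in> R" using f unfolding R_def by blast
    from bexI[where P = "\<lambda>h. h g \<noteq> 0", OF ne this] g
    show "g \<in> {g \<in> carrier (GL n). \<exists>f \<in> R. f g \<noteq> 0}" by simp
  next
    fix g assume "g \<in> {g \<in> carrier (GL n). \<exists>f \<in> R. f g \<noteq> 0}"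
    then obtain h where g: "g \<in> carrier (GL n)" and h: "h \<in> R" "h g \<noteq> 0"
      by (elim CollectE conjE bexE)
    from h(1) obtain f f' where f: "f \<in> S" "f' \<in> T" "h = (\<lambda>g. f g * f' g)"
      unfolding R_def by (elim CollectE exE conjE)
    then have "f g \<noteq> 0" "f' g \<noteq> 0" using h(2) by simp_all
    then show "g \<in> U \<inter> V" unfolding S(2) T(2) using g f(1,2) by simp (meson bexI)
  qed
  ultimately show "zariski_open n (U \<inter> V)" unfolding zariski_open_def by blast
next
  fix K :: "'a mat set set" assume K: "\<forall>U \<in> K. zariski_open n U"
  have ex: "\<exists>S. S \<subseteq> poly_fun n \<and> (\<forall>g. g \<in> U \<longleftrightarrow> g \<in> carrier (GL n) \<and> (\<exists>f \<in> S. f g \<noteq> 0))"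
    if U: "U \<in> K" for U :: "'a mat set"
  proof -
    obtain S where S: "S \<subseteq> poly_fun n" "U = {g \<in> carrier (GL n). \<exists>f \<in> S. f g \<noteq> 0}"
      using bspec[OF K U] unfolding zariski_open_def by (elim exE conjE)
    show ?thesis unfolding S(2) by (rule exI[of _ S]) (use S(1) in simp)
  qed
  define S where "S U = (SOME S. S \<subseteq> poly_fun n \<and>
    (\<forall>g. g \<in> U \<longleftrightarrow> g \<in> carrier (GL n) \<and> (\<exists>f \<in> S. f g \<noteq> 0)))" for U :: "'a mat set"
  have S: "S U \<subseteq> poly_fun n \<and> (\<forall>g. g \<in> U \<longleftrightarrow> g \<in> carrier (GL n) \<and> (\<exists>f \<in> S U. f g \<noteq> 0))"
    if "U \<in> K" for U :: "'a mat set"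
    unfolding S_def by (rule someI_ex[OF ex[OF that]])
  define R where "R = (\<Union>U \<in> K. S U)"
  have "g \<in> \<Union>K \<longleftrightarrow> g \<in> carrier (GL n) \<and> (\<exists>f \<in> R. f g \<noteq> 0)" for g
  proof
    assume "g \<in> \<Union>K"
    then obtain U where U: "U \<in> K" "g \<in> U" by (elim UnionE)
    then obtain f where f: "g \<in> carrier (GL n)" "f \<in> S U" "f g \<noteq> 0" using S[OF U(1)] by auto
    have "f \<in> R" unfolding R_def using U(1) f(2) by (rule UN_I)
    then show "g \<in> carrier (GL n) \<and> (\<exists>f \<in> R. f g \<noteq> 0)" using f by auto
  next
    assume "g \<in> carrier (GL n) \<and> (\<exists>f \<in> R. f g \<noteq> 0)"
    then obtain f U where U: "g \<in> carrier (GL n)" "U \<in> K" "f \<in> S U" "f g \<noteq> 0"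
      unfolding R_def by (elim conjE bexE UN_E)
    then have "g \<in> U" using S[OF U(2)] by auto
    then show "g \<in> \<Union>K" using U(2) by auto
  qed
  then have "\<Union>K = {g \<in> carrier (GL n). \<exists>f \<in> R. f g \<noteq> 0}"
    by (intro equalityI subsetI) (simp_all only: mem_Collect_eq)
  moreover have "R \<subseteq> poly_fun n" unfolding R_def by (rule UN_least) (use S in simp)
  ultimately show "zariski_open n (\<Union>K)" unfolding zariski_open_def by (intro exI[of _ R] conjI)
qed

definition closed_connected_subgroup :: "nat \<Rightarrow> 'k::field mat set \<Rightarrow> bool" where
  "closed_connected_subgroup n H \<longleftrightarrow>
     subgroup H (GL n) \<and> closedin (zariski n) H \<and> connectedin (zariski n) H"

definition is_torus :: "nat \<Rightarrow> 'k::field mat set \<Rightarrow> bool" where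
  "is_torus n T \<longleftrightarrow> closed_connected_subgroup n T \<and>
     (\<exists>P \<in> carrier (GL n). \<forall>t \<in> T. diagonal_mat (P * t * inv\<^bsub>GL n\<^esub> P))"

definition is_maximal_torus :: "nat \<Rightarrow> 'k::field mat set \<Rightarrow> bool" where
  "is_maximal_torus n T \<longleftrightarrow> is_torus n T \<and> (\<forall>T'. is_torus n T' \<and> T \<subseteq> T' \<longrightarrow> T' = T)"

definition connected_solvable :: "nat \<Rightarrow> 'k::field mat set \<Rightarrow> bool" where
  "connected_solvable n H \<longleftrightarrow>
     closed_connected_subgroup n H \<and> solvable ((GL n)\<lparr>carrier := H\<rparr>)"

definition is_borel :: "nat \<Rightarrow> 'k::field mat set \<Rightarrow> bool" where
  "is_borel n B \<longleftrightarrow>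
     connected_solvable n B \<and> (\<forall>B'. connected_solvable n B' \<and> B \<subseteq> B' \<longrightarrow> B' = B)"


section \<open>Quasi-semi-simple classes\<close>

definition conj_by :: "('a, 'b) monoid_scheme \<Rightarrow> 'a \<Rightarrow> 'a \<Rightarrow> 'a" where
  "conj_by G x y = x \<otimes>\<^bsub>G\<^esub> y \<otimes>\<^bsub>G\<^esub> inv\<^bsub>G\<^esub> x"

definition stabilises ::
  "('a \<times> bool, 'b) monoid_scheme \<Rightarrow> 'a \<times> bool \<Rightarrow> 'a set \<Rightarrow> bool" where
  "stabilises Gbar x H \<longleftrightarrow> conj_by Gbar x ` base ` H = base ` H"

definition quasi_semisimple ::
  "nat \<Rightarrow> ('k::field mat \<times> bool) monoid \<Rightarrow> 'k mat \<times> bool \<Rightarrow> bool" where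
  "quasi_semisimple n Gbar x \<longleftrightarrow> x \<in> carrier Gbar \<and>
     (\<exists>T B. is_maximal_torus n T \<and> is_borel n B \<and> T \<subseteq> B \<and>
        stabilises Gbar x T \<and> stabilises Gbar x B)"

definition fixed_coset ::
  "nat \<Rightarrow> nat \<Rightarrow> ('k::field mat \<times> bool) monoid \<Rightarrow> 'k mat \<times> bool \<Rightarrow> ('k mat \<times> bool) set" where
  "fixed_coset n q Gbar s = {base g \<otimes>\<^bsub>Gbar\<^esub> s | g. g \<in> GL_fixed n q}"

definition fixed_conj_class ::
  "nat \<Rightarrow> nat \<Rightarrow> ('k::field mat \<times> bool) monoid \<Rightarrow> 'k mat \<times> bool \<Rightarrow> ('k mat \<times> bool) set" where
  "fixed_conj_class n q Gbar x = {conj_by Gbar (base h) x | h. h \<in> GL_fixed n q}"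

definition qss_classes ::
  "nat \<Rightarrow> nat \<Rightarrow> ('k::field mat \<times> bool) monoid \<Rightarrow> 'k mat \<times> bool \<Rightarrow>
     ('k mat \<times> bool) set set" where
  "qss_classes n q Gbar s =
     {C. C \<subseteq> fixed_coset n q Gbar s \<and>
         (\<exists>x. quasi_semisimple n Gbar x \<and> C = fixed_conj_class n q Gbar x)}"


section \<open>The combinatorial data\<close>

definition hat :: "'k::field \<Rightarrow> 'k set" where
  "hat a = {a, - a, inverse a, - inverse a}"

definition khat :: "'k::field set set" where
  "khat = {hat a | a. a \<noteq> 0}"

definition frob_hat :: "nat \<Rightarrow> 'k::field set \<Rightarrow> 'k set" where
  "frob_hat q A = (\<lambda>x. x ^ q) ` A"

lemma frob_hat_hat: "odd q \<Longrightarrow> frob_hat q (hat a) = hat (a ^ q)"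
  by (simp add: frob_hat_def hat_def power_inverse)

text \<open>Over an algebraic closure of a finite field every element of \<^const>\<open>khat\<close> is periodic under
  Frobenius, so forward orbits are the orbits of the group generated by it.\<close>

definition hat_orbit :: "nat \<Rightarrow> 'k::field set \<Rightarrow> 'k set set" where
  "hat_orbit q A = range (\<lambda>m. (frob_hat q ^^ m) A)"

definition hat_orbits :: "nat \<Rightarrow> 'k::field set set set" where
  "hat_orbits q = hat_orbit q ` khat"

text \<open>A family \<open>(n\<^sub>i, \<alpha>\<^sub>i)\<close> with pairwise distinct \<open>\<alpha>\<^sub>i\<close> is determined up to a bijection of index
  sets by the set of its pairs (see \<open>family_image_eq_iff\<close>); data are therefore taken
  to be triples consisting of \<open>n\<^sub>+\<close>, \<open>n\<^sub>-\<close> and this set. Restricting to index sets of natural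
  numbers loses nothing, since they are finite.\<close>

type_synonym 'k datum = "nat \<times> nat \<times> (nat \<times> 'k set set) set"

definition TCs :: "nat \<Rightarrow> nat \<Rightarrow> 'k::field \<Rightarrow> 'k datum set" where
  "TCs n q \<iota> =
     {(np, nm, (\<lambda>i. (N i, \<alpha> i)) ` \<Lambda>) | np nm N \<alpha> (\<Lambda> :: nat set).
        finite \<Lambda> \<and> np mod 2 = n mod 2 \<and>
        (\<forall>i \<in> \<Lambda>. N i > 0) \<and>
        (\<forall>i \<in> \<Lambda>. \<alpha> i \<in> hat_orbits q \<and> \<alpha> i \<noteq> {hat 1} \<and> \<alpha> i \<noteq> {hat \<iota>}) \<and>
        inj_on \<alpha> \<Lambda> \<and>
        np + nm + (\<Sum>i \<in> \<Lambda>. 2 * N i * card (\<alpha> i)) = n}"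

lemma family_image_eq_iff:
  assumes "inj_on \<alpha> \<Lambda>" "inj_on \<alpha>' \<Lambda>'"
  shows "(\<lambda>i. (N i, \<alpha> i)) ` \<Lambda> = (\<lambda>i. (N' i, \<alpha>' i)) ` \<Lambda>' \<longleftrightarrow>
    (\<exists>f. bij_betw f \<Lambda> \<Lambda>' \<and> (\<forall>i \<in> \<Lambda>. N' (f i) = N i \<and> \<alpha>' (f i) = \<alpha> i))" (is "?L \<longleftrightarrow> ?R")
proof
  assume L: ?L
  have "\<exists>j. j \<in> \<Lambda>' \<and> N' j = N i \<and> \<alpha>' j = \<alpha> i" if "i \<in> \<Lambda>" for i
  proof -
    have "(N i, \<alpha> i) \<in> (\<lambda>i. (N' i, \<alpha>' i)) ` \<Lambda>'" using L that by blast
    then show ?thesis by auto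
  qed
  then obtain f where f: "\<And>i. i \<in> \<Lambda> \<Longrightarrow> f i \<in> \<Lambda>' \<and> N' (f i) = N i \<and> \<alpha>' (f i) = \<alpha> i"
    by metis
  have "inj_on f \<Lambda>" using assms(1) f by (metis inj_on_def)
  moreover have "f ` \<Lambda> = \<Lambda>'"
  proof
    show "f ` \<Lambda> \<subseteq> \<Lambda>'" using f by blast
    show "\<Lambda>' \<subseteq> f ` \<Lambda>"
    proof
      fix j assume j: "j \<in> \<Lambda>'"
      then have "(N' j, \<alpha>' j) \<in> (\<lambda>i. (N i, \<alpha> i)) ` \<Lambda>" using L by blast
      then obtain i where i: "i \<in> \<Lambda>" "\<alpha>' j = \<alpha> i" by auto
      then have "f i = j" using f[OF i(1)] j assms(2) by (metis inj_on_def)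
      then show "j \<in> f ` \<Lambda>" using i(1) by blast
    qed
  qed
  ultimately show ?R using f by (auto simp: bij_betw_def)
next
  assume ?R
  then obtain f where f: "bij_betw f \<Lambda> \<Lambda>'" "\<And>i. i \<in> \<Lambda> \<Longrightarrow> N' (f i) = N i \<and> \<alpha>' (f i) = \<alpha> i"
    by blast
  have "(\<lambda>i. (N' i, \<alpha>' i)) ` \<Lambda>' = (\<lambda>i. (N' i, \<alpha>' i)) ` f ` \<Lambda>"
    using f(1) by (simp add: bij_betw_def)
  also have "\<dots> = (\<lambda>i. (N i, \<alpha> i)) ` \<Lambda>"
    using f(2) by (simp add: image_image cong: image_cong)
  finally show ?L by simp
qed

definition class_parameters :: "nat \<Rightarrow> nat \<Rightarrow> 'k::field \<Rightarrow> (int \<times> 'k datum) set" where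
  "class_parameters n q \<iota> =
     {(\<eta>, (np, nm, D)) | \<eta> np nm D.
        \<eta> \<in> {1, - 1} \<and> (np, nm, D) \<in> TCs n q \<iota> \<and>
        (\<eta> = - 1 \<longrightarrow> even n \<and> nm > 0 \<or> odd n \<and> np > 0)}"

end

theory Submission
 imports Defs "Jordan_Normal_Form.Char_Poly"
begin

text \<open>Let \<open>M\<close> be the matrix that defines the outer automorphism. Sending \<open>(g, True)\<close> to \<open>x = g * M\<close>
 identifies the outer coset with the set of invertible matrices, seen as nondegenerate bilinear
 forms, and conjugation by \<open>h\<close> becomes the congruence that replaces \<open>x\<close> by \<open>h * x\<close> times the
 transpose of \<open>h\<close> (\<open>class_bijection\<close>). So the task is to classify bilinear forms over the field with
 \<open>q\<close> elements, under a condition. What governs a form is its asymmetry \<open>A\<close>, the product of the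
 inverse of \<open>x\<close> with its transpose: \<open>A\<close> is an isometry of \<open>x\<close>, and congruence conjugates it.

 The element is quasi-semi-simple exactly if \<open>A\<close> is semisimple (\<open>stable_torus_borel_iff\<close>). Indeed
 the square of the automorphism defined by \<open>x\<close> is conjugation by the transpose \<open>y\<close> of \<open>A\<close>. If the
 automorphism stabilises a maximal torus \<open>T\<close> and a Borel subgroup \<open>B\<close> that contains it, then
 \<open>y\<close> normalises \<open>B\<close>, hence lies in \<open>B\<close>; its commutators with elements of \<open>T\<close> lie in \<open>T\<close> and in the
 unipotent radical of \<open>B\<close>, so they are trivial, and \<open>T\<close> is its own centraliser. Conversely a form with
 semisimple asymmetry is congruent to an antidiagonal one (\<open>cg_antidiagonal\<close>), whose automorphism
 visibly stabilises the diagonal and the upper triangular group. For this one has to know that the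
 Borel subgroups and the maximal tori are the conjugates of these two groups (\<open>is_borel_iff\<close>,
 \<open>is_maximal_torus_iff\<close>), which comes down to the Lie-Kolchin theorem (\<open>lie_kolchin\<close>). Over
 the algebraic closure of a finite field its proof is short: all matrices have finite order, so
 eigenvalues along a connected group take finitely many values and are constant.

 The spectrum of \<open>A\<close> is a multiset of \<open>n\<close> nonzero elements with product 1 that is stable under inversion
 and under Frobenius, and by Lang's theorem every such multiset occurs (\<open>exists_form\<close>). Two rational
 forms with the same spectrum are congruent over the algebraic closure (\<open>k_class\<close>). If 1 is not an
 eigenvalue, they are congruent over the finite field (\<open>fq_no_one\<close>): one may assume that the
 asymmetries agree, and then the two forms differ by a self-adjoint matrix \<open>d\<close>, which has to be written
 as a norm \<open>h\<^sup>* h\<close>; this is possible by Hilbert 90 because there is an invertible \<open>B\<close> that commutes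
 with \<open>d\<close> and has adjoint \<open>- B\<close>. On the eigenspace of 1 the form is symmetric, and there, as for
 quadratic forms over finite fields, the determinant modulo squares is the only further invariant
 (\<open>fq_class\<close>, \<open>exists_form_det\<close>). This is the origin of the sign \<open>\<eta>\<close>, and of the condition under which
 it is free.

 Finally, squaring identifies the quotient of the multiplicative group of \<open>k\<close> by inversion and sign
 with its quotient by inversion, and sends the classes of \<open>1\<close> and \<open>\<iota>\<close> to those of \<open>1\<close> and \<open>- 1\<close>. So a
 spectrum amounts to the multiplicities of \<open>1\<close> and \<open>- 1\<close> and a family of multiplicities of Frobenius
 orbits (\<open>spec_datum_bij\<close>). Here \<open>n\<^sub>+\<close> is the multiplicity of \<open>1\<close> if \<open>n\<close> is odd and that of \<open>- 1\<close>
 if \<open>n\<close> is even: as the product of the spectrum is \<open>- 1\<close> to the multiplicity of \<open>- 1\<close>, in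
 both cases product 1 means that \<open>n\<^sub>+\<close> and \<open>n\<close> have the same parity.\<close>

section \<open>The algebraic closure of a finite field\<close>

text \<open>The argument \<open>K\<close> pins down the field, whose type would otherwise not be determined by the
 numerical parameters.\<close>

locale frob_closure =
 fixes p e q :: nat and K :: "'k::alg_closed_field itself"
 assumes prime_p: "prime p" and odd_p: "odd p" and e_pos: "e > 0" and q_def: "q = p ^ e"
  and char_k: "CHAR('k) = p"
  and algebraic: "\<forall>x::'k. \<exists>f::'k poly. f \<noteq> 0 \<and> (\<forall>m. coeff f m \<in> {a. a ^ q = a}) \<and> poly f x = 0"
begin

abbreviation Fq :: "'k set" where "Fq \<equiv> {a. a ^ q = a}"

lemma q_gt_1: "q > 1"
 using prime_gt_1_nat[OF prime_p] e_pos unfolding q_def by (metis one_less_power)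

lemma odd_q: "odd q" using odd_p by (simp add: q_def)

lemma of_nat_q: "(of_nat (q ^ m) :: 'k) = 0 \<longleftrightarrow> m > 0"
proof -
 have "(of_nat p :: 'k) = 0" using char_k of_nat_CHAR[where ?'a='k] by simp
 then show ?thesis using e_pos by (auto simp: q_def)
qed

lemma frob_add: "(x + y :: 'k) ^ (q ^ m) = x ^ (q ^ m) + y ^ (q ^ m)"
 by (rule freshmans_dream'[of _ "e * m"]) (use prime_p char_k in \<open>simp_all add: q_def power_mult\<close>)

lemma frob_uminus: "(- x :: 'k) ^ (q ^ m) = - (x ^ (q ^ m))"
 using odd_q by simp

lemma frob_diff: "(x - y :: 'k) ^ (q ^ m) = x ^ (q ^ m) - y ^ (q ^ m)"
 using frob_add[of x "-y" m] by (simp only: frob_uminus) simp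

lemma q_pow_pos: "q ^ m > 0" using q_gt_1 by simp

lemma frob_hom: "field_hom (\<lambda>x::'k. x ^ (q ^ m))"
 by unfold_locales (use q_pow_pos in \<open>auto simp: frob_add power_mult_distrib frob_uminus power_inverse\<close>)

lemma frob_inj: "x ^ (q ^ m) = (y::'k) ^ (q ^ m) \<longleftrightarrow> x = y"
 using frob_diff[of x y m] q_pow_pos[of m] by (metis eq_iff_diff_eq_0 power_eq_0_iff)

lemma two_neq_0: "(2::'k) \<noteq> 0"
proof
 assume "(2::'k) = 0"
 then have "of_nat 2 = (0::'k)" by simp
 then have "p dvd 2" using char_k by (simp only: of_nat_eq_0_iff_char_dvd)
 then show False using odd_p prime_p prime_nat_iff two_is_prime_nat by (metis primes_dvd_imp_eq even_numeral)
qed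

lemma frob_poly_nz: "m > 0 \<Longrightarrow> monom 1 (q ^ m) - monom 1 1 \<noteq> (0::'k poly)"
proof
 assume m: "m > 0" and *: "monom 1 (q ^ m) - monom 1 1 = (0::'k poly)"
 have "q ^ m > 1" using m q_gt_1 by (metis one_less_power)
 then have "coeff (monom 1 (q ^ m) - monom 1 1 :: 'k poly) (q ^ m) = 1" by simp
 moreover have "coeff (monom 1 (q ^ m) - monom 1 1 :: 'k poly) (q ^ m) = 0" unfolding * by simp
 ultimately show False by simp
qed

lemma poly_frob_poly: "poly (monom 1 (q ^ m) - monom 1 1) x = x ^ (q ^ m) - (x::'k)"
 by (simp add: poly_monom)

lemma finite_fixed: "m > 0 \<Longrightarrow> finite {a::'k. a ^ (q ^ m) = a}"
proof -
 assume m: "m > 0"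
 have "{a::'k. a ^ (q ^ m) = a} = {a. poly (monom 1 (q ^ m) - monom 1 1) a = 0}"
  unfolding poly_frob_poly by auto
 then show ?thesis using poly_roots_finite[OF frob_poly_nz[OF m]] by simp
qed

lemma finite_Fq: "finite Fq" using finite_fixed[of 1] by simp

text \<open>The derivative of \<open>X ^ (q ^ m) - X\<close> is the constant \<open>- 1\<close>, so this polynomial has no multiple
 roots.\<close>

lemma card_fixed: assumes m: "m > 0" shows "card {a::'k. a ^ (q ^ m) = a} = q ^ m"
proof -
 define P where "P = monom 1 (q ^ m) - (monom 1 1 :: 'k poly)"
 have Q1: "q ^ m > 1" using m q_gt_1 by (metis one_less_power)
 have dP: "degree P = q ^ m"
 proof (rule antisym)
  show "degree P \<le> q ^ m" unfolding P_def
   by (rule degree_diff_le) (use Q1 in \<open>auto simp: degree_monom_eq\<close>)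
  show "q ^ m \<le> degree P" by (rule le_degree) (use Q1 in \<open>simp add: P_def\<close>)
 qed
 have lc: "lead_coeff P = 1" unfolding dP using Q1 by (simp add: P_def)
 have pd: "pderiv P = [:-1:]" unfolding P_def pderiv_diff pderiv_monom of_nat_q[THEN iffD2, OF m] using Q1
  by (simp add: monom_0)
 obtain A where A: "size A = q ^ m" "P = (\<Prod>x\<in>#A. [:- x, 1:])"
  using alg_closed_imp_factorization[of P] frob_poly_nz[OF m] dP lc unfolding P_def by auto
 have roots: "set_mset A = {a. a ^ (q ^ m) = a}"
 proof -
  have "x \<in># A \<longleftrightarrow> poly P x = 0" for x
   unfolding A(2) by (auto simp: poly_prod_mset prod_mset_zero_iff image_iff)
  then show ?thesis unfolding P_def poly_frob_poly by auto
 qed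
 have cnt: "count A x \<le> 1" for x
 proof (rule ccontr)
  assume "\<not> count A x \<le> 1"
  then have "count A x \<ge> 2" by simp
  then obtain A1 where A1: "A = add_mset x A1" by (metis count_greater_zero_iff mset_add not_numeral_le_zero zero_less_iff_neq_zero)
  then have "x \<in># A1" using \<open>count A x \<ge> 2\<close> by (simp flip: count_greater_zero_iff)
  then obtain A2 where A2: "A1 = add_mset x A2" by (metis mset_add)
  have "P = [:- x, 1:] * ([:- x, 1:] * (\<Prod>x\<in>#A2. [:- x, 1:]))" unfolding A(2) A1 A2 by simp
  then have "poly (pderiv P) x = 0" by (simp only: pderiv_mult poly_add poly_mult) simp
  then show False unfolding pd by simp
 qed
 have "A = mset_set (set_mset A)"
 proof (rule multiset_eqI)
  fix x show "count A x = count (mset_set (set_mset A)) x"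
   using cnt[of x] by (cases "x \<in># A") (auto simp: count_mset_set not_in_iff intro: antisym)
 qed
 then have "size A = card (set_mset A)" by (metis size_mset_set)
 then show ?thesis using A(1) roots by simp
qed

lemma card_Fq: "card Fq = q" using card_fixed[of 1] by simp

lemma frob_frob: "((x::'k) ^ (q ^ a)) ^ (q ^ b) = x ^ (q ^ (a + b))"
 by (simp add: power_add power_mult)

text \<open>The powers of \<open>x\<close> lie in the span of finitely many of them over the finite field, which is a
 finite set; hence two of the Frobenius conjugates of \<open>x\<close> coincide.\<close>

lemma ex_period: "\<exists>m>0. (x::'k) ^ (q ^ m) = x"
proof -
 obtain f :: "'k poly" where f: "f \<noteq> 0" "\<And>m. coeff f m \<in> Fq" "poly f x = 0" using algebraic by blast
 define d where "d = degree f"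
 have dpos: "d > 0"
 proof (rule ccontr)
  assume "\<not> d > 0"
  then obtain c where "f = [:c:]" unfolding d_def by (metis degree_eq_zeroE gr0I)
  then show False using f(1,3) by simp
 qed
 have lc: "coeff f d \<noteq> 0" using f(1) unfolding d_def by simp
 define c where "c i = - coeff f i / coeff f d" for i
 have cF: "c i \<in> Fq" for i using f(2)[of i] f(2)[of d] odd_q by (simp add: c_def power_divide)
 have xd: "x ^ d = (\<Sum>i<d. c i * x ^ i)"
 proof -
  have "0 = (\<Sum>i\<le>d. coeff f i * x ^ i)" using f(3) unfolding poly_altdef d_def by simp
  also have "{..d} = insert d {..<d}" by auto
  finally have "coeff f d * x ^ d = - (\<Sum>i<d. coeff f i * x ^ i)" by (simp add: eq_neg_iff_add_eq_0)
  then have "x ^ d = - (\<Sum>i<d. coeff f i * x ^ i) / coeff f d" using lc by (simp add: field_simps)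
  also have "\<dots> = (\<Sum>i<d. c i * x ^ i)" by (simp add: c_def sum_divide_distrib sum_negf)
  finally show ?thesis .
 qed
 \<comment> \<open>the span of the powers below the degree of an equation of \<open>x\<close>, which contains all powers\<close>
 define S where "S = (\<lambda>a. \<Sum>i<d. a i * x ^ i) ` ({..<d} \<rightarrow>\<^sub>E Fq)"
 have finS: "finite S" unfolding S_def using finite_Fq by (intro finite_imageI finite_PiE) auto
 have Fq_add: "a + b \<in> Fq" if "a \<in> Fq" "b \<in> Fq" for a b using that frob_add[of a b 1] by simp
 have Fq_mult: "a * b \<in> Fq" if "a \<in> Fq" "b \<in> Fq" for a b using that by (simp add: power_mult_distrib)
 have SI: "(\<Sum>i<d. a i * x ^ i) \<in> S" if "\<And>i. i < d \<Longrightarrow> a i \<in> Fq" for a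
 proof -
  have "(\<Sum>i<d. a i * x ^ i) = (\<Sum>i<d. restrict a {..<d} i * x ^ i)" by (rule sum.cong) auto
  then show ?thesis unfolding S_def using that by (intro image_eqI[of _ _ "restrict a {..<d}"]) auto
 qed
 have "x ^ j \<in> S" for j
 proof (induction j)
  case 0
  have "(\<Sum>i<d. (if i = 0 then 1 else 0) * x ^ i) \<in> S" by (rule SI) (use q_gt_1 in auto)
  also have "(\<Sum>i<d. (if i = 0 then 1 else 0) * x ^ i) = (\<Sum>i<d. if i = 0 then 1 else 0)"
   by (rule sum.cong) auto
  also have "\<dots> = 1" using dpos by simp
  finally show ?case by simp
 next
  case (Suc j)
  then obtain a where a: "x ^ j = (\<Sum>i<d. a i * x ^ i)" "\<And>i. i < d \<Longrightarrow> a i \<in> Fq" unfolding S_def by force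
  obtain d' where d': "d = Suc d'" using dpos by (cases d) auto
  have "x ^ Suc j = (\<Sum>i<d. a i * x ^ Suc i)" by (simp add: a(1) sum_distrib_left mult_ac)
  also have "\<dots> = (\<Sum>i<d'. a i * x ^ Suc i) + a d' * x ^ d" by (simp add: d')
  also have "(\<Sum>i<d'. a i * x ^ Suc i) = (\<Sum>i<d. (case i of 0 \<Rightarrow> 0 | Suc i \<Rightarrow> a i) * x ^ i)"
   unfolding d' sum.lessThan_Suc_shift by simp
  also have "\<dots> + a d' * x ^ d = (\<Sum>i<d. ((case i of 0 \<Rightarrow> 0 | Suc i \<Rightarrow> a i) + a d' * c i) * x ^ i)"
   unfolding xd by (simp add: sum_distrib_left sum.distrib algebra_simps)
  also have "\<dots> \<in> S"
  proof (rule SI)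
   fix i assume "i < d"
   then show "(case i of 0 \<Rightarrow> 0 | Suc i \<Rightarrow> a i) + a d' * c i \<in> Fq"
    using q_gt_1 by (intro Fq_add Fq_mult cF a(2)) (auto simp: d' split: nat.split intro: a(2)[simplified])
  qed
  finally show ?case .
 qed
 then have "range (\<lambda>i::nat. x ^ (q ^ i)) \<subseteq> S" by auto
 then have "\<not> inj (\<lambda>i::nat. x ^ (q ^ i))"
  using finS finite_imageD[of "\<lambda>i::nat. x ^ (q ^ i)" UNIV] infinite_UNIV_nat by (meson finite_subset)
 then obtain i j where ij: "x ^ (q ^ i) = x ^ (q ^ j)" "i \<noteq> (j::nat)" unfolding inj_def by blast
 have main: "\<exists>m>0. x ^ (q ^ m) = x" if "i < j" "x ^ (q ^ i) = x ^ (q ^ j)" for i j :: nat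
 proof -
  have "(x ^ (q ^ (j - i))) ^ (q ^ i) = x ^ (q ^ i)" using that by (simp add: frob_frob)
  then have "x ^ (q ^ (j - i)) = x" by (simp only: frob_inj)
  then show ?thesis using that(1) by (intro exI[of _ "j - i"]) auto
 qed
 show ?thesis
 proof (cases "i < j")
  case True then show ?thesis using main ij(1) by blast
 next
  case False then have "j < i" using ij(2) by simp
  then show ?thesis using main ij(1)[symmetric] by blast
 qed
qed

lemma period_mult: "(x::'k) ^ (q ^ m) = x \<Longrightarrow> x ^ (q ^ (m * j)) = x"
proof (induction j)
 case (Suc j)
 have "x ^ (q ^ (m * Suc j)) = (x ^ (q ^ m)) ^ (q ^ (m * j))" by (simp add: frob_frob)
 then show ?case using Suc by simp
qed simp

lemma ex_common_period: assumes "finite X" shows "\<exists>m>0. \<forall>x\<in>X. (x::'k) ^ (q ^ m) = x"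
 using assms
proof (induction X)
 case (insert x X)
 then obtain m where m: "m > 0" "\<forall>x\<in>X. x ^ (q ^ m) = x" by blast
 obtain l where l: "l > 0" "x ^ (q ^ l) = x" using ex_period by blast
 have "x ^ (q ^ (m * l)) = x" using period_mult[OF l(2), of m] by (simp add: mult.commute)
 moreover have "\<forall>y\<in>X. y ^ (q ^ (m * l)) = y" using m(2) period_mult by blast
 ultimately show ?case using m(1) l(1) by (intro exI[of _ "m * l"]) auto
qed (auto intro: exI[of _ 1])

lemma infinite_k: "infinite (UNIV :: 'k set)"
proof
 assume f: "finite (UNIV :: 'k set)"
 have "card {a::'k. a ^ (q ^ m) = a} \<le> card (UNIV::'k set)" for m by (rule card_mono[OF f]) simp
 then have "q ^ Suc m \<le> card (UNIV::'k set)" for m using card_fixed[of "Suc m"] by (metis zero_less_Suc)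
 from this[of "card (UNIV::'k set)"]
 have "q ^ Suc (card (UNIV::'k set)) \<le> card (UNIV::'k set)" .
 moreover have "Suc (card (UNIV::'k set)) < q ^ Suc (card (UNIV::'k set))"
  by (rule power_gt_expt) (use q_gt_1 in simp)
 ultimately show False by linarith
qed

lemma Fq_sq_half: "2 * card ((\<lambda>x. x ^ 2) ` Fq) \<ge> q + 1" "2 * card ((\<lambda>x. x ^ 2) ` (Fq - {0})) = q - 1"
proof -
 let ?F = "Fq - {0}"
 let ?s = "\<lambda>x::'k. x ^ 2"
 have finF: "finite ?F" using finite_Fq by simp
 have card2: "card {x \<in> ?F. x ^ 2 = y} = 2" if y: "y \<in> ?s ` ?F" for y
 proof -
  obtain x where x: "x \<in> ?F" "y = x ^ 2" using y by blast
  have "{z \<in> ?F. z ^ 2 = y} = {x, - x}"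
   using x odd_q by (auto simp: power2_eq_iff)
  moreover have "x \<noteq> - x" using x two_neq_0 by (metis DiffE add_eq_0_iff2 eq_neg_iff_add_eq_0 insertI1 mult_2 mult_eq_0_iff singletonD)
  ultimately show ?thesis by simp
 qed
 have "card ?F = (\<Sum>y\<in>?s ` ?F. card {x \<in> ?F. x ^ 2 = y})"
  by (subst card_UN_disjoint[symmetric]) (use finF in \<open>auto intro!: arg_cong[where f=card]\<close>)
 also have "\<dots> = 2 * card (?s ` ?F)" using card2 by simp
 finally have c: "2 * card (?s ` ?F) = card ?F" by simp
 have "0 \<in> Fq" using q_gt_1 by simp
 then have cF: "card ?F = q - 1" using card_Fq finite_Fq by simp
 show "2 * card (?s ` ?F) = q - 1" using c cF by simp
 have "?s ` Fq = insert 0 (?s ` ?F)" using \<open>0 \<in> Fq\<close> by force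
 moreover have "0 \<notin> ?s ` ?F" by auto
 ultimately have "card (?s ` Fq) = Suc (card (?s ` ?F))" using finF by simp
 then show "2 * card (?s ` Fq) \<ge> q + 1" using c cF q_gt_1 by simp
qed

lemma ex_nonsquare: "\<exists>d\<in>Fq. d \<noteq> 0 \<and> (\<forall>s\<in>Fq. s ^ 2 \<noteq> d)"
proof (rule ccontr)
 assume "\<not> ?thesis"
 then have "Fq - {0} \<subseteq> (\<lambda>x. x ^ 2) ` (Fq - {0})" by fastforce
 then have "card (Fq - {0}) \<le> card ((\<lambda>x. x ^ 2) ` (Fq - {0}))" using finite_Fq by (intro card_mono) auto
 moreover have "card (Fq - {0}) = q - 1" using card_Fq finite_Fq q_gt_1 by simp
 ultimately show False using Fq_sq_half(2) q_gt_1 by linarith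
qed

text \<open>Squares form a subgroup of index two of the multiplicative group.\<close>

lemma nonsquare_mult:
 assumes "d \<in> Fq" "d \<noteq> 0" "\<forall>s\<in>Fq. s ^ 2 \<noteq> d" "c \<in> Fq" "c \<noteq> 0" "\<forall>s\<in>Fq. s ^ 2 \<noteq> c"
 shows "\<exists>s\<in>Fq. s ^ 2 = d * c"
proof -
 let ?S = "(\<lambda>x. x ^ 2) ` (Fq - {0})"
 have disj: "?S \<inter> (*) d ` ?S = {}"
 proof (rule ccontr)
  assume "?S \<inter> (*) d ` ?S \<noteq> {}"
  then obtain a b where ab: "a \<in> Fq" "a \<noteq> 0" "b \<in> Fq" "b \<noteq> 0" "a ^ 2 = d * b ^ 2" by auto
  then have "(a / b) ^ 2 = d" "a / b \<in> Fq" by (auto simp: power_divide)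
  then show False using assms(3) by blast
 qed
 have sq: "(s ^ 2) ^ q = s ^ 2" if "s ^ q = s" for s :: 'k
  using that by (metis mult.commute power_mult)
 have fin: "finite (Fq - {0})" "finite ?S" using finite_Fq by simp_all
 have sub: "?S \<union> (*) d ` ?S \<subseteq> Fq - {0}"
  using assms sq by (auto simp: power_mult_distrib)
 have "card ((*) d ` ?S) = card ?S"
  using assms by (intro card_image) (auto simp: inj_on_def)
 then have "card (?S \<union> (*) d ` ?S) = card ?S + card ?S"
  using disj fin(2) by (subst card_Un_disjoint) auto
 also have "\<dots> = card (Fq - {0})" using Fq_sq_half(2) card_Fq finite_Fq q_gt_1 by simp
 finally have "?S \<union> (*) d ` ?S = Fq - {0}" using sub fin(1) by (intro card_subset_eq) auto
 then have "c \<in> ?S \<union> (*) d ` ?S" using assms by blast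
 moreover have "c \<notin> ?S" using assms(6) by blast
 ultimately obtain b where b: "b \<in> Fq" "c = d * b ^ 2" by blast
 have "(d * b) ^ 2 = d * c" by (simp add: b(2) power2_eq_square)
 moreover have "d * b \<in> Fq" using b assms by (simp add: power_mult_distrib)
 ultimately show ?thesis by blast
qed

text \<open>The values of \<open>a * s ^ 2\<close> and of \<open>1 - b * t ^ 2\<close> fill more than half of the field each, so they
 meet.\<close>

lemma two_squares:
 assumes "a \<in> Fq" "a \<noteq> 0" "b \<in> Fq" "b \<noteq> 0"
 shows "\<exists>s\<in>Fq. \<exists>t\<in>Fq. a * s ^ 2 + b * t ^ 2 = 1"
proof (rule ccontr)
 assume nex: "\<not> ?thesis"
 let ?S = "(\<lambda>x. x ^ 2) ` Fq"
 let ?X = "(*) a ` ?S" and ?Y = "(\<lambda>z. 1 - b * z) ` ?S"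
 have "?X \<inter> ?Y = {}"
 proof (rule ccontr)
  assume "?X \<inter> ?Y \<noteq> {}"
  then obtain s t where st: "s \<in> Fq" "t \<in> Fq" "a * s ^ 2 = 1 - b * t ^ 2" by blast
  then have "a * s ^ 2 + b * t ^ 2 = 1" by simp
  then show False using nex st by blast
 qed
 moreover have fS: "finite ?S" using finite_Fq by simp
 moreover have "card ?X = card ?S" by (rule card_image) (use assms in \<open>auto simp: inj_on_def\<close>)
 moreover have "card ?Y = card ?S" by (rule card_image) (use assms in \<open>auto simp: inj_on_def\<close>)
 ultimately have "card (?X \<union> ?Y) = 2 * card ?S" by (subst card_Un_disjoint) auto
 moreover have "?X \<union> ?Y \<subseteq> Fq"
 proof -
  have sq: "(s ^ 2) ^ q = s ^ 2" if "s ^ q = s" for s :: 'k using that by (metis mult.commute power_mult)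
  have d: "(1 - z) ^ q = 1 - z ^ q" for z :: 'k using frob_diff[of 1 z 1] by simp
  show ?thesis
  proof
   fix z assume "z \<in> ?X \<union> ?Y"
   then consider s where "s ^ q = s" "z = a * s ^ 2" | t where "t ^ q = t" "z = 1 - b * t ^ 2" by blast
   then show "z \<in> Fq" using assms(1,3) by cases (simp_all add: power_mult_distrib sq d)
  qed
 qed
 then have "card (?X \<union> ?Y) \<le> card Fq" by (rule card_mono[OF finite_Fq])
 ultimately show False using Fq_sq_half(1) card_Fq by linarith
qed

end

section \<open>Invertible matrices and bases\<close>

text \<open>The adjugate formula makes the entries of the inverse visibly regular functions, and gives a
 total function that can be used without mentioning the group structure.\<close>

definition minv :: "'a::field mat \<Rightarrow> 'a mat" where
 "minv A = (1 / det A) \<cdot>\<^sub>m adj_mat A"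

definition GLm :: "nat \<Rightarrow> 'a::field mat set" where
 "GLm n = {g \<in> carrier_mat n n. det g \<noteq> 0}"

lemma GLm_carrier[simp]: "g \<in> GLm n \<Longrightarrow> g \<in> carrier_mat n n" unfolding GLm_def by blast
lemma GLm_det[simp]: "g \<in> GLm n \<Longrightarrow> det g \<noteq> 0" unfolding GLm_def by blast
lemma GLmI: "g \<in> carrier_mat n n \<Longrightarrow> det g \<noteq> 0 \<Longrightarrow> g \<in> GLm n" unfolding GLm_def by blast

lemma GLm_dims[simp]: "g \<in> GLm n \<Longrightarrow> dim_row g = n" "g \<in> GLm n \<Longrightarrow> dim_col g = n"
 by (rule carrier_matD[OF GLm_carrier], assumption)+

declare assoc_mult_mat[simp del] index_mult_mat(1)[simp del]

lemma mult_unit_vec: "s < n \<Longrightarrow> dim_col A = n \<Longrightarrow> A *\<^sub>v unit_vec n s = col (A :: 'a::semiring_1 mat) s"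
 by (rule eq_vecI) (auto simp: carrier_vecI scalar_prod_right_unit)

text \<open>Associativity with hypotheses on dimensions only can be used by the simplifier, which normalises
 all products to the right.\<close>

lemma massoc[simp]: "dim_col A = dim_row B \<Longrightarrow> dim_col B = dim_row C \<Longrightarrow>
 (A * B) * C = A * (B * (C :: 'a::semiring_0 mat))"
 by (rule assoc_mult_mat[of _ "dim_row A" "dim_col A" _ "dim_col B" _ "dim_col C"]) auto

lemma lift_eq: "A * P = C * D \<Longrightarrow> dim_col A = dim_row P \<Longrightarrow> dim_col C = dim_row D \<Longrightarrow>
 dim_col P = dim_row X \<Longrightarrow> dim_col D = dim_row X \<Longrightarrow> A * (P * X) = C * (D * (X :: 'a::semiring_0 mat))"
 using massoc[of A P X] massoc[of C D X] by simp

lemma massoc_vec[simp]: "dim_col A = dim_row B \<Longrightarrow> dim_col B = dim_vec v \<Longrightarrow>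
 (A * B) *\<^sub>v v = A *\<^sub>v (B *\<^sub>v (v :: 'a::semiring_0 vec))"
 by (rule assoc_mult_mat_vec[of _ "dim_row A" "dim_col A" _ "dim_col B"]) (auto intro: carrier_vecI)

lemma mult_carrier_iff[simp]: "A * B \<in> carrier_mat n m \<longleftrightarrow> dim_row A = n \<and> dim_col B = m"
 unfolding carrier_mat_def by simp

lemma mult_vec_carrier_iff[simp]: "A *\<^sub>v v \<in> carrier_vec n \<longleftrightarrow> dim_row A = n"
 unfolding carrier_vec_def by simp

lemma mtranspose_mult: "dim_col A = dim_row B \<Longrightarrow>
 (A * B)\<^sup>T = B\<^sup>T * (A :: 'a::comm_semiring_0 mat)\<^sup>T"
 by (rule transpose_mult[of _ "dim_row A" "dim_col A" _ "dim_col B"]) auto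

lemma minv_dims[simp]: "dim_row (minv A) = dim_row A" "dim_col (minv A) = dim_col A"
 by (simp_all add: minv_def adj_mat_def)

lemma minv_carrier[simp]: "A \<in> carrier_mat n n \<Longrightarrow> minv A \<in> carrier_mat n n"
 by (rule carrier_matI) simp_all

lemma minv_right[simp]: "A \<in> GLm n \<Longrightarrow> A * minv A = 1\<^sub>m n"
proof -
 assume A: "A \<in> GLm n"
 have "A * minv A = (1 / det A) \<cdot>\<^sub>m (A * adj_mat A)"
  unfolding minv_def by (rule mult_smult_distrib[of _ n n _ n]) (use A adj_mat(1)[of A n] in auto)
 also have "A * adj_mat A = det A \<cdot>\<^sub>m 1\<^sub>m n" using A by (intro adj_mat(2)) simp
 finally show ?thesis using GLm_det[OF A] by (intro eq_matI) auto
qed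

lemma minv_left[simp]: "A \<in> GLm n \<Longrightarrow> minv A * A = 1\<^sub>m n"
proof -
 assume A: "A \<in> GLm n"
 have "minv A * A = (1 / det A) \<cdot>\<^sub>m (adj_mat A * A)"
  unfolding minv_def by (rule mult_smult_assoc_mat[of _ n n _ n]) (use A adj_mat(1)[of A n] in auto)
 also have "adj_mat A * A = det A \<cdot>\<^sub>m 1\<^sub>m n" using A by (intro adj_mat(3)) simp
 finally show ?thesis using GLm_det[OF A] by (intro eq_matI) auto
qed

lemma det_minv: "A \<in> GLm n \<Longrightarrow> det (minv A) = 1 / det A"
proof -
 assume A: "A \<in> GLm n"
 have "det (A * minv A) = det A * det (minv A)" by (rule det_mult[of A n]) (use A in auto)
 then have "det A * det (minv A) = 1" unfolding minv_right[OF A] by simp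
 then show ?thesis using GLm_det[OF A] by (simp add: field_simps)
qed

lemma minv_GLm[simp]: "A \<in> GLm n \<Longrightarrow> minv A \<in> GLm n"
 by (rule GLmI) (simp_all add: det_minv)

lemma mult_GLm[simp]: "A \<in> GLm n \<Longrightarrow> B \<in> GLm n \<Longrightarrow> A * B \<in> GLm n"
 by (rule GLmI) (simp_all add: det_mult[of _ n])

lemma one_GLm[simp]: "1\<^sub>m n \<in> GLm n" by (rule GLmI) simp_all

lemma transpose_GLm[simp]: "A \<in> GLm n \<Longrightarrow> A\<^sup>T \<in> GLm n"
 by (rule GLmI) (simp_all add: det_transpose[of _ n])

lemma minv_cancel_left[simp]:
 assumes "A \<in> GLm n" "dim_row B = n"
 shows "minv A * (A * B) = B" "A * (minv A * B) = B"
proof -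
 have "(minv A * A) * B = B" "(A * minv A) * B = B" using assms(2) unfolding minv_left[OF assms(1)] minv_right[OF assms(1)] by simp_all
 then show "minv A * (A * B) = B" "A * (minv A * B) = B" using assms by (simp_all del: minv_left minv_right)
qed

lemma minv_cancel_transpose[simp]:
 assumes "A \<in> GLm n" "dim_row B = n"
 shows "minv (A\<^sup>T) * (A\<^sup>T * B) = B" "A\<^sup>T * (minv (A\<^sup>T) * B) = B"
 using minv_cancel_left[OF transpose_GLm[OF assms(1)] assms(2)] .

lemma minv_unique:
 assumes "A \<in> carrier_mat n n" "B \<in> carrier_mat n n" "A * B = 1\<^sub>m n"
 shows "A \<in> GLm n" "minv A = B"
proof -
 have "det A * det B = 1" using det_mult[of A n B] assms by simp
 then show A: "A \<in> GLm n" using assms(1) by (intro GLmI) auto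
 have "minv A * (A * B) = B" using A assms(2) by (intro minv_cancel_left) simp_all
 then show "minv A = B" using A assms by simp
qed

lemma minv_minv[simp]: "A \<in> GLm n \<Longrightarrow> minv (minv A) = A"
 by (rule minv_unique(2)[of _ n]) auto

lemma minv_mult: "A \<in> GLm n \<Longrightarrow> B \<in> GLm n \<Longrightarrow> minv (A * B) = minv B * minv A"
 by (rule minv_unique(2)[of _ n]) auto

lemma minv_one[simp]: "minv (1\<^sub>m n) = 1\<^sub>m n"
 by (rule minv_unique(2)[of _ n]) auto

lemma minv_transpose: "A \<in> GLm n \<Longrightarrow> minv (A\<^sup>T) = (minv A)\<^sup>T"
 by (rule minv_unique(2)[of _ n]) (simp_all flip: mtranspose_mult)

lemma carrier_GL: "carrier (GL n) = GLm n"
proof -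
 have "g \<in> carrier (GL n) \<longleftrightarrow> g \<in> GLm n" for g :: "'a mat"
 proof
  assume g: "g \<in> carrier (GL n)"
  then have "g \<in> Units (ring_mat TYPE('a) n ())" by (simp add: GL_def units_of_carrier)
  then show "g \<in> GLm n" using unit_imp_det_non_zero[of g n "()"]
   by (intro GLmI) (auto simp: Units_def ring_mat_def)
 next
  assume "g \<in> GLm n"
  then show "g \<in> carrier (GL n)" using det_non_zero_imp_unit[of g n "()"]
   by (simp add: GL_def units_of_carrier)
 qed
 then show ?thesis by blast
qed

lemma mult_GL: "x \<otimes>\<^bsub>GL n\<^esub> y = x * y" by (simp add: GL_def units_of_mult ring_mat_def)
lemma one_GL: "\<one>\<^bsub>GL n\<^esub> = 1\<^sub>m n" by (simp add: GL_def units_of_one ring_mat_def)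

lemma group_GL: "group (GL n :: 'a::field mat monoid)"
proof -
 interpret ring "ring_mat TYPE('a) n ()" by (rule ring_mat)
 show ?thesis unfolding GL_def by (rule units_group)
qed

lemma inv_GL: "g \<in> GLm n \<Longrightarrow> inv\<^bsub>GL n\<^esub> g = minv g"
proof -
 assume g: "g \<in> GLm n"
 interpret group "GL n :: 'a mat monoid" by (rule group_GL)
 show ?thesis by (rule inv_equality) (use g in \<open>simp_all add: mult_GL one_GL carrier_GL\<close>)
qed

lemma inj_mult_vec: assumes "A \<in> carrier_mat n n"
 "\<And>v. v \<in> carrier_vec n \<Longrightarrow> A *\<^sub>v v = 0\<^sub>v n \<Longrightarrow> v = 0\<^sub>v n" shows "A \<in> GLm n"
 using det_0_iff_vec_prod_zero_field[OF assms(1)] assms by (intro GLmI) auto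

lemma mult_vec_minv[simp]: assumes "A \<in> GLm n" "v \<in> carrier_vec n"
 shows "A *\<^sub>v (minv A *\<^sub>v v) = v" "minv A *\<^sub>v (A *\<^sub>v v) = v"
proof -
 have "(A * minv A) *\<^sub>v v = v" "(minv A * A) *\<^sub>v v = v" using assms by (simp_all del: massoc_vec)
 then show "A *\<^sub>v (minv A *\<^sub>v v) = v" "minv A *\<^sub>v (A *\<^sub>v v) = v" using assms by (simp_all del: minv_left minv_right)
qed

text \<open>A basis of the space that keeps the first unit vectors and has the given vector as its next
 member; its entries are needed later to see that it is rational if the given vector is.\<close>

lemma extend_to_invertible:
 fixes y :: "'a::field vec"
 assumes "y \<in> carrier_vec n" "i0 < n" "j \<le> i0" "y $ i0 \<noteq> 0"
 obtains E where "E \<in> GLm n" "\<And>s. s < j \<Longrightarrow> col E s = unit_vec n s" "col E j = y"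
  "\<And>r s. r < n \<Longrightarrow> s < n \<Longrightarrow> E $$ (r, s) \<in> {0, 1} \<union> set\<^sub>v y"
proof -
 define E where "E = mat n n (\<lambda>(r, s). if s = j then y $ r else if s = i0 then (if r = j then 1 else 0)
  else if r = s then 1 else 0)"
 have jn: "j < n" using assms by simp
 have E: "E \<in> carrier_mat n n" by (simp add: E_def)
 have "E \<in> GLm n"
 proof (rule inj_mult_vec[OF E])
  fix z assume z: "z \<in> carrier_vec n" and 0: "E *\<^sub>v z = 0\<^sub>v n"
  have eq: "(\<Sum>s<n. E $$ (r, s) * z $ s) = 0" if "r < n" for r
  proof -
   have "(E *\<^sub>v z) $ r = (\<Sum>s<n. E $$ (r, s) * z $ s)"
    using that z E by (auto simp: scalar_prod_def lessThan_atLeast0 intro!: sum.cong)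
   then show ?thesis using 0 that by simp
  qed
  have eq2: "y $ r * z $ j + (\<Sum>s\<in>{..<n} - {j}. E $$ (r, s) * z $ s) = 0" if "r < n" for r
   using eq[OF that] jn that by (subst (asm) sum.remove[of _ j]) (auto simp: E_def)
  have zj: "z $ j = 0"
  proof -
   have "(\<Sum>s\<in>{..<n} - {j}. E $$ (i0, s) * z $ s) = 0"
    by (rule sum.neutral) (use assms in \<open>auto simp: E_def\<close>)
   then show ?thesis using eq2[OF assms(2)] assms(4) by simp
  qed
  have one: "(\<Sum>s\<in>{..<n} - {j}. E $$ (r, s) * z $ s) = z $ s0"
   if "r < n" "s0 < n" "s0 \<noteq> j" "(r = j \<and> s0 = i0) \<or> (r \<noteq> j \<and> r \<noteq> i0 \<and> s0 = r)" for r s0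
  proof -
   have "(\<Sum>s\<in>{..<n} - {j}. E $$ (r, s) * z $ s) = (\<Sum>s\<in>{s0}. E $$ (r, s) * z $ s)"
    by (rule sum.mono_neutral_right) (use that assms in \<open>auto simp: E_def\<close>)
   then show ?thesis using that assms by (auto simp: E_def)
  qed
  show "z = 0\<^sub>v n"
  proof (rule eq_vecI)
   fix s assume "s < dim_vec (0\<^sub>v n)"
   then have s: "s < n" by simp
   show "z $ s = 0\<^sub>v n $ s"
   proof (cases "s = j")
    case True then show ?thesis using zj jn by simp
   next
    case False
    define r where "r = (if s = i0 then j else s)"
    have "(\<Sum>s'\<in>{..<n} - {j}. E $$ (r, s') * z $ s') = z $ s"
     by (rule one) (use s False jn in \<open>auto simp: r_def\<close>)
    then show ?thesis using eq2[of r] zj s jn by (auto simp: r_def split: if_splits)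
   qed
  qed (use z in auto)
 qed
 moreover have "col E s = unit_vec n s" if "s < j" for s
  by (rule eq_vecI) (use that assms jn in \<open>auto simp: E_def unit_vec_def\<close>)
 moreover have "col E j = y"
  by (rule eq_vecI) (use jn assms in \<open>auto simp: E_def\<close>)
 moreover have "E $$ (r, s) \<in> {0, 1} \<union> set\<^sub>v y" if "r < n" "s < n" for r s
  using that assms(1) by (auto simp: E_def vec_setI)
 ultimately show ?thesis using that by blast
qed

lemma row_minv_nonzero: assumes "Q \<in> GLm n" "j < n" shows "row (minv Q) j \<noteq> 0\<^sub>v n"
proof
 assume 0: "row (minv Q) j = 0\<^sub>v n"
 have "(minv Q * Q) $$ (j, j) = row (minv Q) j \<bullet> col Q j"
  using assms minv_carrier[of Q n] by (subst index_mult_mat) auto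
 then show False using assms 0 by (simp add: carrier_vecI)
qed

text \<open>Choose the columns one at a time: as long as the next row of the inverse of the matrix built so
 far does not annihilate \<open>S\<close>, the corresponding column can be exchanged for a member of \<open>S\<close>.\<close>

lemma spanning_imp_basis:
 fixes S :: "'a::field vec set"
 assumes S: "S \<subseteq> carrier_vec n"
  and ann: "\<And>u. u \<in> carrier_vec n \<Longrightarrow> (\<And>v. v \<in> S \<Longrightarrow> u \<bullet> v = 0) \<Longrightarrow> u = 0\<^sub>v n"
 obtains P where "P \<in> GLm n" "\<And>j. j < n \<Longrightarrow> col P j \<in> S"
proof -
 have "\<exists>P \<in> GLm n. \<forall>s<j. col P s \<in> S" if "j \<le> n" for j
  using that
 proof (induction j)
  case 0 then show ?case using one_GLm by blast
 next
  case (Suc j)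
  then obtain Q where Q: "Q \<in> GLm n" "\<And>s. s < j \<Longrightarrow> col Q s \<in> S" by auto
  have j: "j < n" using Suc by simp
  have rc: "row (minv Q) j \<in> carrier_vec n" using Q(1) by (intro carrier_vecI) simp
  obtain v where v: "v \<in> S" "row (minv Q) j \<bullet> v \<noteq> 0"
   using ann[OF rc] row_minv_nonzero[OF Q(1) j] by blast
  define y where "y = minv Q *\<^sub>v v"
  have vc: "v \<in> carrier_vec n" using v S by blast
  have mc: "minv Q \<in> carrier_mat n n" using Q by simp
  have y: "y \<in> carrier_vec n" "y $ j \<noteq> 0" using v(2) j mc vc unfolding y_def by auto
  obtain E where E: "E \<in> GLm n" "\<And>s. s < j \<Longrightarrow> col E s = unit_vec n s" "col E j = y"
   by (rule extend_to_invertible[of y n j j]) (use y j in auto)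
  have cQE: "col (Q * E) s = Q *\<^sub>v col E s" if "s < n" for s
   using that Q(1) E(1) by (intro col_mult2[of _ n n _ n]) auto
  have "col (Q * E) s \<in> S" if "s < Suc j" for s
  proof (cases "s = j")
   case True
   then have "col (Q * E) s = v" using cQE[OF j] E(3) Q(1) vc by (simp add: y_def)
   then show ?thesis using v by simp
  next
   case False
   then have "col (Q * E) s = col Q s" using cQE[of s] E(2)[of s] that j Q(1)
    by (simp add: mult_unit_vec)
   then show ?thesis using Q(2)[of s] that False by simp
  qed
  then show ?case using Q(1) E(1) by (intro bexI[of _ "Q * E"]) auto
 qed
 from this[of n] show ?thesis using that by auto
qed

definition diagm :: "nat \<Rightarrow> (nat \<Rightarrow> 'a::zero) \<Rightarrow> 'a mat" where
 "diagm n d = mat n n (\<lambda>(i, j). if i = j then d i else 0)"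

lemma diagm_carrier[simp]: "diagm n d \<in> carrier_mat n n" by (simp add: diagm_def)

lemma diagm_dims[simp]: "dim_row (diagm n d) = n" "dim_col (diagm n d) = n"
 by (simp_all add: diagm_def)

lemma diagm_index[simp]: "i < n \<Longrightarrow> j < n \<Longrightarrow> diagm n d $$ (i, j) = (if i = j then d i else 0)"
 by (simp add: diagm_def)

lemma mult_mat_index: "A \<in> carrier_mat n m \<Longrightarrow> B \<in> carrier_mat m l \<Longrightarrow> i < n \<Longrightarrow> j < l \<Longrightarrow>
 (A * B) $$ (i, j) = (\<Sum>s<m. A $$ (i, s) * B $$ (s, j))"
 by (auto simp: index_mult_mat(1) scalar_prod_def lessThan_atLeast0 intro!: sum.cong)

lemma diagm_mult_left: "A \<in> carrier_mat n m \<Longrightarrow> i < n \<Longrightarrow> j < m \<Longrightarrow>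
 (diagm n d * A) $$ (i, j) = d i * (A $$ (i, j) :: 'a::comm_ring_1)"
proof -
 assume A: "A \<in> carrier_mat n m" "i < n" "j < m"
 then have "(diagm n d * A) $$ (i, j) = (\<Sum>s<n. diagm n d $$ (i, s) * A $$ (s, j))"
  by (intro mult_mat_index) auto
 also have "\<dots> = (\<Sum>s\<in>{i}. diagm n d $$ (i, s) * A $$ (s, j))"
  by (rule sum.mono_neutral_right) (use A in auto)
 finally show ?thesis using A by simp
qed

lemma diagm_mult_right: "A \<in> carrier_mat m n \<Longrightarrow> i < m \<Longrightarrow> j < n \<Longrightarrow>
 (A * diagm n d) $$ (i, j) = (A $$ (i, j) :: 'a::comm_ring_1) * d j"
proof -
 assume A: "A \<in> carrier_mat m n" "i < m" "j < n"
 then have "(A * diagm n d) $$ (i, j) = (\<Sum>s<n. A $$ (i, s) * diagm n d $$ (s, j))"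
  by (intro mult_mat_index) auto
 also have "\<dots> = (\<Sum>s\<in>{j}. A $$ (i, s) * diagm n d $$ (s, j))"
  by (rule sum.mono_neutral_right) (use A in auto)
 finally show ?thesis using A by simp
qed

lemma diagm_mult: "diagm n d * diagm n d' = diagm n (\<lambda>i. d i * (d' i :: 'a::comm_ring_1))"
 by (rule eq_matI) (auto simp: diagm_mult_left[of _ n n])

lemma diagm_one: "diagm n (\<lambda>_. 1) = 1\<^sub>m n" by (rule eq_matI) auto

lemma transpose_diagm[simp]: "(diagm n d)\<^sup>T = diagm n d" by (rule eq_matI) auto

lemma det_diagm: "det (diagm n d) = (\<Prod>i<n. d i :: 'a::comm_ring_1)"
proof -
 have "det (diagm n d) = prod_list (diag_mat (diagm n d))"
  by (rule det_upper_triangular[of _ n]) auto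
 also have "diag_mat (diagm n d) = map d [0..<n]" by (simp add: diag_mat_def)
 finally show ?thesis by (simp add: lessThan_atLeast0 flip: prod.distinct_set_conv_list)
qed

lemma diagm_GLm: "(\<And>i. i < n \<Longrightarrow> d i \<noteq> 0) \<Longrightarrow> diagm n d \<in> GLm n"
 by (rule GLmI) (auto simp: det_diagm)

lemma diagm_pow: "diagm n d ^\<^sub>m l = diagm n (\<lambda>i. d i ^ l :: 'a::comm_ring_1)"
 by (induction l) (simp_all add: diagm_one diagm_mult mult.commute)

lemma eigen_cols_diag:
 assumes "A \<in> carrier_mat n n" "P \<in> carrier_mat n n" "\<And>j. j < n \<Longrightarrow> A *\<^sub>v col P j = d j \<cdot>\<^sub>v col P j"
 shows "A * P = P * diagm n (d :: nat \<Rightarrow> 'a::comm_ring_1)"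
proof (rule eq_matI)
 fix i j assume "i < dim_row (P * diagm n d)" "j < dim_col (P * diagm n d)"
 then have ij: "i < n" "j < n" using assms by auto
 have "(A * P) $$ (i, j) = (A *\<^sub>v col P j) $ i" using ij assms(1,2) by (simp add: index_mult_mat(1))
 also have "\<dots> = d j * P $$ (i, j)" using ij assms by simp
 finally show "(A * P) $$ (i, j) = (P * diagm n d) $$ (i, j)"
  using ij assms(2) by (simp add: diagm_mult_right[of _ n] mult.commute)
qed (use assms in auto)

lemma commute_pow: "A \<in> carrier_mat n n \<Longrightarrow> B \<in> carrier_mat n n \<Longrightarrow> A * B = B * A \<Longrightarrow>
 (A ^\<^sub>m i) * B = B * (A ^\<^sub>m i :: 'a::semiring_1 mat)"
proof (induction i)
 case (Suc i)
 have "(A ^\<^sub>m Suc i) * B = A ^\<^sub>m i * (B * A)" using Suc.prems by simp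
 also have "\<dots> = (A ^\<^sub>m i * B) * A" using Suc.prems by simp
 also have "\<dots> = B * A ^\<^sub>m Suc i" unfolding Suc.IH[OF Suc.prems] using Suc.prems by simp
 finally show ?case .
qed simp

lemma pow_mat_add: "A \<in> carrier_mat n n \<Longrightarrow> A ^\<^sub>m (i + j) = A ^\<^sub>m i * (A ^\<^sub>m j :: 'a::semiring_1 mat)"
proof (induction j)
 case (Suc j)
 have "A ^\<^sub>m (i + Suc j) = (A ^\<^sub>m i * A ^\<^sub>m j) * A" using Suc by simp
 then show ?case using Suc.prems by simp
qed simp

lemma pow_mat_pow: "A \<in> carrier_mat n n \<Longrightarrow> A ^\<^sub>m (i * j) = (A ^\<^sub>m i :: 'a::semiring_1 mat) ^\<^sub>m j"
proof (induction j)
 case (Suc j)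
 have "A ^\<^sub>m (i * Suc j) = A ^\<^sub>m (i * j + i)" by (simp add: add.commute)
 then show ?case using Suc pow_mat_add[of A n "i * j" i] by simp
qed simp

lemma pow_mat_conj: assumes "A \<in> carrier_mat n n" "P \<in> GLm n"
 shows "(P * A * minv P) ^\<^sub>m i = P * A ^\<^sub>m i * minv P"
proof (induction i)
 case 0 then show ?case using assms by simp
next
 case (Suc i)
 have "(P * A * minv P) ^\<^sub>m Suc i = P * A ^\<^sub>m i * (minv P * (P * (A * minv P)))"
  using Suc assms by simp
 then show ?case using assms by simp
qed

lemma pow_mat_transpose: "A \<in> carrier_mat n n \<Longrightarrow> (A ^\<^sub>m i)\<^sup>T = (A :: 'a::comm_ring_1 mat)\<^sup>T ^\<^sub>m i"
proof (induction i)
 case (Suc i)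
 have "(A ^\<^sub>m Suc i)\<^sup>T = A\<^sup>T * A\<^sup>T ^\<^sub>m i"
  using Suc by (simp add: mtranspose_mult)
 also have "\<dots> = A\<^sup>T ^\<^sub>m i * A\<^sup>T"
  using commute_pow[of "A\<^sup>T" n "A\<^sup>T" i] Suc by simp
 finally show ?case by simp
qed (auto)

lemma pow_minv: "A \<in> GLm n \<Longrightarrow> minv (A ^\<^sub>m i) = minv A ^\<^sub>m i \<and> A ^\<^sub>m i \<in> GLm n"
proof (induction i)
 case (Suc i)
 have "minv (A ^\<^sub>m Suc i) = minv A * minv A ^\<^sub>m i" using Suc minv_mult[of "A ^\<^sub>m i" n A] by simp
 also have "\<dots> = minv A ^\<^sub>m i * minv A"
  using commute_pow[of "minv A" n "minv A" i] Suc by simp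
 finally show ?case using Suc by simp
qed auto

declare One_nat_def [simp del]

context frob_closure
begin

section \<open>The Frobenius map on matrices\<close>

definition Fr :: "nat \<Rightarrow> 'k mat \<Rightarrow> 'k mat" where "Fr m A = map_mat (\<lambda>x. x ^ (q ^ m)) A"

abbreviation rat :: "'k mat \<Rightarrow> bool" where "rat A \<equiv> Fr 1 A = A"

lemma frob_mat_Fr: "frob_mat q = (Fr 1 :: 'k mat \<Rightarrow> 'k mat)"
 by (rule ext) (simp add: frob_mat_def Fr_def)

lemma Fr_dims[simp]: "dim_row (Fr m A) = dim_row A" "dim_col (Fr m A) = dim_col A"
 by (simp_all add: Fr_def)

lemma Fr_carrier[simp]: "Fr m A \<in> carrier_mat n n' \<longleftrightarrow> A \<in> carrier_mat n n'"
 unfolding carrier_mat_def by simp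

lemma Fr_index[simp]: "i < dim_row A \<Longrightarrow> j < dim_col A \<Longrightarrow> Fr m A $$ (i, j) = A $$ (i, j) ^ (q ^ m)"
 by (simp add: Fr_def)

lemma Fr_mult: "dim_col A = dim_row B \<Longrightarrow> Fr m (A * B) = Fr m A * Fr m B"
proof -
 interpret field_hom "\<lambda>x::'k. x ^ (q ^ m)" by (rule frob_hom)
 assume "dim_col A = dim_row B"
 then show ?thesis unfolding Fr_def
  by (intro mat_hom_mult[of _ "dim_row A" "dim_col A" _ "dim_col B"]) auto
qed

lemma Fr_det: "det (Fr m A) = det A ^ (q ^ m)"
proof -
 interpret field_hom "\<lambda>x::'k. x ^ (q ^ m)" by (rule frob_hom)
 show ?thesis unfolding Fr_def by simp
qed

lemma Fr_one[simp]: "Fr m (1\<^sub>m n) = 1\<^sub>m n"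
 by (rule eq_matI) (use q_pow_pos[of m] in auto)

lemma Fr_GLm[simp]: "A \<in> GLm n \<Longrightarrow> Fr m A \<in> GLm n"
 by (rule GLmI) (simp_all add: Fr_det)

lemma Fr_minv: "A \<in> GLm n \<Longrightarrow> Fr m (minv A) = minv (Fr m A)"
 by (rule minv_unique(2)[symmetric, of _ n]) (simp_all flip: Fr_mult)

lemma Fr_transpose: "Fr m (A\<^sup>T) = (Fr m A)\<^sup>T"
 by (rule eq_matI) auto

lemma Fr_Fr: "Fr l (Fr m A) = Fr (m + l) A"
 by (rule eq_matI) (auto simp: frob_frob)

lemma Fr_inj: "Fr m A = Fr m B \<longleftrightarrow> A = B"
proof
 assume eq: "Fr m A = Fr m B"
 then have d: "dim_row A = dim_row B" "dim_col A = dim_col B" by (metis Fr_dims)+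
 show "A = B"
 proof (rule eq_matI)
  fix i j assume ij: "i < dim_row B" "j < dim_col B"
  then have "A $$ (i, j) ^ (q ^ m) = B $$ (i, j) ^ (q ^ m)" using eq d by (metis Fr_index)
  then show "A $$ (i, j) = B $$ (i, j)" by (simp only: frob_inj)
 qed (use d in auto)
qed simp

lemma rat_iff: "A \<in> carrier_mat n n' \<Longrightarrow> rat A \<longleftrightarrow> (\<forall>i<n. \<forall>j<n'. A $$ (i, j) \<in> Fq)"
proof -
 assume A: "A \<in> carrier_mat n n'"
 show ?thesis
 proof
  assume r: "rat A"
  have "A $$ (i, j) ^ q = A $$ (i, j)" if "i < n" "j < n'" for i j
   using Fr_index[of i A j 1] that A unfolding r by simp
  then show "\<forall>i<n. \<forall>j<n'. A $$ (i, j) \<in> Fq" by simp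
 next
  assume "\<forall>i<n. \<forall>j<n'. A $$ (i, j) \<in> Fq"
  then show "rat A" using A by (intro eq_matI) auto
 qed
qed

lemma rat_mult: "rat A \<Longrightarrow> rat B \<Longrightarrow> dim_col A = dim_row B \<Longrightarrow> rat (A * B)"
 by (simp add: Fr_mult)
lemma rat_minv: "rat A \<Longrightarrow> A \<in> GLm n \<Longrightarrow> rat (minv A)" by (simp add: Fr_minv)
lemma rat_transpose: "rat A \<Longrightarrow> rat (A\<^sup>T)" by (simp add: Fr_transpose)
lemma rat_det: "rat A \<Longrightarrow> det A \<in> Fq" using Fr_det[of 1 A] by simp

lemma GL_fixed_iff: "GL_fixed n q = {g \<in> GLm n. rat (g :: 'k mat)}"
 by (simp add: GL_fixed_def carrier_GL frob_mat_Fr)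

lemma ex_Fr_period: "\<exists>m>0. Fr m A = A"
proof -
 have fin: "finite ((\<lambda>(i,j). A $$ (i, j)) ` ({..<dim_row A} \<times> {..<dim_col A}))" (is "finite ?X") by simp
 obtain m where m: "m > 0" "\<And>x. x \<in> ?X \<Longrightarrow> x ^ (q ^ m) = x" using ex_common_period[OF fin] by blast
 have "Fr m A = A" by (rule eq_matI) (auto intro!: m(2) image_eqI)
 then show ?thesis using m by blast
qed

lemma finite_Fr_fixed: assumes "m > 0" shows "finite {A \<in> carrier_mat n n'. Fr m A = A}"
proof -
 let ?K = "{a::'k. a ^ (q ^ m) = a}"
 have "{A \<in> carrier_mat n n'. Fr m A = A} \<subseteq> (\<lambda>f. mat n n' f) ` (({..<n} \<times> {..<n'}) \<rightarrow>\<^sub>E ?K)"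
 proof
  fix A assume A: "A \<in> {A \<in> carrier_mat n n'. Fr m A = A}"
  then have c: "A \<in> carrier_mat n n'" and e: "Fr m A = A" by auto
  have "A = mat n n' (restrict (($$) A) ({..<n} \<times> {..<n'}))" using c by (intro eq_matI) auto
  moreover have "restrict (($$) A) ({..<n} \<times> {..<n'}) \<in> ({..<n} \<times> {..<n'}) \<rightarrow>\<^sub>E ?K"
  proof -
   have "A $$ (i, j) ^ (q ^ m) = A $$ (i, j)" if "i < n" "j < n'" for i j
    using Fr_index[of i A j m] c that unfolding e by simp
   then show ?thesis by auto
  qed
  ultimately show "A \<in> (\<lambda>f. mat n n' f) ` (({..<n} \<times> {..<n'}) \<rightarrow>\<^sub>E ?K)" by blast
 qed
 moreover have "finite (({..<n} \<times> {..<n'}) \<rightarrow>\<^sub>E ?K)" using finite_fixed[OF assms] by (intro finite_PiE) auto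
 ultimately show ?thesis by (meson finite_surj)
qed

section \<open>Lang's theorem\<close>

text \<open>The columns are solutions \<open>v\<close> of \<open>F(v) = w v\<close>. Such solutions are traces \<open>\<Sum> \<psi>\<^sup>i(t e\<^sub>j)\<close> of
 the semilinear map \<open>\<psi> = w\<^sup>-\<^sup>1 F\<close>, which has finite order because it acts on a finite set of
 matrices. They span: a functional that annihilates all of them gives a polynomial in \<open>t\<close> of
 too small degree for its number of zeros.\<close>

lemma lang_columns: assumes w: "w \<in> GLm n" shows "\<exists>P \<in> GLm n. Fr 1 P = w * P"
proof -
 obtain r where r: "r > 0" "Fr r w = w" using ex_Fr_period by blast
 let ?M = "{A \<in> carrier_mat n n. Fr r A = A}"
 define \<psi> where "\<psi> A = minv w * Fr 1 A" for A
 have psi_M: "\<psi> A \<in> ?M" if "A \<in> ?M" for A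
 proof -
  have c: "A \<in> carrier_mat n n" and e: "Fr r A = A" using that by auto
  have "Fr r (\<psi> A) = minv w * Fr r (Fr 1 A)"
   unfolding \<psi>_def using w c r by (simp add: Fr_mult Fr_minv)
  also have "Fr r (Fr 1 A) = Fr 1 (Fr r A)" by (simp add: Fr_Fr add.commute)
  finally show ?thesis using w c by (simp add: e \<psi>_def)
 qed
 have inj: "A = B" if "\<psi> A = \<psi> B" "A \<in> carrier_mat n n" "B \<in> carrier_mat n n" for A B
 proof -
  have "w * \<psi> A = w * \<psi> B" using that by simp
  then have "Fr 1 A = Fr 1 B" using w that(2,3) unfolding \<psi>_def by simp
  then show ?thesis by (simp only: Fr_inj)
 qed
 define a where "a i = (\<psi> ^^ i) (1\<^sub>m n)" for i
 have aM: "a i \<in> ?M" for i unfolding a_def using psi_M by (induction i) auto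
 have ac: "a i \<in> carrier_mat n n" for i using aM by auto
 have "\<not> inj a"
  using finite_imageD[of a UNIV] infinite_UNIV_nat finite_subset[of "range a" ?M] finite_Fr_fixed[OF r(1)] aM by blast
 then obtain i j where "a i = a j" "i \<noteq> j" unfolding inj_def by blast
 then obtain i j where ij: "a i = a j" "i < j" by (metis linorder_neqE_nat)
 have "a (i' + d) = a i' \<Longrightarrow> a d = 1\<^sub>m n" for i' d
 proof (induction i')
  case (Suc i')
  have "\<psi> (a (i' + d)) = \<psi> (a i')" using Suc.prems by (simp add: a_def)
  then show ?case using inj ac Suc.IH by blast
 qed (simp add: a_def)
 from this[of i "j - i"] ij have d1: "a (j - i) = 1\<^sub>m n" by simp
 \<comment> \<open>a common period of \<open>\<psi>\<close> on the identity and of Frobenius on \<open>w\<close>\<close>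
 define N where "N = (j - i) * r"
 have Npos: "N > 0" using ij r by (simp add: N_def)
 have aN: "a N = 1\<^sub>m n"
 proof -
  have "a ((j - i) * l) = 1\<^sub>m n" for l
  proof (induction l)
   case (Suc l)
   have "a ((j - i) * Suc l) = (\<psi> ^^ (j - i)) (a ((j - i) * l))" by (simp add: a_def funpow_add add.commute)
   then show ?case using Suc d1 by (simp add: a_def)
  qed (simp add: a_def)
  then show ?thesis by (simp add: N_def)
 qed
 have wa: "w * a (Suc i) = Fr 1 (a i)" for i
  using w ac[of i] by (simp add: a_def \<psi>_def)
 let ?K = "{t::'k. t ^ (q ^ N) = t}"
 define B where "B j t = vec n (\<lambda>r. \<Sum>i<N. a i $$ (r, j) * t ^ (q ^ i))" for j t
 define S where "S = {v \<in> carrier_vec n. \<forall>r<n. v $ r ^ q = (w *\<^sub>v v) $ r}"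
 have BS: "B j t \<in> S" if j: "j < n" and t: "t \<in> ?K" for j t
 proof -
  have "B j t $ r ^ q = (w *\<^sub>v B j t) $ r" if r: "r < n" for r
  proof -
   have "(w *\<^sub>v B j t) $ r = (\<Sum>s<n. w $$ (r, s) * (\<Sum>i<N. a i $$ (s, j) * t ^ (q ^ i)))"
    using r w by (auto simp: B_def scalar_prod_def lessThan_atLeast0 intro!: sum.cong)
   also have "\<dots> = (\<Sum>i<N. (\<Sum>s<n. w $$ (r, s) * a i $$ (s, j)) * t ^ (q ^ i))"
    unfolding sum_distrib_left sum_distrib_right by (subst sum.swap) (simp add: mult.assoc)
   also have "\<dots> = (\<Sum>i<N. (w * a i) $$ (r, j) * t ^ (q ^ i))"
    using mult_mat_index[of w n n "a _" n r j] w ac r j by simp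
   finally have e1: "(w *\<^sub>v B j t) $ r = (\<Sum>i<N. (w * a i) $$ (r, j) * t ^ (q ^ i))" .
   have "B j t $ r ^ q = (\<Sum>i<N. a i $$ (r, j) * t ^ (q ^ i)) ^ (q ^ 1)" using r by (simp add: B_def)
   also have "\<dots> = (\<Sum>i<N. (a i $$ (r, j) * t ^ (q ^ i)) ^ (q ^ 1))"
   proof -
    have "(sum f X) ^ (q ^ 1) = (\<Sum>i\<in>X. f i ^ (q ^ 1))" for f :: "nat \<Rightarrow> 'k" and X
     using q_gt_1 by (induction X rule: infinite_finite_induct) (use frob_add[of _ _ 1] in auto)
    then show ?thesis .
   qed
   also have "\<dots> = (\<Sum>i<N. (w * a (Suc i)) $$ (r, j) * t ^ (q ^ Suc i))"
    using ac r j by (intro sum.cong) (auto simp: wa carrier_matD[OF ac] power_mult_distrib mult.commute simp flip: power_mult)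
   also have "\<dots> = (\<Sum>i<N. (w * a i) $$ (r, j) * t ^ (q ^ i))"
   proof -
    obtain N' where N': "N = Suc N'" using Npos by (cases N) auto
    have "a 0 = 1\<^sub>m n" by (simp add: a_def)
    then have z: "(w * a N) $$ (r, j) * t ^ (q ^ N) = (w * a 0) $$ (r, j) * t ^ (q ^ 0)" using aN t by simp
    show ?thesis using z unfolding N' sum.lessThan_Suc_shift[of "\<lambda>i. (w * a i) $$ (r, j) * t ^ (q ^ i)"]
     by (simp add: sum.lessThan_Suc)
   qed
   finally show ?thesis using e1 by simp
  qed
  then show ?thesis by (auto simp: S_def B_def intro: carrier_vecI)
 qed
 have ann: "u = 0\<^sub>v n" if u: "u \<in> carrier_vec n" and 0: "\<And>v. v \<in> S \<Longrightarrow> u \<bullet> v = 0" for u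
 proof -
  show "u = 0\<^sub>v n"
  proof (rule eq_vecI)
   fix j assume "j < dim_vec (0\<^sub>v n)"
   then have j: "j < n" by simp
   define c where "c i = (\<Sum>r<n. u $ r * a i $$ (r, j))" for i
   define f where "f = (\<Sum>i<N. monom (c i) (q ^ i))"
   have z: "poly f t = 0" if t: "t \<in> ?K" for t
   proof -
    have "0 = u \<bullet> B j t" using 0 BS[OF j t] by simp
    also have "\<dots> = (\<Sum>r<n. u $ r * (\<Sum>i<N. a i $$ (r, j) * t ^ (q ^ i)))"
     by (auto simp: B_def scalar_prod_def lessThan_atLeast0)
    also have "\<dots> = (\<Sum>i<N. c i * t ^ (q ^ i))"
     unfolding c_def sum_distrib_left sum_distrib_right by (subst sum.swap) (simp add: mult.assoc)
    finally show ?thesis by (simp add: f_def poly_sum poly_monom)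
   qed
   have "f = 0"
   proof (rule ccontr)
    assume f: "f \<noteq> 0"
    have "card ?K \<le> card {t. poly f t = 0}" using z poly_roots_finite[OF f] by (intro card_mono) auto
    also have "\<dots> \<le> degree f" by (rule card_poly_roots_bound[OF f])
    also have "\<dots> \<le> q ^ (N - 1)" unfolding f_def
    proof (rule degree_sum_le)
     fix i assume "i \<in> {..<N}"
     then have "q ^ i \<le> q ^ (N - 1)" using q_gt_1 by (intro power_increasing) auto
     then show "degree (monom (c i) (q ^ i)) \<le> q ^ (N - 1)" using degree_monom_le order_trans by blast
    qed simp
    also have "\<dots> < q ^ N" using q_gt_1 Npos by (intro power_strict_increasing) auto
    finally show False using card_fixed[OF Npos] by simp
   qed
   then have "coeff f 1 = 0" by simp
   moreover have "coeff f 1 = (\<Sum>i<N. if i = 0 then c i else 0)"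
   proof -
    have "q ^ i = 1 \<longleftrightarrow> i = 0" for i using one_less_power[OF q_gt_1, of i] by (cases "i = 0") auto
    then show ?thesis unfolding f_def coeff_sum coeff_monom by simp
   qed
   ultimately have "c 0 = 0" using Npos by simp
   moreover have "c 0 = u $ j"
   proof -
    have "c 0 = (\<Sum>r<n. if r = j then u $ r else 0)"
     unfolding c_def by (rule sum.cong) (use j in \<open>auto simp: a_def\<close>)
    then show ?thesis using j by simp
   qed
   ultimately show "u $ j = 0\<^sub>v n $ j" using j by simp
  qed (use u in auto)
 qed
 have "S \<subseteq> carrier_vec n" by (auto simp: S_def)
 from spanning_imp_basis[OF this ann]
 obtain P where P: "P \<in> GLm n" "\<And>j. j < n \<Longrightarrow> col P j \<in> S" by blast
 have "Fr 1 P = w * P"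
 proof (rule eq_matI)
  fix i j assume "i < dim_row (w * P)" "j < dim_col (w * P)"
  then have ij: "i < n" "j < n" using w P by auto
  have "Fr 1 P $$ (i, j) = col P j $ i ^ q" using ij P(1) by simp
  also have "\<dots> = (w *\<^sub>v col P j) $ i" using P(2)[OF ij(2)] ij by (simp add: S_def)
  also have "\<dots> = (w * P) $$ (i, j)" using ij w P(1) by (simp add: index_mult_mat(1))
  finally show "Fr 1 P $$ (i, j) = (w * P) $$ (i, j)" .
 qed (use w P(1) in auto)
 then show ?thesis using P(1) by blast
qed

section \<open>Rational points of linear subspaces\<close>

text \<open>Linear independence over the field with \<open>q\<close> elements.\<close>

definition indepq :: "'k set \<Rightarrow> bool" where
 "indepq T \<longleftrightarrow> finite T \<and> (\<forall>c. (\<forall>t\<in>T. c t \<in> Fq) \<longrightarrow> (\<Sum>t\<in>T. c t * t) = 0 \<longrightarrow> (\<forall>t\<in>T. c t = 0))"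

lemma ex_indepq: "finite S \<Longrightarrow> \<exists>T. indepq T \<and> (\<forall>s\<in>S. \<exists>c. (\<forall>t\<in>T. c t \<in> Fq) \<and> s = (\<Sum>t\<in>T. c t * t))"
proof (induction S rule: finite_induct)
 case empty show ?case by (rule exI[of _ "{}"]) (simp add: indepq_def)
next
 case (insert s S)
 then obtain T where T: "indepq T" "\<And>s. s \<in> S \<Longrightarrow> \<exists>c. (\<forall>t\<in>T. c t \<in> Fq) \<and> s = (\<Sum>t\<in>T. c t * t)" by blast
 have fT: "finite T" using T by (simp add: indepq_def)
 show ?case
 proof (cases "\<exists>c. (\<forall>t\<in>T. c t \<in> Fq) \<and> s = (\<Sum>t\<in>T. c t * t)")
  case True then show ?thesis using T by blast
 next
  case False
  have sT: "s \<notin> T"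
  proof
   assume "s \<in> T"
   then have "s = (\<Sum>t\<in>T. (if t = s then 1 else 0) * t)"
    using fT by (simp add: if_distrib[where f="\<lambda>x. x * _"] cong: if_cong)
   moreover have "\<forall>t\<in>T. (if t = s then 1 else 0 :: 'k) \<in> Fq" using q_gt_1 by auto
   ultimately have "(\<forall>t\<in>T. (if t = s then 1 else 0) \<in> Fq) \<and> s = (\<Sum>t\<in>T. (if t = s then 1 else 0) * t)"
    by (rule conjI[rotated])
   then show False using False by (elim notE) (rule exI)
  qed
  have "indepq (insert s T)" unfolding indepq_def
  proof (intro conjI allI impI)
   show "finite (insert s T)" using fT by simp
   fix c assume c: "\<forall>t\<in>insert s T. c t \<in> Fq" and 0: "(\<Sum>t\<in>insert s T. c t * t) = 0"
   have 1: "c s * s + (\<Sum>t\<in>T. c t * t) = 0" using 0 sT fT by simp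
   have cs: "c s = 0"
   proof (rule ccontr)
    assume nz: "c s \<noteq> 0"
    then have "s = - (\<Sum>t\<in>T. c t * t) / c s" using 1 by (simp add: field_simps eq_neg_iff_add_eq_0)
    also have "\<dots> = (\<Sum>t\<in>T. (- c t / c s) * t)" by (simp add: sum_divide_distrib sum_negf)
    finally have "s = (\<Sum>t\<in>T. (- c t / c s) * t)" .
    moreover have "\<forall>t\<in>T. - c t / c s \<in> Fq" using c odd_q by (simp add: power_divide)
    ultimately have "\<exists>c. (\<forall>t\<in>T. c t \<in> Fq) \<and> s = (\<Sum>t\<in>T. c t * t)"
     by (intro exI[of _ "\<lambda>t. - c t / c s"]) blast
    then show False using False by blast
   qed
   then have "(\<Sum>t\<in>T. c t * t) = 0" using 1 by simp
   then have "\<forall>t\<in>T. c t = 0" using T(1) c unfolding indepq_def by blast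
   then show "\<forall>t\<in>insert s T. c t = 0" using cs by simp
  qed
  moreover have "\<exists>c. (\<forall>t\<in>insert s T. c t \<in> Fq) \<and> x = (\<Sum>t\<in>insert s T. c t * t)" if x: "x \<in> insert s S" for x
  proof (cases "x = s")
   case True
   have "x = (\<Sum>t\<in>insert s T. (if t = s then 1 else 0) * t)"
    using fT True by (simp add: if_distrib[where f="\<lambda>x. x * _"] cong: if_cong)
   then show ?thesis using q_gt_1 by (intro exI[of _ "\<lambda>t. if t = s then 1 else 0"]) auto
  next
   case F: False
   then obtain c where c: "\<forall>t\<in>T. c t \<in> Fq" "x = (\<Sum>t\<in>T. c t * t)" using T(2) x by blast
   have "(\<Sum>t\<in>T. (c(s := 0)) t * t) = (\<Sum>t\<in>T. c t * t)" by (rule sum.cong) (use sT in auto)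
   then have "x = (\<Sum>t\<in>insert s T. (c(s := 0)) t * t)" using sT fT c(2) by simp
   then show ?thesis using c(1) q_gt_1 by (intro exI[of _ "c(s := 0)"]) auto
  qed
  ultimately show ?thesis by blast
 qed
qed

definition lincomb :: "nat \<Rightarrow> 'k set \<Rightarrow> ('k \<Rightarrow> 'k) \<Rightarrow> ('k \<Rightarrow> 'k mat) \<Rightarrow> 'k mat" where
 "lincomb n T c M = mat n n (\<lambda>(i, j). \<Sum>t\<in>T. c t * M t $$ (i, j))"

lemma lincomb_carrier[simp]: "lincomb n T c M \<in> carrier_mat n n" by (simp add: lincomb_def)

lemma det_line_poly:
 fixes A B :: "'k mat" assumes "A \<in> carrier_mat n n" "B \<in> carrier_mat n n"
 shows "\<exists>f. degree f \<le> n \<and> (\<forall>x. poly f x = det (A + x \<cdot>\<^sub>m B))"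
proof -
 define M where "M = mat n n (\<lambda>(i, j). [:A $$ (i, j), B $$ (i, j):])"
 have "degree (det M) \<le> 1 * n" by (rule degree_det_le) (auto simp: M_def)
 moreover have "poly (det M) x = det (A + x \<cdot>\<^sub>m B)" for x
 proof -
  have pe: "comm_ring_hom (\<lambda>p::'k poly. poly p x)" by unfold_locales auto
  have "map_mat (\<lambda>p. poly p x) M = A + x \<cdot>\<^sub>m B"
   by (rule eq_matI) (use assms in \<open>auto simp: M_def\<close>)
  then show ?thesis using comm_ring_hom.hom_det[OF pe, of M] by simp
 qed
 ultimately show ?thesis by (intro exI[of _ "det M"]) auto
qed

text \<open>Replace the coefficients by rational ones, one after another. As a function of one coefficient
 the determinant is a polynomial of degree at most \<open>n < q\<close>, so it does not vanish on the whole
 finite field.\<close>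

lemma ex_Fq_invertible:
 assumes n: "n < q" and T: "finite T" "\<And>t. t \<in> T \<Longrightarrow> M t \<in> carrier_mat n n"
  and d: "det (lincomb n T c M) \<noteq> 0"
 shows "\<exists>c'. (\<forall>t\<in>T. c' t \<in> Fq) \<and> det (lincomb n T c' M) \<noteq> 0"
proof -
 have "\<exists>c'. (\<forall>t\<in>X. c' t \<in> Fq) \<and> det (lincomb n T c' M) \<noteq> 0" if "X \<subseteq> T" for X
  using finite_subset[OF that T(1)] that
 proof (induction X rule: finite_induct)
  case empty then show ?case using d by blast
 next
  case (insert s X)
  then obtain c' where c': "\<And>t. t \<in> X \<Longrightarrow> c' t \<in> Fq" "det (lincomb n T c' M) \<noteq> 0" by blast
  have sT: "s \<in> T" using insert by simp
  have eq: "lincomb n T (c'(s := x)) M = lincomb n (T - {s}) c' M + x \<cdot>\<^sub>m M s" for x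
  proof (rule eq_matI)
   fix i j assume "i < dim_row (lincomb n (T - {s}) c' M + x \<cdot>\<^sub>m M s)" "j < dim_col (lincomb n (T - {s}) c' M + x \<cdot>\<^sub>m M s)"
   then have ij: "i < n" "j < n" using T(2)[OF sT] by auto
   have "(\<Sum>t\<in>T - {s}. (c'(s := x)) t * M t $$ (i, j)) = (\<Sum>t\<in>T - {s}. c' t * M t $$ (i, j))"
    by (rule sum.cong) auto
   then show "lincomb n T (c'(s := x)) M $$ (i, j) = (lincomb n (T - {s}) c' M + x \<cdot>\<^sub>m M s) $$ (i, j)"
    using ij T(2)[OF sT] sum.remove[OF T(1) sT, of "\<lambda>t. (c'(s := x)) t * M t $$ (i, j)"] by (simp add: lincomb_def)
  qed (use T(2)[OF sT] in \<open>auto simp: lincomb_def\<close>)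
  obtain f where f: "degree f \<le> n" "\<And>x. poly f x = det (lincomb n T (c'(s := x)) M)"
   unfolding eq using det_line_poly[OF lincomb_carrier T(2)[OF sT]] by blast
  have "poly f (c' s) \<noteq> 0" unfolding f(2) using c'(2) by simp
  then have f0: "f \<noteq> 0" by auto
  have "\<exists>x\<in>Fq. poly f x \<noteq> 0"
  proof (rule ccontr)
   assume "\<not> ?thesis"
   then have "card Fq \<le> card {x. poly f x = 0}" using poly_roots_finite[OF f0] by (intro card_mono) auto
   also have "\<dots> \<le> degree f" by (rule card_poly_roots_bound[OF f0])
   finally show False using f(1) n card_Fq by linarith
  qed
  then obtain x where x: "x \<in> Fq" "det (lincomb n T (c'(s := x)) M) \<noteq> 0" using f(2) by auto
  have "\<forall>t\<in>insert s X. (c'(s := x)) t \<in> Fq" using x(1) c'(1) by auto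
  then show ?case using x(2) by blast
 qed
 from this[of T] show ?thesis by blast
qed

text \<open>A linear equation on matrices with coefficients in the finite field.\<close>

definition rational_functional :: "nat \<Rightarrow> ('k mat \<Rightarrow> 'k) \<Rightarrow> bool" where
 "rational_functional n f \<longleftrightarrow>
   (\<forall>A\<in>carrier_mat n n. \<forall>B\<in>carrier_mat n n. f (A + B) = f A + f B) \<and>
   (\<forall>A\<in>carrier_mat n n. \<forall>x. f (x \<cdot>\<^sub>m A) = x * f A) \<and>
   (\<forall>A\<in>carrier_mat n n. rat A \<longrightarrow> f A \<in> Fq)"

lemma functional_lincomb:
 assumes f: "rational_functional n f" and T: "finite T" "\<And>t. t \<in> T \<Longrightarrow> M t \<in> carrier_mat n n"
 shows "f (lincomb n T c M) = (\<Sum>t\<in>T. c t * f (M t))"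
 using T
proof (induction T rule: finite_induct)
 case empty
 have "lincomb n {} c M = 0 \<cdot>\<^sub>m 0\<^sub>m n n" by (rule eq_matI) (auto simp: lincomb_def)
 moreover have "f (0 \<cdot>\<^sub>m 0\<^sub>m n n) = 0 * f (0\<^sub>m n n)"
  using f[unfolded rational_functional_def, THEN conjunct2, THEN conjunct1, rule_format, of "0\<^sub>m n n" 0] by simp
 ultimately show ?case by simp
next
 case (insert s T)
 have Ms: "M s \<in> carrier_mat n n" using insert by simp
 have "lincomb n (insert s T) c M = c s \<cdot>\<^sub>m M s + lincomb n T c M"
  by (rule eq_matI) (use insert.hyps carrier_matD[OF Ms] in \<open>auto simp: lincomb_def\<close>)
 then show ?case using insert Ms f by (simp add: rational_functional_def)
qed

text \<open>Descent for linear systems: write the entries of \<open>B\<close> in terms of elements \<open>t\<close> that are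
 independent over the finite field. The coefficient matrices \<open>M t\<close> are rational solutions, and
 \<open>B\<close>, an invertible combination of them, can be moved to a rational invertible combination.\<close>

lemma rational_point:
 assumes n: "n < q" and \<Phi>: "\<And>f. f \<in> \<Phi> \<Longrightarrow> rational_functional n f"
  and B: "B \<in> GLm n" "\<And>f. f \<in> \<Phi> \<Longrightarrow> f B = 0"
 shows "\<exists>B' \<in> GLm n. rat B' \<and> (\<forall>f\<in>\<Phi>. f B' = 0)"
proof -
 let ?S = "(\<lambda>(i,j). B $$ (i, j)) ` ({..<n} \<times> {..<n})"
 have "finite ?S" by simp
 from ex_indepq[OF this] obtain T where T: "indepq T"
  "\<And>i j. i < n \<Longrightarrow> j < n \<Longrightarrow> \<exists>c. (\<forall>t\<in>T. c t \<in> Fq) \<and> B $$ (i, j) = (\<Sum>t\<in>T. c t * t)" by fastforce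
 then have fT: "finite T" by (simp add: indepq_def)
 obtain C where C: "\<And>i j t. i < n \<Longrightarrow> j < n \<Longrightarrow> t \<in> T \<Longrightarrow> C i j t \<in> Fq"
  "\<And>i j. i < n \<Longrightarrow> j < n \<Longrightarrow> B $$ (i, j) = (\<Sum>t\<in>T. C i j t * t)"
 proof -
  define Pr where "Pr i j c \<longleftrightarrow> (\<forall>t\<in>T. c t \<in> Fq) \<and> B $$ (i, j) = (\<Sum>t\<in>T. c t * t)" for i j c
  define C where "C i j = (SOME c. Pr i j c)" for i j
  have "Pr i j (C i j)" if "i < n" "j < n" for i j
  proof -
   have "\<exists>c. Pr i j c" using T(2)[OF that] unfolding Pr_def .
   then show ?thesis unfolding C_def by (rule someI_ex)
  qed
  then have "(\<forall>t\<in>T. C i j t \<in> Fq) \<and> B $$ (i, j) = (\<Sum>t\<in>T. C i j t * t)" if "i < n" "j < n" for i j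
   using that unfolding Pr_def by blast
  then show ?thesis using that by blast
 qed
 define M where "M t = mat n n (\<lambda>(i, j). C i j t)" for t
 have Mc: "M t \<in> carrier_mat n n" for t by (simp add: M_def)
 have Mr: "rat (M t)" if "t \<in> T" for t unfolding rat_iff[OF Mc] using C(1) that by (simp add: M_def)
 have BM: "B = lincomb n T (\<lambda>t. t) M"
  by (rule eq_matI) (use B(1) C(2) in \<open>auto simp: lincomb_def M_def mult.commute\<close>)
 have fM: "f (M t) = 0" if f: "f \<in> \<Phi>" and t: "t \<in> T" for f t
 proof -
  have z: "(\<Sum>t\<in>T. f (M t) * t) = 0"
   using functional_lincomb[OF \<Phi>[OF f] fT, of M "\<lambda>t. t"] Mc B(2)[OF f] unfolding BM[symmetric] by (simp add: mult.commute)
  have r: "\<forall>t\<in>T. f (M t) \<in> Fq" using \<Phi>[OF f] Mc Mr unfolding rational_functional_def by blast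
  have "(\<forall>t\<in>T. c t \<in> Fq) \<Longrightarrow> (\<Sum>t\<in>T. c t * t) = 0 \<Longrightarrow> (\<forall>t\<in>T. c t = 0)" for c
   using T(1) unfolding indepq_def by blast
  from this[of "\<lambda>t. f (M t)", OF r z] have "\<forall>t\<in>T. f (M t) = 0" .
  then show ?thesis using t by blast
 qed
 have "det (lincomb n T (\<lambda>t. t) M) \<noteq> 0" unfolding BM[symmetric] using B(1) by simp
 then obtain c where c: "\<forall>t\<in>T. c t \<in> Fq" "det (lincomb n T c M) \<noteq> 0" using ex_Fq_invertible[OF n fT, of M "\<lambda>t. t"] Mc by blast
 have "rat (lincomb n T c M)" unfolding rat_iff[OF lincomb_carrier]
 proof (intro allI impI)
  fix i j assume ij: "i < n" "j < n"
  have s: "(\<And>t. t \<in> X \<Longrightarrow> g t \<in> Fq) \<Longrightarrow> sum g X \<in> Fq" for g :: "'k \<Rightarrow> 'k" and X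
   by (induction X rule: infinite_finite_induct) (use frob_add[of _ _ 1] q_gt_1 in auto)
  have "(\<Sum>t\<in>T. c t * M t $$ (i, j)) \<in> Fq"
   by (rule s) (use c(1) C(1) ij in \<open>auto simp: M_def power_mult_distrib\<close>)
  then show "lincomb n T c M $$ (i, j) \<in> Fq" using ij by (simp add: lincomb_def)
 qed
 moreover have "f (lincomb n T c M) = 0" if "f \<in> \<Phi>" for f
  using functional_lincomb[OF \<Phi>[OF that] fT, of M c] Mc fM[OF that] by simp
 moreover have "lincomb n T c M \<in> GLm n" using c(2) by (intro GLmI) auto
 ultimately show ?thesis by blast
qed

end

section \<open>Semisimple matrices\<close>

definition lv :: "nat \<Rightarrow> nat set \<Rightarrow> (nat \<Rightarrow> 'a::comm_ring_1) \<Rightarrow> (nat \<Rightarrow> 'a vec) \<Rightarrow> 'a vec" where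
 "lv n S c h = vec n (\<lambda>r. \<Sum>i\<in>S. c i * h i $ r)"

lemma lv_carrier[simp]: "lv n S c h \<in> carrier_vec n" by (simp add: lv_def)
lemma lv_dim[simp]: "dim_vec (lv n S c h) = n" by (simp add: lv_def)

lemma mult_mat_vec_index: "A \<in> carrier_mat m n \<Longrightarrow> v \<in> carrier_vec n \<Longrightarrow> r < m \<Longrightarrow>
 (A *\<^sub>v v) $ r = (\<Sum>s<n. A $$ (r, s) * v $ s)"
 by (auto simp: scalar_prod_def lessThan_atLeast0 intro!: sum.cong)

lemma scalar_prod_index: "v \<in> carrier_vec n \<Longrightarrow> u \<bullet> v = (\<Sum>s<n. u $ s * v $ s)"
 by (auto simp: scalar_prod_def lessThan_atLeast0 intro!: sum.cong)

lemma mult_lv: assumes "A \<in> carrier_mat n n" "\<And>i. i \<in> S \<Longrightarrow> h i \<in> carrier_vec n"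
 shows "A *\<^sub>v lv n S c h = lv n S c (\<lambda>i. A *\<^sub>v h i)"
proof (rule eq_vecI)
 fix r assume "r < dim_vec (lv n S c (\<lambda>i. A *\<^sub>v h i))"
 then have r: "r < n" by simp
 have "(A *\<^sub>v lv n S c h) $ r = (\<Sum>s<n. A $$ (r, s) * (\<Sum>i\<in>S. c i * h i $ s))"
  using r assms(1) by (subst mult_mat_vec_index[of _ n n]) (auto simp: lv_def)
 also have "\<dots> = (\<Sum>i\<in>S. c i * (\<Sum>s<n. A $$ (r, s) * h i $ s))"
  unfolding sum_distrib_left by (subst sum.swap) (simp add: mult_ac)
 also have "\<dots> = (\<Sum>i\<in>S. c i * (A *\<^sub>v h i) $ r)"
  using r assms by (intro sum.cong) (auto simp: mult_mat_vec_index[of _ n n] simp del: index_mult_mat_vec)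
 finally show "(A *\<^sub>v lv n S c h) $ r = lv n S c (\<lambda>i. A *\<^sub>v h i) $ r" using r by (simp add: lv_def)
qed (use assms in auto)

lemma scalar_lv: assumes "\<And>i. i \<in> S \<Longrightarrow> h i \<in> carrier_vec n"
 shows "u \<bullet> lv n S c h = (\<Sum>i\<in>S. c i * (u \<bullet> h i))"
proof -
 have "u \<bullet> lv n S c h = (\<Sum>s<n. u $ s * (\<Sum>i\<in>S. c i * h i $ s))"
  by (subst scalar_prod_index[of _ n]) (auto simp: lv_def)
 also have "\<dots> = (\<Sum>i\<in>S. c i * (\<Sum>s<n. u $ s * h i $ s))"
  unfolding sum_distrib_left by (subst sum.swap) (simp add: mult_ac)
 finally show ?thesis using assms scalar_prod_index[of _ n u] by simp
qed

lemma lv_closed: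
 assumes "finite S" "\<And>i. i \<in> S \<Longrightarrow> h i \<in> W" "W \<subseteq> carrier_vec n" "w \<in> W"
  and add: "\<And>v w. v \<in> W \<Longrightarrow> w \<in> W \<Longrightarrow> v + w \<in> W" and smult: "\<And>x v. v \<in> W \<Longrightarrow> x \<cdot>\<^sub>v v \<in> W"
 shows "lv n S c h \<in> W"
 using assms(1,2)
proof (induction S rule: finite_induct)
 case empty
 have "lv n {} c h = 0 \<cdot>\<^sub>v w" by (rule eq_vecI) (use assms(3,4) in \<open>auto simp: lv_def\<close>)
 then show ?case using smult assms(4) by simp
next
 case (insert i S)
 have hi: "h i \<in> carrier_vec n" using insert.prems assms(3) by blast
 have "lv n (insert i S) c h = c i \<cdot>\<^sub>v h i + lv n S c h"
  by (rule eq_vecI) (use insert.hyps carrier_vecD[OF hi] in \<open>auto simp: lv_def\<close>)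
 then show ?case using insert add smult by simp
qed

lemma pow_mat_1[simp]: "A ^\<^sub>m 1 = (A :: 'a::semiring_1 mat)"
 by (simp add: One_nat_def)

context frob_closure
begin

text \<open>Every matrix is defined over a finite field, so its eigenvalues satisfy \<open>x ^ (q ^ m) = x\<close> for
 some \<open>m\<close>. Since this equation has no multiple roots, the condition says that the matrix is
 diagonalisable.\<close>

definition ss :: "'k mat \<Rightarrow> bool" where
 "ss A \<longleftrightarrow> (\<exists>m>0. A ^\<^sub>m (q ^ m) = A)"

text \<open>The eigenvectors in an invariant subspace \<open>W\<close> span it, in the form: a functional that vanishes
 on them vanishes on \<open>W\<close>. For \<open>Q = q ^ m\<close> and \<open>x ^ Q = x\<close> nonzero, the sum of the \<open>x ^ i A ^ i
 v\<close> for \<open>1 \<le> i < Q\<close> is an eigenvector of \<open>A\<close>; a polynomial of degree less than \<open>Q\<close> with \<open>Q\<close>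
 zeros vanishes.\<close>

lemma eigen_span:
 assumes A: "A \<in> carrier_mat n n" "ss A" and W: "W \<subseteq> carrier_vec n"
  and cl: "\<And>v. v \<in> W \<Longrightarrow> A *\<^sub>v v \<in> W" "\<And>v w. v \<in> W \<Longrightarrow> w \<in> W \<Longrightarrow> v + w \<in> W"
   "\<And>x v. v \<in> W \<Longrightarrow> x \<cdot>\<^sub>v v \<in> W"
  and u: "u \<in> carrier_vec n" "\<And>w x. w \<in> W \<Longrightarrow> A *\<^sub>v w = x \<cdot>\<^sub>v w \<Longrightarrow> u \<bullet> w = 0"
  and v: "v \<in> W"
 shows "u \<bullet> v = 0"
proof -
 obtain m where m: "m > 0" "A ^\<^sub>m (q ^ m) = A" using A(2) unfolding ss_def by blast
 define Q where "Q = q ^ m"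
 have Q1: "Q > 1" unfolding Q_def using m(1) q_gt_1 by (rule one_less_power[rotated])
 define h where "h i = (A ^\<^sub>m i) *\<^sub>v v" for i
 have vc: "v \<in> carrier_vec n" using v W by blast
 have hS: "A *\<^sub>v h i = h (Suc i)" for i
 proof -
  have "A ^\<^sub>m i * A = A * A ^\<^sub>m i" by (rule commute_pow[of _ n]) (use A in auto)
  then have "h (Suc i) = (A * A ^\<^sub>m i) *\<^sub>v v" unfolding h_def by simp
  then show ?thesis unfolding h_def using A vc by simp
 qed
 have hW: "h i \<in> W" for i
 proof (induction i)
  case 0 show ?case using v vc A by (simp add: h_def)
 next
  case (Suc i) then show ?case using cl(1) unfolding hS[symmetric] by blast
 qed
 have hc: "h i \<in> carrier_vec n" for i using hW W by blast
 have hQ: "h Q = h 1" using m(2) A by (simp add: h_def Q_def)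
 define f where "f i = u \<bullet> h i" for i
 have ev: "(\<Sum>i\<in>{1..<Q}. x ^ i * f i) = 0" if x: "x ^ Q = x" for x
 proof (cases "x = 0")
  case True then show ?thesis by (auto intro!: sum.neutral)
 next
  case False
  define w where "w = lv n {1..<Q} (\<lambda>i. x ^ i) h"
  have wW: "w \<in> W" unfolding w_def by (rule lv_closed[OF _ hW W v cl(2,3)]) auto
  have "A *\<^sub>v w = inverse x \<cdot>\<^sub>v w"
  proof (rule eq_vecI)
   fix r assume "r < dim_vec (inverse x \<cdot>\<^sub>v w)"
   then have r: "r < n" by (simp add: w_def)
   define g where "g i = x ^ i * h i $ r" for i
   have "(\<Sum>i=1..<Q. g (Suc i) - g i) = g Q - g 1" using Q1 by (intro sum_Suc_diff') simp
   also have "\<dots> = 0" using x hQ by (simp add: g_def)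
   finally have eq: "(\<Sum>i=1..<Q. g (Suc i)) = (\<Sum>i=1..<Q. g i)" by (simp add: sum_subtractf)
   have "(A *\<^sub>v w) $ r = (\<Sum>i=1..<Q. x ^ i * h (Suc i) $ r)"
    unfolding w_def using r mult_lv[OF A(1) hc] by (simp add: hS lv_def)
   also have "\<dots> = inverse x * (\<Sum>i=1..<Q. g (Suc i))"
    unfolding sum_distrib_left g_def using False by (intro sum.cong) auto
   also have "\<dots> = inverse x * w $ r" unfolding eq using r by (simp add: w_def lv_def g_def)
   finally show "(A *\<^sub>v w) $ r = (inverse x \<cdot>\<^sub>v w) $ r" using r by (simp add: w_def)
  qed (use A in \<open>simp add: w_def\<close>)
  then have "u \<bullet> w = 0" using u(2) wW by blast
  then show ?thesis unfolding w_def f_def using scalar_lv[where S="{1..<Q}" and h=h and n=n and u=u, OF hc] by simp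
 qed
 define P where "P = (\<Sum>i\<in>{1..<Q}. monom (f i) i)"
 have "P = 0"
 proof (rule ccontr)
  assume P: "P \<noteq> 0"
  have "{x::'k. x ^ (q ^ m) = x} \<subseteq> {x. poly P x = 0}"
   using ev by (auto simp: P_def poly_sum poly_monom Q_def mult.commute)
  then have "card {x::'k. x ^ (q ^ m) = x} \<le> card {x. poly P x = 0}"
   using poly_roots_finite[OF P] by (intro card_mono) auto
  also have "\<dots> \<le> degree P" by (rule card_poly_roots_bound[OF P])
  also have "\<dots> \<le> Q - 1" unfolding P_def
  proof (rule degree_sum_le)
   fix i assume "i \<in> {1..<Q}"
   then show "degree (monom (f i) i) \<le> Q - 1" by (intro order_trans[OF degree_monom_le]) auto
  qed simp
  finally show False using card_fixed[OF m(1)] Q1 by (simp add: Q_def)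
 qed
 then have "coeff P (Q - 1) = 0" by simp
 moreover have "coeff P (Q - 1) = f (Q - 1)"
  unfolding P_def coeff_sum coeff_monom using Q1 by simp
 ultimately have fQ: "u \<bullet> h (Q - 1) = 0" by (simp add: f_def)
 \<comment> \<open>\<open>A ^ (Q - 1)\<close> is the projection to the sum of the eigenspaces of nonzero eigenvalues, so \<open>z\<close> is in the kernel of \<open>A\<close>\<close>
 define z where "z = v + (- 1) \<cdot>\<^sub>v h (Q - 1)"
 have zW: "z \<in> W" unfolding z_def using v hW cl by blast
 have "A *\<^sub>v z = 0 \<cdot>\<^sub>v z"
 proof -
  have "A *\<^sub>v z = A *\<^sub>v v + (- 1) \<cdot>\<^sub>v (A *\<^sub>v h (Q - 1))"
   unfolding z_def using A vc hc by (simp add: mult_add_distrib_mat_vec[of _ n n] mult_mat_vec[of _ n n])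
  also have "A *\<^sub>v h (Q - 1) = h 1" using hQ hS[of "Q - 1"] Q1 by simp
  also have "h 1 = A *\<^sub>v v" using A by (simp add: h_def)
  finally show ?thesis using A vc hc[of "Q - 1"] by (intro eq_vecI) (auto simp: z_def)
 qed
 then have "u \<bullet> z = 0" using u(2) zW by blast
 moreover have "u \<bullet> z = u \<bullet> v + u \<bullet> ((- 1) \<cdot>\<^sub>v h (Q - 1))"
  unfolding z_def by (rule scalar_prod_add_distrib[of _ n]) (use u vc hc in auto)
 moreover have "u \<bullet> ((- 1) \<cdot>\<^sub>v h (Q - 1)) = - (u \<bullet> h (Q - 1))"
  using u hc by (subst scalar_prod_smult_distrib[of _ n]) auto
 ultimately show ?thesis using fQ by simp
qed

lemma simult_diag:
 assumes A: "A \<in> carrier_mat n n" "ss A" and C: "C \<in> carrier_mat n n" "ss C" and comm: "A * C = C * A"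
 shows "\<exists>P a c. P \<in> GLm n \<and> A * P = P * diagm n a \<and> C * P = P * diagm n c"
proof -
 define S where "S = {w \<in> carrier_vec n. (\<exists>x. A *\<^sub>v w = x \<cdot>\<^sub>v w) \<and> (\<exists>x. C *\<^sub>v w = x \<cdot>\<^sub>v w)}"
 have sub: "S \<subseteq> carrier_vec n" by (auto simp: S_def)
 have ann: "u = 0\<^sub>v n" if u: "u \<in> carrier_vec n" "\<And>w. w \<in> S \<Longrightarrow> u \<bullet> w = 0" for u
 proof -
  have 1: "u \<bullet> v = 0" if v: "v \<in> carrier_vec n" "A *\<^sub>v v = x \<cdot>\<^sub>v v" for v x
  proof (rule eigen_span[OF C, of "{v \<in> carrier_vec n. A *\<^sub>v v = x \<cdot>\<^sub>v v}"])
   fix w assume w: "w \<in> {v \<in> carrier_vec n. A *\<^sub>v v = x \<cdot>\<^sub>v v}"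
   have "A *\<^sub>v (C *\<^sub>v w) = (A * C) *\<^sub>v w" using A C w by simp
   also have "\<dots> = C *\<^sub>v (A *\<^sub>v w)" unfolding comm using A C w by simp
   also have "\<dots> = x \<cdot>\<^sub>v (C *\<^sub>v w)" using w C by (simp add: mult_mat_vec[of _ n n])
   finally show "C *\<^sub>v w \<in> {v \<in> carrier_vec n. A *\<^sub>v v = x \<cdot>\<^sub>v v}" using C w by simp
   show "y \<cdot>\<^sub>v w \<in> {v \<in> carrier_vec n. A *\<^sub>v v = x \<cdot>\<^sub>v v}" for y
    using w A by (auto simp: mult_mat_vec[of _ n n] smult_smult_assoc mult.commute)
   show "u \<bullet> w = 0" if "C *\<^sub>v w = y \<cdot>\<^sub>v w" for y using that w u(2) by (auto simp: S_def)
   fix w' assume w': "w' \<in> {v \<in> carrier_vec n. A *\<^sub>v v = x \<cdot>\<^sub>v v}"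
   show "w + w' \<in> {v \<in> carrier_vec n. A *\<^sub>v v = x \<cdot>\<^sub>v v}"
    using w w' A by (auto simp: mult_add_distrib_mat_vec[of _ n n] smult_add_distrib_vec[of _ n])
  qed (use u v in auto)
  have 2: "u \<bullet> v = 0" if v: "v \<in> carrier_vec n" for v
   by (rule eigen_span[OF A, of "carrier_vec n"]) (use A 1 u v in auto)
  show ?thesis
  proof (rule eq_vecI)
   fix i assume "i < dim_vec (0\<^sub>v n)"
   then have i: "i < n" by simp
   have "u \<bullet> unit_vec n i = u $ i" using i u(1) by (simp add: scalar_prod_right_unit)
   then show "u $ i = 0\<^sub>v n $ i" using 2[of "unit_vec n i"] i by simp
  qed (use u in auto)
 qed
 obtain P where P: "P \<in> GLm n" "\<And>j. j < n \<Longrightarrow> col P j \<in> S" using spanning_imp_basis[OF sub ann] by blast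
 define a where "a j = (SOME x. A *\<^sub>v col P j = x \<cdot>\<^sub>v col P j)" for j
 define c where "c j = (SOME x. C *\<^sub>v col P j = x \<cdot>\<^sub>v col P j)" for j
 have a: "A *\<^sub>v col P j = a j \<cdot>\<^sub>v col P j" if "j < n" for j
  unfolding a_def by (rule someI_ex) (use P(2)[OF that] in \<open>simp add: S_def\<close>)
 have c: "C *\<^sub>v col P j = c j \<cdot>\<^sub>v col P j" if "j < n" for j
  unfolding c_def by (rule someI_ex) (use P(2)[OF that] in \<open>simp add: S_def\<close>)
 have "A * P = P * diagm n a" "C * P = P * diagm n c"
  using eigen_cols_diag[of A n P a] eigen_cols_diag[of C n P c] A C P a c by auto
 then show ?thesis using P(1) by blast
qed

lemma ss_diag: assumes A: "A \<in> carrier_mat n n" "ss A" shows "\<exists>P a. P \<in> GLm n \<and> A * P = P * diagm n a"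
 using simult_diag[OF A A refl] by blast

lemma diag_eq_conj: assumes "P \<in> GLm n" "A * P = P * B" "A \<in> carrier_mat n n" "B \<in> carrier_mat n n"
 shows "A = P * B * minv P"
proof -
 have "A = (A * P) * minv P" using assms(1,3) by simp
 then show ?thesis unfolding assms(2) .
qed

lemma ss_conj: assumes "A \<in> carrier_mat n n" "P \<in> GLm n" "ss A" shows "ss (P * A * minv P)"
 using assms unfolding ss_def by (auto simp: pow_mat_conj[of A n P] simp del: massoc)

lemma ss_diagm: "ss (diagm n d)"
proof -
 obtain m where m: "m > 0" "\<forall>x\<in>d ` {..<n}. x ^ (q ^ m) = x" using ex_common_period[of "d ` {..<n}"] by auto
 have "diagm n d ^\<^sub>m (q ^ m) = diagm n d" unfolding diagm_pow by (rule eq_matI) (use m in auto)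
 then show ?thesis using m(1) unfolding ss_def by blast
qed

lemma diag_ss: assumes "A \<in> carrier_mat n n" "P \<in> GLm n" "A * P = P * diagm n a" shows "ss A"
 using ss_conj[OF diagm_carrier assms(2) ss_diagm] diag_eq_conj[OF assms(2,3,1)] by simp

lemma ss_transpose: "A \<in> carrier_mat n n \<Longrightarrow> ss A \<Longrightarrow> ss (A\<^sup>T)"
 unfolding ss_def using pow_mat_transpose[of A n] by metis

text \<open>The powers of \<open>q\<close> modulo \<open>N\<close> repeat and \<open>q\<close> is invertible modulo \<open>N\<close>, so \<open>q ^ m\<close> is 1 modulo \<open>N\<close>
 for some \<open>m\<close>.\<close>

lemma ss_of_order: assumes "A \<in> carrier_mat n n" "N > 0" "coprime N p" "A ^\<^sub>m N = 1\<^sub>m n" shows "ss A"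
proof -
 have cop: "coprime N (q ^ i)" for i using assms(3) by (simp add: q_def)
 have "range (\<lambda>i. q ^ i mod N) \<subseteq> {..<N}" using assms(2) by auto
 then have "\<not> inj (\<lambda>i. q ^ i mod N)"
  using finite_imageD[of "\<lambda>i. q ^ i mod N" UNIV] infinite_UNIV_nat finite_subset by blast
 then obtain i j where "q ^ i mod N = q ^ j mod N" "i \<noteq> j" unfolding inj_def by blast
 then obtain i j where ij: "q ^ i mod N = q ^ j mod N" "i < j" by (metis linorder_neqE_nat)
 have "N dvd q ^ j - q ^ i" using mod_eq_dvd_iff_nat[of "q ^ i" "q ^ j" N] ij q_gt_1 by (simp add: power_increasing)
 also have "q ^ j - q ^ i = q ^ i * (q ^ (j - i) - 1)"
  using ij(2) by (simp add: right_diff_distrib' flip: power_add)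
 finally have "N dvd q ^ (j - i) - 1" using cop[of i] by (simp add: coprime_dvd_mult_right_iff)
 then obtain l where "q ^ (j - i) - 1 = N * l" by (rule dvdE)
 moreover define m where "m = j - i"
 ultimately have "q ^ m - 1 = N * l" by simp
 then have l: "q ^ m = 1 + N * l" using q_pow_pos[of m] by linarith
 have m: "m > 0" using ij(2) by (simp add: m_def)
 have "A ^\<^sub>m (q ^ m) = A ^\<^sub>m 1 * (A ^\<^sub>m N) ^\<^sub>m l" unfolding l using pow_mat_add[OF assms(1), of 1 "N * l"] pow_mat_pow[OF assms(1)] by simp
 also have "(A ^\<^sub>m N) ^\<^sub>m l = 1\<^sub>m n" unfolding assms(4) by (induction l) auto
 finally show ?thesis using m(1) assms(1) unfolding ss_def by auto
qed

text \<open>All powers of \<open>A\<close> have entries in one finite field.\<close>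

lemma finite_order: assumes "A \<in> GLm n" shows "\<exists>N>0. A ^\<^sub>m N = (1\<^sub>m n :: 'k mat)"
proof -
 obtain m where m: "m > 0" "Fr m A = A" using ex_Fr_period by blast
 have c: "A ^\<^sub>m i \<in> {A \<in> carrier_mat n n. Fr m A = A}" for i
  using assms m by (induction i) (auto simp: Fr_mult)
 have "\<not> inj (\<lambda>i. A ^\<^sub>m i)"
  using finite_imageD[of "\<lambda>i. A ^\<^sub>m i" UNIV] infinite_UNIV_nat finite_subset[of "range (\<lambda>i. A ^\<^sub>m i)"]
   finite_Fr_fixed[OF m(1), of n n] c by blast
 then obtain i j where "A ^\<^sub>m i = A ^\<^sub>m j" "i \<noteq> j" unfolding inj_def by blast
 then obtain i j where ij: "A ^\<^sub>m i = A ^\<^sub>m j" "i < j" by (metis linorder_neqE_nat)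
 have "A ^\<^sub>m (i + (j - i)) = A ^\<^sub>m i * A ^\<^sub>m (j - i)" by (rule pow_mat_add[OF GLm_carrier[OF assms]])
 then have "A ^\<^sub>m i = A ^\<^sub>m i * A ^\<^sub>m (j - i)" using ij by simp
 then have "minv (A ^\<^sub>m i) * A ^\<^sub>m i = minv (A ^\<^sub>m i) * (A ^\<^sub>m i * A ^\<^sub>m (j - i))" by simp
 moreover have "A ^\<^sub>m i \<in> GLm n" "A ^\<^sub>m (j - i) \<in> GLm n" using pow_minv[OF assms] by blast+
 ultimately have "1\<^sub>m n = A ^\<^sub>m (j - i)" using minv_left[of "A ^\<^sub>m i" n] minv_cancel_left(1)[of "A ^\<^sub>m i" n "A ^\<^sub>m (j - i)"] GLm_dims(1)[of "A ^\<^sub>m (j - i)" n] by argo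
 then show ?thesis using ij(2) by (intro exI[of _ "j - i"]) auto
qed

section \<open>Spectra\<close>

definition eigs :: "'k mat \<Rightarrow> 'k multiset" where "eigs A = proots (char_poly A)"

lemma eigs_conj: assumes "A \<in> carrier_mat n n" "P \<in> GLm n" shows "eigs (P * A * minv P) = eigs A"
proof -
 have "similar_mat (P * A * minv P) A"
  by (rule similar_matI[of _ _ P "minv P" n]) (use assms in auto)
 then show ?thesis unfolding eigs_def by (simp add: char_poly_similar)
qed

lemma eigs_diagm: "eigs (diagm n d) = mset (map d [0..<n])"
proof -
 have "char_poly (diagm n d) = (\<Prod>a\<leftarrow>map d [0..<n]. [:- a, 1:])"
 proof -
  have dm: "diag_mat (diagm n d) = map d [0..<n]" by (simp add: diag_mat_def)
  have "upper_triangular (diagm n d)" by (auto simp: upper_triangular_def)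
  then show ?thesis using char_poly_upper_triangular[of "diagm n d" n] unfolding dm by simp
 qed
 also have "proots \<dots> = mset (map d [0..<n])"
 proof -
  have "proots (\<Prod>a\<leftarrow>as. [:- a, 1:]) = mset as" for as :: "'k list"
  proof (induction as)
   case (Cons a as)
   have "(\<Prod>a\<leftarrow>as. [:- a, 1:]) \<noteq> (0 :: 'k poly)" by (induction as) (simp_all del: mult_pCons_left)
   then show ?case using Cons by (simp add: proots_mult del: mult_pCons_left)
  qed simp
  then show ?thesis .
 qed
 finally show ?thesis unfolding eigs_def .
qed

lemma eigs_diag: assumes "A \<in> carrier_mat n n" "P \<in> GLm n" "A * P = P * diagm n a"
 shows "eigs A = mset (map a [0..<n])"
 using eigs_conj[OF diagm_carrier assms(2), of a] diag_eq_conj[OF assms(2,3,1)] eigs_diagm by simp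

lemma eigs_transpose: "A \<in> carrier_mat n n \<Longrightarrow> eigs (A\<^sup>T) = eigs A"
 by (simp add: eigs_def char_poly_transpose_mat)

lemma similar_of_eigs:
 assumes A: "A \<in> carrier_mat n n" "ss A" and B: "B \<in> carrier_mat n n" "ss B" and eq: "eigs A = eigs B"
 shows "\<exists>h \<in> GLm n. A * h = h * B"
proof -
 obtain P a where P: "P \<in> GLm n" "A * P = P * diagm n a" using ss_diag[OF A] by blast
 obtain R b where R: "R \<in> GLm n" "B * R = R * diagm n b" using ss_diag[OF B] by blast
 have "mset (map a [0..<n]) = mset (map b [0..<n])"
  using eigs_diag[OF A(1) P] eigs_diag[OF B(1) R] eq by simp
 then obtain \<pi> where pi: "\<pi> permutes {..<n}" "permute_list \<pi> (map b [0..<n]) = map a [0..<n]"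
  by (metis mset_eq_permutation length_map length_upt diff_zero)
 have ab: "a i = b (\<pi> i)" if "i < n" for i
 proof -
  have "permute_list \<pi> (map b [0..<n]) ! i = b (\<pi> i)"
   using that pi(1) permutes_in_image[OF pi(1), of i] by (subst permute_list_nth) auto
  then show ?thesis using that unfolding pi(2) by simp
 qed
 have pin: "\<pi> i < n" if "i < n" for i using that permutes_in_image[OF pi(1), of i] by simp
 define W where "W = mat n n (\<lambda>(i, j). if i = \<pi> j then 1 else (0::'k))"
 have W: "W \<in> carrier_mat n n" by (simp add: W_def)
 have "W\<^sup>T * W = 1\<^sub>m n"
 proof (rule eq_matI)
  fix i j assume "i < dim_row (1\<^sub>m n)" "j < dim_col (1\<^sub>m n)"
  then have ij: "i < n" "j < n" by auto
  have "(W\<^sup>T * W) $$ (i, j) = (\<Sum>s<n. W\<^sup>T $$ (i, s) * W $$ (s, j))"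
   using W ij by (intro mult_mat_index[of _ n n _ n]) auto
  also have "\<dots> = (\<Sum>s<n. if s = \<pi> i then (if s = \<pi> j then 1 else 0) else 0)"
   using ij by (intro sum.cong) (auto simp: W_def)
  also have "\<dots> = (if \<pi> i = \<pi> j then 1 else 0)" using pin[OF ij(1)] by simp
  also have "\<dots> = 1\<^sub>m n $$ (i, j)" using ij permutes_inj[OF pi(1)] by (auto dest: injD)
  finally show "(W\<^sup>T * W) $$ (i, j) = 1\<^sub>m n $$ (i, j)" .
 qed (use W in auto)
 then have "W\<^sup>T \<in> GLm n" using minv_unique(1)[of "W\<^sup>T" n W] W by simp
 then have WG: "W \<in> GLm n" using transpose_GLm[of "W\<^sup>T" n] by simp
 have DW: "diagm n b * W = W * diagm n a"
 proof (rule eq_matI)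
  fix i j assume "i < dim_row (W * diagm n a)" "j < dim_col (W * diagm n a)"
  then have ij: "i < n" "j < n" using W by auto
  then show "(diagm n b * W) $$ (i, j) = (W * diagm n a) $$ (i, j)"
   using ab by (simp add: diagm_mult_left[of _ n n] diagm_mult_right[of _ n n] W) (simp add: W_def)
 qed (use W in auto)
 have "\<exists>T. T \<in> GLm n \<and> B * T = T * diagm n a"
 proof (intro exI[of _ "R * W"] conjI)
  have "B * (R * W) = R * (diagm n b * W)"
   using lift_eq[OF R(2), of W] B(1) R(1) W by simp
  then show "B * (R * W) = R * W * diagm n a" unfolding DW using R(1) W by simp
 qed (use R WG in simp)
 then obtain T where T: "T \<in> GLm n" "B * T = T * diagm n a" by blast
 define h where "h = P * minv T"
 have "A * h = h * B"
  unfolding h_def diag_eq_conj[OF P A(1) diagm_carrier] diag_eq_conj[OF T B(1) diagm_carrier]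
  using P(1) T(1) by simp
 then show ?thesis using P(1) T(1) by (intro bexI[of _ h]) (simp_all add: h_def)
qed

end

section \<open>A norm equation for commuting rational matrices\<close>

lemma (in comm_group) card_image_kernel:
 assumes fin: "finite (carrier G)" and f: "f \<in> hom G G"
 shows "card (carrier G) = card (f ` carrier G) * card {x \<in> carrier G. f x = \<one>}"
proof -
 interpret f: group_hom G G f by unfold_locales (rule f)
 have fib: "card {x \<in> carrier G. f x = y} = card {x \<in> carrier G. f x = \<one>}" if "y \<in> f ` carrier G" for y
 proof -
  obtain x0 where x0: "x0 \<in> carrier G" "y = f x0" using \<open>y \<in> f ` carrier G\<close> by blast
  have "bij_betw (\<lambda>x. x0 \<otimes> x) {x \<in> carrier G. f x = \<one>} {x \<in> carrier G. f x = y}"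
   unfolding bij_betw_def
  proof
   show "inj_on (\<lambda>x. x0 \<otimes> x) {x \<in> carrier G. f x = \<one>}" using x0 by (auto simp: inj_on_def)
   show "(\<lambda>x. x0 \<otimes> x) ` {x \<in> carrier G. f x = \<one>} = {x \<in> carrier G. f x = y}"
   proof (intro equalityI subsetI)
    fix z assume z: "z \<in> {x \<in> carrier G. f x = y}"
    then have "f (inv x0 \<otimes> z) = \<one>" "z = x0 \<otimes> (inv x0 \<otimes> z)" using x0 by (simp_all flip: m_assoc)
    then show "z \<in> (\<lambda>x. x0 \<otimes> x) ` {x \<in> carrier G. f x = \<one>}" using x0 z by (intro image_eqI) auto
   qed (use x0 in auto)
  qed
  then show ?thesis by (simp add: bij_betw_same_card)
 qed
 have "card (carrier G) = (\<Sum>y\<in>f ` carrier G. card {x \<in> carrier G. f x = y})"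
  by (subst card_UN_disjoint[symmetric]) (use fin in \<open>auto intro!: arg_cong[where f=card]\<close>)
 then show ?thesis using fib by simp
qed

text \<open>The norm \<open>h \<otimes> \<sigma> h\<close> and the map from \<open>u\<close> to \<open>u \<otimes> inv (\<sigma> u)\<close> are endomorphisms; by Hilbert 90 the
 kernel of the first is the image of the second, whose kernel is the group of fixed points.
 Comparing orders, the norms and the fixed points are equally many, so they coincide.\<close>

lemma (in comm_group) hilbert90_norm_surj:
 assumes fin: "finite (carrier G)" and s: "\<sigma> \<in> hom G G" "\<And>x. x \<in> carrier G \<Longrightarrow> \<sigma> (\<sigma> x) = x"
  and H90: "\<And>h. h \<in> carrier G \<Longrightarrow> h \<otimes> \<sigma> h = \<one> \<Longrightarrow> \<exists>u\<in>carrier G. h = u \<otimes> inv (\<sigma> u)"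
  and d: "d \<in> carrier G" "\<sigma> d = d"
 shows "\<exists>h\<in>carrier G. h \<otimes> \<sigma> h = d"
proof -
 interpret s: group_hom G G \<sigma> by unfold_locales (rule s(1))
 let ?N = "\<lambda>h. h \<otimes> \<sigma> h" and ?C = "\<lambda>u. u \<otimes> inv (\<sigma> u)"
 let ?K = "{h \<in> carrier G. ?N h = \<one>}" and ?S = "{h \<in> carrier G. \<sigma> h = h}"
 have hN: "?N \<in> hom G G" by (rule homI) (auto simp: m_ac)
 have hC: "?C \<in> hom G G" by (rule homI) (auto simp: m_ac inv_mult)
 have kC: "{u \<in> carrier G. ?C u = \<one>} = ?S"
 proof -
  have "u \<otimes> inv (\<sigma> u) = \<one> \<longleftrightarrow> \<sigma> u = u" if u: "u \<in> carrier G" for u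
   using inv_solve_right[of "\<one>" u "\<sigma> u"] u by auto
  then show ?thesis by blast
 qed
 have iC: "?C ` carrier G = ?K"
 proof (intro equalityI subsetI)
  fix z assume "z \<in> ?C ` carrier G"
  then obtain u where u: "u \<in> carrier G" "z = ?C u" by blast
  have c: "u \<in> carrier G" "\<sigma> u \<in> carrier G" using u(1) by auto
  have e: "inv (\<sigma> u) \<otimes> (\<sigma> u \<otimes> inv u) = inv u" using c by (simp flip: m_assoc)
  have "?N z = u \<otimes> (inv (\<sigma> u) \<otimes> (\<sigma> u \<otimes> inv u))"
   unfolding u(2) using c s(2)[OF u(1)] by (simp add: m_assoc)
  also have "\<dots> = \<one>" unfolding e using c by simp
  finally have "?N z = \<one>" .
  then show "z \<in> ?K" using u by simp
 next
  fix z assume "z \<in> ?K" then show "z \<in> ?C ` carrier G" using H90 by blast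
 qed
 have "card (?N ` carrier G) * card ?K = card ?K * card ?S"
  using card_image_kernel[OF fin hN] card_image_kernel[OF fin hC, unfolded kC iC] by argo
 moreover have "card ?K > 0" using fin by (auto simp: card_gt_0_iff intro!: exI[of _ \<one>])
 ultimately have "card (?N ` carrier G) = card ?S" by simp
 moreover have "?N ` carrier G \<subseteq> ?S" using s(2) by (auto simp: m_comm)
 ultimately have "?N ` carrier G = ?S" using fin by (intro card_subset_eq) auto
 then show ?thesis using d by (metis (mono_tags, lifting) imageE mem_Collect_eq)
qed

context frob_closure
begin

lemma Fq_closed: "a \<in> Fq \<Longrightarrow> b \<in> Fq \<Longrightarrow> a + b \<in> Fq" "a \<in> Fq \<Longrightarrow> b \<in> Fq \<Longrightarrow> a - b \<in> Fq"
 "a \<in> Fq \<Longrightarrow> b \<in> Fq \<Longrightarrow> a * b \<in> Fq" "1 \<in> Fq" "0 \<in> Fq"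
 using frob_add[of a b 1] frob_diff[of a b 1] q_gt_1 by (auto simp: power_mult_distrib)

lemma rat_add: "rat A \<Longrightarrow> rat B \<Longrightarrow> A \<in> carrier_mat n m \<Longrightarrow> B \<in> carrier_mat n m \<Longrightarrow> rat (A + B)"
 using Fq_closed(1) by (simp add: rat_iff[of _ n m])

lemma rat_minus: "rat A \<Longrightarrow> rat B \<Longrightarrow> A \<in> carrier_mat n m \<Longrightarrow> B \<in> carrier_mat n m \<Longrightarrow> rat (A - B)"
 using Fq_closed(2) by (simp add: rat_iff[of _ n m] minus_carrier_mat)

lemma rat_smult: "t \<in> Fq \<Longrightarrow> rat B \<Longrightarrow> B \<in> carrier_mat n m \<Longrightarrow> rat (t \<cdot>\<^sub>m B)"
 using Fq_closed(3) by (simp add: rat_iff[of _ n m])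

lemma diag_GLm_iff: "diagm n d \<in> GLm n \<longleftrightarrow> (\<forall>i<n. d i \<noteq> (0::'k))"
proof
 assume "diagm n d \<in> GLm n"
 then have "(\<Prod>i<n. d i) \<noteq> 0" using GLm_det det_diagm by metis
 then show "\<forall>i<n. d i \<noteq> 0" by auto
qed (use diagm_GLm in blast)

lemma diag_conj_GLm: assumes "P \<in> GLm n" "M \<in> carrier_mat n n" "M * P = P * diagm n d"
 shows "M \<in> GLm n \<longleftrightarrow> (\<forall>i<n. d i \<noteq> (0::'k))"
proof
 assume "M \<in> GLm n"
 then have "minv P * (M * P) \<in> GLm n" using assms(1) by simp
 then show "\<forall>i<n. d i \<noteq> 0" unfolding assms(3) using assms(1) by (simp add: diag_GLm_iff)
next
 assume "\<forall>i<n. d i \<noteq> 0"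
 then show "M \<in> GLm n" using diag_eq_conj[OF assms(1,3,2) diagm_carrier] assms(1) by (simp add: diag_GLm_iff)
qed

text \<open>The adjoint of a matrix \<open>M\<close> with respect to \<open>x\<close> is \<open>star M\<close>, the product of the inverse of \<open>x\<close>,
 the transpose of \<open>M\<close>, and \<open>x\<close>. Rational matrices that act as scalars on the joint eigenspaces
 of \<open>B\<close> and \<open>d\<close> form a finite commutative group \<open>RU\<close> on which the adjoint is an involution, and
 a solution of \<open>h * star h = d\<close> in it is wanted. Hilbert 90 holds there: if \<open>h * star h = 1\<close>,
 then \<open>u = v + h * star v\<close> satisfies \<open>h * star u = u\<close> for every \<open>v\<close>; taking \<open>v = 1 + t * B\<close>,
 where \<open>B\<close> has adjoint \<open>- B\<close>, some \<open>t\<close> in the finite field makes \<open>u\<close> invertible, as at most \<open>n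
 < q\<close> values of \<open>t\<close> are bad.\<close>

lemma norm_surj:
 assumes n: "n < q" and x: "x \<in> GLm n" "rat x" and B: "B \<in> GLm n" "rat B" "ss B"
  and d: "d \<in> GLm n" "rat d" "ss d"
  and Bx: "B\<^sup>T * x = (- 1) \<cdot>\<^sub>m (x * B)" and dx: "d\<^sup>T * x = x * d"
  and comm: "B * d = d * B"
 shows "\<exists>h\<in>GLm n. rat h \<and> h\<^sup>T * x * h = x * d"
proof -
 obtain P b e where P: "P \<in> GLm n" "B * P = P * diagm n b" "d * P = P * diagm n e"
  using simult_diag[of B n d] B d comm by auto
 define y where "y = P\<^sup>T * (x * P)"
 have y: "y \<in> GLm n" using P x by (simp add: y_def)
 have tr: "diagm n m * y = P\<^sup>T * (M\<^sup>T * (x * P))"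
  if "M \<in> carrier_mat n n" "M * P = P * diagm n m" for M m
 proof -
  have "diagm n m * P\<^sup>T = P\<^sup>T * M\<^sup>T"
   using arg_cong[OF that(2), of transpose_mat] that(1) P(1) by (simp add: mtranspose_mult)
  from lift_eq[OF this, of "x * P"] show ?thesis using P x that(1) by (simp add: y_def)
 qed
 have bB: "b i = - b j" if "i < n" "j < n" "y $$ (i, j) \<noteq> 0" for i j
 proof -
  have "diagm n b * y = P\<^sup>T * ((B\<^sup>T * x) * P)"
   using tr[OF _ P(2)] B x P(1) by simp
  also have "\<dots> = (- 1) \<cdot>\<^sub>m (P\<^sup>T * (x * (B * P)))"
   unfolding Bx using P(1) x B by (simp add: mult_smult_distrib[of _ n n _ n] mult_smult_assoc_mat[of _ n n _ n])
  also have "\<dots> = (- 1) \<cdot>\<^sub>m (y * diagm n b)" unfolding P(2) y_def using P(1) x by simp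
  finally have "(diagm n b * y) $$ (i, j) = ((- 1) \<cdot>\<^sub>m (y * diagm n b)) $$ (i, j)" by simp
  then have "b i * y $$ (i, j) = - (y $$ (i, j) * b j)"
   using that y by (simp add: diagm_mult_left[of _ n n] diagm_mult_right[of _ n n])
  then have "(b i + b j) * y $$ (i, j) = 0" by (simp add: algebra_simps)
  then show ?thesis using that(3) by (simp add: eq_neg_iff_add_eq_0)
 qed
 have eE: "e i = e j" if "i < n" "j < n" "y $$ (i, j) \<noteq> 0" for i j
 proof -
  have "diagm n e * y = P\<^sup>T * ((d\<^sup>T * x) * P)"
   using tr[OF _ P(3)] d x P(1) by simp
  also have "\<dots> = P\<^sup>T * (x * (d * P))" unfolding dx using P(1) x d by simp
  also have "\<dots> = y * diagm n e" unfolding P(3) y_def using P(1) x by simp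
  finally have "(diagm n e * y) $$ (i, j) = (y * diagm n e) $$ (i, j)" by simp
  then have "e i * y $$ (i, j) = y $$ (i, j) * e j"
   using that y by (simp add: diagm_mult_left[of _ n n] diagm_mult_right[of _ n n])
  then show ?thesis using that(3) by simp
 qed
 have b0: "b i \<noteq> 0" if "i < n" for i using diag_conj_GLm[OF P(1) _ P(2)] B that by simp
 have coln: "\<exists>i<n. y $$ (i, j) \<noteq> 0" if j: "j < n" for j
 proof (rule ccontr)
  assume "\<not> ?thesis"
  then have "col y j = 0\<^sub>v n" using y j by (intro eq_vecI) auto
  then have "y *\<^sub>v unit_vec n j = 0\<^sub>v n" using y j by (simp add: mult_unit_vec)
  then have "minv y *\<^sub>v (y *\<^sub>v unit_vec n j) = minv y *\<^sub>v 0\<^sub>v n" by simp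
  moreover have "minv y *\<^sub>v 0\<^sub>v n = 0\<^sub>v n" using y by (intro eq_vecI) auto
  ultimately have "unit_vec n j = (0\<^sub>v n :: 'k vec)" using y j by (simp add: mult_vec_minv[of y n])
  then show False using j unit_vec_nonzero[of n j] by simp
 qed
 \<comment> \<open>the diagonal entries of matrices that are scalar on joint eigenspaces\<close>
 define good where "good m \<longleftrightarrow> (\<forall>i<n. \<forall>j<n. b i = b j \<longrightarrow> e i = e j \<longrightarrow> m i = (m j :: 'k))" for m
 \<comment> \<open>the diagonal entries of a matrix and of its adjoint: the form pairs each joint eigenspace with just one other\<close>
 define dual where "dual m m' \<longleftrightarrow> (\<forall>i<n. \<forall>j<n. y $$ (i, j) \<noteq> 0 \<longrightarrow> m i = (m' j :: 'k))" for m m'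
 define star where "star M = minv x * (M\<^sup>T * x)" for M
 have goodD: "m i = m j" if "good m" "i < n" "j < n" "b i = b j" "e i = e j" for m i j
  using that unfolding good_def by blast
 have ex_dual: "\<exists>m'. dual m m' \<and> good m'" if g: "good m" for m
 proof -
  define c where "c j = (SOME i. i < n \<and> y $$ (i, j) \<noteq> 0)" for j
  have c: "c j < n \<and> y $$ (c j, j) \<noteq> 0" if "j < n" for j unfolding c_def by (rule someI_ex[OF coln[OF that]])
  have gm: "m i = m i'" if "i < n" "i' < n" "b i = b i'" "e i = e i'" for i i'
   using g that unfolding good_def by blast
  have "dual m (\<lambda>j. m (c j))" unfolding dual_def
  proof (intro allI impI)
   fix i j assume ij: "i < n" "j < n" "y $$ (i, j) \<noteq> 0"
   then show "m i = m (c j)" using c[OF ij(2)] bB eE by (intro gm) auto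
  qed
  moreover have "good (\<lambda>j. m (c j))" unfolding good_def
  proof (intro allI impI)
   fix i j assume ij: "i < n" "j < n" "b i = b j" "e i = e j"
   then show "m (c i) = m (c j)" using c[OF ij(2)] c[OF ij(1)] bB eE by (intro gm) auto
  qed
  ultimately show ?thesis by blast
 qed
 have star_dual: "star M * P = P * diagm n m'" if M: "M \<in> carrier_mat n n" "M * P = P * diagm n m" and du: "dual m m'" for M m m'
 proof -
  have "diagm n m * y = y * diagm n m'"
  proof (rule eq_matI)
   fix i j assume "i < dim_row (y * diagm n m')" "j < dim_col (y * diagm n m')"
   then have ij: "i < n" "j < n" using y by auto
   then show "(diagm n m * y) $$ (i, j) = (y * diagm n m') $$ (i, j)"
    using y du unfolding dual_def
    by (cases "y $$ (i, j) = 0") (simp_all add: diagm_mult_left[of _ n n] diagm_mult_right[of _ n n])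
  qed (use y in auto)
  then have "P\<^sup>T * (M\<^sup>T * (x * P)) = P\<^sup>T * (x * (P * diagm n m'))"
   using tr[OF M] x P(1) by (simp add: y_def)
  then have "minv (P\<^sup>T) * (P\<^sup>T * (M\<^sup>T * (x * P)))
   = minv (P\<^sup>T) * (P\<^sup>T * (x * (P * diagm n m')))" by simp
  then have "M\<^sup>T * (x * P) = x * (P * diagm n m')"
   using P(1) x M(1) by (simp add: minv_cancel_left[of "P\<^sup>T" n])
  then show ?thesis unfolding star_def using x M(1) P(1) by simp
 qed
 have diag_eq: "M = M'" if "M \<in> carrier_mat n n" "M' \<in> carrier_mat n n" "M * P = P * diagm n m" "M' * P = P * diagm n m'"
  "\<And>i. i < n \<Longrightarrow> m i = m' i" for M M' m m'
 proof -
  have "diagm n m = diagm n m'" by (rule eq_matI) (use that(5) in auto)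
  then show ?thesis using diag_eq_conj[OF P(1) that(3,1) diagm_carrier] diag_eq_conj[OF P(1) that(4,2) diagm_carrier] by simp
 qed
 have diag_mult: "(M * M') * P = P * diagm n (\<lambda>i. m i * m' i)"
  if "M \<in> carrier_mat n n" "M' \<in> carrier_mat n n" "M * P = P * diagm n m" "M' * P = P * diagm n m'" for M M' m m'
 proof -
  have "(M * M') * P = M * (P * diagm n m')" unfolding that(4)[symmetric] using that(1,2) P(1) by simp
  also have "\<dots> = P * (diagm n m * diagm n m')" using lift_eq[OF that(3), of "diagm n m'"] that(1) P(1) by simp
  finally show ?thesis by (simp add: diagm_mult)
 qed
 define RU where "RU = {M \<in> GLm n. rat M \<and> (\<exists>m. good m \<and> M * P = P * diagm n m)}"
 have RUD: "M \<in> GLm n" "rat M" "\<exists>m. good m \<and> M * P = P * diagm n m" if "M \<in> RU" for M using that unfolding RU_def by auto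
 have star_GL: "star M \<in> GLm n" if "M \<in> GLm n" for M using that x by (simp add: star_def)
 have star_RU: "star M \<in> RU" if M: "M \<in> RU" for M
 proof -
  obtain m where m: "good m" "M * P = P * diagm n m" using RUD[OF M] by blast
  obtain m' where m': "dual m m'" "good m'" using ex_dual[OF m(1)] by blast
  have "rat (star M)" unfolding star_def using RUD[OF M] x by (intro rat_mult rat_minv rat_transpose) auto
  then show ?thesis using star_dual[OF _ m(2) m'(1)] m'(2) star_GL RUD[OF M] unfolding RU_def by auto
 qed
 have star_star: "star (star M) = M" if M: "M \<in> RU" for M
 proof -
  obtain m where m: "good m" "M * P = P * diagm n m" using RUD[OF M] by blast
  obtain m' where m': "dual m m'" "good m'" using ex_dual[OF m(1)] by blast
  have "dual m' m" unfolding dual_def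
  proof (intro allI impI)
   fix i j assume ij: "i < n" "j < n" "y $$ (i, j) \<noteq> 0"
   obtain l where l: "l < n" "y $$ (l, i) \<noteq> 0" using coln ij by blast
   have "m l = m' i" using m'(1) l ij unfolding dual_def by blast
   moreover have "m l = m j"
    by (rule goodD[OF m(1) l(1) ij(2)])
     (simp_all add: bB[OF l(1) ij(1) l(2)] bB[OF ij] eE[OF l(1) ij(1) l(2)] eE[OF ij])
   ultimately show "m' i = m j" by simp
  qed
  from star_dual[OF _ star_dual[OF _ m(2) m'(1)] this]
  have "star (star M) * P = P * diagm n m" using star_GL RUD[OF M] by simp
  then show ?thesis using diag_eq[OF _ _ _ m(2)] star_GL RUD[OF M] by simp
 qed
 have RU_mult: "M * M' \<in> RU" if M: "M \<in> RU" "M' \<in> RU" for M M'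
 proof -
  obtain m where m: "good m" "M * P = P * diagm n m" using RUD[OF M(1)] by blast
  obtain m' where m': "good m'" "M' * P = P * diagm n m'" using RUD[OF M(2)] by blast
  have "good (\<lambda>i. m i * m' i)" unfolding good_def
   by (intro allI impI arg_cong2[where f="(*)"] goodD[OF m(1)] goodD[OF m'(1)])
  moreover have "rat (M * M')" using RUD[OF M(1)] RUD[OF M(2)] by (intro rat_mult) auto
  ultimately show ?thesis using diag_mult[OF _ _ m(2) m'(2)] RUD[OF M(1)] RUD[OF M(2)] unfolding RU_def by auto
 qed
 have RU_comm: "M * M' = M' * M" if M: "M \<in> RU" "M' \<in> RU" for M M'
 proof -
  obtain m where m: "good m" "M * P = P * diagm n m" using RUD[OF M(1)] by blast
  obtain m' where m': "good m'" "M' * P = P * diagm n m'" using RUD[OF M(2)] by blast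
  show ?thesis using diag_eq[OF _ _ diag_mult[OF _ _ m(2) m'(2)] diag_mult[OF _ _ m'(2) m(2)]] RUD[OF M(1)] RUD[OF M(2)]
   by (simp add: mult.commute)
 qed
 have RU_inv: "minv M \<in> RU" if M: "M \<in> RU" for M
 proof -
  obtain m where m: "good m" "M * P = P * diagm n m" using RUD[OF M] by blast
  have m0: "m i \<noteq> 0" if "i < n" for i using diag_conj_GLm[OF P(1) _ m(2)] RUD[OF M] that by simp
  have mm: "diagm n m * diagm n (\<lambda>i. inverse (m i)) = 1\<^sub>m n"
   unfolding diagm_mult by (rule eq_matI) (use m0 in auto)
  have "M * (P * diagm n (\<lambda>i. inverse (m i))) = P * (diagm n m * diagm n (\<lambda>i. inverse (m i)))"
   using lift_eq[OF m(2), of "diagm n (\<lambda>i. inverse (m i))"] RUD[OF M] P(1) by simp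
  also have "\<dots> = P" unfolding mm using P(1) by simp
  finally have "minv M * P = minv M * (M * (P * diagm n (\<lambda>i. inverse (m i))))" by simp
  then have "minv M * P = P * diagm n (\<lambda>i. inverse (m i))" using RUD[OF M] P(1) by simp
  moreover have "good (\<lambda>i. inverse (m i))" unfolding good_def
   by (intro allI impI arg_cong[where f=inverse] goodD[OF m(1)])
  ultimately show ?thesis using RUD[OF M] rat_minv[of M n] unfolding RU_def by auto
 qed
 have RU_1: "1\<^sub>m n \<in> RU"
 proof -
  have "1\<^sub>m n * P = P * diagm n (\<lambda>_. 1)" unfolding diagm_one using P(1) by simp
  moreover have "good (\<lambda>_. 1)" by (simp add: good_def)
  ultimately show ?thesis unfolding RU_def by auto
 qed
 define G :: "'k mat monoid" where "G = \<lparr>carrier = RU, monoid.mult = (*), one = 1\<^sub>m n\<rparr>"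
 interpret G: comm_group G
 proof (rule comm_groupI)
  fix M M' M'' assume "M \<in> carrier G" "M' \<in> carrier G" "M'' \<in> carrier G"
  then have "M \<in> GLm n" "M' \<in> GLm n" "M'' \<in> GLm n" using RUD(1) by (auto simp: G_def)
  then show "M \<otimes>\<^bsub>G\<^esub> M' \<otimes>\<^bsub>G\<^esub> M'' = M \<otimes>\<^bsub>G\<^esub> (M' \<otimes>\<^bsub>G\<^esub> M'')" by (simp add: G_def)
 next
  fix M assume M: "M \<in> carrier G"
  then have "minv M * M = 1\<^sub>m n" using RUD(1)[of M] by (simp add: G_def)
  then show "\<exists>M'\<in>carrier G. M' \<otimes>\<^bsub>G\<^esub> M = \<one>\<^bsub>G\<^esub>" using RU_inv[of M] M by (auto simp: G_def)
 qed (use RU_mult RU_1 RU_comm RUD(1) in \<open>auto simp: G_def\<close>)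
 have invG: "inv\<^bsub>G\<^esub> M = minv M" if "M \<in> RU" for M
  using G.inv_equality[of "minv M" M] RUD(1)[OF that] RU_inv[OF that] that by (simp add: G_def)
 have "\<exists>h\<in>carrier G. h \<otimes>\<^bsub>G\<^esub> star h = d"
 proof (rule G.hilbert90_norm_surj)
  have "RU \<subseteq> {A \<in> carrier_mat n n. Fr 1 A = A}" using RUD by auto
  then show "finite (carrier G)" using finite_Fr_fixed[of 1 n n] by (simp add: G_def finite_subset)
  show "star \<in> hom G G"
  proof (rule homI)
   fix M M' assume MM: "M \<in> carrier G" "M' \<in> carrier G"
   then have "M \<in> GLm n" "M' \<in> GLm n" using RUD(1) by (auto simp: G_def)
   then have "star (M * M') = star M' * star M"
    unfolding star_def using x(1) by (simp add: mtranspose_mult)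
   also have "\<dots> = star M * star M'" using RU_comm star_RU MM by (simp add: G_def)
   finally show "star (M \<otimes>\<^bsub>G\<^esub> M') = star M \<otimes>\<^bsub>G\<^esub> star M'" by (simp add: G_def)
  qed (use star_RU in \<open>simp add: G_def\<close>)
  show "star (star M) = M" if "M \<in> carrier G" for M using star_star that by (simp add: G_def)
  show "d \<in> carrier G" unfolding G_def RU_def using d P(3) by (auto simp: good_def)
  show "star d = d" unfolding star_def dx using x d by simp
 next
  fix h assume h': "h \<in> carrier G" "h \<otimes>\<^bsub>G\<^esub> star h = \<one>\<^bsub>G\<^esub>"
  then have h: "h \<in> RU" "h * star h = 1\<^sub>m n" by (simp_all add: G_def)
  note hG = RUD[OF h(1)]
  obtain \<eta> where eta: "good \<eta>" "h * P = P * diagm n \<eta>" using hG(3) by blast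
  obtain \<eta>' where eta': "dual \<eta> \<eta>'" "good \<eta>'" using ex_dual[OF eta(1)] by blast
  have sh: "star h * P = P * diagm n \<eta>'" using star_dual[OF _ eta(2) eta'(1)] hG by simp
  have ee: "\<eta> i * \<eta>' i = 1" if i: "i < n" for i
  proof -
   have "P * 1\<^sub>m n = P * diagm n (\<lambda>i. \<eta> i * \<eta>' i)"
    using diag_mult[OF _ _ eta(2) sh] hG star_GL[OF hG(1)] P(1) unfolding h(2) by simp
   then have "minv P * (P * 1\<^sub>m n) = minv P * (P * diagm n (\<lambda>i. \<eta> i * \<eta>' i))" by simp
   then have "1\<^sub>m n = diagm n (\<lambda>i. \<eta> i * \<eta>' i)" using P(1) by simp
   then have "(1\<^sub>m n :: 'k mat) $$ (i, i) = diagm n (\<lambda>i. \<eta> i * \<eta>' i) $$ (i, i)" by simp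
   then show ?thesis using i by simp
  qed
  define \<mu> where "\<mu> t i = (1 + \<eta> i) + t * (b i * (1 - \<eta> i))" for t i
  \<comment> \<open>the only value of \<open>t\<close> at which entry \<open>i\<close> of \<open>u\<close> vanishes; if the coefficient of \<open>t\<close> is 0, the entry is 2, and excluding the default 0 costs nothing\<close>
  define bad where "bad i = (if b i * (1 - \<eta> i) = 0 then 0 else - (1 + \<eta> i) / (b i * (1 - \<eta> i)))" for i
  have "\<exists>t\<in>Fq. \<forall>i<n. \<mu> t i \<noteq> 0"
  proof -
   have "card (bad ` {..<n}) \<le> n" using card_image_le[of "{..<n}" bad] by simp
   then have "card (bad ` {..<n}) < card Fq" using n card_Fq by simp
   then have "\<not> Fq \<subseteq> bad ` {..<n}" using card_mono[of "bad ` {..<n}" Fq] by auto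
   then obtain t where t: "t \<in> Fq" "t \<notin> bad ` {..<n}" by blast
   have "\<mu> t i \<noteq> 0" if i: "i < n" for i
   proof
    assume 0: "\<mu> t i = 0"
    show False
    proof (cases "b i * (1 - \<eta> i) = 0")
     case True
     then have "\<eta> i = 1" using b0[OF i] by simp
     then show False using 0 two_neq_0 by (simp add: \<mu>_def)
    next
     case False
     then have "t = bad i" using 0 unfolding bad_def \<mu>_def
      by (simp add: field_simps eq_neg_iff_add_eq_0 add_ac)
     then show False using t(2) i by blast
    qed
   qed
   then show ?thesis using t(1) by blast
  qed
  then obtain t where t: "t \<in> Fq" "\<And>i. i < n \<Longrightarrow> \<mu> t i \<noteq> 0" by blast
  define u where "u = (1\<^sub>m n + h) + t \<cdot>\<^sub>m (B - B * h)"
  have uc: "u \<in> carrier_mat n n" unfolding u_def using hG(1) B(1)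
   by (intro add_carrier_mat smult_carrier_mat minus_carrier_mat) simp
  have urat: "rat u" unfolding u_def
   using hG B t(1) by (intro rat_add[of _ _ n n] rat_smult[of _ _ n n] rat_minus[of _ _ n n] rat_mult) auto
  have uP: "u * P = P * diagm n (\<mu> t)"
  proof -
   have BhP: "(B * h) * P = P * diagm n (\<lambda>i. b i * \<eta> i)" by (rule diag_mult) (use B hG P(2) eta(2) in auto)
   have c: "1\<^sub>m n + h \<in> carrier_mat n n" "t \<cdot>\<^sub>m (B - B * h) \<in> carrier_mat n n" "B - B * h \<in> carrier_mat n n"
    "B * h \<in> carrier_mat n n" "h \<in> carrier_mat n n" "B \<in> carrier_mat n n" "P \<in> carrier_mat n n"
    using hG(1) B(1) P(1) by auto
   have "u * P = (1\<^sub>m n * P + h * P) + t \<cdot>\<^sub>m (B * P - (B * h) * P)"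
    unfolding u_def add_mult_distrib_mat[OF c(1,2,7)] add_mult_distrib_mat[OF one_carrier_mat c(5,7)]
     mult_smult_assoc_mat[OF c(3,7)] minus_mult_distrib_mat[OF c(6,4,7)] ..
   also have "\<dots> = P * diagm n (\<mu> t)"
    unfolding eta(2) P(2) BhP
    by (rule eq_matI) (use P(1) in \<open>auto simp: diagm_mult_right[of _ n n] \<mu>_def algebra_simps\<close>)
   finally show ?thesis .
  qed
  have uG: "u \<in> GLm n" using diag_conj_GLm[OF P(1) uc uP] t(2) by blast
  have ugood: "good (\<mu> t)" unfolding good_def
  proof (intro allI impI)
   fix i j assume ij: "i < n" "j < n" "b i = b j" "e i = e j"
   then have "\<eta> i = \<eta> j" by (intro goodD[OF eta(1)])
   then show "\<mu> t i = \<mu> t j" using ij(3) by (simp add: \<mu>_def)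
  qed
  have uRU: "u \<in> RU" unfolding RU_def using uG urat ugood uP by blast
  define \<mu>' where "\<mu>' i = (1 + \<eta>' i) - t * (b i * (1 - \<eta>' i))" for i
  have "dual (\<mu> t) \<mu>'" unfolding dual_def
  proof (intro allI impI)
   fix i j assume ij: "i < n" "j < n" "y $$ (i, j) \<noteq> 0"
   then have "\<eta> i = \<eta>' j" "b i = - b j" using eta'(1) bB unfolding dual_def by blast+
   then show "\<mu> t i = \<mu>' j" by (simp add: \<mu>_def \<mu>'_def algebra_simps)
  qed
  from star_dual[OF uc uP this] have su: "star u * P = P * diagm n \<mu>'" .
  have "h * star u = u"
  proof (rule diag_eq[OF _ uc diag_mult[OF _ _ eta(2) su] uP])
   fix i assume i: "i < n"
   have "\<eta> i * \<mu>' i = (\<eta> i + \<eta> i * \<eta>' i) - t * (b i * (\<eta> i - \<eta> i * \<eta>' i))" by (simp add: \<mu>'_def algebra_simps)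
   then show "\<eta> i * \<mu>' i = \<mu> t i" unfolding ee[OF i] by (simp add: \<mu>_def algebra_simps)
  qed (use hG star_GL[OF uG] in auto)
  moreover have "h = (h * star u) * minv (star u)" using hG(1) star_GL[OF uG] by simp
  ultimately have "h = u * minv (star u)" by simp
  then show "\<exists>u\<in>carrier G. h = u \<otimes>\<^bsub>G\<^esub> inv\<^bsub>G\<^esub> (star u)"
   using uRU by (intro bexI[of _ u]) (simp_all only: invG[OF star_RU[OF uRU]], simp_all add: G_def)
 qed
 then obtain h where h: "h \<in> RU" "h * star h = d" by (auto simp: G_def)
 have "star h * h = d" using RU_comm[OF star_RU[OF h(1)] h(1)] h(2) by simp
 then have "x * (star h * h) = x * d" by simp
 then have "h\<^sup>T * x * h = x * d" unfolding star_def using x RUD(1)[OF h(1)] by simp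
 then show ?thesis using RUD[OF h(1)] by blast
qed

end

section \<open>Bilinear forms and their asymmetries\<close>

definition asymmetry :: "'a::field mat \<Rightarrow> 'a mat" where "asymmetry x = minv x * x\<^sup>T"

definition act :: "'a::field mat \<Rightarrow> 'a mat \<Rightarrow> 'a mat" where "act h x = h\<^sup>T * (x * h)"

lemma asym_dims[simp]: "dim_row (asymmetry x) = dim_row x" "dim_col (asymmetry x) = dim_row x"
 by (simp_all add: asymmetry_def)

lemma asym_GLm[simp]: "x \<in> GLm n \<Longrightarrow> asymmetry x \<in> GLm n" by (simp add: asymmetry_def)
lemma act_GLm[simp]: "x \<in> GLm n \<Longrightarrow> h \<in> GLm n \<Longrightarrow> act h x \<in> GLm n" by (simp add: act_def)

lemma transpose_asym: "x \<in> GLm n \<Longrightarrow> x * asymmetry x = x\<^sup>T" by (simp add: asymmetry_def)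

lemma asym_act: "x \<in> GLm n \<Longrightarrow> h \<in> GLm n \<Longrightarrow> asymmetry (act h x) = minv h * (asymmetry x * h)"
 by (simp add: asymmetry_def act_def mtranspose_mult minv_mult[of _ n])

lemma act_act: "x \<in> GLm n \<Longrightarrow> h \<in> GLm n \<Longrightarrow> g \<in> GLm n \<Longrightarrow> act g (act h x) = act (h * g) x"
 by (simp add: act_def mtranspose_mult)

lemma act_one: "x \<in> GLm n \<Longrightarrow> act (1\<^sub>m n) x = x" by (simp add: act_def)

lemma pow_GLm[simp]: "A \<in> GLm n \<Longrightarrow> A ^\<^sub>m i \<in> GLm n" using pow_minv by blast

lemma smult_smult: "a \<cdot>\<^sub>m (b \<cdot>\<^sub>m A) = (a * b :: 'a::comm_ring_1) \<cdot>\<^sub>m A" by (rule eq_matI) auto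
lemma smult_one[simp]: "1 \<cdot>\<^sub>m A = (A :: 'a::comm_ring_1 mat)" by (rule eq_matI) auto

lemma mult_smult_dim: "dim_col A = dim_row B \<Longrightarrow> A * (a \<cdot>\<^sub>m B) = a \<cdot>\<^sub>m (A * (B :: 'a::comm_ring_1 mat))"
 by (rule mult_smult_distrib[of _ "dim_row A" "dim_col A" _ "dim_col B"]) auto
lemma smult_mult_dim: "dim_col A = dim_row B \<Longrightarrow> (a \<cdot>\<^sub>m A) * B = a \<cdot>\<^sub>m (A * (B :: 'a::comm_ring_1 mat))"
 by (rule mult_smult_assoc_mat[of _ "dim_row A" "dim_col A" _ "dim_col B"]) auto

lemma adjoint_pow:
 assumes "x \<in> carrier_mat n n" "M \<in> carrier_mat n n" "M\<^sup>T * x = a \<cdot>\<^sub>m (x * M)"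
 shows "(M ^\<^sub>m i)\<^sup>T * x = a ^ i \<cdot>\<^sub>m (x * M ^\<^sub>m i :: 'a::field mat)"
proof (induction i)
 case 0 then show ?case using assms(1,2) by simp
next
 case (Suc i)
 have "(M ^\<^sub>m Suc i)\<^sup>T * x = M\<^sup>T * ((M ^\<^sub>m i)\<^sup>T * x)"
  using assms(1,2) by (simp add: mtranspose_mult)
 also have "\<dots> = a ^ i \<cdot>\<^sub>m ((M\<^sup>T * x) * M ^\<^sub>m i)"
  unfolding Suc using assms(1,2) by (simp add: mult_smult_dim)
 also have "\<dots> = a ^ Suc i \<cdot>\<^sub>m (x * (M * M ^\<^sub>m i))"
  unfolding assms(3) using assms(1,2) by (simp add: smult_mult_dim smult_smult mult.commute)
 also have "M * M ^\<^sub>m i = M ^\<^sub>m Suc i" using commute_pow[OF assms(2) assms(2) refl, of i] by simp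
 finally show ?case .
qed

text \<open>Adjointness with respect to \<open>x\<close> is compatible with a change of basis.\<close>

lemma adjoint_transport:
 assumes x: "x \<in> GLm n" and P: "P \<in> GLm n" and M: "M \<in> carrier_mat n n" "M' \<in> carrier_mat n n"
  and D: "D \<in> carrier_mat n n" "D' \<in> carrier_mat n n" and MP: "M * P = P * D" "M' * P = P * D'"
 shows "M\<^sup>T * x = a \<cdot>\<^sub>m (x * M') \<longleftrightarrow>
  D\<^sup>T * act P x = a \<cdot>\<^sub>m (act P x * (D' :: 'a::field mat))"
proof -
 have PM: "P\<^sup>T * M\<^sup>T = D\<^sup>T * P\<^sup>T"
  using arg_cong[OF MP(1), of transpose_mat] M P D by (simp add: mtranspose_mult)
 have 1: "D\<^sup>T * act P x = P\<^sup>T * ((M\<^sup>T * x) * P)"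
  unfolding act_def using lift_eq[OF PM, of "x * P"] x P M D by simp
 have 2: "a \<cdot>\<^sub>m (act P x * D') = P\<^sup>T * ((a \<cdot>\<^sub>m (x * M')) * P)"
 proof -
  have "P\<^sup>T * ((a \<cdot>\<^sub>m (x * M')) * P) = a \<cdot>\<^sub>m (P\<^sup>T * (x * (M' * P)))"
   using x P M by (simp add: mult_smult_dim smult_mult_dim)
  then show ?thesis unfolding MP(2) act_def using x P D by simp
 qed
 show ?thesis
 proof
  assume "M\<^sup>T * x = a \<cdot>\<^sub>m (x * M')"
  then show "D\<^sup>T * act P x = a \<cdot>\<^sub>m (act P x * D')" unfolding 1 2 by simp
 next
  assume eq: "D\<^sup>T * act P x = a \<cdot>\<^sub>m (act P x * D')"
  define Y where "Y = M\<^sup>T * x"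
  define Z where "Z = a \<cdot>\<^sub>m (x * M')"
  have YZ: "Y \<in> carrier_mat n n" "Z \<in> carrier_mat n n" using x M by (auto simp: Y_def Z_def)
  have tP: "P\<^sup>T \<in> GLm n" using P by simp
  have "P\<^sup>T * (Y * P) = P\<^sup>T * (Z * P)" using eq unfolding 1 2 Y_def Z_def .
  then have "minv (P\<^sup>T) * (P\<^sup>T * (Y * P)) = minv (P\<^sup>T) * (P\<^sup>T * (Z * P))" by simp
  then have "Y * P = Z * P" using minv_cancel_left(1)[OF tP] YZ by simp
  then have "(Y * P) * minv P = (Z * P) * minv P" by simp
  then have "Y = Z" using YZ P by simp
  then show "M\<^sup>T * x = a \<cdot>\<^sub>m (x * M')" unfolding Y_def Z_def .
 qed
qed

context frob_closure
begin

text \<open>The flag \<open>R\<close> selects congruence over the finite field rather than over its algebraic closure.\<close>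

definition cg :: "nat \<Rightarrow> bool \<Rightarrow> 'k mat \<Rightarrow> 'k mat \<Rightarrow> bool" where
 "cg n R x x' \<longleftrightarrow> (\<exists>h\<in>GLm n. (R \<longrightarrow> rat h) \<and> x' = act h x)"

lemma rat_pow: "rat A \<Longrightarrow> A \<in> carrier_mat n n \<Longrightarrow> rat (A ^\<^sub>m i)"
 by (induction i) (auto intro!: rat_mult)

lemma rat_act: "rat x \<Longrightarrow> rat h \<Longrightarrow> x \<in> GLm n \<Longrightarrow> h \<in> GLm n \<Longrightarrow> rat (act h x)"
 unfolding act_def by (intro rat_mult rat_transpose) auto

lemma rat_asym: "rat x \<Longrightarrow> x \<in> GLm n \<Longrightarrow> rat (asymmetry x)"
 unfolding asymmetry_def by (intro rat_mult rat_transpose rat_minv) auto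

lemma cg_refl: "x \<in> GLm n \<Longrightarrow> cg n R x x"
 unfolding cg_def by (rule bexI[of _ "1\<^sub>m n"]) (simp_all add: act_one)

lemma cg_sym: assumes "x \<in> GLm n" "cg n R x x'" shows "cg n R x' x"
proof -
 obtain h where h: "h \<in> GLm n" "R \<longrightarrow> rat h" "x' = act h x" using assms(2) unfolding cg_def by blast
 have "x = act (minv h) x'" unfolding h(3) using act_act[OF assms(1) h(1), of "minv h"] h(1) assms(1) by (simp add: act_one)
 then show ?thesis unfolding cg_def using h rat_minv[of h n] by (intro bexI[of _ "minv h"]) auto
qed

lemma cg_trans: assumes "x \<in> GLm n" "cg n R x x'" "cg n R x' x''" shows "cg n R x x''"
proof -
 obtain h where h: "h \<in> GLm n" "R \<longrightarrow> rat h" "x' = act h x" using assms(2) unfolding cg_def by blast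
 obtain g where g: "g \<in> GLm n" "R \<longrightarrow> rat g" "x'' = act g x'" using assms(3) unfolding cg_def by blast
 have "x'' = act (h * g) x" unfolding g(3) h(3) using act_act[OF assms(1) h(1) g(1)] .
 then show ?thesis unfolding cg_def using h g by (intro bexI[of _ "h * g"]) (auto intro!: rat_mult)
qed

lemma cg_GLm: "cg n R x x' \<Longrightarrow> x \<in> GLm n \<Longrightarrow> x' \<in> GLm n" unfolding cg_def by auto
lemma cg_rat: "cg n True x x' \<Longrightarrow> x \<in> GLm n \<Longrightarrow> rat x \<Longrightarrow> rat x'" unfolding cg_def using rat_act by blast

section \<open>Congruence over the algebraic closure\<close>

lemma same_asym:
 assumes x: "x \<in> GLm n" and x': "x' \<in> GLm n" and eq: "asymmetry x = asymmetry (x' :: 'k mat)"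
 defines "c \<equiv> minv x * x'"
 shows "c\<^sup>T * x = x * c" "asymmetry x * c = c * asymmetry x"
proof -
 define A where "A = asymmetry x"
 have A: "A \<in> GLm n" using x by (simp add: A_def)
 have t: "x\<^sup>T = x * A" "x'\<^sup>T = x' * A"
  using transpose_asym[OF x] transpose_asym[OF x'] unfolding A_def eq by simp_all
 have c: "c \<in> GLm n" using x x' by (simp add: c_def)
 have xc: "x * c = x'" using x x' by (simp add: c_def)
 have "c\<^sup>T = x'\<^sup>T * minv (x\<^sup>T)"
  unfolding c_def using x x' by (simp add: mtranspose_mult minv_transpose)
 also have "\<dots> = x' * minv x" unfolding t using x x' A by (simp add: minv_mult[of _ n])
 finally have "c\<^sup>T * x = x'" using x x' by simp
 then show 1: "c\<^sup>T * x = x * c" unfolding xc .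
 have "x * (A * c) = x\<^sup>T * c" unfolding t using x A c by simp
 also have "\<dots> = (c\<^sup>T * x)\<^sup>T" using x c by (simp add: mtranspose_mult)
 also have "\<dots> = x'\<^sup>T" unfolding 1 xc ..
 also have "\<dots> = (x * c) * A" unfolding t(2) xc ..
 also have "\<dots> = x * (c * A)" using x A c by simp
 finally have "minv x * (x * (A * c)) = minv x * (x * (c * A))" by simp
 then show "asymmetry x * c = c * asymmetry x" using x A c by (simp flip: A_def)
qed

lemma coprime_p: "\<not> p dvd m \<Longrightarrow> coprime m p"
 using prime_p by (metis coprime_commute prime_imp_coprime)

text \<open>If \<open>c\<close> is self-adjoint, acting by \<open>c ^ j\<close> multiplies the form by \<open>c ^ (2 * j)\<close>. With \<open>2 * j + 1\<close>
 the odd part of the order of \<open>c\<close>, this turns \<open>x * c\<close> into \<open>x * d\<close> where \<open>d\<close> has order a power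
 of 2, prime to the characteristic; so \<open>d\<close> is semisimple.\<close>

lemma two_power:
 assumes x: "x \<in> GLm n" and x': "x' \<in> GLm n" and adj: "(minv x * x')\<^sup>T * x = x * (minv x * x')"
 obtains g d where "g \<in> GLm n" "d \<in> GLm n" "act g x' = x * d" "ss d" "d\<^sup>T * x = x * d"
  "rat x \<Longrightarrow> rat x' \<Longrightarrow> rat g \<and> rat d"
  "\<And>A. A \<in> carrier_mat n n \<Longrightarrow> A * (minv x * x') = (minv x * x') * A \<Longrightarrow> A * d = d * A"
proof -
 define c where "c = minv x * x'"
 have c: "c \<in> GLm n" using x x' by (simp add: c_def)
 have xc: "x' = x * c" using x x' by (simp add: c_def)
 obtain N where N: "N > 0" "c ^\<^sub>m N = 1\<^sub>m n" using finite_order[OF c] by blast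
 obtain N' where N': "N = 2 ^ multiplicity 2 N * N'" "\<not> 2 dvd N'"
  using multiplicity_decompose'[of N 2] N(1) by auto
 obtain j where j: "N' = 2 * j + 1" using N'(2) oddE by blast
 have adjc: "c\<^sup>T * x = 1 \<cdot>\<^sub>m (x * c)" using adj by (simp add: c_def)
 have adjp: "(c ^\<^sub>m i)\<^sup>T * x = x * c ^\<^sub>m i" for i
  using adjoint_pow[OF _ _ adjc, of n i] x c by simp
 have ac: "act (c ^\<^sub>m j) x' = x * c ^\<^sub>m N'"
 proof -
  have "act (c ^\<^sub>m j) x' = ((c ^\<^sub>m j)\<^sup>T * x) * (c * c ^\<^sub>m j)"
   unfolding act_def xc using x c pow_GLm[OF c, of j] by simp
  also have "\<dots> = x * (c ^\<^sub>m j * (c * c ^\<^sub>m j))" unfolding adjp using x c pow_GLm[OF c, of j] by simp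
  also have "c ^\<^sub>m j * (c * c ^\<^sub>m j) = c ^\<^sub>m (j + (1 + j))"
   using c pow_mat_add[of c n j "1 + j"] pow_mat_add[of c n 1 j] by simp
  finally show ?thesis by (simp add: j mult_2 add_ac)
 qed
 have ord: "(c ^\<^sub>m N') ^\<^sub>m (2 ^ multiplicity 2 N) = 1\<^sub>m n"
  using N(2) pow_mat_pow[of c n N' "2 ^ multiplicity 2 N"] c by (subst (asm) N'(1)) (simp add: mult.commute)
 have "\<not> p dvd 2 ^ multiplicity 2 N"
  using odd_p prime_p by (metis prime_dvd_power primes_dvd_imp_eq two_is_prime_nat even_numeral)
 then have "ss (c ^\<^sub>m N')" using c ord by (intro ss_of_order[OF _ _ coprime_p]) auto
 moreover have "rat (c ^\<^sub>m i)" if "rat x" "rat x'" for i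
  using that x x' c by (intro rat_pow[of _ n]) (auto simp: c_def intro!: rat_mult rat_minv)
 moreover have "A * c ^\<^sub>m N' = c ^\<^sub>m N' * A" if "A \<in> carrier_mat n n" "A * (minv x * x') = (minv x * x') * A" for A
  using commute_pow[of c n A N'] that c unfolding c_def[symmetric] by simp
 ultimately show ?thesis using that[of "c ^\<^sub>m j" "c ^\<^sub>m N'"] c ac adjp by simp
qed

text \<open>Diagonalise \<open>d\<close> and take square roots of its eigenvalues, the same root for equal eigenvalues;
 then the root \<open>h\<close> is self-adjoint as well, and \<open>h * h = d\<close>.\<close>

lemma sqrt_form:
 assumes x: "x \<in> GLm n" and d: "d \<in> GLm n" "ss d" "d\<^sup>T * x = x * (d :: 'k mat)"
 shows "\<exists>h\<in>GLm n. act h x = x * d"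
proof -
 obtain P \<delta> where P: "P \<in> GLm n" "d * P = P * diagm n \<delta>" using ss_diag[of d n] d by auto
 define r where "r z = (SOME w. w ^ 2 = (z::'k))" for z
 have r: "r z ^ 2 = z" for z unfolding r_def by (rule someI_ex) (use nth_root_exists[of 2 z] in simp)
 define D where "D = diagm n (\<lambda>i. r (\<delta> i))"
 define y where "y = act P x"
 have y: "y \<in> GLm n" using P x by (simp add: y_def)
 have "d\<^sup>T * x = 1 \<cdot>\<^sub>m (x * d)" using d(3) by simp
 then have "(diagm n \<delta>)\<^sup>T * y = 1 \<cdot>\<^sub>m (y * diagm n \<delta>)"
  using adjoint_transport[OF x P(1) _ _ _ _ P(2) P(2), of 1] d(1) by (simp add: y_def)
 then have dy: "diagm n \<delta> * y = y * diagm n \<delta>" by simp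
 have "D * y = y * D"
 proof (rule eq_matI)
  fix i j assume "i < dim_row (y * D)" "j < dim_col (y * D)"
  then have ij: "i < n" "j < n" using y by (auto simp: D_def)
  have "(diagm n \<delta> * y) $$ (i, j) = (y * diagm n \<delta>) $$ (i, j)" unfolding dy ..
  then have "\<delta> i * y $$ (i, j) = y $$ (i, j) * \<delta> j"
   using ij y by (simp add: diagm_mult_left[of _ n n] diagm_mult_right[of _ n n])
  then have "y $$ (i, j) = 0 \<or> \<delta> i = \<delta> j" by auto
  then show "(D * y) $$ (i, j) = (y * D) $$ (i, j)"
   unfolding D_def using ij y by (auto simp: diagm_mult_left[of _ n n] diagm_mult_right[of _ n n])
 qed (use y in \<open>auto simp: D_def\<close>)
 define h where "h = P * D * minv P"
 have DC: "D \<in> carrier_mat n n" "D\<^sup>T = D" by (simp_all add: D_def)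
 have hc: "h \<in> carrier_mat n n" using P DC by (simp add: h_def)
 have hP: "h * P = P * D" using P(1) DC by (simp add: h_def)
 have "D\<^sup>T * act P x = 1 \<cdot>\<^sub>m (act P x * D)" using \<open>D * y = y * D\<close> DC by (simp add: y_def)
 then have "h\<^sup>T * x = 1 \<cdot>\<^sub>m (x * h)"
  using adjoint_transport[OF x P(1) hc hc DC(1) DC(1) hP hP, of 1] by simp
 then have adj: "h\<^sup>T * x = x * h" by simp
 have "D * D = diagm n \<delta>" unfolding D_def diagm_mult by (rule eq_matI) (use r in \<open>auto simp: power2_eq_square\<close>)
 then have hh: "h * h = d"
  unfolding diag_eq_conj[OF P GLm_carrier[OF d(1)] diagm_carrier] h_def using P(1) DC(1)
  by (simp flip: massoc) (simp add: massoc)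
 have "det h * det h = det d" using det_mult[OF hc hc] hh by simp
 then have "h \<in> GLm n" using hc d(1) by (intro GLmI) auto
 moreover have "act h x = x * d"
 proof -
  have "act h x = (h\<^sup>T * x) * h" unfolding act_def using x hc by simp
  also have "\<dots> = x * (h * h)" unfolding adj using x hc by simp
  finally show ?thesis unfolding hh .
 qed
 ultimately show ?thesis by blast
qed

text \<open>After a change of basis the asymmetries agree, so the forms differ by a self-adjoint factor,
 which may be assumed semisimple and has a self-adjoint square root.\<close>

lemma k_class:
 assumes x: "x \<in> GLm n" "ss (asymmetry x)" and x': "x' \<in> GLm n" "ss (asymmetry x')"
  and eq: "eigs (asymmetry x) = eigs (asymmetry x')"
 shows "cg n False x x'"
proof -
 obtain h0 where h0: "h0 \<in> GLm n" "asymmetry x * h0 = h0 * asymmetry x'"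
  using similar_of_eigs[of "asymmetry x" n "asymmetry x'"] x x' eq by auto
 define x1 where "x1 = act (minv h0) x'"
 have x1: "x1 \<in> GLm n" "cg n False x' x1" using x' h0 by (auto simp: x1_def cg_def)
 have "asymmetry x1 = h0 * (asymmetry x' * minv h0)" unfolding x1_def using asym_act[OF x'(1), of "minv h0"] h0(1) by simp
 also have "\<dots> = (h0 * asymmetry x') * minv h0" using h0(1) x'(1) by simp
 also have "\<dots> = asymmetry x" unfolding h0(2)[symmetric] using h0(1) x(1) by simp
 finally have eq1: "asymmetry x = asymmetry x1" ..
 obtain g d where gd: "g \<in> GLm n" "d \<in> GLm n" "act g x1 = x * d" "ss d" "d\<^sup>T * x = x * d"
  by (rule two_power[OF x(1) x1(1) same_asym(1)[OF x(1) x1(1) eq1]]) blast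
 obtain h where h: "h \<in> GLm n" "act h x = x * d" using sqrt_form[OF x(1) gd(2,4,5)] by blast
 have "cg n False x (x * d)" unfolding cg_def using h by metis
 moreover have "cg n False x1 (x * d)" unfolding cg_def using gd by metis
 ultimately show ?thesis using cg_trans cg_sym x1 x(1) x'(1) by blast
qed

section \<open>Rational congruence when 1 is not an eigenvalue\<close>

lemma rf_entry: "i < n \<Longrightarrow> j < n \<Longrightarrow> c \<in> Fq \<Longrightarrow> rational_functional n (\<lambda>M. c * M $$ (i, j))"
 unfolding rational_functional_def
proof (intro conjI ballI allI impI)
 fix A :: "'k mat" assume ij: "i < n" "j < n" "c \<in> Fq" and A: "A \<in> carrier_mat n n" and r: "rat A"
 have "A $$ (i, j) \<in> Fq" using rat_iff[OF A] r ij by blast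
 then show "c * A $$ (i, j) \<in> Fq" using ij(3) Fq_closed(3) by blast
qed (auto simp: algebra_simps)

lemma rf_add: "rational_functional n f \<Longrightarrow> rational_functional n g \<Longrightarrow> rational_functional n (\<lambda>M. f M + g M)"
 unfolding rational_functional_def using Fq_closed(1) by (auto simp: algebra_simps)

lemma rf_zero: "rational_functional n (\<lambda>M. 0)"
 unfolding rational_functional_def using q_gt_1 by auto

lemma rf_sum: "(\<And>s. s \<in> S \<Longrightarrow> rational_functional n (f s)) \<Longrightarrow> rational_functional n (\<lambda>M. \<Sum>s\<in>S. f s M)"
 by (induction S rule: infinite_finite_induct) (auto simp: rf_zero intro: rf_add)

text \<open>The entries of \<open>M * A' - A * M\<close> as linear functionals of \<open>M\<close>.\<close>

definition itw :: "nat \<Rightarrow> 'k mat \<Rightarrow> 'k mat \<Rightarrow> nat \<Rightarrow> nat \<Rightarrow> 'k mat \<Rightarrow> 'k" where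
 "itw n A A' i j M = (\<Sum>s<n. (- A $$ (i, s)) * M $$ (s, j) + A' $$ (s, j) * M $$ (i, s))"

text \<open>The coefficients of the condition that the adjoint of \<open>M\<close> is \<open>- M\<close>.\<close>

definition skw :: "nat \<Rightarrow> 'k mat \<Rightarrow> nat \<Rightarrow> nat \<Rightarrow> 'k mat \<Rightarrow> 'k" where
 "skw n x i j M = (\<Sum>s<n. x $$ (s, j) * M $$ (s, i) + x $$ (i, s) * M $$ (s, j))"

lemma rf_itw: assumes "A \<in> carrier_mat n n" "A' \<in> carrier_mat n n" "rat A" "rat A'" "i < n" "j < n"
 shows "rational_functional n (itw n A A' i j)"
proof -
 have 1: "A $$ (i, s) \<in> Fq" "A' $$ (s, j) \<in> Fq" if "s < n" for s using that assms rat_iff by blast+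
 then have "- A $$ (i, s) \<in> Fq" if "s < n" for s using that odd_q by simp
 then show ?thesis unfolding itw_def using 1 assms(5,6) by (intro rf_sum rf_add rf_entry) auto
qed

lemma rf_skw: assumes "x \<in> carrier_mat n n" "rat x" "i < n" "j < n"
 shows "rational_functional n (skw n x i j)"
proof -
 have 1: "x $$ (i, s) \<in> Fq" "x $$ (s, j) \<in> Fq" if "s < n" for s using that assms rat_iff by blast+
 then show ?thesis unfolding skw_def using 1 assms(3,4) by (intro rf_sum rf_add rf_entry) auto
qed

lemma itw_zero: assumes "A \<in> carrier_mat n n" "A' \<in> carrier_mat n n" "M \<in> carrier_mat n n"
 shows "(\<forall>i<n. \<forall>j<n. itw n A A' i j M = 0) \<longleftrightarrow> A * M = M * A'"
proof -
 have "itw n A A' i j M = (M * A') $$ (i, j) - (A * M) $$ (i, j)" if "i < n" "j < n" for i j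
  using that assms by (simp add: itw_def mult_mat_index[of _ n n _ n] sum_subtractf mult.commute)
 then show ?thesis using assms by (auto intro!: eq_matI)
qed

lemma skw_zero: assumes "x \<in> carrier_mat n n" "M \<in> carrier_mat n n"
 shows "(\<forall>i<n. \<forall>j<n. skw n x i j M = 0) \<longleftrightarrow> M\<^sup>T * x = (- 1) \<cdot>\<^sub>m (x * M)"
proof -
 have e: "skw n x i j M = (M\<^sup>T * x) $$ (i, j) + (x * M) $$ (i, j)" if "i < n" "j < n" for i j
 proof -
  have "(M\<^sup>T * x) $$ (i, j) = (\<Sum>s<n. M\<^sup>T $$ (i, s) * x $$ (s, j))"
   using that assms by (intro mult_mat_index[of _ n n _ n]) auto
  also have "\<dots> = (\<Sum>s<n. x $$ (s, j) * M $$ (s, i))" using that assms by (intro sum.cong) auto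
  finally show ?thesis using that assms by (simp add: skw_def mult_mat_index[of x n n M n] sum.distrib)
 qed
 show ?thesis
 proof
  assume 0: "\<forall>i<n. \<forall>j<n. skw n x i j M = 0"
  show "M\<^sup>T * x = (- 1) \<cdot>\<^sub>m (x * M)"
  proof (rule eq_matI)
   fix i j assume "i < dim_row ((- 1) \<cdot>\<^sub>m (x * M))" "j < dim_col ((- 1) \<cdot>\<^sub>m (x * M))"
   then have ij: "i < n" "j < n" using assms by auto
   then show "(M\<^sup>T * x) $$ (i, j) = ((- 1) \<cdot>\<^sub>m (x * M)) $$ (i, j)"
    using 0 e[OF ij] assms by (simp add: eq_neg_iff_add_eq_0)
  qed (use assms in auto)
 next
  assume eq: "M\<^sup>T * x = (- 1) \<cdot>\<^sub>m (x * M)"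
  show "\<forall>i<n. \<forall>j<n. skw n x i j M = 0"
  proof (intro allI impI)
   fix i j assume ij: "i < n" "j < n"
   show "skw n x i j M = 0" unfolding e[OF ij] eq using ij assms by simp
  qed
 qed
qed

lemma rational_intertwiner:
 assumes n: "n < q" and A: "A \<in> carrier_mat n n" "rat A" "A' \<in> carrier_mat n n" "rat A'"
  and h: "h \<in> GLm n" "A * h = h * A'"
 shows "\<exists>h\<in>GLm n. rat h \<and> A * h = h * A'"
proof -
 let ?\<Phi> = "{itw n A A' i j | i j. i < n \<and> j < n}"
 have "\<exists>B'\<in>GLm n. rat B' \<and> (\<forall>f\<in>?\<Phi>. f B' = 0)"
 proof (rule rational_point[OF n _ h(1)])
  show "rational_functional n f" if "f \<in> ?\<Phi>" for f using that rf_itw A by blast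
  show "f h = 0" if "f \<in> ?\<Phi>" for f using that itw_zero[OF A(1,3), of h] h by auto
 qed
 then obtain B' where B': "B' \<in> GLm n" "rat B'" "\<forall>f\<in>?\<Phi>. f B' = 0" by blast
 then have "\<forall>i<n. \<forall>j<n. itw n A A' i j B' = 0" by blast
 then show ?thesis using itw_zero[OF A(1,3), of B'] B' by auto
qed

lemma rational_skew:
 assumes n: "n < q" and x: "x \<in> GLm n" "rat x" and d: "d \<in> GLm n" "rat d"
  and B: "B \<in> GLm n" "B\<^sup>T * x = (- 1) \<cdot>\<^sub>m (x * B)" "d * B = B * d"
 shows "\<exists>B\<in>GLm n. rat B \<and> B\<^sup>T * x = (- 1) \<cdot>\<^sub>m (x * B) \<and> d * B = B * d"
proof -
 let ?\<Phi> = "{itw n d d i j | i j. i < n \<and> j < n} \<union> {skw n x i j | i j. i < n \<and> j < n}"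
 note c = GLm_carrier[OF x(1)] GLm_carrier[OF d(1)]
 have "\<exists>B'\<in>GLm n. rat B' \<and> (\<forall>f\<in>?\<Phi>. f B' = 0)"
 proof (rule rational_point[OF n _ B(1)])
  show "rational_functional n f" if "f \<in> ?\<Phi>" for f using that rf_itw[OF c(2) c(2)] rf_skw[OF c(1)] x d by blast
  show "f B = 0" if "f \<in> ?\<Phi>" for f using that itw_zero[OF c(2) c(2), of B] skw_zero[OF c(1), of B] B by auto
 qed
 then obtain B' where B': "B' \<in> GLm n" "rat B'" "\<forall>f\<in>?\<Phi>. f B' = 0" by blast
 then have "\<forall>i<n. \<forall>j<n. itw n d d i j B' = 0" "\<forall>i<n. \<forall>j<n. skw n x i j B' = 0" by blast+
 then show ?thesis using itw_zero[OF c(2) c(2), of B'] skw_zero[OF c(1), of B'] B' by auto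
qed

text \<open>In a basis that diagonalises the asymmetry and \<open>d\<close>, let \<open>\<lambda>\<close> run through the eigenvalues of the
 asymmetry: the form pairs \<open>\<lambda>\<close> only with its inverse. If \<open>- 1\<close> were not an eigenvalue, the
 matrix of \<open>\<lambda> - 1 / \<lambda>\<close> would do. On the eigenspace of \<open>- 1\<close>, where this vanishes, the form is
 alternating, and the inverse of the form itself is used instead.\<close>

lemma ex_skew_k:
 assumes x: "x \<in> GLm n" and A: "ss (asymmetry x)" and one: "1 \<notin># eigs (asymmetry x)"
  and d: "d \<in> GLm n" "ss d" "d\<^sup>T * x = x * d" and comm: "asymmetry x * d = d * asymmetry x"
 shows "\<exists>B\<in>GLm n. B\<^sup>T * x = (- 1) \<cdot>\<^sub>m (x * B) \<and> d * B = B * (d :: 'k mat)"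
proof -
 have Ac: "asymmetry x \<in> carrier_mat n n" using x by simp
 obtain P lam \<delta> where P: "P \<in> GLm n" "asymmetry x * P = P * diagm n lam" "d * P = P * diagm n \<delta>"
  using simult_diag[OF Ac A GLm_carrier[OF d(1)] d(2) comm] by blast
 have "eigs (asymmetry x) = mset (map lam [0..<n])" by (rule eigs_diag[OF Ac P(1,2)])
 then have l1: "lam i \<noteq> 1" if "i < n" for i using one that by auto
 have l0: "lam i \<noteq> 0" if "i < n" for i using diag_conj_GLm[OF P(1) Ac P(2)] x that by simp
 define y where "y = act P x"
 have y: "y \<in> GLm n" using P x by (simp add: y_def)
 define z where "z = minv y"
 have z: "z \<in> GLm n" using y by (simp add: z_def)
 have "d\<^sup>T * x = 1 \<cdot>\<^sub>m (x * d)" using d(3) by simp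
 then have "(diagm n \<delta>)\<^sup>T * y = 1 \<cdot>\<^sub>m (y * diagm n \<delta>)"
  using adjoint_transport[OF x P(1) _ _ _ _ P(3) P(3), of 1] d(1) by (simp add: y_def)
 then have dy: "diagm n \<delta> * y = y * diagm n \<delta>" by simp
 have ty: "y\<^sup>T = y * diagm n lam"
 proof -
  have "y\<^sup>T = P\<^sup>T * (x\<^sup>T * P)"
   unfolding y_def act_def using P x by (simp add: mtranspose_mult)
  also have "\<dots> = P\<^sup>T * (x * (asymmetry x * P))" unfolding transpose_asym[OF x, symmetric] using x P(1) asym_GLm[OF x] by simp
  also have "\<dots> = y * diagm n lam" unfolding P(2) y_def act_def using x P(1) by simp
  finally show ?thesis .
 qed
 have tyi: "y $$ (j, i) = y $$ (i, j) * lam j" if ij: "i < n" "j < n" for i j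
 proof -
  have "y\<^sup>T $$ (i, j) = (y * diagm n lam) $$ (i, j)" unfolding ty ..
  then show ?thesis using ij y by (simp add: diagm_mult_right[of _ n n])
 qed
 have ll: "lam i * lam j = 1" if ij: "i < n" "j < n" "y $$ (i, j) \<noteq> 0" for i j
 proof -
  have "y $$ (i, j) = y $$ (i, j) * lam j * lam i" using tyi[OF ij(1,2)] tyi[OF ij(2,1)] by simp
  then show ?thesis using ij(3) by (simp add: mult.commute)
 qed
 have ldy: "diagm n lam * (y * diagm n lam) = y"
 proof (rule eq_matI)
  fix i j assume "i < dim_row y" "j < dim_col y"
  then have ij: "i < n" "j < n" using y by auto
  then have "(diagm n lam * (y * diagm n lam)) $$ (i, j) = lam i * (y $$ (i, j) * lam j)"
   using y by (simp add: diagm_mult_left[of _ n n] diagm_mult_right[of _ n n])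
  then show "(diagm n lam * (y * diagm n lam)) $$ (i, j) = y $$ (i, j)"
   using ll[OF ij] by (cases "y $$ (i, j) = 0") (simp_all add: mult.left_commute)
 qed (use y in auto)
 have dz: "diagm n \<delta> * z = z * diagm n \<delta>"
 proof -
  have "z * ((diagm n \<delta> * y) * z) = z * ((y * diagm n \<delta>) * z)" unfolding dy ..
  then show ?thesis using y by (simp add: z_def)
 qed
 have lz: "z = diagm n lam * (z * diagm n lam)"
 proof -
  have dl: "diagm n lam \<in> GLm n" using l0 by (simp add: diag_GLm_iff)
  have "z = minv (diagm n lam * (y * diagm n lam))" unfolding ldy z_def ..
  also have "\<dots> = minv (diagm n lam) * (z * minv (diagm n lam))"
   using y dl by (simp add: minv_mult[of _ n] z_def)
  finally have "diagm n lam * (z * diagm n lam)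
   = diagm n lam * ((minv (diagm n lam) * (z * minv (diagm n lam))) * diagm n lam)" by simp
  then show ?thesis using dl z by simp
 qed
 have zl: "lam i * lam j = 1" if ij: "i < n" "j < n" "z $$ (i, j) \<noteq> 0" for i j
 proof -
  have "z $$ (i, j) = (diagm n lam * (z * diagm n lam)) $$ (i, j)" using lz by simp
  then have "z $$ (i, j) = lam i * (z $$ (i, j) * lam j)"
   using ij z by (simp add: diagm_mult_left[of _ n n] diagm_mult_right[of _ n n])
  then show ?thesis using ij(3) by (simp add: mult.left_commute)
 qed
 define \<nu> where "\<nu> i = lam i - inverse (lam i)" for i
 \<comment> \<open>the projection to the eigenspace of \<open>- 1\<close>\<close>
 define \<epsilon> where "\<epsilon> i = (if lam i = - 1 then 1 else (0::'k))" for i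
 define D where "D = diagm n \<nu> + diagm n \<epsilon> * z"
 have Dc: "D \<in> carrier_mat n n" using z by (simp add: D_def)
 have nu: "\<nu> i * y $$ (i, j) = - (y $$ (i, j) * \<nu> j)" if ij: "i < n" "j < n" for i j
 proof (cases "y $$ (i, j) = 0")
  case False
  then have "inverse (lam i) = lam j" "inverse (lam j) = lam i" using ll[OF ij] l0 ij
   by (simp_all add: inverse_unique mult.commute)
  then show ?thesis by (simp add: \<nu>_def algebra_simps)
 qed simp
 have ee: "\<epsilon> i = \<epsilon> j" if ij: "i < n" "j < n" "y $$ (i, j) \<noteq> 0" for i j
 proof -
  have "lam i = - 1 \<longleftrightarrow> lam j = - 1" using ll[OF ij] by (metis minus_equation_iff mult_minus1 mult_minus1_right)
  then show ?thesis by (simp add: \<epsilon>_def)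
 qed
 have ey: "diagm n \<epsilon> * y = y * diagm n \<epsilon>"
 proof (rule eq_matI)
  fix i j assume "i < dim_row (y * diagm n \<epsilon>)" "j < dim_col (y * diagm n \<epsilon>)"
  then have ij: "i < n" "j < n" using y by auto
  then show "(diagm n \<epsilon> * y) $$ (i, j) = (y * diagm n \<epsilon>) $$ (i, j)"
   using y ee[OF ij] by (cases "y $$ (i, j) = 0") (simp_all add: diagm_mult_left[of _ n n] diagm_mult_right[of _ n n])
 qed (use y in auto)
 have tz: "z\<^sup>T = diagm n (\<lambda>i. inverse (lam i)) * z"
 proof -
  have dl: "diagm n lam \<in> GLm n" using l0 by (simp add: diag_GLm_iff)
  have ml: "minv (diagm n lam) = diagm n (\<lambda>i. inverse (lam i))"
   by (rule minv_unique(2)[of _ n]) (auto simp: diagm_mult l0 intro!: eq_matI)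
  have "z\<^sup>T = minv (y\<^sup>T)" using y by (simp add: z_def minv_transpose)
  also have "\<dots> = minv (diagm n lam) * z" unfolding ty using y dl by (simp add: minv_mult[of _ n] z_def)
  finally show ?thesis unfolding ml .
 qed
 have "D\<^sup>T * y = (- 1) \<cdot>\<^sub>m (y * D)"
 proof -
  have e1: "(diagm n \<epsilon> * z)\<^sup>T * y = diagm n (\<lambda>i. - \<epsilon> i)"
  proof -
   have "(diagm n \<epsilon> * z)\<^sup>T * y = z\<^sup>T * (diagm n \<epsilon> * y)"
    using y z by (simp add: mtranspose_mult)
   also have "\<dots> = diagm n (\<lambda>i. inverse (lam i)) * (z * (y * diagm n \<epsilon>))" unfolding tz ey using y z by simp
   also have "\<dots> = diagm n (\<lambda>i. inverse (lam i)) * diagm n \<epsilon>" using y by (simp add: z_def)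
   also have "\<dots> = diagm n (\<lambda>i. - \<epsilon> i)" unfolding diagm_mult by (rule eq_matI) (auto simp: \<epsilon>_def)
   finally show ?thesis .
  qed
  have e2: "y * (diagm n \<epsilon> * z) = diagm n \<epsilon>"
  proof -
   have "y * (diagm n \<epsilon> * z) = diagm n \<epsilon> * (y * z)" using lift_eq[OF ey, of z] y z by simp
   then show ?thesis using y by (simp add: z_def)
  qed
  have "D\<^sup>T * y = diagm n \<nu> * y + (diagm n \<epsilon> * z)\<^sup>T * y"
   unfolding D_def using y z by (subst transpose_add[of _ n n]) (auto intro!: add_mult_distrib_mat[of _ n n _ _ n])
  moreover have "y * D = y * diagm n \<nu> + y * (diagm n \<epsilon> * z)"
   unfolding D_def using y z by (intro mult_add_distrib_mat[of _ n n _ n]) auto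
  ultimately show ?thesis unfolding e1 e2
   by (intro eq_matI) (use y nu in \<open>auto simp: diagm_mult_left[of _ n n] diagm_mult_right[of _ n n]\<close>)
 qed
 have "diagm n \<delta> * D = D * diagm n \<delta>"
 proof -
  have "diagm n \<delta> * D = diagm n \<delta> * diagm n \<nu> + diagm n \<delta> * (diagm n \<epsilon> * z)"
   unfolding D_def using z by (intro mult_add_distrib_mat[of _ n n _ n]) auto
  also have "diagm n \<delta> * (diagm n \<epsilon> * z) = diagm n \<epsilon> * (diagm n \<delta> * z)"
   using lift_eq[of "diagm n \<delta>" "diagm n \<epsilon>" "diagm n \<epsilon>" "diagm n \<delta>" z] z by (simp add: diagm_mult mult.commute)
  also have "\<dots> = (diagm n \<epsilon> * z) * diagm n \<delta>" unfolding dz using z by simp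
  also have "diagm n \<delta> * diagm n \<nu> = diagm n \<nu> * diagm n \<delta>" by (simp add: diagm_mult mult.commute)
  also have "diagm n \<nu> * diagm n \<delta> + (diagm n \<epsilon> * z) * diagm n \<delta> = D * diagm n \<delta>"
   unfolding D_def using z by (intro add_mult_distrib_mat[of _ n n _ _ n, symmetric]) auto
  finally show ?thesis .
 qed
 have DG: "D \<in> GLm n"
 proof (rule inj_mult_vec[OF Dc])
  fix v assume v: "v \<in> carrier_vec n" and 0: "D *\<^sub>v v = 0\<^sub>v n"
  have Dv: "\<nu> i * v $ i + \<epsilon> i * (z *\<^sub>v v) $ i = 0" if i: "i < n" for i
  proof -
   have "(D *\<^sub>v v) $ i = (\<Sum>s<n. D $$ (i, s) * v $ s)" using Dc v i by (intro mult_mat_vec_index)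
   also have "\<dots> = (\<Sum>s<n. (if s = i then \<nu> i * v $ i else 0) + \<epsilon> i * (z $$ (i, s) * v $ s))"
    using i z by (intro sum.cong) (auto simp: D_def diagm_mult_left[of _ n n] algebra_simps)
   also have "\<dots> = \<nu> i * v $ i + \<epsilon> i * (\<Sum>s<n. z $$ (i, s) * v $ s)"
    using i by (simp add: sum.distrib sum_distrib_left)
   also have "(\<Sum>s<n. z $$ (i, s) * v $ s) = (z *\<^sub>v v) $ i"
    using z v i by (intro mult_mat_vec_index[symmetric, of _ n n]) auto
   finally show ?thesis using 0 i by simp
  qed
  have v0: "v $ i = 0" if i: "i < n" "lam i \<noteq> - 1" for i
  proof -
   have "\<nu> i \<noteq> 0"
   proof
    assume "\<nu> i = 0"
    then have "lam i = inverse (lam i)" by (simp add: \<nu>_def)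
    then have "lam i * lam i = 1" using l0[OF i(1)] by (metis right_inverse)
    then have "lam i ^ 2 = 1" by (simp add: power2_eq_square)
    then show False using l1[OF i(1)] i(2) by (auto simp: power2_eq_1_iff)
   qed
   then show ?thesis using Dv[OF i(1)] i(2) by (simp add: \<epsilon>_def)
  qed
  have "z *\<^sub>v v = 0\<^sub>v n"
  proof (rule eq_vecI)
   fix i assume "i < dim_vec (0\<^sub>v n)"
   then have i: "i < n" by simp
   show "(z *\<^sub>v v) $ i = 0\<^sub>v n $ i"
   proof (cases "lam i = - 1")
    case True
    then have "\<nu> i = 0" by (simp add: \<nu>_def)
    then show ?thesis using Dv[OF i] i True by (simp add: \<epsilon>_def)
   next
    case False
    have "(z *\<^sub>v v) $ i = (\<Sum>s<n. z $$ (i, s) * v $ s)"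
     using z v i by (intro mult_mat_vec_index[of _ n n]) auto
    also have "\<dots> = 0"
    proof (rule sum.neutral, rule ballI)
     fix s assume "s \<in> {..<n}"
     then have s: "s < n" by simp
     show "z $$ (i, s) * v $ s = 0"
     proof (cases "z $$ (i, s) = 0")
      case F: False
      have "lam s \<noteq> - 1"
      proof
       assume "lam s = - 1"
       then have "- lam i = 1" using zl[OF i s F] by simp
       then show False using False by (metis minus_minus)
      qed
      then show ?thesis using v0 s by simp
     qed simp
    qed
    finally show ?thesis using i by simp
   qed
  qed (use z in auto)
  then have "minv z *\<^sub>v (z *\<^sub>v v) = minv z *\<^sub>v 0\<^sub>v n" by simp
  moreover have "minv z *\<^sub>v 0\<^sub>v n = 0\<^sub>v n" using z by (intro eq_vecI) auto
  ultimately show "v = 0\<^sub>v n" using z v by (simp add: mult_vec_minv[of z n])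
 qed
 define B where "B = P * D * minv P"
 have BG: "B \<in> GLm n" using P DG by (simp add: B_def)
 have BP: "B * P = P * D" using P(1) Dc by (simp add: B_def)
 have "B\<^sup>T * x = (- 1) \<cdot>\<^sub>m (x * B)"
  using adjoint_transport[OF x P(1) _ _ Dc Dc BP BP, of "- 1"] BG \<open>D\<^sup>T * y = (- 1) \<cdot>\<^sub>m (y * D)\<close>
  by (simp add: y_def)
 moreover have "d * B = B * d"
 proof -
  have "d * B = P * (diagm n \<delta> * D) * minv P"
   unfolding diag_eq_conj[OF P(1,3) GLm_carrier[OF d(1)] diagm_carrier] B_def using P(1) Dc by simp
  also have "\<dots> = B * d"
   unfolding \<open>diagm n \<delta> * D = D * diagm n \<delta>\<close> diag_eq_conj[OF P(1,3) GLm_carrier[OF d(1)] diagm_carrier] B_def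
   using P(1) Dc by simp
  finally show ?thesis .
 qed
 ultimately show ?thesis using BG by blast
qed

text \<open>The linear conditions on \<open>B\<close> have rational coefficients, so there is a rational invertible
 solution; an odd power of it, by the full power of \<open>p\<close> in its order, is semisimple and still
 has adjoint its negative.\<close>

lemma ex_skew:
 assumes n: "n < q" and x: "x \<in> GLm n" "rat x" and A: "ss (asymmetry x)" and one: "1 \<notin># eigs (asymmetry x)"
  and d: "d \<in> GLm n" "rat d" "ss d" "d\<^sup>T * x = x * d" and comm: "asymmetry x * d = d * asymmetry x"
 shows "\<exists>B\<in>GLm n. rat B \<and> ss B \<and> B\<^sup>T * x = (- 1) \<cdot>\<^sub>m (x * B) \<and> B * d = d * B"
proof -
 obtain B0 where B0: "B0 \<in> GLm n" "B0\<^sup>T * x = (- 1) \<cdot>\<^sub>m (x * B0)" "d * B0 = B0 * d"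
  using ex_skew_k[OF x(1) A one d(1,3,4) comm] by blast
 obtain B where B: "B \<in> GLm n" "rat B" "B\<^sup>T * x = (- 1) \<cdot>\<^sub>m (x * B)" "d * B = B * d"
  using rational_skew[OF n x d(1,2) B0] by blast
 obtain N where N: "N > 0" "B ^\<^sub>m N = 1\<^sub>m n" using finite_order[OF B(1)] by blast
 have "p \<noteq> 1" using prime_p by auto
 then obtain N' where N': "N = p ^ multiplicity p N * N'" "\<not> p dvd N'"
  using multiplicity_decompose'[of N p] N(1) by auto
 define a where "a = p ^ multiplicity p N"
 have Bc: "B \<in> carrier_mat n n" using B by simp
 have "(B ^\<^sub>m a) ^\<^sub>m N' = 1\<^sub>m n" using N(2) pow_mat_pow[OF Bc, of a N'] N'(1) by (simp add: a_def)
 moreover have "N' > 0" using N'(2) by (cases N') auto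
 ultimately have "ss (B ^\<^sub>m a)" using ss_of_order[of "B ^\<^sub>m a" n N'] B(1) coprime_p[OF N'(2)] by simp
 moreover have "(B ^\<^sub>m a)\<^sup>T * x = (- 1) \<cdot>\<^sub>m (x * B ^\<^sub>m a)"
 proof -
  have "odd a" using odd_p by (simp add: a_def)
  then show ?thesis using adjoint_pow[OF _ Bc B(3), of a] x(1) by simp
 qed
 moreover have "B ^\<^sub>m a * d = d * B ^\<^sub>m a" by (rule commute_pow[OF Bc]) (use d B in auto)
 moreover have "rat (B ^\<^sub>m a)" using B(2) Bc by (rule rat_pow)
 ultimately show ?thesis using B(1) by (intro bexI[of _ "B ^\<^sub>m a"]) auto
qed

text \<open>Being conjugate over the algebraic closure, the asymmetries are conjugate over the finite field,
 so they may be assumed equal. Then the forms differ by a semisimple self-adjoint matrix, which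
 is a norm.\<close>

lemma fq_no_one:
 assumes n: "n < q" and x: "x \<in> GLm n" "rat x" and x': "x' \<in> GLm n" "rat x'"
  and A: "ss (asymmetry x)" and one: "1 \<notin># eigs (asymmetry x)" and cg: "cg n False x x'"
 shows "cg n True x x'"
proof -
 obtain h0 where h0: "h0 \<in> GLm n" "x' = act h0 x" using cg unfolding cg_def by blast
 have "asymmetry x * h0 = h0 * asymmetry x'" unfolding h0(2) using asym_act[OF x(1) h0(1)] h0(1) x(1) by simp
 then obtain h1 where h1: "h1 \<in> GLm n" "rat h1" "asymmetry x * h1 = h1 * asymmetry x'"
  using rational_intertwiner[OF n, of "asymmetry x" "asymmetry x'" h0] rat_asym[OF x(2,1)] rat_asym[OF x'(2,1)] h0(1) x(1) x'(1) by auto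
 define x1 where "x1 = act (minv h1) x'"
 have x1: "x1 \<in> GLm n" "cg n True x' x1" using x' h1 rat_minv[of h1 n] by (auto simp: x1_def cg_def)
 have x1r: "rat x1" using cg_rat x1 x' by blast
 have "asymmetry x1 = h1 * (asymmetry x' * minv h1)" unfolding x1_def using asym_act[OF x'(1), of "minv h1"] h1(1) by simp
 also have "\<dots> = (h1 * asymmetry x') * minv h1" using h1(1) x'(1) by simp
 also have "\<dots> = asymmetry x" unfolding h1(3)[symmetric] using h1(1) x(1) by simp
 finally have eq1: "asymmetry x = asymmetry x1" ..
 note sa = same_asym[OF x(1) x1(1) eq1]
 obtain g d where gd: "g \<in> GLm n" "d \<in> GLm n" "act g x1 = x * d" "ss d" "d\<^sup>T * x = x * d"
  "rat g \<and> rat d" "asymmetry x * d = d * asymmetry x"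
  by (rule two_power[OF x(1) x1(1) sa(1)]) (use x(2) x1r sa(2) GLm_carrier[OF asym_GLm[OF x(1)]] in blast)
 obtain B where B: "B \<in> GLm n" "rat B" "ss B" "B\<^sup>T * x = (- 1) \<cdot>\<^sub>m (x * B)" "B * d = d * B"
  using ex_skew[OF n x A one gd(2) _ gd(4,5,7)] gd(6) by blast
 obtain h where h: "h \<in> GLm n" "rat h" "h\<^sup>T * x * h = x * d"
  using norm_surj[OF n x B(1-3) gd(2) _ gd(4) B(4) gd(5) B(5)] gd(6) by blast
 have "act h x = x * d" using h(3) h(1) x(1) by (simp add: act_def)
 then have "cg n True x (x * d)" unfolding cg_def using h by metis
 moreover have "cg n True x1 (x * d)" unfolding cg_def using gd by metis
 ultimately show ?thesis using cg_trans cg_sym x1 x(1) x'(1) by blast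
qed

end

section \<open>Splitting off a symmetric line\<close>

text \<open>The orthogonal sum of the form of rank one with value \<open>a\<close> and the form \<open>X\<close>.\<close>

definition bl :: "nat \<Rightarrow> 'a::zero \<Rightarrow> 'a mat \<Rightarrow> 'a mat" where
 "bl n a X = four_block_mat (mat 1 1 (\<lambda>_. a)) (0\<^sub>m 1 n) (0\<^sub>m n 1) X"

lemma bl_carrier[simp]: "X \<in> carrier_mat n n \<Longrightarrow> bl n a X \<in> carrier_mat (Suc n) (Suc n)"
 unfolding bl_def by (metis four_block_carrier_mat mat_carrier plus_1_eq_Suc)

lemma bl_dims: assumes "X \<in> carrier_mat n n" shows "dim_row (bl n a X) = Suc n" "dim_col (bl n a X) = Suc n"
 using bl_carrier[OF assms, of a] by (auto dest: carrier_matD)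

lemma bl_index: "X \<in> carrier_mat n n \<Longrightarrow> i < Suc n \<Longrightarrow> j < Suc n \<Longrightarrow>
 bl n a X $$ (i, j) = (if i = 0 then if j = 0 then a else 0 else if j = 0 then 0 else X $$ (i - 1, j - 1))"
 unfolding bl_def by (subst index_mat_four_block) auto

lemma bl_mult: assumes "X \<in> carrier_mat n n" "Y \<in> carrier_mat n n"
 shows "bl n a X * bl n b Y = bl n (a * b) (X * (Y :: 'a::comm_ring_1 mat))"
proof -
 have m: "mat 1 1 (\<lambda>_. a) * mat 1 1 (\<lambda>_. b) = (mat 1 1 (\<lambda>_. a * b) :: 'a mat)"
  by (rule eq_matI) (auto simp: mult_mat_index[of _ 1 1 _ 1] One_nat_def)
 show ?thesis unfolding bl_def
  by (subst mult_four_block_mat[of _ 1 1 _ n _ n _ _ 1 _ n]) (use assms m in auto)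
qed

lemma bl_transpose: "X \<in> carrier_mat n n \<Longrightarrow> (bl n a X)\<^sup>T = bl n a (X\<^sup>T)"
 by (rule eq_matI) (auto simp: bl_index bl_dims)

lemma bl_one: "bl n 1 (1\<^sub>m n) = 1\<^sub>m (Suc n)"
 by (rule eq_matI) (auto simp: bl_index bl_dims)

lemma bl_det: assumes "X \<in> carrier_mat n n" shows "det (bl n a X) = a * det (X :: 'a::idom mat)"
proof -
 have "det (bl n a X) = det (mat 1 1 (\<lambda>_. a)) * det X" unfolding bl_def
  by (rule det_four_block_mat_lower_left_zero) (use assms in auto)
 also have "det (mat 1 1 (\<lambda>_. a)) = a" by (subst det_single) auto
 finally show ?thesis .
qed

lemma bl_GLm: assumes "X \<in> carrier_mat n n" shows "bl n a X \<in> GLm (Suc n) \<longleftrightarrow> a \<noteq> 0 \<and> X \<in> GLm n"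
 using bl_det[OF assms, of a] bl_carrier[OF assms, of a] assms GLmI GLm_det by (metis mult_eq_0_iff)

lemma bl_inj: assumes "X \<in> carrier_mat n n" "Y \<in> carrier_mat n n" "bl n a X = bl n b Y" shows "a = b" "X = Y"
proof -
 have e: "bl n a X $$ (i, j) = bl n b Y $$ (i, j)" for i j using assms(3) by simp
 show "a = b" using e[of 0 0] bl_index[OF assms(1), of 0 0 a] bl_index[OF assms(2), of 0 0 b] by simp
 show "X = Y"
 proof (rule eq_matI)
  fix i j assume "i < dim_row Y" "j < dim_col Y"
  then show "X $$ (i, j) = Y $$ (i, j)" using e[of "Suc i" "Suc j"] assms(1,2)
    bl_index[OF assms(1), of "Suc i" "Suc j" a] bl_index[OF assms(2), of "Suc i" "Suc j" b] by simp
 qed (use assms in auto)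
qed

lemma bl_minv: assumes "X \<in> GLm n" "a \<noteq> 0" shows "minv (bl n a X) = bl n (1 / a) (minv (X :: 'a::field mat))"
 by (rule minv_unique(2)[of _ "Suc n"]) (use assms in \<open>simp_all add: bl_mult bl_one\<close>)

lemma bl_asym: assumes "X \<in> GLm n" "a \<noteq> 0" shows "asymmetry (bl n a X) = bl n 1 (asymmetry (X :: 'a::field mat))"
 unfolding asymmetry_def bl_minv[OF assms] bl_transpose[OF GLm_carrier[OF assms(1)]]
 using assms by (simp add: bl_mult)

lemma bl_act: assumes "X \<in> GLm n" "Y \<in> GLm n"
 shows "act (bl n b Y) (bl n a X) = bl n (b * (a * b)) (act Y (X :: 'a::field mat))"
 unfolding act_def using assms by (simp add: bl_transpose bl_mult)

lemma bl_pow: assumes "X \<in> carrier_mat n n" shows "bl n a X ^\<^sub>m i = bl n (a ^ i) (X ^\<^sub>m i :: 'a::comm_ring_1 mat)"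
proof (induction i)
 case 0 then show ?case using assms by (simp add: bl_one bl_dims)
next
 case (Suc i) then show ?case using assms by (simp add: bl_mult mult.commute)
qed

lemma act_index: assumes "x \<in> carrier_mat n n" "h \<in> carrier_mat n n" "i < n" "j < n"
 shows "act h x $$ (i, j) = col h i \<bullet> (x *\<^sub>v col h j)"
proof -
 have "act h x $$ (i, j) = row (h\<^sup>T) i \<bullet> col (x * h) j"
  unfolding act_def using assms by (subst index_mult_mat(1)) auto
 also have "col (x * h) j = x *\<^sub>v col h j" using assms by (intro col_mult2[of _ n n _ n]) auto
 finally show ?thesis using assms by simp
qed

lemma bilinear_transpose: assumes "x \<in> carrier_mat n n" "v \<in> carrier_vec n" "w \<in> carrier_vec n"
 shows "v \<bullet> (x *\<^sub>v w) = (x\<^sup>T *\<^sub>v v) \<bullet> (w :: 'a::comm_ring_1 vec)"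
 using transpose_vec_mult_scalar[OF assms(1,3,2)] assms
 by (metis mult_mat_vec_carrier comm_scalar_prod transpose_carrier_mat)

text \<open>For \<open>A\<close> with \<open>A ^ (k + 1) = A\<close> and \<open>k = - 1\<close> in the field, the sum of the first \<open>k\<close> powers is,
 up to sign, the projection to the fixed vectors of \<open>A\<close>; it has the advantage of being rational
 with \<open>A\<close>.\<close>

primrec power_sum :: "'a::semiring_1 mat \<Rightarrow> nat \<Rightarrow> 'a mat" where
 "power_sum A 0 = 0\<^sub>m (dim_row A) (dim_row A)"
| "power_sum A (Suc k) = power_sum A k + A ^\<^sub>m Suc k"

lemma power_sum_carrier[simp]: "A \<in> carrier_mat n n \<Longrightarrow> power_sum A k \<in> carrier_mat n n"
 by (induction k) auto

lemma power_sum_shift: assumes A: "A \<in> carrier_mat n n"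
 shows "A * power_sum A k + A = power_sum A k + (A ^\<^sub>m Suc k :: 'a::ring_1 mat)"
proof (induction k)
 case 0 then show ?case using A by simp
next
 case (Suc k)
 note c = power_sum_carrier[OF A, of k] pow_carrier_mat[OF A, of "Suc k"] A
 have "A * power_sum A (Suc k) + A = (A * power_sum A k + A * A ^\<^sub>m Suc k) + A"
  using c by (simp add: mult_add_distrib_mat[of _ n n _ n])
 also have "\<dots> = (A * power_sum A k + A) + A * A ^\<^sub>m Suc k"
  using c by (intro eq_matI) (auto simp: algebra_simps)
 also have "\<dots> = power_sum A (Suc k) + A ^\<^sub>m Suc (Suc k)"
  unfolding Suc using commute_pow[OF A A refl, of "Suc k"] by simp
 finally show ?case .
qed

lemma power_sum_absorb: assumes A: "A \<in> carrier_mat n n" and M: "M \<in> carrier_mat n n" "M * A = M"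
 shows "M * power_sum A k = of_nat k \<cdot>\<^sub>m (M :: 'a::comm_ring_1 mat)"
proof (induction k)
 case 0 show ?case using A M by (intro eq_matI) (auto simp: power_sum.simps)
next
 case (Suc k)
 have p: "M * A ^\<^sub>m i = M" for i
 proof (induction i)
  case (Suc i)
  have "M * A ^\<^sub>m Suc i = (M * A ^\<^sub>m i) * A" using A M(1) by simp
  then show ?case using Suc M by simp
 qed (use A M in simp)
 have "M * power_sum A (Suc k) = M * power_sum A k + M * A ^\<^sub>m Suc k"
  using A M(1) by (simp only: power_sum.simps) (intro mult_add_distrib_mat[of _ n n _ n], auto)
 also have "\<dots> = of_nat (Suc k) \<cdot>\<^sub>m M" unfolding Suc p by (rule eq_matI) (auto simp: algebra_simps)
 finally show ?case .
qed

context frob_closure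
begin

lemma bl_Fr: "X \<in> carrier_mat n n \<Longrightarrow> Fr m (bl n a X) = bl n (a ^ (q ^ m)) (Fr m X)"
 by (rule eq_matI) (use q_pow_pos[of m] in \<open>auto simp: bl_index bl_dims\<close>)

lemma bl_rat: "X \<in> carrier_mat n n \<Longrightarrow> rat (bl n a X) \<longleftrightarrow> a \<in> Fq \<and> rat X"
 using bl_Fr[of X n 1 a] bl_inj[of "Fr 1 X" n X "a ^ q" a] by auto

lemma bl_ss: assumes "X \<in> carrier_mat n n" shows "ss (bl n 1 X) \<longleftrightarrow> ss X"
 unfolding ss_def bl_pow[OF assms] using bl_inj(2)[of _ n X 1 1] assms pow_carrier_mat by auto

lemma bl_eigs: assumes "X \<in> carrier_mat n n" shows "eigs (bl n a X) = add_mset a (eigs X)"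
proof -
 have "char_poly (bl n a X) = char_poly (mat 1 1 (\<lambda>_. a)) * char_poly X"
  unfolding bl_def by (rule char_poly_four_block_zeros_col[of _ _ n]) (use assms in auto)
 also have "char_poly (mat 1 1 (\<lambda>_. a)) = [:- a, 1:]"
  by (subst char_poly_upper_triangular[of _ 1]) (auto simp: diag_mat_def upper_triangular_def One_nat_def)
 moreover have "char_poly X \<noteq> 0" using degree_monic_char_poly[OF assms] by auto
 ultimately show ?thesis unfolding eigs_def by (simp add: proots_mult del: mult_pCons_left)
qed

text \<open>A fixed vector \<open>v\<close> of the asymmetry satisfies \<open>x(v, w) = x(w, v)\<close> for all \<open>w\<close>. So left and right
 orthogonal complement of \<open>v\<close> agree, and if \<open>x(v, v)\<close> is nonzero, the space is the orthogonal
 sum of the line of \<open>v\<close> and this complement.\<close>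

lemma split_off:
 assumes x: "x \<in> GLm (Suc n)" "rat x" and v: "v \<in> carrier_vec (Suc n)" "\<And>i. i < Suc n \<Longrightarrow> v $ i \<in> Fq"
  "asymmetry x *\<^sub>v v = v" and b: "b = v \<bullet> (x *\<^sub>v v)" "b \<noteq> 0"
 shows "\<exists>x1. x1 \<in> GLm n \<and> rat x1 \<and> cg (Suc n) True x (bl n b x1)"
proof -
 let ?N = "Suc n"
 have xc: "x \<in> carrier_mat ?N ?N" using x by simp
 have "v \<noteq> 0\<^sub>v ?N" using b xc v by auto
 then obtain i0 where i0: "i0 < ?N" "v $ i0 \<noteq> 0" using v(1) by (metis eq_vecI carrier_vecD index_zero_vec)
 obtain E where E: "E \<in> GLm ?N" "col E 0 = v" "\<And>r s. r < ?N \<Longrightarrow> s < ?N \<Longrightarrow> E $$ (r, s) \<in> {0, 1} \<union> set\<^sub>v v"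
  by (rule extend_to_invertible[OF v(1) i0(1) le0 i0(2)]) blast
 have rE: "rat E" unfolding rat_iff[OF GLm_carrier[OF E(1)]]
 proof (intro allI impI)
  fix r s assume "r < ?N" "s < ?N"
  then have "E $$ (r, s) \<in> {0, 1} \<union> set\<^sub>v v" by (rule E(3))
  then have "E $$ (r, s) = 0 \<or> E $$ (r, s) = 1 \<or> (\<exists>i<?N. E $$ (r, s) = v $ i)"
   using v(1) by (auto elim!: vec_setE)
  then show "E $$ (r, s) \<in> Fq"
  proof (elim disjE exE conjE)
   fix i assume "i < ?N" "E $$ (r, s) = v $ i"
   then show ?thesis using v(2)[of i] by simp
  qed (use q_gt_1 in auto)
 qed
 define c where "c j = (v \<bullet> (x *\<^sub>v col E j)) / b" for j
 define S where "S = mat ?N ?N (\<lambda>(i, j). if i = j then 1 else if i = 0 then - c j else 0)"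
 have Sc: "S \<in> carrier_mat ?N ?N" by (simp add: S_def)
 have cF: "c j \<in> Fq" if j: "j < ?N" for j
 proof -
  have "act E x $$ (0, j) \<in> Fq" using rat_iff[of "act E x" ?N ?N] rat_act[OF x(2) rE x(1) E(1)] x E j by simp
  moreover have "act E x $$ (0, 0) \<in> Fq" using rat_iff[of "act E x" ?N ?N] rat_act[OF x(2) rE x(1) E(1)] x E by simp
  ultimately have "v \<bullet> (x *\<^sub>v col E j) \<in> Fq" "b \<in> Fq"
   using act_index[OF xc GLm_carrier[OF E(1)], of 0] j E(2) b(1) by auto
  then show ?thesis by (simp add: c_def power_divide)
 qed
 have rS: "rat S" unfolding rat_iff[OF Sc] using cF Fq_closed(4,5) odd_q by (auto simp: S_def)
 have "det S = prod_list (diag_mat S)" by (rule det_upper_triangular[OF _ Sc]) (auto simp: S_def)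
 also have "diag_mat S = map (\<lambda>_. 1) [0..<?N]" unfolding diag_mat_def by (rule map_cong) (auto simp: S_def)
 finally have "det S = 1" by (simp add: map_replicate_const)
 then have SG: "S \<in> GLm ?N" using Sc by (intro GLmI) auto
 define h where "h = E * S"
 have h: "h \<in> GLm ?N" "rat h" using E(1) SG rE rS by (auto simp: h_def intro!: rat_mult)
 have colh: "col h j = (if j = 0 then v else col E j + (- c j) \<cdot>\<^sub>v v)" if j: "j < ?N" for j
 proof (rule eq_vecI)
  fix r assume "r < dim_vec (if j = 0 then v else col E j + (- c j) \<cdot>\<^sub>v v)"
  then have r: "r < ?N" using v(1) E(1) by (auto split: if_splits)
  have "col h j $ r = (\<Sum>s<?N. E $$ (r, s) * S $$ (s, j))"
   using r j E(1) Sc unfolding h_def by (simp add: mult_mat_index[of _ ?N ?N _ ?N] del: sum.lessThan_Suc)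
  also have "\<dots> = (\<Sum>s<?N. (if s = j then E $$ (r, j) else 0) + (if s = 0 then (if j = 0 then 0 else - c j * E $$ (r, 0)) else 0))"
   using j by (intro sum.cong) (auto simp: S_def)
  also have "\<dots> = E $$ (r, j) + (if j = 0 then 0 else - c j * E $$ (r, 0))"
   using j by (simp add: sum.distrib del: sum.lessThan_Suc)
  also have "\<dots> = (if j = 0 then v else col E j + (- c j) \<cdot>\<^sub>v v) $ r"
  proof -
   have "E $$ (r, 0) = v $ r" using r E(1) unfolding E(2)[symmetric] by simp
   then show ?thesis using r j E(1) v(1) by simp
  qed
  finally show "col h j $ r = (if j = 0 then v else col E j + (- c j) \<cdot>\<^sub>v v) $ r" .
 qed (use j v(1) E(1) h(1) in auto)
 have xtv: "x\<^sup>T *\<^sub>v v = x *\<^sub>v v"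
  unfolding transpose_asym[OF x(1), symmetric] using x v by simp
 have left: "v \<bullet> (x *\<^sub>v u) = u \<bullet> (x *\<^sub>v v)" if u: "u \<in> carrier_vec ?N" for u
  using bilinear_transpose[OF xc v(1) u] xtv u xc v by (simp add: comm_scalar_prod[of _ ?N])
 have ch: "col h j \<in> carrier_vec ?N" for j using h(1) by (intro carrier_vecI) simp
 have zero: "v \<bullet> (x *\<^sub>v col h j) = 0" if j: "j < ?N" "j \<noteq> 0" for j
 proof -
  have cE: "col E j \<in> carrier_vec ?N" using E(1) by (intro carrier_vecI) simp
  have "x *\<^sub>v col h j = x *\<^sub>v col E j + (- c j) \<cdot>\<^sub>v (x *\<^sub>v v)"
   unfolding colh[OF j(1)] using j(2) xc cE v(1) by (simp add: mult_add_distrib_mat_vec[of _ ?N ?N] mult_mat_vec[of _ ?N ?N])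
  then have "v \<bullet> (x *\<^sub>v col h j) = v \<bullet> (x *\<^sub>v col E j) + v \<bullet> ((- c j) \<cdot>\<^sub>v (x *\<^sub>v v))"
   using xc cE v(1) by (simp add: scalar_prod_add_distrib[of _ ?N])
  also have "v \<bullet> ((- c j) \<cdot>\<^sub>v (x *\<^sub>v v)) = - c j * b" unfolding b(1) using v(1) xc
   by (subst scalar_prod_smult_distrib[of _ ?N]) auto
  finally show ?thesis using b(2) by (simp add: c_def)
 qed
 define x1 where "x1 = mat n n (\<lambda>(i, j). act h x $$ (Suc i, Suc j))"
 have x1c: "x1 \<in> carrier_mat n n" by (simp add: x1_def)
 have eq: "act h x = bl n b x1"
 proof (rule eq_matI)
  fix i j assume "i < dim_row (bl n b x1)" "j < dim_col (bl n b x1)"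
  then have ij: "i < ?N" "j < ?N" using bl_dims[OF x1c] by auto
  have ai: "act h x $$ (i, j) = col h i \<bullet> (x *\<^sub>v col h j)" by (rule act_index[OF xc GLm_carrier[OF h(1)] ij])
  show "act h x $$ (i, j) = bl n b x1 $$ (i, j)"
  proof (cases "i = 0")
   case True
   then show ?thesis using ai zero[OF ij(2)] colh[of 0] bl_index[OF x1c ij] b(1) by (cases "j = 0") auto
  next
   case False
   show ?thesis
   proof (cases "j = 0")
    case True
    then have "act h x $$ (i, j) = v \<bullet> (x *\<^sub>v col h i)" using ai colh[of 0] left[OF ch] by simp
    then show ?thesis using zero[OF ij(1) False] bl_index[OF x1c ij] False True by simp
   next
    case F: False
    then show ?thesis using False bl_index[OF x1c ij] ij by (simp add: x1_def)
   qed
  qed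
 qed (use h x1c bl_dims[OF x1c] in \<open>auto simp: act_def\<close>)
 have G: "act h x \<in> GLm ?N" "rat (act h x)" using x h rat_act by auto
 then have "x1 \<in> GLm n" "rat x1" unfolding eq using bl_GLm[OF x1c] bl_rat[OF x1c] by auto
 moreover have "cg ?N True x (bl n b x1)" unfolding cg_def eq[symmetric] using h by blast
 ultimately show ?thesis by blast
qed

text \<open>The columns of the projection to the fixed space of the asymmetry span it and are rational. The
 restriction of \<open>x\<close> to this space is symmetric and nonzero, and in odd characteristic such a
 form takes a nonzero value at a member of a spanning set or at a sum of two.\<close>

lemma ex_fixed_vec:
 assumes x: "x \<in> GLm n" "rat x" and A: "ss (asymmetry x)" and one: "1 \<in># eigs (asymmetry x)"
 shows "\<exists>v\<in>carrier_vec n. (\<forall>i<n. v $ i \<in> Fq) \<and> asymmetry x *\<^sub>v v = v \<and> v \<bullet> (x *\<^sub>v v) \<noteq> 0"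
proof -
 define A where "A = asymmetry x"
 have Ac: "A \<in> carrier_mat n n" using x by (simp add: A_def)
 have xc: "x \<in> carrier_mat n n" using x by simp
 obtain m where m: "m > 0" "A ^\<^sub>m (q ^ m) = A" using A unfolding ss_def A_def by blast
 define k where "k = q ^ m - 1"
 have Qk: "q ^ m = Suc k" using q_pow_pos[of m] by (simp add: k_def)
 have ofk: "(of_nat k :: 'k) = - 1"
 proof -
  have "(of_nat (q ^ m) :: 'k) = 0" using of_nat_q m(1) by blast
  then show ?thesis unfolding Qk by (simp add: eq_neg_iff_add_eq_0 add.commute)
 qed
 define E where "E = power_sum A k"
 have Ec: "E \<in> carrier_mat n n" using Ac by (simp add: E_def)
 have AE: "A * E = E"
 proof -
  have e: "A * E + A = E + A" using power_sum_shift[OF Ac, of k] m(2) unfolding E_def Qk[symmetric] by simp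
  show ?thesis
  proof (rule eq_matI)
   fix i j assume ij: "i < dim_row E" "j < dim_col E"
   have "(A * E + A) $$ (i, j) = (E + A) $$ (i, j)" unfolding e ..
   then show "(A * E) $$ (i, j) = E $$ (i, j)" using ij Ac Ec by simp
  qed (use Ac Ec in auto)
 qed
 have E0: "E \<noteq> 0\<^sub>m n n"
 proof
  assume E0: "E = 0\<^sub>m n n"
  obtain P d where P: "P \<in> GLm n" "A * P = P * diagm n d" using ss_diag[OF Ac] A unfolding A_def by blast
  have "eigs A = mset (map d [0..<n])" by (rule eigs_diag[OF Ac P])
  then obtain j where j: "j < n" "d j = 1" using one unfolding A_def by auto
  \<comment> \<open>an eigenvector for the eigenvalue 1 as the only nonzero column\<close>
  define M where "M = mat n n (\<lambda>(r, s). if s = j then P $$ (r, j) else 0)"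
  have Mc: "M \<in> carrier_mat n n" by (simp add: M_def)
  have "M\<^sup>T * A\<^sup>T = M\<^sup>T"
  proof -
   have "A * M = M"
   proof (rule eq_matI)
    fix r s assume "r < dim_row M" "s < dim_col M"
    then have rs: "r < n" "s < n" using Mc by auto
    have "(A * M) $$ (r, s) = (\<Sum>t<n. A $$ (r, t) * M $$ (t, s))" using rs Ac Mc by (intro mult_mat_index)
    also have "\<dots> = (if s = j then (\<Sum>t<n. A $$ (r, t) * P $$ (t, j)) else 0)"
     using rs by (auto simp: M_def intro!: sum.neutral)
    also have "(\<Sum>t<n. A $$ (r, t) * P $$ (t, j)) = (A * P) $$ (r, j)"
     using rs j Ac P(1) by (intro mult_mat_index[symmetric, of _ n n _ n]) auto
    also have "\<dots> = P $$ (r, j)" unfolding P(2) using rs j P(1) by (simp add: diagm_mult_right[of _ n n])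
    finally show "(A * M) $$ (r, s) = M $$ (r, s)" using rs by (simp add: M_def)
   qed (use Ac Mc in auto)
   then have "(A * M)\<^sup>T = M\<^sup>T" by simp
   moreover have "(A * M)\<^sup>T = M\<^sup>T * A\<^sup>T" using Ac Mc by (intro mtranspose_mult) simp
   ultimately show ?thesis by simp
  qed
  then have "M\<^sup>T * power_sum (A\<^sup>T) k = of_nat k \<cdot>\<^sub>m M\<^sup>T"
   using Ac Mc by (intro power_sum_absorb[of _ n]) auto
  moreover have "power_sum (A\<^sup>T) k = E\<^sup>T"
   unfolding E_def
  proof (induction k)
   case (Suc k)
   then show ?case using Ac pow_mat_transpose[OF Ac, of "Suc k"] by (simp only: power_sum.simps) (subst transpose_add[of _ n n], auto)
  qed (use Ac in simp)
  ultimately have "of_nat k \<cdot>\<^sub>m M\<^sup>T = M\<^sup>T * (0\<^sub>m n n)\<^sup>T" unfolding E0 by simp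
  then have M0: "of_nat k \<cdot>\<^sub>m M\<^sup>T = 0\<^sub>m n n" using Mc by simp
  have "P $$ (r, j) = 0" if r: "r < n" for r
  proof -
   have "(of_nat k \<cdot>\<^sub>m M\<^sup>T) $$ (j, r) = 0" unfolding M0 using r j by simp
   then show ?thesis using r j Mc ofk by (simp add: M_def)
  qed
  then have "col P j = 0\<^sub>v n" using P(1) j by (intro eq_vecI) auto
  then have "P *\<^sub>v unit_vec n j = 0\<^sub>v n" using P(1) j by (simp add: mult_unit_vec)
  then have "minv P *\<^sub>v (P *\<^sub>v unit_vec n j) = minv P *\<^sub>v 0\<^sub>v n" by simp
  moreover have "minv P *\<^sub>v 0\<^sub>v n = 0\<^sub>v n" using P(1) by (intro eq_vecI) auto
  ultimately have "unit_vec n j = (0\<^sub>v n :: 'k vec)" using P(1) j by (simp add: mult_vec_minv[of P n])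
  then show False using j(1) unit_vec_nonzero[of n j] by simp
 qed
 define N where "N = E\<^sup>T * (x * E)"
 have xE: "x\<^sup>T * E = x * E"
 proof -
  have "x * E = x * (A * E)" unfolding AE ..
  also have "\<dots> = (x * A) * E" using xc Ac Ec by simp
  also have "x * A = x\<^sup>T" unfolding A_def by (rule transpose_asym[OF x(1)])
  finally show ?thesis ..
 qed
 have tE: "E\<^sup>T * x = E\<^sup>T * x\<^sup>T"
  using arg_cong[OF xE, of transpose_mat] xc Ec by (simp add: mtranspose_mult)
 have NE: "N = - 1 \<cdot>\<^sub>m (E\<^sup>T * x)"
 proof -
  have "(E\<^sup>T * x) * A = E\<^sup>T * x"
  proof -
   have "(E\<^sup>T * x) * A = E\<^sup>T * (x * A)" using xc Ac Ec by simp
   also have "x * A = x\<^sup>T" unfolding A_def by (rule transpose_asym[OF x(1)])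
   finally show ?thesis unfolding tE .
  qed
  then have "(E\<^sup>T * x) * power_sum A k = of_nat k \<cdot>\<^sub>m (E\<^sup>T * x)"
   by (rule power_sum_absorb[OF Ac, rotated]) (use xc Ec in simp)
  then have "(E\<^sup>T * x) * E = of_nat k \<cdot>\<^sub>m (E\<^sup>T * x)" unfolding E_def[symmetric] .
  then show ?thesis unfolding ofk N_def using xc Ec by simp
 qed
 have Nc: "N \<in> carrier_mat n n" using xc Ec by (simp add: N_def)
 have N0: "N \<noteq> 0\<^sub>m n n"
 proof
  assume "N = 0\<^sub>m n n"
  then have "E\<^sup>T * x = 0\<^sub>m n n" unfolding NE using xc Ec
   by (intro eq_matI) (auto dest!: arg_cong[where f="\<lambda>M. M $$ _"] simp: mat_eq_iff)
  then have "(E\<^sup>T * x) * minv x = 0\<^sub>m n n * minv x" by simp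
  then have "E\<^sup>T = 0\<^sub>m n n" using x Ec by simp
  then have "(E\<^sup>T)\<^sup>T = (0\<^sub>m n n)\<^sup>T" by simp
  then show False using E0 by simp
 qed
 have Nsym: "N\<^sup>T = N"
  unfolding N_def using xc Ec xE by (simp add: mtranspose_mult)
 have Nb: "N $$ (i, j) = col E i \<bullet> (x *\<^sub>v col E j)" if "i < n" "j < n" for i j
  using act_index[OF xc Ec that] unfolding act_def N_def .
 have rE: "rat E"
 proof -
  have "rat (power_sum A l)" for l
  proof (induction l)
   case (Suc l)
   have "rat (power_sum A l + A ^\<^sub>m Suc l)"
    using rat_asym[OF x(2,1)] Ac Suc by (intro rat_add[of _ _ n n] rat_pow[of _ n]) (auto simp: A_def)
   then show ?case by simp
  qed (use Ac Fq_closed(5) in \<open>simp add: rat_iff[of _ n n]\<close>)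
  then show ?thesis by (simp add: E_def)
 qed
 have EF: "E $$ (i, j) \<in> Fq" if "i < n" "j < n" for i j using that rE rat_iff[OF Ec] by blast
 have cE: "col E j \<in> carrier_vec n" for j using Ec by (intro carrier_vecI) simp
 have Ace: "A *\<^sub>v col E j = col E j" if j: "j < n" for j
 proof -
  have "col (A * E) j = A *\<^sub>v col E j" using j Ac Ec by (intro col_mult2[of _ n n _ n]) auto
  then show ?thesis unfolding AE ..
 qed
 show ?thesis
 proof (cases "\<exists>j<n. N $$ (j, j) \<noteq> 0")
  case True
  then obtain j where j: "j < n" "N $$ (j, j) \<noteq> 0" by blast
  show ?thesis using Ace[OF j(1)] cE Nb[OF j(1) j(1)] j EF Ec by (intro bexI[of _ "col E j"]) (auto simp: A_def)
 next
  case False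
  obtain i j where ij: "i < n" "j < n" "N $$ (i, j) \<noteq> 0"
  proof -
   have "\<not> (\<forall>i<n. \<forall>j<n. N $$ (i, j) = 0)"
   proof
    assume "\<forall>i<n. \<forall>j<n. N $$ (i, j) = 0"
    then have "N = 0\<^sub>m n n" using Nc by (intro eq_matI) auto
    then show False using N0 by blast
   qed
   then show ?thesis using that by blast
  qed
  have ji: "N $$ (j, i) = N $$ (i, j)"
  proof -
   have "N\<^sup>T $$ (i, j) = N $$ (i, j)" unfolding Nsym ..
   then show ?thesis using ij Nc by simp
  qed
  define v where "v = col E i + col E j"
  have vc: "v \<in> carrier_vec n" using cE by (simp add: v_def)
  have "A *\<^sub>v v = v" unfolding v_def using Ac cE Ace ij by (simp add: mult_add_distrib_mat_vec[of _ n n])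
  moreover have "v \<bullet> (x *\<^sub>v v) = N $$ (i, i) + N $$ (i, j) + (N $$ (j, i) + N $$ (j, j))"
  proof -
   have xv: "x *\<^sub>v v = x *\<^sub>v col E i + x *\<^sub>v col E j" unfolding v_def using xc cE by (simp add: mult_add_distrib_mat_vec[of _ n n])
   have xcE: "x *\<^sub>v col E l \<in> carrier_vec n" for l using xc by simp
   show ?thesis unfolding xv unfolding v_def Nb[OF ij(1) ij(1)] Nb[OF ij(1,2)] Nb[OF ij(2,1)] Nb[OF ij(2) ij(2)]
    using cE xcE by (simp add: add_scalar_prod_distrib[of _ n] scalar_prod_add_distrib[of _ n] del: mult_mat_vec)
  qed
  moreover have "N $$ (i, i) = 0" "N $$ (j, j) = 0" using False ij by blast+
  ultimately have "v \<bullet> (x *\<^sub>v v) = 2 * N $$ (i, j)" unfolding ji by simp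
  then have "v \<bullet> (x *\<^sub>v v) \<noteq> 0" using ij(3) two_neq_0 by simp
  moreover have "\<forall>l<n. v $ l \<in> Fq"
  proof (intro allI impI)
   fix l assume l: "l < n"
   then have "v $ l = E $$ (l, i) + E $$ (l, j)" using ij Ec by (simp add: v_def)
   then show "v $ l \<in> Fq" using Fq_closed(1)[OF EF[OF l ij(1)] EF[OF l ij(2)]] by simp
  qed
  ultimately show ?thesis using vc \<open>A *\<^sub>v v = v\<close> unfolding A_def by blast
 qed
qed

end

lemma bl_vec: assumes "X \<in> carrier_mat n n" "w \<in> carrier_vec n"
 shows "bl n a X *\<^sub>v vCons s w = vCons (a * s) (X *\<^sub>v (w :: 'a::comm_ring_1 vec))"
proof (rule eq_vecI)
 fix i assume "i < dim_vec (vCons (a * s) (X *\<^sub>v w))"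
 then have i: "i < Suc n" using assms by simp
 have vc: "vCons s w \<in> carrier_vec (Suc n)" using assms by simp
 have "(bl n a X *\<^sub>v vCons s w) $ i = (\<Sum>j<Suc n. bl n a X $$ (i, j) * vCons s w $ j)"
  by (rule mult_mat_vec_index[OF bl_carrier[OF assms(1)] vc i])
 also have "\<dots> = bl n a X $$ (i, 0) * s + (\<Sum>j<n. bl n a X $$ (i, Suc j) * w $ j)"
  unfolding sum.lessThan_Suc_shift using assms(2) by simp
 also have "\<dots> = vCons (a * s) (X *\<^sub>v w) $ i"
 proof (cases i)
  case 0
  then show ?thesis using assms by (simp add: bl_index)
 next
  case (Suc i')
  then have "i' < n" using i by simp
  then have "(X *\<^sub>v w) $ i' = (\<Sum>j<n. X $$ (i', j) * w $ j)" using assms by (intro mult_mat_vec_index)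
  moreover have "(\<Sum>j<n. bl n a X $$ (i, Suc j) * w $ j) = (\<Sum>j<n. X $$ (i', j) * w $ j)"
   using assms Suc \<open>i' < n\<close> by (intro sum.cong) (auto simp: bl_index)
  ultimately show ?thesis using Suc \<open>i' < n\<close> assms by (simp add: bl_index)
 qed
 finally show "(bl n a X *\<^sub>v vCons s w) $ i = vCons (a * s) (X *\<^sub>v w) $ i" .
qed (use assms bl_dims[OF assms(1)] in auto)

section \<open>Multisets stable under inversion\<close>

text \<open>An element other than its own inverse can be removed together with its inverse, as can two
 copies of \<open>1\<close> or of \<open>- 1\<close>; what is left has at most one \<open>1\<close> and one \<open>- 1\<close>.\<close>

lemma inverse_invariant_induct [consumes 2, case_names empty one minus both step]:
 fixes M :: "'a::field multiset"
 assumes "image_mset inverse M = M" "0 \<notin># M"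
  and "P {#}" "P {#1#}" "P {#- 1#}" "P {#1, - 1#}"
  and step: "\<And>x M. x \<noteq> 0 \<Longrightarrow> image_mset inverse M = M \<Longrightarrow> 0 \<notin># M \<Longrightarrow> P M \<Longrightarrow> P (add_mset x (add_mset (inverse x) M))"
 shows "P M"
 using assms(1,2)
proof (induction "size M" arbitrary: M rule: less_induct)
 case less
 have red: "P M" if M: "M = add_mset x (add_mset (inverse x) M')" for x M'
 proof -
  have x: "x \<noteq> 0" using less.prems M by auto
  have "add_mset x (add_mset (inverse x) (image_mset inverse M')) = add_mset x (add_mset (inverse x) M')"
   using less.prems(1) unfolding M by (simp add: add_mset_commute)
  then have "image_mset inverse M' = M'" by simp
  moreover have "0 \<notin># M'" using less.prems(2) M by simp
  moreover have "size M' < size M" unfolding M by simp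
  ultimately have "P M'" using less.hyps by blast
  then show ?thesis unfolding M
   by (intro step[OF x \<open>image_mset inverse M' = M'\<close> \<open>0 \<notin># M'\<close>])
 qed
 show ?case
 proof (cases "\<exists>x\<in>#M. inverse x \<noteq> x")
  case True
  then obtain x where x: "x \<in># M" "inverse x \<noteq> x" by blast
  have "inverse x \<in># image_mset inverse M" using x(1) by simp
  then have "inverse x \<in># M" using less.prems(1) by simp
  then obtain M1 where M1: "M = add_mset x M1" using x(1) by (metis mset_add)
  then have "inverse x \<in># M1" using \<open>inverse x \<in># M\<close> x(2) by simp
  then obtain M2 where "M1 = add_mset (inverse x) M2" by (metis mset_add)
  then show ?thesis using red M1 by simp
 next
  case False
  have pm: "x = 1 \<or> x = - 1" if "x \<in># M" for x
  proof -
   have "inverse x = x" "x \<noteq> 0" using False less.prems(2) that by auto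
   then have "x * x = 1" by (metis right_inverse)
   then have "(x - 1) * (x + 1) = 0" by (simp add: algebra_simps)
   then show ?thesis by (auto simp: eq_neg_iff_add_eq_0)
  qed
  show ?thesis
  proof (cases "\<exists>x. count M x \<ge> 2")
   case True
   then obtain x where x: "count M x \<ge> 2" by blast
   then have xM: "x \<in># M" by (metis count_greater_zero_iff not_numeral_le_zero zero_less_iff_neq_zero)
   then obtain M1 where M1: "M = add_mset x M1" by (metis mset_add)
   then have "x \<in># M1" using x by (simp flip: count_greater_zero_iff)
   then obtain M2 where "M1 = add_mset x M2" by (metis mset_add)
   moreover have "inverse x = x" using False xM by blast
   ultimately show ?thesis using red[of x M2] M1 by simp
  next
   case F: False
   then have c: "count M x \<le> 1" for x using not_less_eq_eq by (metis Suc_1)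
   have "M = mset_set (set_mset M)"
   proof (rule multiset_eqI)
    fix x show "count M x = count (mset_set (set_mset M)) x"
     using c[of x] by (cases "x \<in># M") (auto simp: count_mset_set not_in_iff intro: antisym)
   qed
   moreover have "set_mset M \<subseteq> {1, - 1}" using pm by auto
   then have "set_mset M = {} \<or> set_mset M = {1} \<or> set_mset M = {- 1} \<or> set_mset M = {1, - 1}" by blast
   moreover have "P (mset_set {1, - 1})"
   proof (cases "(1::'a) = - 1")
    case True
    then have s: "{1, - 1} = {1::'a}" by auto
    show ?thesis unfolding s using assms(4) by simp
   next
    case F: False
    then show ?thesis using assms(6) by simp
   qed
   ultimately have "P (mset_set (set_mset M))"
    using assms(3-5) by (elim disjE) simp_all
   then show ?thesis using \<open>M = mset_set (set_mset M)\<close> by simp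
  qed
 qed
qed

lemma prod_inverse_invariant:
 fixes M :: "'a::field multiset"
 assumes "image_mset inverse M = M" "0 \<notin># M" "(1::'a) \<noteq> - 1"
 shows "prod_mset M = (- 1) ^ count M (- 1)"
 using assms(1,2)
proof (induction rule: inverse_invariant_induct)
 case (step x M)
 have i: "inverse x = - 1 \<longleftrightarrow> x = - 1" using inverse_eq_iff_eq[of x "- 1"] by simp
 have "prod_mset (add_mset x (add_mset (inverse x) M)) = prod_mset M"
  using step.hyps(1) by (simp flip: mult.assoc)
 also have "\<dots> = (- 1) ^ count M (- 1)" by (rule step.IH)
 also have "\<dots> = (- 1) ^ count (add_mset x (add_mset (inverse x) M)) (- 1)" using i by simp
 finally show ?case .
qed (use assms(3) in auto)

text \<open>If the product is 1, the multiplicity of \<open>- 1\<close> is even, and the multiset can be arranged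
 symmetrically, opposite entries being inverse to each other and a middle entry being 1.\<close>

lemma inverse_invariant_list:
 fixes M :: "'a::field multiset"
 assumes "image_mset inverse M = M" "0 \<notin># M" "(1::'a) \<noteq> - 1" "prod_mset M = 1"
 shows "\<exists>ls. mset ls = M \<and> (\<forall>i<length ls. ls ! i * ls ! (length ls - 1 - i) = 1) \<and>
  (\<forall>i. 2 * i + 1 = length ls \<longrightarrow> ls ! i = 1)"
 using assms(1,2,4)
proof (induction rule: inverse_invariant_induct)
 case empty show ?case by (rule exI[of _ "[]"]) simp
next
 case one show ?case by (rule exI[of _ "[1]"]) simp
next
 case minus then show ?case using assms(3) by simp
next
 case both then show ?case using assms(3) by simp
next
 case (step x M)
 have "prod_mset M = 1" using step.prems step.hyps(1) by (simp flip: mult.assoc)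
 then obtain ls where ls: "mset ls = M" "\<And>i. i < length ls \<Longrightarrow> ls ! i * ls ! (length ls - 1 - i) = 1"
  "\<And>i. 2 * i + 1 = length ls \<Longrightarrow> ls ! i = 1" using step.IH by blast
 let ?l = "x # ls @ [inverse x]"
 have "?l ! i * ?l ! (length ?l - 1 - i) = 1" if i: "i < length ?l" for i
 proof (cases i)
  case 0 then show ?thesis using step.hyps(1) by (simp add: nth_append)
 next
  case (Suc j)
  show ?thesis
  proof (cases "j < length ls")
   case True
   then have "length ?l - 1 - i = Suc (length ls - 1 - j)" using Suc by simp
   then show ?thesis using True ls(2)[OF True] Suc by (simp add: nth_append)
  next
   case False
   then have "j = length ls" using i Suc by simp
   then show ?thesis using Suc step.hyps(1) by (simp add: nth_append)
  qed
 qed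
 moreover have "?l ! i = 1" if i: "2 * i + 1 = length ?l" for i
 proof (cases i)
  case 0 then show ?thesis using i by simp
 next
  case (Suc j)
  then have "2 * j + 1 = length ls" using i by simp
  then show ?thesis using ls(3)[of j] Suc by (simp add: nth_append)
 qed
 moreover have "mset ?l = add_mset x (add_mset (inverse x) M)" using ls(1) by simp
 ultimately show ?case by blast
qed

section \<open>Antidiagonal matrices\<close>

lemma J_carrier[simp]: "J_mat n \<in> carrier_mat n n" by (simp add: J_mat_def)
lemma J_dims[simp]: "dim_row (J_mat n) = n" "dim_col (J_mat n) = n" by (simp_all add: J_mat_def)
lemma J_index: "i < n \<Longrightarrow> j < n \<Longrightarrow> J_mat n $$ (i, j) = (if i + j + 1 = n then 1 else 0)"
 by (simp add: J_mat_def)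
lemma J_transpose[simp]: "(J_mat n)\<^sup>T = J_mat n"
 by (rule eq_matI) (auto simp: J_index add.commute)

lemma J_mult_left: assumes "A \<in> carrier_mat n m" "i < n" "j < m"
 shows "(J_mat n * A) $$ (i, j) = (A $$ (n - 1 - i, j) :: 'a::field)"
proof -
 have "(J_mat n * A) $$ (i, j) = (\<Sum>s<n. J_mat n $$ (i, s) * A $$ (s, j))"
  using assms by (intro mult_mat_index) auto
 also have "\<dots> = (\<Sum>s<n. if s = n - 1 - i then A $$ (s, j) else 0)"
  using assms by (intro sum.cong) (auto simp: J_index)
 also have "\<dots> = A $$ (n - 1 - i, j)" using assms by simp
 finally show ?thesis .
qed

lemma J_mult_right: assumes "A \<in> carrier_mat m n" "i < m" "j < n"
 shows "(A * J_mat n) $$ (i, j) = (A $$ (i, n - 1 - j) :: 'a::field)"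
proof -
 have "(A * J_mat n) $$ (i, j) = (\<Sum>s<n. A $$ (i, s) * J_mat n $$ (s, j))"
  using assms by (intro mult_mat_index) auto
 also have "\<dots> = (\<Sum>s<n. if s = n - 1 - j then A $$ (i, s) else 0)"
  using assms by (intro sum.cong) (auto simp: J_index)
 also have "\<dots> = A $$ (i, n - 1 - j)" using assms by simp
 finally show ?thesis .
qed

lemma J_J: "J_mat n * J_mat n = (1\<^sub>m n :: 'a::field mat)"
proof (rule eq_matI)
 fix i j assume "i < dim_row (1\<^sub>m n :: 'a mat)" "j < dim_col (1\<^sub>m n :: 'a mat)"
 then have ij: "i < n" "j < n" by auto
 have "(J_mat n * J_mat n) $$ (i, j) = (J_mat n $$ (n - 1 - i, j) :: 'a)" by (rule J_mult_left[OF J_carrier ij])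
 also have "\<dots> = (if n - 1 - i + j + 1 = n then 1 else 0)" using ij by (intro J_index) auto
 also have "n - 1 - i + j + 1 = n \<longleftrightarrow> i = j" using ij by linarith
 finally show "(J_mat n * J_mat n) $$ (i, j) = (1\<^sub>m n $$ (i, j) :: 'a)" using ij by simp
qed simp_all

lemmas J_GLm[simp] = minv_unique(1)[OF J_carrier J_carrier J_J]
 and J_minv[simp] = minv_unique(2)[OF J_carrier J_carrier J_J]

lemma J_diagm: "J_mat n * diagm n d = diagm n (\<lambda>i. d (n - 1 - i)) * (J_mat n :: 'a::field mat)"
proof (rule eq_matI)
 fix i j assume "i < dim_row (diagm n (\<lambda>i. d (n - 1 - i)) * (J_mat n :: 'a mat))" "j < dim_col (diagm n (\<lambda>i. d (n - 1 - i)) * (J_mat n :: 'a mat))"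
 then have ij: "i < n" "j < n" by auto
 have "(J_mat n * diagm n d) $$ (i, j) = J_mat n $$ (i, j) * d j" using ij by (intro diagm_mult_right) auto
 also have "\<dots> = d (n - 1 - i) * J_mat n $$ (i, j)"
 proof (cases "i + j + 1 = n")
  case True
  then have "n - 1 - i = j" by simp
  then show ?thesis by simp
 next
  case False then show ?thesis using ij by (simp add: J_index)
 qed
 also have "\<dots> = (diagm n (\<lambda>i. d (n - 1 - i)) * J_mat n) $$ (i, j)" using ij by (intro diagm_mult_left[symmetric]) auto
 finally show "(J_mat n * diagm n d) $$ (i, j) = (diagm n (\<lambda>i. d (n - 1 - i)) * (J_mat n :: 'a mat)) $$ (i, j)" .
qed auto

context frob_closure
begin

section \<open>Congruence over the finite field\<close>

lemma one_neq_minus_one: "(1::'k) \<noteq> - 1"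
 using two_neq_0 by (metis add.right_inverse one_add_one)

lemma cg_ss: assumes "cg n R x x'" "x \<in> GLm n" "ss (asymmetry x)" shows "ss (asymmetry x')"
proof -
 obtain h where h: "h \<in> GLm n" "x' = act h x" using assms(1) unfolding cg_def by blast
 have "ss (minv h * asymmetry x * minv (minv h))" using assms h by (intro ss_conj[of _ n]) auto
 then show ?thesis unfolding h(2) using asym_act[OF assms(2) h(1)] h(1) assms(2) by simp
qed

lemma cg_eigs: assumes "cg n R x x'" "x \<in> GLm n" shows "eigs (asymmetry x') = eigs (asymmetry x)"
proof -
 obtain h where h: "h \<in> GLm n" "x' = act h x" using assms(1) unfolding cg_def by blast
 have "eigs (minv h * asymmetry x * minv (minv h)) = eigs (asymmetry x)" using assms h by (intro eigs_conj[of _ n]) auto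
 then show ?thesis unfolding h(2) using asym_act[OF assms(2) h(1)] h(1) assms(2) by simp
qed

lemma cg_det: assumes "cg n True x x'" "x \<in> GLm n" shows "\<exists>s\<in>Fq. s \<noteq> 0 \<and> det x' = s ^ 2 * det x"
proof -
 obtain h where h: "h \<in> GLm n" "rat h" "x' = act h x" using assms(1) unfolding cg_def by blast
 have "det x' = det h * (det x * det h)"
  unfolding h(3) act_def using h(1) assms(2) by (simp add: det_mult[of _ n] det_transpose[of _ n])
 then show ?thesis using h rat_det by (intro bexI[of _ "det h"]) (auto simp: power2_eq_square)
qed

lemma split_eig:
 assumes x: "x \<in> GLm (Suc n)" "rat x" and A: "ss (asymmetry x)"
  and v: "v \<in> carrier_vec (Suc n)" "\<And>i. i < Suc n \<Longrightarrow> v $ i \<in> Fq"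
  "asymmetry x *\<^sub>v v = v" and b: "b = v \<bullet> (x *\<^sub>v v)" "b \<noteq> 0"
 shows "\<exists>x1. b \<in> Fq \<and> x1 \<in> GLm n \<and> rat x1 \<and> ss (asymmetry x1) \<and>
  eigs (asymmetry x) = add_mset 1 (eigs (asymmetry x1)) \<and> cg (Suc n) True x (bl n b x1)"
proof -
 obtain x1 where x1: "x1 \<in> GLm n" "rat x1" "cg (Suc n) True x (bl n b x1)"
  using split_off[OF x v b] by blast
 have as: "asymmetry (bl n b x1) = bl n 1 (asymmetry x1)" by (rule bl_asym[OF x1(1) b(2)])
 have ac: "asymmetry x1 \<in> carrier_mat n n" using x1 by simp
 have "b \<in> Fq" using cg_rat[OF x1(3) x] bl_rat[of x1 n b] x1(1) by auto
 moreover have "ss (asymmetry x1)" using cg_ss[OF x1(3) x(1) A] unfolding as bl_ss[OF ac] .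
 moreover have "eigs (asymmetry x) = add_mset 1 (eigs (asymmetry x1))"
  using cg_eigs[OF x1(3) x(1)] unfolding as bl_eigs[OF ac] by simp
 ultimately show ?thesis using x1 by blast
qed

lemma Fq_sum: "(\<And>s. s \<in> X \<Longrightarrow> g s \<in> Fq) \<Longrightarrow> sum g X \<in> Fq"
 by (induction X rule: infinite_finite_induct) (use Fq_closed(1,5) in auto)

text \<open>With multiplicity at least two, two orthogonal vectors of values \<open>b\<close> and \<open>c\<close> can be split off,
 and \<open>b * s ^ 2 + c * t ^ 2\<close> represents 1; so the value of the split vector can be normalised.\<close>

lemma split_eig_one:
 assumes x: "x \<in> GLm (Suc n)" "rat x" and A: "ss (asymmetry x)" and c2: "count (eigs (asymmetry x)) 1 \<ge> 2"
 shows "\<exists>x1. x1 \<in> GLm n \<and> rat x1 \<and> ss (asymmetry x1) \<and>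
  eigs (asymmetry x) = add_mset 1 (eigs (asymmetry x1)) \<and> cg (Suc n) True x (bl n 1 x1)"
proof -
 have "1 \<in># eigs (asymmetry x)" using c2 by (simp flip: count_greater_zero_iff)
 then obtain v where v: "v \<in> carrier_vec (Suc n)" "\<And>i. i < Suc n \<Longrightarrow> v $ i \<in> Fq"
  "asymmetry x *\<^sub>v v = v" "v \<bullet> (x *\<^sub>v v) \<noteq> 0" using ex_fixed_vec[OF x A] by blast
 define b where "b = v \<bullet> (x *\<^sub>v v)"
 have b0: "b \<noteq> 0" using v(4) by (simp add: b_def)
 obtain x1 where x1: "b \<in> Fq" "x1 \<in> GLm n" "rat x1" "ss (asymmetry x1)"
  "eigs (asymmetry x) = add_mset 1 (eigs (asymmetry x1))" "cg (Suc n) True x (bl n b x1)"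
  using split_eig[OF x A v(1-3) b_def b0] by blast
 have xc: "x1 \<in> carrier_mat n n" using x1 by simp
 have ac: "asymmetry x1 \<in> carrier_mat n n" using x1 by simp
 have "1 \<in># eigs (asymmetry x1)" using c2 unfolding x1(5) by (simp flip: count_greater_zero_iff)
 then obtain u where u: "u \<in> carrier_vec n" "\<And>i. i < n \<Longrightarrow> u $ i \<in> Fq"
  "asymmetry x1 *\<^sub>v u = u" "u \<bullet> (x1 *\<^sub>v u) \<noteq> 0" using ex_fixed_vec[OF x1(2,3,4)] by blast
 define c where "c = u \<bullet> (x1 *\<^sub>v u)"
 have cF: "c \<in> Fq"
 proof -
  have xF: "x1 $$ (i, j) \<in> Fq" if "i < n" "j < n" for i j using rat_iff[OF xc] x1(3) that by blast
  have "c = (\<Sum>i<n. u $ i * (\<Sum>j<n. x1 $$ (i, j) * u $ j))"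
   unfolding c_def using xc u(1) by (subst scalar_prod_index[of _ n]) (auto simp: mult_mat_vec_index[of _ n n] simp del: index_mult_mat_vec)
  also have "\<dots> \<in> Fq" using u(2) xF by (intro Fq_sum Fq_closed(3)) auto
  finally show ?thesis .
 qed
 \<comment> \<open>the vector with coordinates \<open>s\<close> and \<open>t\<close> in the two split lines has value 1\<close>
 obtain s t where st: "s \<in> Fq" "t \<in> Fq" "b * s ^ 2 + c * t ^ 2 = 1"
  using two_squares[OF x1(1) b0 cF] u(4) unfolding c_def by blast
 define y where "y = bl n b x1"
 have y: "y \<in> GLm (Suc n)" "rat y" unfolding y_def using bl_GLm[OF xc] bl_rat[OF xc] x1 b0 by auto
 have yc: "cg (Suc n) True x y" using x1(6) by (simp add: y_def)
 define w where "w = vCons s (t \<cdot>\<^sub>v u)"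
 have wc: "w \<in> carrier_vec (Suc n)" using u(1) by (simp add: w_def)
 have tu: "t \<cdot>\<^sub>v u \<in> carrier_vec n" using u(1) by simp
 have wF: "w $ i \<in> Fq" if "i < Suc n" for i
  using that st(1,2) u(1,2) Fq_closed(3) unfolding w_def by (cases i) auto
 have ay: "asymmetry y = bl n 1 (asymmetry x1)" unfolding y_def by (rule bl_asym[OF x1(2) b0])
 have yw: "asymmetry y *\<^sub>v w = w"
  unfolding ay w_def bl_vec[OF ac tu] using u(1,3) ac by (simp add: mult_mat_vec[of _ n n])
 have "1 = w \<bullet> (y *\<^sub>v w)"
 proof -
  have "y *\<^sub>v w = vCons (b * s) (t \<cdot>\<^sub>v (x1 *\<^sub>v u))"
   unfolding y_def w_def bl_vec[OF xc tu] using u(1) xc by (simp add: mult_mat_vec[of _ n n])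
  moreover have "(t \<cdot>\<^sub>v u) \<bullet> (t \<cdot>\<^sub>v (x1 *\<^sub>v u)) = t * (t * c)"
   unfolding c_def using u(1) xc
   by (subst smult_scalar_prod_distrib[of _ n], simp, simp, subst scalar_prod_smult_distrib[of _ n]) auto
  ultimately show ?thesis using st(3) unfolding w_def by (simp add: power2_eq_square mult_ac)
 qed
 from split_eig[OF y cg_ss[OF yc x(1) A] wc wF yw this]
 obtain x2 where x2: "x2 \<in> GLm n" "rat x2" "ss (asymmetry x2)"
  "eigs (asymmetry y) = add_mset 1 (eigs (asymmetry x2))" "cg (Suc n) True y (bl n 1 x2)" by auto
 show ?thesis using x2 cg_trans[OF x(1) yc x2(5)] cg_eigs[OF yc x(1)] by auto
qed

lemma bl_cg: assumes "x1 \<in> GLm n" "cg n True x1 x1'" "s \<in> Fq" "s \<noteq> 0" "b' = s ^ 2 * b"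
 shows "cg (Suc n) True (bl n b x1) (bl n b' x1')"
proof -
 obtain h where h: "h \<in> GLm n" "rat h" "x1' = act h x1" using assms(2) unfolding cg_def by blast
 have "bl n b' x1' = act (bl n s h) (bl n b x1)" unfolding h(3) bl_act[OF assms(1) h(1)] assms(5)
  by (simp add: power2_eq_square mult_ac)
 moreover have "bl n s h \<in> GLm (Suc n)" "rat (bl n s h)" using bl_GLm[of h n] bl_rat[of h n] h assms by auto
 ultimately show ?thesis unfolding cg_def by blast
qed

text \<open>Split off lines with value 1 until the multiplicity of the eigenvalue 1 is at most one. A last
 line has value determined modulo squares by the determinant, since what remains has no
 eigenvalue 1 and its class is determined by its spectrum.\<close>

theorem fq_class:
 assumes n: "n < q" and x: "x \<in> GLm n" "rat x" "ss (asymmetry x)" and x': "x' \<in> GLm n" "rat x'" "ss (asymmetry x')"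
  and eq: "eigs (asymmetry x) = eigs (asymmetry x')"
  and det: "1 \<in># eigs (asymmetry x) \<Longrightarrow> \<exists>s\<in>Fq. s \<noteq> 0 \<and> det x' = s ^ 2 * det x"
 shows "cg n True x x'"
 using n x x' eq det
proof (induction n arbitrary: x x')
 case 0
 have "x = x'" using 0 by (intro eq_matI) auto
 then show ?case using cg_refl 0 by blast
next
 case (Suc n)
 note X = Suc.prems(2-4) and X' = Suc.prems(5-7) and E = Suc.prems(8) and Dt = Suc.prems(9)
 have nq: "n < q" using Suc.prems(1) by simp
 show ?case
 proof (cases "1 \<in># eigs (asymmetry x)")
  case False
  show ?thesis using fq_no_one[OF Suc.prems(1) X(1,2) X'(1,2) X(3) False k_class[OF X(1,3) X'(1,3) E]] .
 next
  case True
  obtain s where s: "s \<in> Fq" "s \<noteq> 0" "det x' = s ^ 2 * det x" using Dt True by blast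
  show ?thesis
  proof (cases "count (eigs (asymmetry x)) 1 \<ge> 2")
   case True
   obtain x1 where x1: "x1 \<in> GLm n" "rat x1" "ss (asymmetry x1)"
    "eigs (asymmetry x) = add_mset 1 (eigs (asymmetry x1))" "cg (Suc n) True x (bl n 1 x1)"
    using split_eig_one[OF X True] by blast
   obtain x1' where x1': "x1' \<in> GLm n" "rat x1'" "ss (asymmetry x1')"
    "eigs (asymmetry x') = add_mset 1 (eigs (asymmetry x1'))" "cg (Suc n) True x' (bl n 1 x1')"
    using split_eig_one[OF X'] True E by auto
   obtain t where t: "t \<in> Fq" "t \<noteq> 0" "det x1 = t ^ 2 * det x"
    using cg_det[OF x1(5) X(1)] bl_det[of x1 n 1] x1(1) by auto
   obtain t' where t': "t' \<in> Fq" "t' \<noteq> 0" "det x1' = t' ^ 2 * det x'"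
    using cg_det[OF x1'(5) X'(1)] bl_det[of x1' n 1] x1'(1) by auto
   have "det x1' = (t' * s / t) ^ 2 * det x1" unfolding t(3) t'(3) s(3) using t(2) by (simp add: field_simps power2_eq_square)
   moreover have "t' * s / t \<in> Fq" using t s t' by (simp add: power_mult_distrib power_divide)
   ultimately have d: "\<exists>s\<in>Fq. s \<noteq> 0 \<and> det x1' = s ^ 2 * det x1" using t s t' by (intro bexI[of _ "t' * s / t"]) auto
   have "cg n True x1 x1'" by (rule Suc.IH[OF nq x1(1-3) x1'(1-3) _ d]) (use x1(4) x1'(4) E in simp)
   then have "cg (Suc n) True (bl n 1 x1) (bl n 1 x1')" using bl_cg[OF x1(1), of x1' 1 1 1] Fq_closed(4) by simp
   then show ?thesis using cg_trans[OF X(1) x1(5)] cg_trans[OF X(1)] cg_sym[OF X'(1) x1'(5)] by blast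
  next
   case F: False
   obtain v where v: "v \<in> carrier_vec (Suc n)" "\<And>i. i < Suc n \<Longrightarrow> v $ i \<in> Fq"
    "asymmetry x *\<^sub>v v = v" "v \<bullet> (x *\<^sub>v v) \<noteq> 0" using ex_fixed_vec[OF X True] by blast
   obtain b x1 where x1: "b \<noteq> 0" "x1 \<in> GLm n" "rat x1" "ss (asymmetry x1)"
    "eigs (asymmetry x) = add_mset 1 (eigs (asymmetry x1))" "cg (Suc n) True x (bl n b x1)" "b \<in> Fq"
    using split_eig[OF X v(1-3) refl v(4)] v(4) by blast
   have "1 \<in># eigs (asymmetry x')" using True E by simp
   then obtain v' where v': "v' \<in> carrier_vec (Suc n)" "\<And>i. i < Suc n \<Longrightarrow> v' $ i \<in> Fq"
    "asymmetry x' *\<^sub>v v' = v'" "v' \<bullet> (x' *\<^sub>v v') \<noteq> 0" using ex_fixed_vec[OF X'] by blast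
   obtain b' x1' where x1': "b' \<noteq> 0" "x1' \<in> GLm n" "rat x1'" "ss (asymmetry x1')"
    "eigs (asymmetry x') = add_mset 1 (eigs (asymmetry x1'))" "cg (Suc n) True x' (bl n b' x1')" "b' \<in> Fq"
    using split_eig[OF X' v'(1-3) refl v'(4)] v'(4) by blast
   have no1: "1 \<notin># eigs (asymmetry x1)" using F unfolding x1(5) by (simp add: not_in_iff)
   have c1: "cg n True x1 x1'"
    by (rule Suc.IH[OF nq x1(2-4) x1'(2-4)]) (use x1(5) x1'(5) E no1 in auto)
   obtain r where r: "r \<in> Fq" "r \<noteq> 0" "det x1' = r ^ 2 * det x1" using cg_det[OF c1 x1(2)] by blast
   obtain t where t: "t \<in> Fq" "t \<noteq> 0" "b * det x1 = t ^ 2 * det x"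
    using cg_det[OF x1(6) X(1)] bl_det[of x1 n b] x1(2) by auto
   obtain t' where t': "t' \<in> Fq" "t' \<noteq> 0" "b' * det x1' = t' ^ 2 * det x'"
    using cg_det[OF x1'(6) X'(1)] bl_det[of x1' n b'] x1'(2) by auto
   have d0: "det x1 \<noteq> 0" "det x \<noteq> 0" using x1(2) X(1) by auto
   have "b' * r ^ 2 * det x1 = t' ^ 2 * s ^ 2 * det x" using t'(3) r(3) s(3) by (simp add: mult_ac)
   then have "(b' * r ^ 2 * t ^ 2) * det x1 = t' ^ 2 * s ^ 2 * (t ^ 2 * det x)" by (simp add: mult_ac)
   also have "\<dots> = (t' ^ 2 * s ^ 2 * b) * det x1" unfolding t(3)[symmetric] by (simp add: mult_ac)
   finally have "(b' * r ^ 2 * t ^ 2) * det x1 = (t' ^ 2 * s ^ 2 * b) * det x1" .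
   then have "b' * (r ^ 2 * t ^ 2) = t' ^ 2 * s ^ 2 * b" using d0 by (simp add: mult.assoc)
   then have "b' = (t' * s / (r * t)) ^ 2 * b" using r(2) t(2)
    by (simp add: field_simps power_mult_distrib power_divide)
   moreover have "t' * s / (r * t) \<in> Fq" using t s t' r by (simp add: power_mult_distrib power_divide)
   moreover have "t' * s / (r * t) \<noteq> 0" using t s t' r by simp
   ultimately have "cg (Suc n) True (bl n b x1) (bl n b' x1')" using bl_cg[OF x1(2) c1] by blast
   then show ?thesis using cg_trans[OF X(1) x1(6)] cg_trans[OF X(1)] cg_sym[OF X'(1) x1'(6)] by blast
  qed
 qed
qed

section \<open>Forms with a given spectrum\<close>

lemma eigs_size: "A \<in> carrier_mat n n \<Longrightarrow> ss A \<Longrightarrow> size (eigs A) = n"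
 using ss_diag eigs_diag by (metis length_map length_upt diff_zero size_mset)

text \<open>The asymmetry is an isometry of the form, so it is conjugate to its inverse transpose; its
 determinant is 1.\<close>

lemma spectrum_asymmetry:
 assumes x: "x \<in> GLm n" and A: "ss (asymmetry x)"
 shows "image_mset inverse (eigs (asymmetry x)) = eigs (asymmetry x)" "0 \<notin># eigs (asymmetry x)"
  "prod_mset (eigs (asymmetry x)) = 1"
proof -
 define A where "A = asymmetry x"
 have AG: "A \<in> GLm n" using x by (simp add: A_def)
 have Ac: "A \<in> carrier_mat n n" using AG by simp
 obtain P d where P: "P \<in> GLm n" "A * P = P * diagm n d" using ss_diag[OF Ac] A unfolding A_def by blast
 have e: "eigs A = mset (map d [0..<n])" by (rule eigs_diag[OF Ac P])
 have d0: "d i \<noteq> 0" if "i < n" for i using diag_conj_GLm[OF P(1) Ac P(2)] AG that by simp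
 show "0 \<notin># eigs (asymmetry x)" unfolding A_def[symmetric] e using d0 by auto
 have Ai: "minv A * P = P * diagm n (\<lambda>i. inverse (d i))"
 proof -
  have dd: "diagm n d * diagm n (\<lambda>i. inverse (d i)) = 1\<^sub>m n"
   unfolding diagm_mult by (rule eq_matI) (use d0 in auto)
  have "A * (P * diagm n (\<lambda>i. inverse (d i))) = P * (diagm n d * diagm n (\<lambda>i. inverse (d i)))"
   using lift_eq[OF P(2), of "diagm n (\<lambda>i. inverse (d i))"] AG P(1) by simp
  also have "\<dots> = P" unfolding dd using P(1) by simp
  finally have "minv A * (A * (P * diagm n (\<lambda>i. inverse (d i)))) = minv A * P" by simp
  then show ?thesis using AG P(1) by simp
 qed
 have "minv A = minv x * A\<^sup>T * minv (minv x)"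
 proof -
  have "A\<^sup>T = x * minv (x\<^sup>T)" unfolding A_def asymmetry_def using x by (simp add: mtranspose_mult minv_transpose)
  then show ?thesis unfolding A_def asymmetry_def using x by (simp add: minv_mult[of _ n])
 qed
 then have "eigs (minv A) = eigs A" using eigs_conj[of "A\<^sup>T" n "minv x"] eigs_transpose[OF Ac] x AG by simp
 moreover have "eigs (minv A) = mset (map (\<lambda>i. inverse (d i)) [0..<n])" by (rule eigs_diag[OF _ P(1) Ai]) (use AG in simp)
 moreover have "mset (map (\<lambda>i. inverse (d i)) [0..<n]) = image_mset inverse (eigs A)"
  unfolding e by (simp add: multiset.map_comp o_def)
 ultimately show "image_mset inverse (eigs (asymmetry x)) = eigs (asymmetry x)" unfolding A_def by simp
 have "det A = 1" unfolding A_def asymmetry_def using x by (simp add: det_mult[of _ n] det_minv[of _ n] det_transpose[of _ n])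
 moreover have "det A = (\<Prod>i<n. d i)"
 proof -
  have "det (A * P) = det (P * diagm n d)" unfolding P(2) ..
  then show ?thesis using Ac P(1) by (simp add: det_mult[of _ n] det_diagm)
 qed
 moreover have "prod_mset (eigs A) = (\<Prod>i<n. d i)"
  unfolding e by (simp add: prod_unfold_prod_mset lessThan_atLeast0)
 ultimately show "prod_mset (eigs (asymmetry x)) = 1" unfolding A_def by simp
qed

lemma eigs_Fr: assumes "A \<in> carrier_mat n n" "ss A" shows "eigs (Fr m A) = image_mset (\<lambda>z. z ^ (q ^ m)) (eigs A)" "ss (Fr m A)"
proof -
 obtain P d where P: "P \<in> GLm n" "A * P = P * diagm n d" using ss_diag[OF assms] by blast
 have "Fr m (A * P) = Fr m (P * diagm n d)" unfolding P(2) ..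
 moreover have "Fr m (diagm n d) = diagm n (\<lambda>i. d i ^ (q ^ m))" by (rule eq_matI) (use q_pow_pos[of m] in auto)
 ultimately have FP: "Fr m A * Fr m P = Fr m P * diagm n (\<lambda>i. d i ^ (q ^ m))" using P(1) assms(1) by (simp add: Fr_mult)
 have G: "Fr m A \<in> carrier_mat n n" "Fr m P \<in> GLm n" using assms(1) P(1) by auto
 show "ss (Fr m A)" by (rule diag_ss[OF G FP])
 show "eigs (Fr m A) = image_mset (\<lambda>z. z ^ (q ^ m)) (eigs A)"
  unfolding eigs_diag[OF G FP] eigs_diag[OF assms(1) P] by (simp add: multiset.map_comp o_def)
qed

lemma spectrum_rational: "x \<in> GLm n \<Longrightarrow> rat x \<Longrightarrow> ss (asymmetry x) \<Longrightarrow>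
 image_mset (\<lambda>z. z ^ q) (eigs (asymmetry x)) = eigs (asymmetry x)"
 using eigs_Fr(1)[of "asymmetry x" n 1] rat_asym[of x n] by simp

text \<open>The asymmetry of an antidiagonal matrix is diagonal, with the quotients of opposite entries as
 eigenvalues, so a symmetric arrangement of the spectrum prescribes the entries.\<close>

lemma antidiagonal_form:
 assumes M: "image_mset inverse M = M" "0 \<notin># M" "prod_mset M = (1::'k)"
 defines "n \<equiv> size M"
 shows "\<exists>c. (\<forall>i<n. c i \<noteq> 0) \<and> diagm n c * J_mat n \<in> GLm n \<and> ss (asymmetry (diagm n c * J_mat n)) \<and>
  eigs (asymmetry (diagm n c * J_mat n)) = M"
proof -
 obtain ls where ls: "mset ls = M" "\<And>i. i < length ls \<Longrightarrow> ls ! i * ls ! (length ls - 1 - i) = 1"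
  "\<And>i. 2 * i + 1 = length ls \<Longrightarrow> ls ! i = 1"
  using inverse_invariant_list[OF M(1,2) one_neq_minus_one M(3)] by blast
 have len: "length ls = n" unfolding n_def ls(1)[symmetric] by simp
 define c where "c i = (if i < n - 1 - i then ls ! i else 1)" for i
 have l0: "ls ! i \<noteq> 0" if "i < n" for i using that ls(1) M(2) len by (metis nth_mem set_mset_mset)
 have c0: "c i \<noteq> 0" if "i < n" for i using l0[OF that] by (simp add: c_def)
 define y where "y = diagm n c * J_mat n"
 have dG: "diagm n c \<in> GLm n" using c0 by (simp add: diag_GLm_iff)
 have y: "y \<in> GLm n" using dG by (simp add: y_def)
 have di: "minv (diagm n c) = diagm n (\<lambda>i. inverse (c i))"
  by (rule minv_unique(2)[of _ n]) (auto simp: diagm_mult c0 intro!: eq_matI)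
 have "asymmetry y = J_mat n * (diagm n (\<lambda>i. inverse (c i)) * (J_mat n * diagm n c))"
  unfolding asymmetry_def y_def using dG by (simp add: minv_mult[of _ n] mtranspose_mult di)
 also have "\<dots> = diagm n (\<lambda>i. inverse (c (n - 1 - i))) * (J_mat n * (J_mat n * diagm n c))"
  using lift_eq[OF J_diagm[of n "\<lambda>i. inverse (c i)"], where X="J_mat n * diagm n c"] by simp
 also have "J_mat n * (J_mat n * diagm n c) = diagm n c" using massoc[of "J_mat n" "J_mat n" "diagm n c"] J_J[of n, where 'a='k] by simp
 finally have ay: "asymmetry y = diagm n (\<lambda>i. inverse (c (n - 1 - i)) * c i)" unfolding diagm_mult .
 have "inverse (c (n - 1 - i)) * c i = ls ! i" if i: "i < n" for i
 proof -
  have p: "ls ! i * ls ! (n - 1 - i) = 1" using ls(2)[of i] i len by simp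
  consider "i < n - 1 - i" | "n - 1 - i < i" | "2 * i + 1 = n" using i by linarith
  then show ?thesis
  proof cases
   case 1
   then have "\<not> n - 1 - i < n - 1 - (n - 1 - i)" using i by linarith
   then show ?thesis using 1 by (simp add: c_def)
  next
   case 2
   then have "n - 1 - i < n - 1 - (n - 1 - i)" using i by linarith
   then show ?thesis using 2 p inverse_unique[of "ls ! (n - 1 - i)" "ls ! i"] by (simp add: c_def mult.commute)
  next
   case 3
   then have "\<not> i < n - 1 - i" "n - 1 - i = i" using i by linarith+
   then show ?thesis using ls(3)[of i] 3 len by (simp add: c_def)
  qed
 qed
 then have ay2: "asymmetry y = diagm n (\<lambda>i. ls ! i)" unfolding ay by (intro eq_matI) auto
 have "ss (asymmetry y)" unfolding ay2 by (rule ss_diagm)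
 moreover have "eigs (asymmetry y) = M" unfolding ay2 eigs_diagm ls(1)[symmetric] len[symmetric] map_nth ..
 ultimately show ?thesis using y c0 unfolding y_def by blast
qed

lemma cg_antidiagonal:
 assumes x: "x \<in> GLm n" "ss (asymmetry x)"
 shows "\<exists>c. (\<forall>i<n. c i \<noteq> 0) \<and> cg n False x (diagm n c * J_mat n)"
proof -
 have n: "size (eigs (asymmetry x)) = n" using eigs_size[of "asymmetry x" n] x by simp
 obtain c where c: "\<forall>i<n. c i \<noteq> 0" "diagm n c * J_mat n \<in> GLm n" "ss (asymmetry (diagm n c * J_mat n))"
  "eigs (asymmetry (diagm n c * J_mat n)) = eigs (asymmetry x)"
  using antidiagonal_form[OF spectrum_asymmetry[OF x], unfolded n] by blast
 have "cg n False x (diagm n c * J_mat n)" by (rule k_class[OF x c(2,3)]) (use c(4) in simp)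
 then show ?thesis using c(1) by blast
qed

text \<open>An antidiagonal form with spectrum \<open>M\<close> is congruent to its Frobenius conjugate, which has the
 same spectrum. By Lang's theorem the congruence can be absorbed into a change of basis after
 which the form is rational.\<close>

lemma exists_form:
 assumes M: "image_mset inverse M = M" "0 \<notin># M" "prod_mset M = (1::'k)" "image_mset (\<lambda>z. z ^ q) M = M"
 shows "\<exists>x\<in>GLm (size M). rat x \<and> ss (asymmetry x) \<and> eigs (asymmetry x) = M"
proof -
 let ?n = "size M"
 obtain y where y: "y \<in> GLm ?n" "ss (asymmetry y)" "eigs (asymmetry y) = M" using antidiagonal_form[OF M(1-3)] by blast
 have Fy: "Fr 1 y \<in> GLm ?n" using y by simp
 have aF: "asymmetry (Fr 1 y) = Fr 1 (asymmetry y)"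
  unfolding asymmetry_def using y(1) by (simp add: Fr_mult Fr_minv[of _ ?n] Fr_transpose)
 have "ss (asymmetry (Fr 1 y))" "eigs (asymmetry (Fr 1 y)) = M"
  unfolding aF using eigs_Fr[of "asymmetry y" ?n 1] y M(4) by auto
 then have "cg ?n False (Fr 1 y) y" using k_class[OF Fy _ y(1,2)] y(3) by simp
 then obtain h where h: "h \<in> GLm ?n" "y = act h (Fr 1 y)" unfolding cg_def by blast
 obtain g where g: "g \<in> GLm ?n" "Fr 1 g = h * g" using lang_columns[OF h(1)] by blast
 define x where "x = act g y"
 have "Fr 1 x = act (Fr 1 g) (Fr 1 y)" unfolding x_def act_def using y g(1) by (simp add: Fr_mult Fr_transpose)
 also have "\<dots> = act g (act h (Fr 1 y))" unfolding g(2) using act_act[OF Fy h(1) g(1)] by simp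
 also have "\<dots> = x" using h(2) by (simp add: x_def)
 finally have "rat x" .
 moreover have "cg ?n False y x" unfolding cg_def x_def using g by blast
 ultimately show ?thesis using cg_ss[OF _ y(1,2)] cg_eigs[OF _ y(1)] y(3) cg_GLm[OF _ y(1)] by blast
qed

text \<open>Multiply the value on a split line in the eigenspace of 1 by \<open>\<delta>\<close>; neither the asymmetry nor the
 spectrum changes.\<close>

lemma exists_form_det:
 assumes x: "x \<in> GLm n" "rat x" "ss (asymmetry x)" "1 \<in># eigs (asymmetry x)" and d: "\<delta> \<in> Fq" "\<delta> \<noteq> 0"
 shows "\<exists>x'\<in>GLm n. rat x' \<and> ss (asymmetry x') \<and> eigs (asymmetry x') = eigs (asymmetry x) \<and>
  (\<exists>s\<in>Fq. s \<noteq> 0 \<and> det x' = \<delta> * (s ^ 2 * det x))"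
proof -
 have "n \<noteq> 0"
 proof
  assume "n = 0"
  then have "size (eigs (asymmetry x)) = 0" using eigs_size[of "asymmetry x" n] x by simp
  then show False using x(4) by simp
 qed
 then obtain m where m: "n = Suc m" by (cases n) auto
 note xm = x[unfolded m]
 obtain v where v: "v \<in> carrier_vec (Suc m)" "\<And>i. i < Suc m \<Longrightarrow> v $ i \<in> Fq"
  "asymmetry x *\<^sub>v v = v" "v \<bullet> (x *\<^sub>v v) \<noteq> 0" using ex_fixed_vec[OF xm] by blast
 obtain b x1 where x1: "b \<noteq> 0" "x1 \<in> GLm m" "rat x1" "ss (asymmetry x1)"
  "eigs (asymmetry x) = add_mset 1 (eigs (asymmetry x1))" "cg (Suc m) True x (bl m b x1)" "b \<in> Fq"
  using split_eig[OF xm(1-3) v(1-3) refl v(4)] v(4) by blast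
 have xc: "x1 \<in> carrier_mat m m" and ac: "asymmetry x1 \<in> carrier_mat m m" using x1 by auto
 define x' where "x' = bl m (\<delta> * b) x1"
 have as: "asymmetry x' = bl m 1 (asymmetry x1)" unfolding x'_def by (rule bl_asym) (use x1 d in auto)
 have "x' \<in> GLm (Suc m)" unfolding x'_def using bl_GLm[OF xc] x1 d by simp
 moreover have "rat x'" unfolding x'_def using bl_rat[OF xc] x1 d Fq_closed(3) by blast
 moreover have "ss (asymmetry x')" unfolding as bl_ss[OF ac] by (rule x1(4))
 moreover have "eigs (asymmetry x') = eigs (asymmetry x)" unfolding as bl_eigs[OF ac] x1(5) ..
 moreover have "\<exists>s\<in>Fq. s \<noteq> 0 \<and> det x' = \<delta> * (s ^ 2 * det x)"
  using cg_det[OF x1(6) xm(1)] unfolding x'_def bl_det[OF xc] by auto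
 ultimately show ?thesis unfolding m by blast
qed

end

section \<open>Regular functions and the Zariski topology\<close>

lemma openin_zariski: "openin (zariski n) U \<longleftrightarrow> zariski_open n (U :: 'a::field mat set)"
 unfolding zariski_def by (simp add: topology_inverse' istopology_zariski_open)

lemma topspace_zariski: "topspace (zariski n) = (GLm n :: 'a::field mat set)"
proof
 show "topspace (zariski n) \<subseteq> (GLm n :: 'a mat set)"
  unfolding topspace_def openin_zariski zariski_open_def carrier_GL by blast
 have "zariski_open n (GLm n :: 'a mat set)" unfolding zariski_open_def carrier_GL
  by (rule exI[of _ "{\<lambda>_. 1}"]) (auto intro: poly_fun.const)
 then show "(GLm n :: 'a mat set) \<subseteq> topspace (zariski n)" unfolding topspace_def openin_zariski
  by (intro Union_upper) simp
qed

lemma closedin_zariski: assumes "S \<subseteq> poly_fun n"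
 shows "closedin (zariski n) {g \<in> GLm n. \<forall>f\<in>S. f g = (0 :: 'a::field)}"
proof -
 have "GLm n - {g \<in> GLm n. \<forall>f\<in>S. f g = 0} = {g \<in> GLm n. \<exists>f\<in>S. f g \<noteq> 0}" by blast
 then show ?thesis unfolding closedin_def topspace_zariski openin_zariski zariski_open_def carrier_GL using assms by auto
qed

lemma poly_fun_sum: "(\<And>s. s \<in> S \<Longrightarrow> f s \<in> poly_fun n) \<Longrightarrow> (\<lambda>g. \<Sum>s\<in>S. f s g) \<in> poly_fun n"
proof (induction S rule: infinite_finite_induct)
 case (insert s S)
 then show ?case using poly_fun.add[of "f s" n "\<lambda>g. \<Sum>s\<in>S. f s g"] by simp
qed (simp_all add: poly_fun.const)

lemma poly_fun_prod: "(\<And>s. s \<in> S \<Longrightarrow> f s \<in> poly_fun n) \<Longrightarrow> (\<lambda>g. \<Prod>s\<in>S. f s g) \<in> poly_fun n"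
proof (induction S rule: infinite_finite_induct)
 case (insert s S)
 then show ?case using poly_fun.mult[of "f s" n "\<lambda>g. \<Prod>s\<in>S. f s g"] by simp
qed (simp_all add: poly_fun.const)

lemma poly_fun_power: "f \<in> poly_fun n \<Longrightarrow> (\<lambda>g. f g ^ N) \<in> poly_fun n"
 by (induction N) (auto intro: poly_fun.const poly_fun.mult)

lemma poly_fun_det_minor:
 assumes "\<And>i. i < m \<Longrightarrow> r i < n" "\<And>j. j < m \<Longrightarrow> c j < n"
 shows "(\<lambda>g. det (mat m m (\<lambda>(i, j). g $$ (r i, c j)))) \<in> (poly_fun n :: ('a::field mat \<Rightarrow> 'a) set)"
proof -
 have "(\<lambda>g. \<Sum>p\<in>{p. p permutes {0..<m}}. signof p * (\<Prod>i\<in>{0..<m}. g $$ (r i, c (p i)))) \<in> (poly_fun n :: ('a mat \<Rightarrow> 'a) set)"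
 proof (intro poly_fun_sum poly_fun.mult poly_fun.const poly_fun_prod poly_fun.entry)
  fix p i assume "p \<in> {p. p permutes {0..<m}}" "i \<in> {0..<m}"
  then show "r i < n" "c (p i) < n" using assms permutes_in_image[of p "{0..<m}" i] by auto
 qed
 moreover have "det (mat m m (\<lambda>(i, j). g $$ (r i, c j))) =
  (\<Sum>p\<in>{p. p permutes {0..<m}}. signof p * (\<Prod>i\<in>{0..<m}. g $$ (r i, c (p i))))" for g :: "'a mat"
 proof -
  have "p i < m" if "p permutes {0..<m}" "i < m" for p i using that permutes_in_image[of p "{0..<m}" i] by auto
  then show ?thesis by (subst det_def'[of _ m]) (auto intro!: sum.cong prod.cong)
 qed
 ultimately show ?thesis by simp
qed

definition dete :: "nat \<Rightarrow> 'a::field mat \<Rightarrow> 'a" where "dete n g = det (mat n n (\<lambda>(i, j). g $$ (i, j)))"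

lemma dete_poly: "dete n \<in> poly_fun n"
proof -
 have "(\<lambda>g. det (mat n n (\<lambda>(i, j). g $$ (i, j)))) \<in> (poly_fun n :: ('a mat \<Rightarrow> 'a) set)"
  using poly_fun_det_minor[of n "\<lambda>i. i" n "\<lambda>j. j"] by simp
 then show ?thesis unfolding dete_def[abs_def] .
qed

lemma dete_eq: "g \<in> carrier_mat n n \<Longrightarrow> dete n g = det g"
proof -
 assume "g \<in> carrier_mat n n"
 then have "mat n n (\<lambda>(i, j). g $$ (i, j)) = g" by (intro eq_matI) auto
 then show ?thesis by (simp add: dete_def)
qed

text \<open>A regular function on the group is a polynomial in the entries divided by a power of the
 determinant.\<close>

definition regf :: "nat \<Rightarrow> ('a::field mat \<Rightarrow> 'a) \<Rightarrow> bool" where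
 "regf n \<phi> \<longleftrightarrow> (\<exists>N. \<exists>f\<in>poly_fun n. \<forall>g\<in>GLm n. f g = det g ^ N * \<phi> g)"

lemma regf_poly: "f \<in> poly_fun n \<Longrightarrow> regf n f" unfolding regf_def by (rule exI[of _ 0]) auto

lemma regf_add: assumes "regf n \<phi>" "regf n \<psi>" shows "regf n (\<lambda>g. \<phi> g + \<psi> g :: 'a::field)"
proof -
 obtain N f where f: "f \<in> poly_fun n" "\<And>g. g \<in> GLm n \<Longrightarrow> f g = det g ^ N * \<phi> g" using assms(1) unfolding regf_def by blast
 obtain M h where h: "h \<in> poly_fun n" "\<And>g. g \<in> GLm n \<Longrightarrow> h g = det g ^ M * \<psi> g" using assms(2) unfolding regf_def by blast
 have "(\<lambda>g. dete n g ^ M * f g + dete n g ^ N * h g) \<in> poly_fun n"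
  by (intro poly_fun.add poly_fun.mult poly_fun_power dete_poly f(1) h(1))
 moreover have "dete n g ^ M * f g + dete n g ^ N * h g = det g ^ (N + M) * (\<phi> g + \<psi> g)" if "g \<in> GLm n" for g
  using f(2)[OF that] h(2)[OF that] that by (simp add: dete_eq power_add algebra_simps)
 ultimately show ?thesis unfolding regf_def by (intro exI[of _ "N + M"]) (rule bexI, auto)
qed

lemma regf_mult: assumes "regf n \<phi>" "regf n \<psi>" shows "regf n (\<lambda>g. \<phi> g * \<psi> g :: 'a::field)"
proof -
 obtain N f where f: "f \<in> poly_fun n" "\<And>g. g \<in> GLm n \<Longrightarrow> f g = det g ^ N * \<phi> g" using assms(1) unfolding regf_def by blast
 obtain M h where h: "h \<in> poly_fun n" "\<And>g. g \<in> GLm n \<Longrightarrow> h g = det g ^ M * \<psi> g" using assms(2) unfolding regf_def by blast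
 have "(\<lambda>g. f g * h g) \<in> poly_fun n" by (intro poly_fun.mult f(1) h(1))
 moreover have "f g * h g = det g ^ (N + M) * (\<phi> g * \<psi> g)" if "g \<in> GLm n" for g
  using f(2)[OF that] h(2)[OF that] by (simp add: power_add algebra_simps)
 ultimately show ?thesis unfolding regf_def by (intro exI[of _ "N + M"]) (rule bexI, auto)
qed

lemma regf_sum: "(\<And>s. s \<in> S \<Longrightarrow> regf n (f s)) \<Longrightarrow> regf n (\<lambda>g. \<Sum>s\<in>S. f s g :: 'a::field)"
proof (induction S rule: infinite_finite_induct)
 case (insert s S)
 then show ?case using regf_add[of n "f s" "\<lambda>g. \<Sum>s\<in>S. f s g"] by simp
qed (simp_all add: regf_poly poly_fun.const)

lemma regf_cong: "regf n \<phi> \<Longrightarrow> (\<And>g. g \<in> GLm n \<Longrightarrow> \<phi> g = \<psi> g) \<Longrightarrow> regf n \<psi>"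
 unfolding regf_def by (metis (no_types, lifting))

lemma regf_minv: assumes "i < n" "j < n" shows "regf n (\<lambda>g. minv g $$ (i, j) :: 'a::field)"
proof -
 define f where "f g = (- 1) ^ (j + i) * det (mat (n - 1) (n - 1) (\<lambda>(i', j').
  g $$ (if i' < j then i' else Suc i', if j' < i then j' else Suc j')))" for g :: "'a mat"
 have "(\<lambda>g. det (mat (n - 1) (n - 1) (\<lambda>(i', j').
  g $$ (if i' < j then i' else Suc i', if j' < i then j' else Suc j')))) \<in> (poly_fun n :: ('a mat \<Rightarrow> 'a) set)"
  by (rule poly_fun_det_minor) (use assms in auto)
 then have "f \<in> poly_fun n" unfolding f_def[abs_def] by (intro poly_fun.mult poly_fun.const)
 moreover have "f g = det g ^ 1 * minv g $$ (i, j)" if g: "g \<in> GLm n" for g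
 proof -
  have "minv g $$ (i, j) = (1 / det g) * adj_mat g $$ (i, j)"
   unfolding minv_def using g assms by (simp add: adj_mat_def)
  also have "adj_mat g $$ (i, j) = f g"
   using g assms by (simp add: adj_mat_def cofactor_def mat_delete_def f_def add.commute)
  finally show ?thesis using GLm_det[OF g] by simp
 qed
 ultimately show ?thesis unfolding regf_def by blast
qed

lemma regf_mat_mult:
 assumes "\<And>g. g \<in> GLm n \<Longrightarrow> \<phi> g \<in> GLm n" "\<And>g. g \<in> GLm n \<Longrightarrow> \<psi> g \<in> GLm n"
  "\<And>i j. i < n \<Longrightarrow> j < n \<Longrightarrow> regf n (\<lambda>g. \<phi> g $$ (i, j))"
  "\<And>i j. i < n \<Longrightarrow> j < n \<Longrightarrow> regf n (\<lambda>g. \<psi> g $$ (i, j) :: 'a::field)" "i < n" "j < n"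
 shows "regf n (\<lambda>g. (\<phi> g * \<psi> g) $$ (i, j))"
proof (rule regf_cong)
 show "regf n (\<lambda>g. \<Sum>s<n. \<phi> g $$ (i, s) * \<psi> g $$ (s, j))"
  using assms(3-6) by (intro regf_sum regf_mult) auto
 show "(\<Sum>s<n. \<phi> g $$ (i, s) * \<psi> g $$ (s, j)) = (\<phi> g * \<psi> g) $$ (i, j)" if "g \<in> GLm n" for g
  using assms(1,2)[OF that] assms(5,6) by (intro mult_mat_index[symmetric, of _ n n _ n]) auto
qed

text \<open>The pullback of a polynomial is a polynomial divided by a power of the determinant, which
 vanishes nowhere, so it has the zeros of a polynomial.\<close>

lemma continuous_regular:
 assumes \<phi>: "\<And>g. g \<in> GLm n \<Longrightarrow> \<phi> g \<in> GLm n"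
  and r: "\<And>i j. i < n \<Longrightarrow> j < n \<Longrightarrow> regf n (\<lambda>g. \<phi> g $$ (i, j) :: 'a::field)"
 shows "continuous_map (zariski n) (zariski n) \<phi>"
proof -
 have pull: "regf n (\<lambda>g. f (\<phi> g))" if "f \<in> poly_fun n" for f
  using that by (induction rule: poly_fun.induct) (auto intro: regf_poly poly_fun.const r regf_add regf_mult)
 show ?thesis unfolding continuous_map topspace_zariski
 proof (intro conjI allI impI)
  show "\<phi> ` GLm n \<subseteq> GLm n" using \<phi> by blast
  fix U assume "openin (zariski n) (U :: 'a mat set)"
  then obtain S where S: "S \<subseteq> poly_fun n" "U = {g \<in> GLm n. \<exists>f\<in>S. f g \<noteq> 0}"
   unfolding openin_zariski zariski_open_def carrier_GL by blast
  define S' where "S' = {f' \<in> poly_fun n. \<exists>f\<in>S. \<exists>N. \<forall>g\<in>GLm n. f' g = det g ^ N * f (\<phi> g)}"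
  have "{x \<in> GLm n. \<phi> x \<in> U} = {g \<in> GLm n. \<exists>f\<in>S'. f g \<noteq> 0}"
  proof (intro equalityI subsetI)
   fix x assume x: "x \<in> {x \<in> GLm n. \<phi> x \<in> U}"
   then obtain f where f: "f \<in> S" "f (\<phi> x) \<noteq> 0" unfolding S(2) by auto
   obtain N f' where f': "f' \<in> poly_fun n" "\<forall>g\<in>GLm n. f' g = det g ^ N * f (\<phi> g)"
    using pull[of f] f(1) S(1) unfolding regf_def by auto
   have "f' x \<noteq> 0" using f'(2) x f(2) by auto
   moreover have "f' \<in> S'" unfolding S'_def using f' f(1) by blast
   ultimately show "x \<in> {g \<in> GLm n. \<exists>f\<in>S'. f g \<noteq> 0}" using x by blast
  next
   fix x assume "x \<in> {g \<in> GLm n. \<exists>f\<in>S'. f g \<noteq> 0}"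
   then obtain f' where f': "f' \<in> S'" "f' x \<noteq> 0" "x \<in> GLm n" by blast
   then obtain f N where "f \<in> S" "f' x = det x ^ N * f (\<phi> x)" unfolding S'_def by auto
   then have "f \<in> S \<and> f (\<phi> x) \<noteq> 0" using f'(2) by auto
   then show "x \<in> {x \<in> GLm n. \<phi> x \<in> U}" unfolding S(2) using \<phi>[OF f'(3)] f'(3) by auto
  qed
  moreover have "S' \<subseteq> poly_fun n" unfolding S'_def by blast
  ultimately show "openin (zariski n) {x \<in> GLm n. \<phi> x \<in> U}"
   unfolding openin_zariski zariski_open_def carrier_GL by blast
 qed
qed

lemma regf_const: "regf n (\<lambda>_. c :: 'a::field)"
 by (rule regf_poly[OF poly_fun.const])

lemma regf_entry: "i < n \<Longrightarrow> j < n \<Longrightarrow> regf n (\<lambda>g. g $$ (i, j) :: 'a::field)"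
 by (rule regf_poly[OF poly_fun.entry])

lemma continuous_left_mult: assumes "x \<in> GLm n"
 shows "continuous_map (zariski n) (zariski n) (\<lambda>g. x * g :: 'a::field mat)"
 using assms by (intro continuous_regular regf_mat_mult regf_const regf_entry mult_GLm)

lemma continuous_commutator: assumes "a \<in> GLm n"
 shows "continuous_map (zariski n) (zariski n) (\<lambda>b. a * b * minv a * minv b :: 'a::field mat)"
 using assms by (intro continuous_regular regf_mat_mult regf_const regf_entry regf_minv mult_GLm minv_GLm)

section \<open>Connected sets\<close>

definition line :: "nat \<Rightarrow> 'a::field mat \<Rightarrow> 'a mat \<Rightarrow> 'a \<Rightarrow> 'a mat" where
 "line n g h t = mat n n (\<lambda>(i, j). g $$ (i, j) + t * (h $$ (i, j) - g $$ (i, j)))"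

lemma line_poly: "f \<in> poly_fun n \<Longrightarrow> \<exists>r. \<forall>t. poly r t = f (line n g h (t :: 'a::field))"
proof (induction rule: poly_fun.induct)
 case (const c) show ?case by (rule exI[of _ "[:c:]"]) simp
next
 case (entry i j)
 then show ?case by (intro exI[of _ "[:g $$ (i, j), h $$ (i, j) - g $$ (i, j):]"]) (simp add: line_def)
next
 case (add f f')
 then obtain r r' where "\<forall>t. poly r t = f (line n g h t)" "\<forall>t. poly r' t = f' (line n g h t)" by blast
 then show ?case by (intro exI[of _ "r + r'"]) simp
next
 case (mult f f')
 then obtain r r' where "\<forall>t. poly r t = f (line n g h t)" "\<forall>t. poly r' t = f' (line n g h t)" by blast
 then show ?case by (intro exI[of _ "r * r'"]) simp
qed

lemma line_carrier[simp]: "line n g h t \<in> carrier_mat n n" by (simp add: line_def)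

text \<open>A set of invertible matrices that contains the invertible points of every line through two of
 its points is irreducible, like an open set of a linear space: two nonvanishing conditions
 that hold at some points of a line hold simultaneously at all but finitely many of its points.\<close>

lemma line_connected:
 assumes inf: "infinite (UNIV :: 'a::field set)" and S: "S \<subseteq> GLm n"
  and line: "\<And>g h t. g \<in> S \<Longrightarrow> h \<in> S \<Longrightarrow> line n g h t \<in> GLm n \<Longrightarrow> line n g h (t :: 'a) \<in> S"
 shows "connectedin (zariski n) S"
 unfolding connectedin topspace_zariski
proof (intro conjI notI)
 show "S \<subseteq> GLm n" by (rule S)
 assume "\<exists>E1 E2. openin (zariski n) E1 \<and> openin (zariski n) E2 \<and> S \<subseteq> E1 \<union> E2 \<and> E1 \<inter> E2 \<inter> S = {} \<and> E1 \<inter> S \<noteq> {} \<and> E2 \<inter> S \<noteq> {}"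
 then obtain E1 E2 g h where E: "openin (zariski n) E1" "openin (zariski n) E2" "E1 \<inter> E2 \<inter> S = {}"
  "g \<in> E1" "g \<in> S" "h \<in> E2" "h \<in> S" by blast
 obtain S1 where S1: "S1 \<subseteq> poly_fun n" "E1 = {g \<in> GLm n. \<exists>f\<in>S1. f g \<noteq> 0}"
  using E(1) unfolding openin_zariski zariski_open_def carrier_GL by blast
 obtain S2 where S2: "S2 \<subseteq> poly_fun n" "E2 = {g \<in> GLm n. \<exists>f\<in>S2. f g \<noteq> 0}"
  using E(2) unfolding openin_zariski zariski_open_def carrier_GL by blast
 obtain f1 where f1: "f1 \<in> S1" "f1 g \<noteq> 0" using E(4) unfolding S1(2) by blast
 obtain f2 where f2: "f2 \<in> S2" "f2 h \<noteq> 0" using E(6) unfolding S2(2) by blast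
 have gh: "g \<in> GLm n" "h \<in> GLm n" using E S by auto
 have l0: "line n g h 0 = g" and l1: "line n g h 1 = h"
  using gh by (auto intro!: eq_matI simp: line_def)
 obtain r1 where r1: "\<And>t. poly r1 t = f1 (line n g h t)" using line_poly f1(1) S1(1) by blast
 obtain r2 where r2: "\<And>t. poly r2 t = f2 (line n g h t)" using line_poly f2(1) S2(1) by blast
 obtain r3 where r3: "\<And>t. poly r3 t = dete n (line n g h t)" using line_poly[OF dete_poly] by blast
 have "poly r1 0 \<noteq> 0" "poly r2 1 \<noteq> 0" "poly r3 0 \<noteq> 0"
  unfolding r1 r2 r3 l0 l1 using f1 f2 gh by (auto simp: dete_eq)
 then have "r1 \<noteq> 0" "r2 \<noteq> 0" "r3 \<noteq> 0" by auto
 then have r0: "r1 * r2 * r3 \<noteq> 0" by simp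
 have "finite {t. poly (r1 * r2 * r3) t = 0}" by (rule poly_roots_finite[OF r0])
 then obtain t where "poly (r1 * r2 * r3) t \<noteq> 0" using inf by (metis (mono_tags, lifting) UNIV_I finite_subset mem_Collect_eq subsetI)
 then have t: "f1 (line n g h t) \<noteq> 0" "f2 (line n g h t) \<noteq> 0" "det (line n g h t) \<noteq> 0"
  using r1 r2 r3 by (auto simp: dete_eq)
 then have G: "line n g h t \<in> GLm n" by (intro GLmI) auto
 then have "line n g h t \<in> E1 \<inter> E2" unfolding S1(2) S2(2) using t f1 f2 by blast
 then show False using E(3) line[OF E(5,7) G] by blast
qed

section \<open>The triangular group, its filtration and the diagonal group\<close>

text \<open>The invertible matrices whose conjugate by \<open>Q\<close> has prescribed zero entries. Both the conjugates
 of the triangular group and those of the diagonal group have this form, and the defining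
 conditions are linear.\<close>

definition Zg :: "nat \<Rightarrow> 'a::field mat \<Rightarrow> (nat \<times> nat) set \<Rightarrow> 'a mat set" where
 "Zg n Q Z = {g \<in> GLm n. \<forall>i<n. \<forall>j<n. (i, j) \<in> Z \<longrightarrow> (Q * (g * minv Q)) $$ (i, j) = 0}"

lemma conj_index: assumes "Q \<in> GLm n" "g \<in> carrier_mat n n" "i < n" "j < n"
 shows "(Q * (g * minv Q)) $$ (i, j) = (\<Sum>s<n. \<Sum>t<n. (Q $$ (i, s) * minv Q $$ (t, j)) * g $$ (s, t) :: 'a::field)"
proof -
 have "(Q * (g * minv Q)) $$ (i, j) = (\<Sum>s<n. Q $$ (i, s) * (g * minv Q) $$ (s, j))"
  using assms by (intro mult_mat_index[of _ n n _ n]) auto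
 also have "\<dots> = (\<Sum>s<n. Q $$ (i, s) * (\<Sum>t<n. g $$ (s, t) * minv Q $$ (t, j)))"
  using assms by (intro sum.cong refl arg_cong2[where f="(*)"] mult_mat_index[of _ n n _ n]) auto
 finally show ?thesis by (simp add: sum_distrib_left mult_ac)
qed

lemma Zg_closed: assumes Q: "Q \<in> GLm n" shows "closedin (zariski n) (Zg n Q (Z :: (nat \<times> nat) set) :: 'a::field mat set)"
proof -
 define S where "S = {\<lambda>g. (\<Sum>s<n. \<Sum>t<n. (Q $$ (i, s) * minv Q $$ (t, j)) * g $$ (s, t)) | i j. i < n \<and> j < n \<and> (i, j) \<in> Z}"
 have "S \<subseteq> poly_fun n" unfolding S_def by (auto intro!: poly_fun_sum poly_fun.mult poly_fun.const poly_fun.entry)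
 from closedin_zariski[OF this]
 have "closedin (zariski n) {g \<in> GLm n. \<forall>f\<in>S. f g = 0}" .
 also have "{g \<in> GLm n. \<forall>f\<in>S. f g = 0} = Zg n Q Z"
  unfolding Zg_def S_def using conj_index[OF Q] by (auto 4 4)
 finally show ?thesis .
qed

lemma Zg_connected: assumes Q: "Q \<in> GLm n" and inf: "infinite (UNIV :: 'a::field set)"
 shows "connectedin (zariski n) (Zg n Q Z :: 'a mat set)"
proof (rule line_connected[OF inf])
 show "Zg n Q Z \<subseteq> GLm n" by (auto simp: Zg_def)
 fix g h :: "'a mat" and t assume gh: "g \<in> Zg n Q Z" "h \<in> Zg n Q Z" and G: "line n g h t \<in> GLm n"
 then have c: "g \<in> GLm n" "h \<in> GLm n" by (auto simp: Zg_def)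
 have "(Q * (line n g h t * minv Q)) $$ (i, j) = 0" if ij: "i < n" "j < n" "(i, j) \<in> Z" for i j
 proof -
  have "(Q * (line n g h t * minv Q)) $$ (i, j) = (\<Sum>s<n. \<Sum>u<n. (Q $$ (i, s) * minv Q $$ (u, j)) * (g $$ (s, u) + t * (h $$ (s, u) - g $$ (s, u))))"
   using conj_index[OF Q line_carrier ij(1,2)] by (simp add: line_def)
  also have "\<dots> = (Q * (g * minv Q)) $$ (i, j) + t * ((Q * (h * minv Q)) $$ (i, j) - (Q * (g * minv Q)) $$ (i, j))"
   using conj_index[OF Q GLm_carrier[OF c(1)] ij(1,2)] conj_index[OF Q GLm_carrier[OF c(2)] ij(1,2)]
   by (simp add: sum_distrib_left algebra_simps sum.distrib sum_subtractf)
  also have "\<dots> = 0" using gh ij by (simp add: Zg_def)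
  finally show ?thesis .
 qed
 then show "line n g h t \<in> Zg n Q Z" using G by (simp add: Zg_def)
qed

text \<open>For \<open>j = 0\<close> the upper triangular group, for \<open>j > 0\<close> the unitriangular matrices whose first \<open>j -
 1\<close> superdiagonals vanish.\<close>

definition Fil :: "nat \<Rightarrow> nat \<Rightarrow> 'a::field mat set" where
 "Fil n j = {g \<in> GLm n. (\<forall>a<n. \<forall>b<n. b < a \<longrightarrow> g $$ (a, b) = 0) \<and>
   (j > 0 \<longrightarrow> (\<forall>a<n. \<forall>b<n. b < a + j \<longrightarrow> g $$ (a, b) = (if a = b then 1 else 0)))}"

abbreviation Up :: "nat \<Rightarrow> 'a::field mat set" where "Up n \<equiv> Fil n 0"

definition Dg :: "nat \<Rightarrow> 'a::field mat set" where
 "Dg n = {g \<in> GLm n. \<forall>a<n. \<forall>b<n. a \<noteq> b \<longrightarrow> g $$ (a, b) = 0}"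

lemma Fil_GLm: "g \<in> Fil n j \<Longrightarrow> g \<in> GLm n" by (simp add: Fil_def)
lemma Fil_Up: "g \<in> Fil n j \<Longrightarrow> g \<in> Up n" by (simp add: Fil_def)
lemma Fil_upper: "g \<in> Fil n j \<Longrightarrow> a < n \<Longrightarrow> b < a \<Longrightarrow> g $$ (a, b) = 0" unfolding Fil_def by auto
lemma Dg_GLm: "g \<in> Dg n \<Longrightarrow> g \<in> GLm n" by (simp add: Dg_def)
lemma Dg_Up: "g \<in> Dg n \<Longrightarrow> g \<in> Up n" by (auto simp: Dg_def Fil_def)

lemma upper_mult_index:
 assumes "u \<in> carrier_mat n n" "w \<in> Up n" "a < n" "b < n"
 shows "(u * w) $$ (a, b) = (\<Sum>s\<in>{..b}. u $$ (a, s) * (w $$ (s, b) :: 'a::field))"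
proof -
 have "(u * w) $$ (a, b) = (\<Sum>s<n. u $$ (a, s) * w $$ (s, b))"
  using assms Fil_GLm[OF assms(2)] by (intro mult_mat_index[of _ n n _ n]) auto
 also have "\<dots> = (\<Sum>s\<in>{..b}. u $$ (a, s) * w $$ (s, b))"
  by (rule sum.mono_neutral_right) (use assms Fil_upper[OF assms(2)] in auto)
 finally show ?thesis .
qed

lemma Fil_mult: assumes g: "g \<in> Fil n j" and h: "h \<in> Fil n j" shows "g * h \<in> (Fil n j :: 'a::field mat set)"
proof -
 have G: "g \<in> GLm n" "h \<in> GLm n" using g h Fil_GLm by auto
 have gc: "g \<in> carrier_mat n n" using G by simp
 have e: "(g * h) $$ (a, b) = (\<Sum>s\<in>{..b}. g $$ (a, s) * h $$ (s, b))" if "a < n" "b < n" for a b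
  by (rule upper_mult_index[OF gc Fil_Up[OF h] that])
 have "(g * h) $$ (a, b) = 0" if "a < n" "b < n" "b < a" for a b
  unfolding e[OF that(1,2)] by (rule sum.neutral) (use Fil_upper[OF g] that in auto)
 moreover have "(g * h) $$ (a, b) = (if a = b then 1 else 0)" if j: "j > 0" and ab: "a < n" "b < n" "b < a + j" for a b
 proof -
  have ga: "g $$ (a, s) = (if a = s then 1 else 0)" if "s \<le> b" for s using g j ab that unfolding Fil_def by auto
  have "(g * h) $$ (a, b) = (\<Sum>s\<in>{..b}. if s = a then h $$ (s, b) else 0)"
   unfolding e[OF ab(1,2)] by (rule sum.cong) (use ga in auto)
  also have "\<dots> = (if a \<le> b then h $$ (a, b) else 0)" by simp
  finally show ?thesis using h j ab unfolding Fil_def by auto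
 qed
 ultimately show ?thesis using G unfolding Fil_def by auto
qed

text \<open>Modulo the next step of the filtration, products of diagonal matrices, or sums of
 superdiagonals, do not depend on the order.\<close>

lemma Fil_commutator_eq:
 assumes g: "g \<in> Fil n j" and h: "h \<in> Fil n j" and ab: "a < n" "b < n" "b < a + Suc j"
 shows "(g * h) $$ (a, b) = (h * g) $$ (a, b)"
proof -
 have key: "(g * h) $$ (a, b) = (if b < a then 0 else if j = 0 then g $$ (a, a) * h $$ (a, a) else
   if a = b then 1 else if b < a + j then 0 else g $$ (a, b) + h $$ (a, b))"
  if g: "g \<in> Fil n j" and h: "h \<in> Fil n j" for g h :: "'a mat"
 proof -
  have gc: "g \<in> carrier_mat n n" using Fil_GLm[OF g] by simp
  have e: "(g * h) $$ (a, b) = (\<Sum>s\<in>{..b}. g $$ (a, s) * h $$ (s, b))" by (rule upper_mult_index[OF gc Fil_Up[OF h] ab(1,2)])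
  show ?thesis
  proof (cases "b < a")
   case True
   then show ?thesis using Fil_upper[OF Fil_mult[OF g h] ab(1) True] by simp
  next
   case False
   show ?thesis
   proof (cases "j = 0")
    case True
    then have ba: "b = a" using False ab(3) by simp
    have "(\<Sum>s\<in>{..b}. g $$ (a, s) * h $$ (s, b)) = (\<Sum>s\<in>{a}. g $$ (a, s) * h $$ (s, b))"
     by (rule sum.mono_neutral_right) (use ba Fil_upper[OF g] ab in auto)
    then show ?thesis using e ba True by simp
   next
    case j: False
    show ?thesis
    proof (cases "b < a + j")
     case True
     then have "(g * h) $$ (a, b) = (if a = b then 1 else 0)" using Fil_mult[OF g h] ab j unfolding Fil_def by auto
     then show ?thesis using False j True by simp
    next
     case b: False
     then have ba: "b = a + j" "a \<noteq> b" using ab j by auto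
     have gs: "g $$ (a, s) = (if s = a then 1 else 0)" if "s < b" for s
      using g ab j that ba unfolding Fil_def by auto
     have hbb: "h $$ (b, b) = 1" using h ab j unfolding Fil_def by auto
     have "(\<Sum>s\<in>{..b}. g $$ (a, s) * h $$ (s, b)) = (\<Sum>s\<in>{a, b}. g $$ (a, s) * h $$ (s, b))"
      by (rule sum.mono_neutral_right) (use gs ba in auto)
     also have "\<dots> = g $$ (a, b) + h $$ (a, b)" using ba gs[of a] hbb j by simp
     finally show ?thesis using e False j b ba by simp
    qed
   qed
  qed
 qed
 show "(g * h) $$ (a, b) = (h * g) $$ (a, b)"
  unfolding key[OF g h] key[OF h g] by (auto simp: mult.commute add.commute)
qed

section \<open>Conjugates of the triangular and of the diagonal group\<close>

definition cj :: "nat \<Rightarrow> 'a::field mat \<Rightarrow> 'a mat set \<Rightarrow> 'a mat set" where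
 "cj n Q H = {g \<in> GLm n. Q * (g * minv Q) \<in> H}"

lemma subgroup_GL: "subgroup H (GL n) \<longleftrightarrow>
 H \<subseteq> GLm n \<and> 1\<^sub>m n \<in> H \<and> (\<forall>g\<in>H. \<forall>h\<in>H. g * h \<in> H) \<and> (\<forall>g\<in>H. minv g \<in> (H :: 'a::field mat set))"
proof -
 have "inv\<^bsub>GL n\<^esub> g = minv g" if "H \<subseteq> GLm n" "g \<in> H" for g using that inv_GL by blast
 then show ?thesis unfolding subgroup_def carrier_GL mult_GL one_GL by auto
qed

lemma subgroup_GLm: "subgroup H (GL n) \<Longrightarrow> h \<in> H \<Longrightarrow> h \<in> GLm n" unfolding subgroup_GL by blast
lemma subgroup_mult: "subgroup H (GL n) \<Longrightarrow> g \<in> H \<Longrightarrow> h \<in> H \<Longrightarrow> g * h \<in> H" unfolding subgroup_GL by blast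
lemma subgroup_minv: "subgroup H (GL n) \<Longrightarrow> h \<in> H \<Longrightarrow> minv h \<in> H" unfolding subgroup_GL by blast
lemma subgroup_one: "subgroup H (GL n) \<Longrightarrow> 1\<^sub>m n \<in> H" unfolding subgroup_GL by blast

lemma cj_GLm: "g \<in> cj n Q H \<Longrightarrow> g \<in> GLm n" by (simp add: cj_def)

lemma minv_conj: "Q \<in> GLm n \<Longrightarrow> g \<in> GLm n \<Longrightarrow> minv (Q * (g * minv Q)) = Q * (minv g * minv Q)"
 by (simp add: minv_mult[of _ n])

lemma cj_subgroup: assumes "subgroup H (GL n)" and Q: "Q \<in> GLm n" shows "subgroup (cj n Q H) (GL n)"
proof -
 have m: "Q * ((g * h) * minv Q) \<in> H" if g: "g \<in> cj n Q H" and h: "h \<in> cj n Q H" for g h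
 proof -
  have "(Q * (g * minv Q)) * (Q * (h * minv Q)) \<in> H" using g h subgroup_mult[OF assms(1)] unfolding cj_def by blast
  moreover have "(Q * (g * minv Q)) * (Q * (h * minv Q)) = Q * ((g * h) * minv Q)"
   using Q cj_GLm[OF g] cj_GLm[OF h] by simp
  ultimately show ?thesis by simp
 qed
 have i: "Q * (minv g * minv Q) \<in> H" if g: "g \<in> cj n Q H" for g
 proof -
  have "minv (Q * (g * minv Q)) \<in> H" using g subgroup_minv[OF assms(1)] unfolding cj_def by blast
  moreover have "minv (Q * (g * minv Q)) = Q * (minv g * minv Q)"
   using Q cj_GLm[OF g] by (simp add: minv_mult)
  ultimately show ?thesis by simp
 qed
 show ?thesis unfolding subgroup_GL
 proof (intro conjI ballI)
  show "1\<^sub>m n \<in> cj n Q H" unfolding cj_def using Q subgroup_one[OF assms(1)] by simp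
 qed (use m i cj_GLm in \<open>auto simp: cj_def simp del: massoc\<close>)
qed

lemma Fil_one: "1\<^sub>m n \<in> Fil n j" unfolding Fil_def by simp

lemma Dg_one: "1\<^sub>m n \<in> Dg n" unfolding Dg_def by simp

lemma Dg_diagm: "g \<in> Dg n \<Longrightarrow> g = diagm n (\<lambda>i. g $$ (i, i))"
 unfolding Dg_def by (intro eq_matI) auto

lemma Dg_mult: assumes "g \<in> Dg n" "h \<in> Dg n" shows "g * h \<in> Dg n"
proof -
 have "g * h = diagm n (\<lambda>i. g $$ (i, i) * h $$ (i, i))"
  using Dg_diagm[OF assms(1)] Dg_diagm[OF assms(2)] diagm_mult by metis
 then show ?thesis using assms Dg_GLm[OF assms(1)] Dg_GLm[OF assms(2)] mult_GLm[of g n h] unfolding Dg_def by auto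
qed

lemma cj_Up_Zg: "Q \<in> GLm n \<Longrightarrow> cj n Q (Up n) = Zg n Q {(a, b). b < a}"
 unfolding cj_def Zg_def Fil_def by auto

lemma cj_Dg_Zg: "Q \<in> GLm n \<Longrightarrow> cj n Q (Dg n) = Zg n Q {(a, b). a \<noteq> b}"
 unfolding cj_def Zg_def Dg_def by auto

section \<open>Derived groups\<close>

lemma derived_in_exp:
 assumes "subgroup H (GL n)"
 shows "(derived (GL n) ^^ m) H \<subseteq> H" "(derived ((GL n)\<lparr>carrier := H\<rparr>) ^^ m) H = (derived (GL n) ^^ m) (H :: 'a::field mat set)"
proof -
 interpret group "GL n :: 'a mat monoid" by (rule group_GL)
 show 1: "(derived (GL n) ^^ m) H \<subseteq> H" for m
  using derived_incl[OF _ assms] by (induction m) auto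
 show "(derived ((GL n)\<lparr>carrier := H\<rparr>) ^^ m) H = (derived (GL n) ^^ m) H"
  using derived_consistent[OF 1 assms] by (induction m) auto
qed

lemma solvable_GL_iff:
 assumes "subgroup H (GL n)"
 shows "solvable ((GL n)\<lparr>carrier := H\<rparr>) \<longleftrightarrow> (\<exists>m. (derived (GL n) ^^ m) H = {1\<^sub>m n :: 'a::field mat})"
proof -
 interpret group "GL n :: 'a mat monoid" by (rule group_GL)
 interpret H: group "(GL n)\<lparr>carrier := H\<rparr>" by (rule subgroup.subgroup_is_group[OF assms group_GL])
 show ?thesis using H.solvable_iff_trivial_derived_seq derived_in_exp(2)[OF assms] by (simp add: one_GL)
qed

lemma derived_set_GL: assumes "H \<subseteq> GLm n"
 shows "derived_set (GL n) H = {a * b * minv a * minv b | a b. a \<in> H \<and> b \<in> (H :: 'a::field mat set)}"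
proof -
 have "a \<otimes>\<^bsub>GL n\<^esub> b \<otimes>\<^bsub>GL n\<^esub> inv\<^bsub>GL n\<^esub> a \<otimes>\<^bsub>GL n\<^esub> inv\<^bsub>GL n\<^esub> b = a * b * minv a * minv b" if "a \<in> H" "b \<in> H" for a b
 proof -
  have "a \<in> GLm n" "b \<in> GLm n" using that assms by blast+
  then show ?thesis unfolding mult_GL by (simp add: inv_GL)
 qed
 then show ?thesis by auto
qed

lemma derived_set_connected:
 assumes H: "subgroup H (GL n)" "connectedin (zariski n) H" and x: "x \<in> derived (GL n) H"
 shows "\<exists>C. connectedin (zariski n) C \<and> C \<subseteq> derived (GL n) H \<and> 1\<^sub>m n \<in> C \<and> (x :: 'a::field mat) \<in> C"
proof -
 interpret group "GL n :: 'a mat monoid" by (rule group_GL)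
 have D: "subgroup (derived (GL n) H) (GL n)" using derived_is_subgroup subgroup.subset[OF H(1)] by blast
 have comm: "\<exists>C. connectedin (zariski n) C \<and> C \<subseteq> derived (GL n) H \<and> 1\<^sub>m n \<in> C \<and> a * b * minv a * minv b \<in> C"
  if a: "a \<in> H" and b: "b \<in> H" for a b
 proof -
  have G: "g \<in> GLm n" if "g \<in> H" for g using that subgroup_GLm[OF H(1)] by blast
  let ?C = "(\<lambda>b. a * b * minv a * minv b) ` H"
  have "connectedin (zariski n) ?C"
   by (rule connectedin_continuous_map_image[OF continuous_commutator[OF G[OF a]] H(2)])
  moreover have "?C \<subseteq> derived (GL n) H"
  proof
   fix y assume "y \<in> ?C"
   then obtain b where b: "b \<in> H" "y = a * b * minv a * minv b" by blast
   have "y \<in> derived_set (GL n) H" unfolding derived_set_GL[OF subgroup.subset[OF H(1), unfolded carrier_GL]] using a b by blast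
   then show "y \<in> derived (GL n) H" unfolding derived_def by (rule generate.incl)
  qed
  moreover have "1\<^sub>m n \<in> ?C"
   using subgroup_one[OF H(1)] G[OF a] by (intro image_eqI[of _ _ "1\<^sub>m n"]) auto
  ultimately show ?thesis using b by blast
 qed
 have x: "x \<in> generate (GL n) (derived_set (GL n) H)" using x unfolding derived_def .
 show ?thesis using x
 proof (induction rule: generate.induct)
  case one
  have "1\<^sub>m n \<in> derived (GL n) H" by (rule subgroup_one[OF D])
  then show ?case unfolding one_GL by (intro exI[of _ "{1\<^sub>m n}"]) (auto simp: topspace_zariski)
 next
  case (incl h)
  then obtain a b where ab: "a \<in> H" "b \<in> H" "h = a * b * minv a * minv b"
   unfolding derived_set_GL[OF subgroup.subset[OF H(1), unfolded carrier_GL]] by blast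
  then show ?case using comm by blast
 next
  case (inv h)
  then obtain a b where ab: "a \<in> H" "b \<in> H" "h = a * b * minv a * minv b"
   unfolding derived_set_GL[OF subgroup.subset[OF H(1), unfolded carrier_GL]] by blast
  have G: "a \<in> GLm n" "b \<in> GLm n" using ab subgroup_GLm[OF H(1)] by auto
  then have "inv\<^bsub>GL n\<^esub> h = b * a * minv b * minv a" unfolding ab(3) by (subst inv_GL) (auto simp: minv_mult[of _ n])
  then show ?case using comm[OF ab(2,1)] by simp
 next
  case (eng x y)
  then obtain C C' where C: "connectedin (zariski n) C" "C \<subseteq> derived (GL n) H" "1\<^sub>m n \<in> C" "x \<in> C"
   and C': "connectedin (zariski n) C'" "C' \<subseteq> derived (GL n) H" "1\<^sub>m n \<in> C'" "y \<in> C'" by blast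
  have xG: "x \<in> GLm n" using C D subgroup_GLm by blast
  let ?E = "(\<lambda>g. x * g) ` C'"
  have xE: "x \<in> ?E" using C'(3) xG by (intro image_eqI[of _ _ "1\<^sub>m n"]) auto
  have "connectedin (zariski n) ?E"
   by (rule connectedin_continuous_map_image[OF continuous_left_mult[OF xG] C'(1)])
  then have "connectedin (zariski n) (C \<union> ?E)" using C(1) connectedin_Un xE C(4) by blast
  moreover have "?E \<subseteq> derived (GL n) H" using subgroup_mult[OF D] C C' by blast
  ultimately show ?case unfolding mult_GL using C C' by (intro exI[of _ "C \<union> ?E"]) auto
 qed
qed

text \<open>A commutator of \<open>a\<close> and \<open>b\<close> is joined to the identity by the commutators of \<open>a\<close> with the
 elements of the group, and products inherit such connections.\<close>

lemma derived_connected: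
 assumes H: "subgroup H (GL n)" "connectedin (zariski n) H"
 shows "connectedin (zariski n) (derived (GL n) (H :: 'a::field mat set))"
proof -
 define \<C> where "\<C> = {C. connectedin (zariski n) C \<and> C \<subseteq> derived (GL n) H \<and> 1\<^sub>m n \<in> C}"
 have "derived (GL n) H = \<Union>\<C>" unfolding \<C>_def using derived_set_connected[OF H] by blast
 moreover have "connectedin (zariski n) (\<Union>\<C>)"
  by (rule connectedin_Union) (auto simp: \<C>_def)
 ultimately show ?thesis by simp
qed

text \<open>The fibres of a regular function with finitely many values, here roots of unity of order \<open>N\<close>,
 are closed and cover the set, so a connected set lies in one of them.\<close>

lemma continuous_poly_constant:
 assumes C: "connectedin (zariski n) C" and \<phi>: "continuous_map (zariski n) (zariski n) \<phi>" and f: "f \<in> poly_fun n"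
  and N: "N > 0" "\<And>h. h \<in> C \<Longrightarrow> f (\<phi> h) ^ N = (1 :: 'a::field)" and gh: "g \<in> C" "h \<in> C"
 shows "f (\<phi> g) = f (\<phi> h)"
proof (rule ccontr)
 assume ne: "f (\<phi> g) \<noteq> f (\<phi> h)"
 have cl: "closedin (zariski n) {x \<in> GLm n. f' x = 0}" if "f' \<in> poly_fun n" for f' :: "'a mat \<Rightarrow> 'a"
  using closedin_zariski[of "{f'}" n] that by simp
 define F where "F = {c :: 'a. c ^ N = 1} - {f (\<phi> g)}"
 obtain N' where N': "N = Suc N'" using N(1) by (cases N) auto
 have "(monom 1 N + [:-1:] :: 'a poly) \<noteq> 0"
 proof
  assume "(monom 1 N + [:-1:] :: 'a poly) = 0"
  then have "coeff (monom 1 N + [:-1:] :: 'a poly) N = 0" by (simp only: coeff_0)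
  then show False unfolding N' coeff_add coeff_pCons_Suc by simp
 qed
 from poly_roots_finite[OF this] have finF: "finite F" unfolding F_def
  by (rule rev_finite_subset) (auto simp: poly_monom)
 define E1 where "E1 = {x \<in> GLm n. f x + (- f (\<phi> g)) = 0}"
 define E2 where "E2 = {x \<in> GLm n. (\<Prod>c\<in>F. f x + (- c)) = 0}"
 have "closedin (zariski n) E1" unfolding E1_def by (intro cl poly_fun.add f poly_fun.const)
 moreover have "closedin (zariski n) E2" unfolding E2_def by (intro cl poly_fun_prod poly_fun.add f poly_fun.const)
 moreover have im: "\<phi> ` C \<subseteq> GLm n"
  using continuous_map_image_subset_topspace[OF \<phi>] connectedin_subset_topspace[OF C] unfolding topspace_zariski by blast
 have v: "f (\<phi> x) \<in> insert (f (\<phi> g)) F" if "x \<in> C" for x using N(2)[OF that] unfolding F_def by blast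
 have "\<phi> ` C \<subseteq> E1 \<union> E2"
 proof
  fix y assume "y \<in> \<phi> ` C"
  then obtain x where x: "x \<in> C" "y = \<phi> x" by blast
  then show "y \<in> E1 \<union> E2" unfolding E1_def E2_def using v[OF x(1)] im finF by (auto simp: prod_zero_iff)
 qed
 moreover have "E1 \<inter> E2 = {}" unfolding E1_def E2_def using finF by (auto simp: prod_zero_iff F_def)
 moreover have "\<phi> g \<in> E1" unfolding E1_def using im gh by auto
 moreover have "\<phi> h \<in> E2" unfolding E2_def using im gh v[OF gh(2)] ne finF by (auto simp: prod_zero_iff)
 moreover have "connectedin (zariski n) (\<phi> ` C)" by (rule connectedin_continuous_map_image[OF \<phi> C])
 ultimately show False unfolding connectedin_closedin using gh by blast
qed

context frob_closure
begin

text \<open>Elements have finite order, so inverses are powers.\<close>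

lemma subgroup_of_monoid:
 assumes S: "S \<subseteq> GLm n" "1\<^sub>m n \<in> S" and mult: "\<And>g h. g \<in> S \<Longrightarrow> h \<in> S \<Longrightarrow> g * h \<in> S"
 shows "subgroup S (GL n :: 'k mat monoid)"
proof -
 have "minv g \<in> S" if g: "g \<in> S" for g
 proof -
  have G: "g \<in> GLm n" using g S by blast
  have p: "g ^\<^sub>m i \<in> S" for i using S g mult G by (induction i) auto
  obtain N where N: "N > 0" "g ^\<^sub>m N = 1\<^sub>m n" using finite_order[OF G] by blast
  have "g * g ^\<^sub>m (N - 1) = g ^\<^sub>m N" using pow_mat_add[of g n 1 "N - 1"] N(1) G by simp
  then have "minv g = g ^\<^sub>m (N - 1)" using minv_unique(2)[of g n "g ^\<^sub>m (N - 1)"] N G by simp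
  then show ?thesis using p by simp
 qed
 then show ?thesis unfolding subgroup_GL using assms by blast
qed

lemma Fil_subgroup: "subgroup (Fil n j) (GL n :: 'k mat monoid)"
 by (rule subgroup_of_monoid) (auto intro: Fil_one Fil_mult Fil_GLm)

lemma Dg_subgroup: "subgroup (Dg n) (GL n :: 'k mat monoid)"
 by (rule subgroup_of_monoid) (auto intro: Dg_one Dg_mult Dg_GLm)

lemma Fil_commutator: assumes g: "g \<in> Fil n j" and h: "h \<in> Fil n j"
 shows "g * (h * (minv g * minv h)) \<in> (Fil n (Suc j) :: 'k mat set)"
proof -
 define z where "z = minv (h * g)"
 have G: "g \<in> GLm n" "h \<in> GLm n" using g h Fil_GLm by auto
 have hg: "h * g \<in> Fil n j" by (rule Fil_mult[OF h g])
 have z: "z \<in> Fil n j" unfolding z_def by (rule subgroup_minv[OF Fil_subgroup hg])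
 have e: "g * (h * (minv g * minv h)) = (g * h) * z" unfolding z_def using G by (simp add: minv_mult)
 have i: "((g * h) * z) $$ (a, b) = (1\<^sub>m n) $$ (a, b)" if ab: "a < n" "b < n" "b < a + Suc j" for a b
 proof -
  have "((g * h) * z) $$ (a, b) = (\<Sum>s\<in>{..b}. (g * h) $$ (a, s) * z $$ (s, b))"
   by (rule upper_mult_index[OF _ Fil_Up[OF z] ab(1,2)]) (use G in simp)
  also have "\<dots> = (\<Sum>s\<in>{..b}. (h * g) $$ (a, s) * z $$ (s, b))"
   using Fil_commutator_eq[OF g h ab(1)] ab by (intro sum.cong) auto
  also have "\<dots> = ((h * g) * z) $$ (a, b)"
   by (rule upper_mult_index[OF _ Fil_Up[OF z] ab(1,2), symmetric]) (use G in simp)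
  also have "(h * g) * z = 1\<^sub>m n" unfolding z_def by (rule minv_right) (use G in simp)
  finally show ?thesis .
 qed
 have "(g * h) * z \<in> Fil n (Suc j)" unfolding Fil_def
 proof (intro CollectI conjI impI allI)
  show "(g * h) * z \<in> GLm n" using Fil_GLm[OF z] G by (intro mult_GLm)
 qed (simp_all only: i index_one_mat(1), auto)
 then show ?thesis unfolding e .
qed

lemma derived_cj_Fil: assumes Q: "Q \<in> GLm n"
 shows "derived (GL n) (cj n Q (Fil n j)) \<subseteq> (cj n Q (Fil n (Suc j)) :: 'k mat set)"
proof -
 interpret group "GL n :: 'k mat monoid" by (rule group_GL)
 have sub: "cj n Q (Fil n j) \<subseteq> GLm n" using cj_GLm by blast
 show ?thesis unfolding derived_def
 proof (rule generate_subgroup_incl[OF _ cj_subgroup[OF Fil_subgroup Q]])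
  show "derived_set (GL n) (cj n Q (Fil n j)) \<subseteq> cj n Q (Fil n (Suc j))"
  proof
   fix x assume "x \<in> derived_set (GL n) (cj n Q (Fil n j))"
   then obtain g h where gh: "g \<in> cj n Q (Fil n j)" "h \<in> cj n Q (Fil n j)" "x = g * h * minv g * minv h"
    unfolding derived_set_GL[OF sub] by blast
   have G: "g \<in> GLm n" "h \<in> GLm n" using gh cj_GLm by auto
   let ?g = "Q * (g * minv Q)" and ?h = "Q * (h * minv Q)"
   have "?g * (?h * (minv ?g * minv ?h)) \<in> Fil n (Suc j)"
    by (rule Fil_commutator) (use gh in \<open>simp_all add: cj_def del: massoc\<close>)
   moreover have "?g * (?h * (minv ?g * minv ?h)) = Q * (x * minv Q)"
    unfolding gh(3) minv_conj[OF Q G(1)] minv_conj[OF Q G(2)] using G Q by simp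
   moreover have "x \<in> GLm n" unfolding gh(3) using G by simp
   ultimately show "x \<in> cj n Q (Fil n (Suc j))" unfolding cj_def by simp
  qed
 qed
qed

text \<open>Each derived group lies one step deeper in the filtration.\<close>

lemma cj_Up_solvable: assumes Q: "Q \<in> GLm n" shows "solvable ((GL n)\<lparr>carrier := cj n Q (Up n) :: 'k mat set\<rparr>)"
proof -
 interpret group "GL n :: 'k mat monoid" by (rule group_GL)
 have S: "subgroup (cj n Q (Up n)) (GL n)" by (rule cj_subgroup[OF Fil_subgroup Q])
 have "(derived (GL n) ^^ j) (cj n Q (Up n)) \<subseteq> cj n Q (Fil n j)" for j
 proof (induction j)
  case (Suc j)
  then show ?case using mono_derived[OF Suc] derived_cj_Fil[OF Q, of j] by auto
 qed simp
 moreover have "cj n Q (Fil n (Suc n)) \<subseteq> {1\<^sub>m n}"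
 proof
  fix g assume g: "g \<in> cj n Q (Fil n (Suc n))"
  then have G: "g \<in> GLm n" and F: "Q * (g * minv Q) \<in> Fil n (Suc n)" by (auto simp: cj_def)
  have "Q * (g * minv Q) = 1\<^sub>m n" using F Q G unfolding Fil_def by (intro eq_matI) auto
  then have "minv Q * ((Q * (g * minv Q)) * Q) = 1\<^sub>m n" using Q by simp
  then show "g \<in> {1\<^sub>m n}" using G Q by simp
 qed
 moreover have "1\<^sub>m n \<in> (derived (GL n) ^^ Suc n) (cj n Q (Up n))"
  by (rule subgroup_one[OF exp_of_derived_is_subgroup[OF S]])
 ultimately have "(derived (GL n) ^^ Suc n) (cj n Q (Up n)) = {1\<^sub>m n}" by blast
 then show ?thesis using solvable_GL_iff[OF S] by blast
qed

lemma cj_closed_connected: assumes Q: "Q \<in> GLm n"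
 shows "closed_connected_subgroup n (cj n Q (Up n) :: 'k mat set)" "closed_connected_subgroup n (cj n Q (Dg n) :: 'k mat set)"
 unfolding closed_connected_subgroup_def
 using cj_subgroup[OF Fil_subgroup Q, of 0] cj_subgroup[OF Dg_subgroup Q] Zg_closed[OF Q] Zg_connected[OF Q infinite_k]
 unfolding cj_Up_Zg[OF Q] cj_Dg_Zg[OF Q] by blast+

end

section \<open>Common eigenvectors of connected solvable groups\<close>

definition subsp :: "nat \<Rightarrow> 'a::field vec set \<Rightarrow> bool" where
 "subsp d X \<longleftrightarrow> X \<subseteq> carrier_vec d \<and> (\<forall>v\<in>X. \<forall>w\<in>X. v + w \<in> X) \<and> (\<forall>c. \<forall>v\<in>X. c \<cdot>\<^sub>v v \<in> X)"

lemma subsp_carrier: "subsp d X \<Longrightarrow> v \<in> X \<Longrightarrow> v \<in> carrier_vec d" unfolding subsp_def by blast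
lemma subsp_add: "subsp d X \<Longrightarrow> v \<in> X \<Longrightarrow> w \<in> X \<Longrightarrow> v + w \<in> X" unfolding subsp_def by blast
lemma subsp_smult: "subsp d X \<Longrightarrow> v \<in> X \<Longrightarrow> c \<cdot>\<^sub>v v \<in> X" unfolding subsp_def by blast

lemma subsp_diff: assumes "subsp d X" "v \<in> X" "w \<in> X" shows "v - w \<in> X"
proof -
 have "v - w = v + (- 1) \<cdot>\<^sub>v w"
  using assms(2,3)[THEN subsp_carrier[OF assms(1)]] by (intro eq_vecI) auto
 then show ?thesis using subsp_add[OF assms(1,2) subsp_smult[OF assms(1,3)]] by simp
qed

lemma subsp_eigen:
 assumes X: "subsp d X" and A: "\<And>u. u \<in> U \<Longrightarrow> A u \<in> carrier_mat d d"
 shows "subsp d {v \<in> X. \<forall>u\<in>U. A u *\<^sub>v v = \<chi> u \<cdot>\<^sub>v v}"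
 unfolding subsp_def
proof (intro conjI ballI allI)
 fix v w assume "v \<in> {v \<in> X. \<forall>u\<in>U. A u *\<^sub>v v = \<chi> u \<cdot>\<^sub>v v}" "w \<in> {v \<in> X. \<forall>u\<in>U. A u *\<^sub>v v = \<chi> u \<cdot>\<^sub>v v}"
 then have v: "v \<in> X" "w \<in> X" "v \<in> carrier_vec d" "w \<in> carrier_vec d"
  "\<And>u. u \<in> U \<Longrightarrow> A u *\<^sub>v v = \<chi> u \<cdot>\<^sub>v v" "\<And>u. u \<in> U \<Longrightarrow> A u *\<^sub>v w = \<chi> u \<cdot>\<^sub>v w"
  using subsp_carrier[OF X] by auto
 have "A u *\<^sub>v (v + w) = \<chi> u \<cdot>\<^sub>v (v + w)" if u: "u \<in> U" for u
  using mult_add_distrib_mat_vec[OF A[OF u] v(3,4)] v(5,6)[OF u] smult_add_distrib_vec[OF v(3,4)] by simp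
 then show "v + w \<in> {v \<in> X. \<forall>u\<in>U. A u *\<^sub>v v = \<chi> u \<cdot>\<^sub>v v}" using subsp_add[OF X v(1,2)] by blast
next
 fix c v assume "v \<in> {v \<in> X. \<forall>u\<in>U. A u *\<^sub>v v = \<chi> u \<cdot>\<^sub>v v}"
 then have v: "v \<in> X" "v \<in> carrier_vec d" "\<And>u. u \<in> U \<Longrightarrow> A u *\<^sub>v v = \<chi> u \<cdot>\<^sub>v v"
  using subsp_carrier[OF X] by auto
 have "A u *\<^sub>v (c \<cdot>\<^sub>v v) = \<chi> u \<cdot>\<^sub>v (c \<cdot>\<^sub>v v)" if u: "u \<in> U" for u
  using mult_mat_vec[OF A[OF u] v(2)] v(3)[OF u] by (simp add: smult_smult_assoc mult.commute)
 then show "c \<cdot>\<^sub>v v \<in> {v \<in> X. \<forall>u\<in>U. A u *\<^sub>v v = \<chi> u \<cdot>\<^sub>v v}" using subsp_smult[OF X v(1)] by blast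
qed (use subsp_carrier[OF X] in blast)

text \<open>The positions of leading entries of vectors; a set of this kind replaces the dimension of a
 subspace (\<open>Piv_eq\<close>).\<close>

definition Piv :: "nat \<Rightarrow> 'a::field vec set \<Rightarrow> nat set" where
 "Piv d X = {i. i < d \<and> (\<exists>v\<in>X. v $ i \<noteq> 0 \<and> (\<forall>s<i. v $ s = 0))}"

lemma Piv_finite: "finite (Piv d X)" unfolding Piv_def by simp
lemma Piv_mono: "X \<subseteq> Y \<Longrightarrow> Piv d X \<subseteq> Piv d Y" unfolding Piv_def by blast

lemma Piv_eq: assumes X: "subsp d X" and Y: "subsp d Y" and XY: "X \<subseteq> Y" "X \<noteq> {}" and P: "Piv d Y \<subseteq> Piv d X"
 shows "X = Y"
proof
 show "Y \<subseteq> X"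
 proof
  fix y assume y: "y \<in> Y"
  have "\<exists>x\<in>X. \<forall>s<i. x $ s = y $ s" if "i \<le> d" for i using that
  proof (induction i)
   case 0 then show ?case using XY(2) by blast
  next
   case (Suc i)
   then obtain x where x: "x \<in> X" "\<forall>s<i. x $ s = y $ s" by auto
   show ?case
   proof (cases "x $ i = y $ i")
    case True then show ?thesis using x by (metis less_Suc_eq)
   next
    case False
    have c: "x \<in> carrier_vec d" "y \<in> carrier_vec d" using x y subsp_carrier X Y by blast+
    have "y - x \<in> Y" using subsp_diff[OF Y y] x XY by blast
    then have "i \<in> Piv d Y" unfolding Piv_def using False x(2) Suc.prems c by (auto intro!: bexI[of _ "y - x"])
    then obtain z where z: "z \<in> X" "z $ i \<noteq> 0" "\<forall>s<i. z $ s = 0" using P unfolding Piv_def by auto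
    have zc: "z \<in> carrier_vec d" using z subsp_carrier X by blast
    define t where "t = (y $ i - x $ i) / z $ i"
    have "x + t \<cdot>\<^sub>v z \<in> X" using subsp_add[OF X x(1) subsp_smult[OF X z(1)]] .
    moreover have "(x + t \<cdot>\<^sub>v z) $ s = y $ s" if "s < Suc i" for s
     using that x(2) z c zc Suc.prems by (cases "s = i") (auto simp: t_def)
    ultimately show ?thesis by blast
   qed
  qed
  from this[of d] obtain x where "x \<in> X" "\<forall>s<d. x $ s = y $ s" by auto
  moreover have "x = y" using calculation subsp_carrier[OF X] subsp_carrier[OF Y y] by (intro eq_vecI) auto
  ultimately show "y \<in> X" by simp
 qed
qed (rule XY(1))

text \<open>Applies the product of the factors \<open>A - c\<close> for \<open>c\<close> in a list.\<close>

fun root_chain :: "'a::field mat \<Rightarrow> 'a list \<Rightarrow> 'a vec \<Rightarrow> 'a vec" where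
 "root_chain A [] v = v"
| "root_chain A (c # cs) v = root_chain A cs (A *\<^sub>v v - c \<cdot>\<^sub>v v)"

lemma root_chain_eigen:
 assumes A: "A \<in> carrier_mat d d" and X: "subsp d X" "\<And>v. v \<in> X \<Longrightarrow> A *\<^sub>v v \<in> X"
 shows "v \<in> X \<Longrightarrow> v \<noteq> 0\<^sub>v d \<Longrightarrow> root_chain A cs v = 0\<^sub>v d \<Longrightarrow> \<exists>w\<in>X. w \<noteq> 0\<^sub>v d \<and> (\<exists>c. A *\<^sub>v w = c \<cdot>\<^sub>v w)"
proof (induction cs arbitrary: v)
 case (Cons c cs)
 have vc: "v \<in> carrier_vec d" by (rule subsp_carrier[OF X(1) Cons.prems(1)])
 show ?case
 proof (cases "A *\<^sub>v v - c \<cdot>\<^sub>v v = 0\<^sub>v d")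
  case True
  have "A *\<^sub>v v = c \<cdot>\<^sub>v v"
  proof (rule eq_vecI)
   fix i assume "i < dim_vec (c \<cdot>\<^sub>v v)"
   then show "(A *\<^sub>v v) $ i = (c \<cdot>\<^sub>v v) $ i" using arg_cong[OF True, of "\<lambda>w. w $ i"] vc A by simp
  qed (use A vc in auto)
  then show ?thesis using Cons.prems by blast
 next
  case False
  then show ?thesis using Cons.IH[OF subsp_diff[OF X(1) X(2) subsp_smult[OF X(1)]]] Cons.prems by simp
 qed
qed simp

lemma root_chain_poly:
 assumes A: "A \<in> carrier_mat d d"
 shows "v \<in> carrier_vec d \<Longrightarrow> root_chain A cs v =
  lv d {..length cs} (coeff (\<Prod>c\<leftarrow>cs. [:- c, 1:])) (\<lambda>i. A ^\<^sub>m i *\<^sub>v v)"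
proof (induction cs arbitrary: v)
 case Nil
 then show ?case using A by (intro eq_vecI) (auto simp: lv_def)
next
 case (Cons c cs)
 define P where "P = (\<Prod>c\<leftarrow>cs. [:- c, 1:])"
 define N where "N = length cs"
 have deg: "coeff P (Suc N) = 0"
 proof (rule coeff_eq_0)
  have "degree P \<le> length cs" unfolding P_def by (simp add: degree_linear_factors)
  then show "degree P < Suc N" by (simp add: N_def)
 qed
 let ?w = "A *\<^sub>v v - c \<cdot>\<^sub>v v"
 have wc: "?w \<in> carrier_vec d" using A Cons.prems by simp
 have Aw: "A ^\<^sub>m i *\<^sub>v ?w = A ^\<^sub>m (Suc i) *\<^sub>v v - c \<cdot>\<^sub>v (A ^\<^sub>m i *\<^sub>v v)" for i
  using A Cons.prems by (simp add: mult_minus_distrib_mat_vec[of _ d d] mult_mat_vec[of _ d d])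
 have "root_chain A (c # cs) v = lv d {..N} (coeff P) (\<lambda>i. A ^\<^sub>m (Suc i) *\<^sub>v v - c \<cdot>\<^sub>v (A ^\<^sub>m i *\<^sub>v v))"
  using Cons.IH[OF wc] by (simp add: Aw P_def N_def)
 also have "\<dots> = lv d {..Suc N} (coeff ([:- c, 1:] * P)) (\<lambda>i. A ^\<^sub>m i *\<^sub>v v)"
 proof (rule eq_vecI)
  fix r assume "r < dim_vec (lv d {..Suc N} (coeff ([:- c, 1:] * P)) (\<lambda>i. A ^\<^sub>m i *\<^sub>v v))"
  then have r: "r < d" by simp
  define f where "f i = (A ^\<^sub>m i *\<^sub>v v) $ r" for i
  have cf: "coeff ([:- c, 1:] * P) (Suc i) = coeff P i - c * coeff P (Suc i)"
   "coeff ([:- c, 1:] * P) 0 = - c * coeff P 0" for i by simp_all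
  have "lv d {..N} (coeff P) (\<lambda>i. A ^\<^sub>m (Suc i) *\<^sub>v v - c \<cdot>\<^sub>v (A ^\<^sub>m i *\<^sub>v v)) $ r =
   (\<Sum>i\<le>N. coeff P i * f (Suc i)) - c * (\<Sum>i\<le>N. coeff P i * f i)"
   using r A Cons.prems by (simp add: lv_def f_def sum_distrib_left algebra_simps flip: sum_subtractf)
  also have "(\<Sum>i\<le>N. coeff P i * f i) = coeff P 0 * f 0 + (\<Sum>i\<le>N. coeff P (Suc i) * f (Suc i))"
   using sum.atMost_Suc_shift[of "\<lambda>i. coeff P i * f i" N] deg by simp
  also have "(\<Sum>i\<le>N. coeff P i * f (Suc i)) - c * (coeff P 0 * f 0 + (\<Sum>i\<le>N. coeff P (Suc i) * f (Suc i))) =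
   (\<Sum>i\<le>Suc N. coeff ([:- c, 1:] * P) i * f i)"
   unfolding sum.atMost_Suc_shift cf by (simp add: algebra_simps sum_distrib_left sum_subtractf)
  finally show "lv d {..N} (coeff P) (\<lambda>i. A ^\<^sub>m (Suc i) *\<^sub>v v - c \<cdot>\<^sub>v (A ^\<^sub>m i *\<^sub>v v)) $ r =
   lv d {..Suc N} (coeff ([:- c, 1:] * P)) (\<lambda>i. A ^\<^sub>m i *\<^sub>v v) $ r" using r by (simp add: lv_def f_def)
 qed simp
 finally show ?case unfolding P_def N_def by (simp only: list.map prod_list.Cons list.size(4) add_0_right add_Suc_right One_nat_def)
qed

text \<open>The product of the \<open>A - c\<close> over all \<open>N\<close>-th roots of unity \<open>c\<close>, with multiplicity, is \<open>A ^ N - 1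
 = 0\<close>; applied to \<open>v\<close> factor by factor, it meets an eigenvector before it reaches 0.\<close>

lemma eigenvector_finite_order:
 fixes A :: "'a::alg_closed_field mat"
 assumes A: "A \<in> carrier_mat d d" "A ^\<^sub>m N = 1\<^sub>m d" "N > 0" and X: "subsp d X" "\<And>v. v \<in> X \<Longrightarrow> A *\<^sub>v v \<in> X"
  and v: "v \<in> X" "v \<noteq> 0\<^sub>v d"
 shows "\<exists>w\<in>X. w \<noteq> 0\<^sub>v d \<and> (\<exists>c. A *\<^sub>v w = c \<cdot>\<^sub>v w)"
proof -
 define P :: "'a poly" where "P = monom 1 N - 1"
 have cP: "coeff P i = (if i = N then 1 else if i = 0 then - 1 else 0)" for i
  using A(3) unfolding P_def by (auto simp: coeff_diff)
 have "degree P = N"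
 proof (rule antisym)
  show "degree P \<le> N" by (rule degree_le) (simp add: cP)
  show "N \<le> degree P" by (rule le_degree) (simp add: cP)
 qed
 then have lc: "lead_coeff P = 1" using cP[of N] by simp
 then have P0: "P \<noteq> 0" by (metis coeff_0 zero_neq_one)
 obtain M where M: "P = smult (lead_coeff P) (\<Prod>x\<in>#M. [:- x, 1:])" "size M = degree P"
  using alg_closed_imp_factorization[OF P0] by blast
 obtain cs where cs: "mset cs = M" using ex_mset by blast
 have P: "P = (\<Prod>c\<leftarrow>cs. [:- c, 1:])" "length cs = N"
  using M(1)[unfolded lc] M(2) \<open>degree P = N\<close> by (simp_all add: cs[symmetric] prod_mset_prod_list[symmetric] del: prod_mset_prod_list)
 have vc: "v \<in> carrier_vec d" by (rule subsp_carrier[OF X(1) v(1)])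
 have "root_chain A cs v = lv d {..N} (coeff P) (\<lambda>i. A ^\<^sub>m i *\<^sub>v v)"
  using root_chain_poly[OF A(1) vc, of cs] P by simp
 also have "\<dots> = 0\<^sub>v d"
 proof (rule eq_vecI)
  fix r assume "r < dim_vec (0\<^sub>v d :: 'a vec)"
  then have r: "r < d" by simp
  have "(\<Sum>i\<le>N. coeff P i * (A ^\<^sub>m i *\<^sub>v v) $ r) = (\<Sum>i\<in>{0, N}. coeff P i * (A ^\<^sub>m i *\<^sub>v v) $ r)"
   by (rule sum.mono_neutral_right) (auto simp: cP)
  also have "\<dots> = 0" using A vc r cP by simp
  finally show "lv d {..N} (coeff P) (\<lambda>i. A ^\<^sub>m i *\<^sub>v v) $ r = 0\<^sub>v d $ r" using r by (simp add: lv_def)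
 qed simp
 finally show ?thesis using root_chain_eigen[OF A(1) X v] by blast
qed

text \<open>A representation of dimension \<open>d\<close> of a subgroup of the general linear group, given by
 polynomials. Passing from the group to its action on a quotient space stays within this
 notion.\<close>

definition rep :: "nat \<Rightarrow> nat \<Rightarrow> 'a::field mat set \<Rightarrow> ('a mat \<Rightarrow> 'a mat) \<Rightarrow> bool" where
 "rep n d \<Gamma> R \<longleftrightarrow> subgroup \<Gamma> (GL n) \<and> (\<forall>g\<in>\<Gamma>. R g \<in> carrier_mat d d) \<and>
  (\<forall>g\<in>\<Gamma>. \<forall>h\<in>\<Gamma>. R (g * h) = R g * R h) \<and> R (1\<^sub>m n) = 1\<^sub>m d \<and>
  (\<forall>i<d. \<forall>j<d. (\<lambda>g. R g $$ (i, j)) \<in> poly_fun n)"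

lemma repD: assumes "rep n d \<Gamma> R"
 shows "subgroup \<Gamma> (GL n)" "\<And>g. g \<in> \<Gamma> \<Longrightarrow> R g \<in> carrier_mat d d"
  "\<And>g h. g \<in> \<Gamma> \<Longrightarrow> h \<in> \<Gamma> \<Longrightarrow> R (g * h) = R g * R h" "R (1\<^sub>m n) = 1\<^sub>m d"
  "\<And>i j. i < d \<Longrightarrow> j < d \<Longrightarrow> (\<lambda>g. R g $$ (i, j)) \<in> poly_fun n"
 using assms unfolding rep_def by auto

lemma rep_vec: assumes "rep n d \<Gamma> R" "g \<in> \<Gamma>" "h \<in> \<Gamma>" "v \<in> carrier_vec d"
 shows "R (g * h) *\<^sub>v v = R g *\<^sub>v (R h *\<^sub>v v)"
 using repD(3)[OF assms(1-3)] repD(2)[OF assms(1,2)] repD(2)[OF assms(1,3)] assms(4) by simp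

lemma subgroup_pow: assumes "subgroup \<Gamma> (GL n)" "u \<in> \<Gamma>" shows "u ^\<^sub>m i \<in> \<Gamma>"
 using subgroup_one[OF assms(1)] subgroup_mult[OF assms(1) _ assms(2)] subgroup_GLm[OF assms]
 by (induction i) auto

lemma rep_pow_eig: assumes R: "rep n d \<Gamma> R" and u: "u \<in> \<Gamma>" and v: "v \<in> carrier_vec d" "R u *\<^sub>v v = c \<cdot>\<^sub>v v"
 shows "R (u ^\<^sub>m i) *\<^sub>v v = c ^ i \<cdot>\<^sub>v v"
proof (induction i)
 case 0 then show ?case using repD(4)[OF R] subgroup_GLm[OF repD(1)[OF R] u] v(1) by simp
next
 case (Suc i)
 have p: "u ^\<^sub>m i \<in> \<Gamma>" by (rule subgroup_pow[OF repD(1)[OF R] u])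
 have "R (u ^\<^sub>m Suc i) *\<^sub>v v = R (u ^\<^sub>m i) *\<^sub>v (c \<cdot>\<^sub>v v)" using rep_vec[OF R p u v(1)] v(2) by simp
 also have "\<dots> = c \<cdot>\<^sub>v (c ^ i \<cdot>\<^sub>v v)" using mult_mat_vec[OF repD(2)[OF R p] v(1)] Suc by simp
 finally show ?case by (simp add: smult_smult_assoc)
qed

lemma smult_vec_eqD: assumes "c \<cdot>\<^sub>v v = c' \<cdot>\<^sub>v v" "v \<in> carrier_vec d" "v \<noteq> 0\<^sub>v d" shows "c = (c' :: 'a::field)"
proof -
 obtain i where i: "i < d" "v $ i \<noteq> 0" using assms(2,3) by (metis eq_vecI carrier_vecD index_zero_vec)
 have "(c \<cdot>\<^sub>v v) $ i = (c' \<cdot>\<^sub>v v) $ i" using assms(1) by simp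
 then show ?thesis using i assms(2) by simp
qed

lemma rep_eig_order: assumes R: "rep n d \<Gamma> R" and u: "u \<in> \<Gamma>" "u ^\<^sub>m N = 1\<^sub>m n"
 and v: "v \<in> carrier_vec d" "v \<noteq> 0\<^sub>v d" "R u *\<^sub>v v = c \<cdot>\<^sub>v v"
 shows "c ^ N = (1 :: 'a::field)"
proof -
 have "c ^ N \<cdot>\<^sub>v v = 1 \<cdot>\<^sub>v v" using rep_pow_eig[OF R u(1) v(1,3), of N] u(2) repD(4)[OF R] v(1) by simp
 then show ?thesis using smult_vec_eqD v by blast
qed

text \<open>Read off at a nonzero coordinate of \<open>v\<close>, the eigenvalue is a regular function, and its values
 are roots of unity.\<close>

lemma rep_scalar_const:
 assumes R: "rep n d \<Gamma> R" and C: "connectedin (zariski n) C" and \<phi>: "continuous_map (zariski n) (zariski n) \<phi>"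
  "\<And>h. h \<in> C \<Longrightarrow> \<phi> h \<in> \<Gamma>" and v: "v \<in> carrier_vec d" "v \<noteq> 0\<^sub>v d" "\<And>h. h \<in> C \<Longrightarrow> R (\<phi> h) *\<^sub>v v = \<chi> h \<cdot>\<^sub>v v"
  and N: "N > 0" "\<And>h. h \<in> C \<Longrightarrow> \<chi> h ^ N = (1 :: 'a::field)" and gh: "g \<in> C" "h \<in> C"
 shows "\<chi> g = \<chi> h"
proof -
 obtain i where i: "i < d" "v $ i \<noteq> 0" using v(1,2) by (metis eq_vecI carrier_vecD index_zero_vec)
 define f where "f g = (\<Sum>s<d. R g $$ (i, s) * (v $ s / v $ i))" for g
 have f: "f \<in> poly_fun n" unfolding f_def[abs_def]
  by (intro poly_fun_sum poly_fun.mult poly_fun.const repD(5)[OF R]) (use i in auto)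
 have e: "f (\<phi> h) = \<chi> h" if h: "h \<in> C" for h
 proof -
  have "f (\<phi> h) = (R (\<phi> h) *\<^sub>v v) $ i / v $ i"
   unfolding mult_mat_vec_index[OF repD(2)[OF R \<phi>(2)[OF h]] v(1) i(1)] f_def by (simp add: sum_divide_distrib)
  also have "\<dots> = \<chi> h" unfolding v(3)[OF h] using i v(1) by simp
  finally show ?thesis .
 qed
 have "f (\<phi> g) = f (\<phi> h)" by (rule continuous_poly_constant[OF C \<phi>(1) f N(1) _ gh]) (simp add: e N(2))
 then show ?thesis using e gh by simp
qed

lemma continuous_conj: assumes "u \<in> GLm n"
 shows "continuous_map (zariski n) (zariski n) (\<lambda>h. minv h * u * h :: 'a::field mat)"
 using assms by (intro continuous_regular regf_mat_mult regf_const regf_entry regf_minv mult_GLm minv_GLm)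

context frob_closure
begin

text \<open>On a minimal nonzero invariant subspace each element acts as a scalar, since its eigenspaces are
 invariant under the others.\<close>

lemma commuting_eigenvector:
 fixes R :: "'k mat \<Rightarrow> 'k mat"
 assumes R: "rep n d \<Gamma> R" and X: "subsp d X" "v \<in> X" "v \<noteq> 0\<^sub>v d" "\<And>h v. h \<in> H \<Longrightarrow> v \<in> X \<Longrightarrow> R h *\<^sub>v v \<in> X"
  and H: "H \<subseteq> \<Gamma>" and comm: "\<And>a b v. a \<in> H \<Longrightarrow> b \<in> H \<Longrightarrow> v \<in> X \<Longrightarrow> R a *\<^sub>v (R b *\<^sub>v v) = R b *\<^sub>v (R a *\<^sub>v v)"
 shows "\<exists>v\<in>X. v \<noteq> 0\<^sub>v d \<and> (\<forall>h\<in>H. \<exists>c. R h *\<^sub>v v = c \<cdot>\<^sub>v v)"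
proof -
 define P where "P Y \<longleftrightarrow> subsp d Y \<and> Y \<subseteq> X \<and> (\<exists>v\<in>Y. v \<noteq> 0\<^sub>v d) \<and> (\<forall>h\<in>H. \<forall>v\<in>Y. R h *\<^sub>v v \<in> Y)" for Y
 have "P X" unfolding P_def using X by blast
 \<comment> \<open>a nonzero invariant subspace with as few leading positions as possible\<close>
 then obtain Y where Y: "P Y" "\<And>Z. P Z \<Longrightarrow> card (Piv d Y) \<le> card (Piv d Z)"
  using ex_has_least_nat[of P X "\<lambda>Y. card (Piv d Y)"] by blast
 have Ys: "subsp d Y" "Y \<subseteq> X" "\<And>h v. h \<in> H \<Longrightarrow> v \<in> Y \<Longrightarrow> R h *\<^sub>v v \<in> Y" using Y(1) unfolding P_def by auto
 obtain v where v: "v \<in> Y" "v \<noteq> 0\<^sub>v d" using Y(1) unfolding P_def by blast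
 have "\<exists>c. R a *\<^sub>v v = c \<cdot>\<^sub>v v" if a: "a \<in> H" for a
 proof -
  have a': "a \<in> \<Gamma>" using a H by blast
  have Ra: "R a \<in> carrier_mat d d" by (rule repD(2)[OF R a'])
  obtain N where N: "N > 0" "a ^\<^sub>m N = 1\<^sub>m n" using finite_order[OF subgroup_GLm[OF repD(1)[OF R] a']] by blast
  have Rp: "R (a ^\<^sub>m i) = R a ^\<^sub>m i" for i
  proof (induction i)
   case 0 then show ?case using Ra repD(4)[OF R] subgroup_GLm[OF repD(1)[OF R] a'] by simp
  next
   case (Suc i) then show ?case using repD(3)[OF R subgroup_pow[OF repD(1)[OF R] a'] a'] by simp
  qed
  have "R a ^\<^sub>m N = 1\<^sub>m d" using Rp[of N] N(2) repD(4)[OF R] by simp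
  then obtain w c where w: "w \<in> Y" "w \<noteq> 0\<^sub>v d" "R a *\<^sub>v w = c \<cdot>\<^sub>v w"
   using eigenvector_finite_order[OF Ra _ N(1) Ys(1) Ys(3)[OF a] v] by blast
  define Z where "Z = {v \<in> Y. \<forall>u\<in>{a}. R u *\<^sub>v v = c \<cdot>\<^sub>v v}"
  have Zs: "subsp d Z" unfolding Z_def by (rule subsp_eigen[OF Ys(1)]) (use Ra in simp)
  have st: "R h *\<^sub>v v \<in> Z" if h: "h \<in> H" and v: "v \<in> Z" for h v
  proof -
   have v': "v \<in> Y" "R a *\<^sub>v v = c \<cdot>\<^sub>v v" using v unfolding Z_def by auto
   have Rh: "R h \<in> carrier_mat d d" using repD(2)[OF R] h H by blast
   have "R a *\<^sub>v (R h *\<^sub>v v) = R h *\<^sub>v (c \<cdot>\<^sub>v v)" using comm[OF a h] v' Ys(2) by auto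
   also have "\<dots> = c \<cdot>\<^sub>v (R h *\<^sub>v v)" by (rule mult_mat_vec[OF Rh subsp_carrier[OF Ys(1) v'(1)]])
   finally show ?thesis unfolding Z_def using Ys(3)[OF h v'(1)] by simp
  qed
  have wZ: "w \<in> Z" using w unfolding Z_def by simp
  have ZY: "Z \<subseteq> Y" unfolding Z_def by blast
  have "P Z" unfolding P_def using Zs ZY Ys(2) wZ w(2) st by blast
  then have "card (Piv d Y) \<le> card (Piv d Z)" by (rule Y(2))
  then have "Piv d Z = Piv d Y" by (intro card_seteq Piv_finite Piv_mono[OF ZY])
  then have "Z = Y" by (intro Piv_eq[OF Zs Ys(1) ZY]) (use wZ in auto)
  then have "v \<in> Z" using v by simp
  then show ?thesis unfolding Z_def by blast
 qed
 then show ?thesis using v Ys(2) by blast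
qed

text \<open>By induction on the derived length. The derived group \<open>D\<close> is connected and has a common
 eigenvector, with character \<open>\<chi>\<close> say; let \<open>Y\<close> be the corresponding weight space. For \<open>u\<close> in \<open>D\<close>
 the value of \<open>\<chi>\<close> at conjugates of \<open>u\<close> is a root of unity of bounded order, hence constant, so
 \<open>Y\<close> is stable under the group. On \<open>Y\<close> a commutator of \<open>a\<close> and \<open>b\<close> acts as a scalar \<open>r\<close>, so a
 conjugate of the inverse of \<open>a\<close> equals \<open>r\<close> times this inverse; therefore \<open>r\<close> is a root of
 unity of order dividing that of \<open>a\<close>, hence independent of \<open>b\<close>, and equal to 1. So the group
 acts on \<open>Y\<close> through commuting operators.\<close>

lemma lie_kolchin:
 fixes R :: "'k mat \<Rightarrow> 'k mat"
 assumes R: "rep n d \<Gamma> R"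
 shows "subgroup H (GL n) \<Longrightarrow> H \<subseteq> \<Gamma> \<Longrightarrow> connectedin (zariski n) H \<Longrightarrow> (derived (GL n) ^^ m) H = {1\<^sub>m n} \<Longrightarrow>
  subsp d X \<Longrightarrow> v \<in> X \<Longrightarrow> v \<noteq> 0\<^sub>v d \<Longrightarrow> (\<And>h v. h \<in> H \<Longrightarrow> v \<in> X \<Longrightarrow> R h *\<^sub>v v \<in> X) \<Longrightarrow>
  \<exists>v\<in>X. v \<noteq> 0\<^sub>v d \<and> (\<forall>h\<in>H. \<exists>c. R h *\<^sub>v v = c \<cdot>\<^sub>v v)"
proof (induction m arbitrary: H)
 case 0
 have "R (1\<^sub>m n) *\<^sub>v v = 1 \<cdot>\<^sub>v v" using repD(4)[OF R] subsp_carrier[OF 0(5,6)] by simp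
 moreover have "H = {1\<^sub>m n}" using 0(4) by simp
 ultimately have "\<forall>h\<in>H. \<exists>c. R h *\<^sub>v v = c \<cdot>\<^sub>v v" by blast
 then show ?case using 0(6,7) by blast
next
 case (Suc m)
 note H = Suc.prems(1) and H\<Gamma> = Suc.prems(2) and X = Suc.prems(5) and stX = Suc.prems(8)
 interpret group "GL n :: 'k mat monoid" by (rule group_GL)
 define D where "D = derived (GL n) H"
 have D: "subgroup D (GL n)" unfolding D_def using derived_is_subgroup[OF subgroup.subset[OF H]] .
 have DH: "D \<subseteq> H" unfolding D_def using derived_incl[OF _ H] by blast
 have "(derived (GL n) ^^ m) D = {1\<^sub>m n}" using Suc.prems(4) unfolding D_def by (simp only: funpow_Suc_right o_apply)
 then have "\<exists>v\<in>X. v \<noteq> 0\<^sub>v d \<and> (\<forall>h\<in>D. \<exists>c. R h *\<^sub>v v = c \<cdot>\<^sub>v v)"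
  using Suc.IH[OF D _ _ _ X Suc.prems(6,7)] derived_connected[OF H Suc.prems(3)] DH H\<Gamma> stX
  unfolding D_def by blast
 then obtain v0 \<chi> where v0: "v0 \<in> X" "v0 \<noteq> 0\<^sub>v d" "\<And>u. u \<in> D \<Longrightarrow> R u *\<^sub>v v0 = \<chi> u \<cdot>\<^sub>v v0" by metis
 have v0c: "v0 \<in> carrier_vec d" by (rule subsp_carrier[OF X v0(1)])
 define Y where "Y = {v \<in> X. \<forall>u\<in>D. R u *\<^sub>v v = \<chi> u \<cdot>\<^sub>v v}"
 have G: "g \<in> GLm n" if "g \<in> H" for g using that subgroup_GLm[OF H] by blast
 have Rc: "R u \<in> carrier_mat d d" if "u \<in> H" for u using that repD(2)[OF R] H\<Gamma> by blast
 have Ys: "subsp d Y" unfolding Y_def by (rule subsp_eigen[OF X]) (use Rc DH in blast)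
 have v0Y: "v0 \<in> Y" unfolding Y_def using v0 by blast
 have comD: "a * b * minv a * minv b \<in> D" if "a \<in> H" "b \<in> H" for a b
  unfolding D_def derived_def derived_set_GL[OF subgroup.subset[OF H, unfolded carrier_GL]]
  by (rule generate.incl) (use that in blast)
 have cjD: "minv h * u * h \<in> D" if h: "h \<in> H" and u: "u \<in> D" for h u
 proof -
  have uH: "u \<in> H" using u DH by blast
  have "u * (minv u * minv h * minv (minv u) * minv (minv h)) \<in> D"
   by (rule subgroup_mult[OF D u comD]) (use h uH subgroup_minv[OF H] in auto)
  moreover have "u * (minv u * minv h * minv (minv u) * minv (minv h)) = minv h * u * h"
   using G[OF h] G[OF uH] by simp
  ultimately show ?thesis by simp
 qed
 have one: "1\<^sub>m n \<in> H" by (rule subgroup_one[OF H])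
 have chi_conj: "\<chi> (minv h * u * h) = \<chi> u" if h: "h \<in> H" and u: "u \<in> D" for h u
 proof -
  have uG: "u \<in> GLm n" using u DH G by blast
  obtain N where N: "N > 0" "u ^\<^sub>m N = 1\<^sub>m n" using finite_order[OF uG] by blast
  have "\<chi> (minv h * u * h) = \<chi> (minv (1\<^sub>m n) * u * 1\<^sub>m n)"
  proof (rule rep_scalar_const[OF R Suc.prems(3) continuous_conj[OF uG] _ v0c v0(2) _ N(1) _ h one])
   fix g assume g: "g \<in> H"
   have gu: "minv g * u * g \<in> D" by (rule cjD[OF g u])
   show "minv g * u * g \<in> \<Gamma>" using gu DH H\<Gamma> by blast
   show "R (minv g * u * g) *\<^sub>v v0 = \<chi> (minv g * u * g) \<cdot>\<^sub>v v0" by (rule v0(3)[OF gu])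
   have "(minv g * u * minv (minv g)) ^\<^sub>m N = minv g * u ^\<^sub>m N * minv (minv g)"
    by (rule pow_mat_conj[of _ n]) (use uG G[OF g] in simp_all)
   then have "(minv g * u * g) ^\<^sub>m N = 1\<^sub>m n" unfolding N(2) using G[OF g] by simp
   then show "\<chi> (minv g * u * g) ^ N = 1"
    using rep_eig_order[OF R _ _ v0c v0(2) v0(3)[OF gu]] gu DH H\<Gamma> by blast
  qed
  then show ?thesis using uG by simp
 qed
 have stY: "R h *\<^sub>v v \<in> Y" if h: "h \<in> H" and v: "v \<in> Y" for h v
 proof -
  have v': "v \<in> X" "v \<in> carrier_vec d" using v subsp_carrier[OF X] unfolding Y_def by auto
  have "R u *\<^sub>v (R h *\<^sub>v v) = \<chi> u \<cdot>\<^sub>v (R h *\<^sub>v v)" if u: "u \<in> D" for u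
  proof -
   have uH: "u \<in> H" using u DH by blast
   have c: "minv h * u * h \<in> D" by (rule cjD[OF h u])
   have in\<Gamma>: "u \<in> \<Gamma>" "h \<in> \<Gamma>" "minv h * u * h \<in> \<Gamma>" using c uH h DH H\<Gamma> by auto
   have "R u *\<^sub>v (R h *\<^sub>v v) = R (u * h) *\<^sub>v v" using rep_vec[OF R in\<Gamma>(1,2) v'(2)] by simp
   also have "u * h = h * (minv h * u * h)" using G[OF h] G[OF uH] by simp
   also have "R (h * (minv h * u * h)) *\<^sub>v v = R h *\<^sub>v (R (minv h * u * h) *\<^sub>v v)"
    by (rule rep_vec[OF R in\<Gamma>(2,3) v'(2)])
   also have "R (minv h * u * h) *\<^sub>v v = \<chi> u \<cdot>\<^sub>v v" using v c chi_conj[OF h u] unfolding Y_def by auto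
   also have "R h *\<^sub>v (\<chi> u \<cdot>\<^sub>v v) = \<chi> u \<cdot>\<^sub>v (R h *\<^sub>v v)" by (rule mult_mat_vec[OF Rc[OF h] v'(2)])
   finally show ?thesis .
  qed
  then show ?thesis unfolding Y_def using stX[OF h v'(1)] by blast
 qed
 have chi_comm: "\<chi> (a * b * minv a * minv b) = 1" if a: "a \<in> H" and b: "b \<in> H" for a b
 proof -
  obtain N where N: "N > 0" "minv a ^\<^sub>m N = 1\<^sub>m n" using finite_order[OF minv_GLm[OF G[OF a]]] by blast
  have ma: "minv a \<in> H" by (rule subgroup_minv[OF H a])
  have root: "\<chi> (a * b * minv a * minv b) ^ N = 1" if b: "b \<in> H" for b
  proof -
   define r where "r = \<chi> (a * b * minv a * minv b)"
   \<comment> \<open>a conjugate of the inverse of \<open>a\<close>, hence of the same order\<close>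
   define w where "w = b * minv a * minv b"
   have w: "w \<in> H" unfolding w_def by (intro subgroup_mult[OF H] subgroup_minv[OF H] a b)
   have we: "w = minv a * (a * b * minv a * minv b)" unfolding w_def using G[OF a] G[OF b] by simp
   have Rw: "R w *\<^sub>v v = r \<cdot>\<^sub>v (R (minv a) *\<^sub>v v)" if v: "v \<in> Y" for v
   proof -
    have vc: "v \<in> carrier_vec d" by (rule subsp_carrier[OF Ys v])
    have "R w *\<^sub>v v = R (minv a) *\<^sub>v (R (a * b * minv a * minv b) *\<^sub>v v)"
     unfolding we by (rule rep_vec[OF R _ _ vc]) (use ma comD[OF a b] DH H\<Gamma> in auto)
    also have "R (a * b * minv a * minv b) *\<^sub>v v = r \<cdot>\<^sub>v v" unfolding r_def using v comD[OF a b] unfolding Y_def by auto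
    also have "R (minv a) *\<^sub>v (r \<cdot>\<^sub>v v) = r \<cdot>\<^sub>v (R (minv a) *\<^sub>v v)" by (rule mult_mat_vec[OF Rc[OF ma] vc])
    finally show ?thesis .
   qed
   have pw: "R (w ^\<^sub>m i) *\<^sub>v v = r ^ i \<cdot>\<^sub>v (R (minv a ^\<^sub>m i) *\<^sub>v v)" if "v \<in> Y" for v i using that
   proof (induction i arbitrary: v)
    case 0 then show ?case using G[OF w] G[OF a] repD(4)[OF R] subsp_carrier[OF Ys 0] by simp
   next
    case (Suc i)
    have vc: "v \<in> carrier_vec d" by (rule subsp_carrier[OF Ys Suc.prems])
    have p: "w ^\<^sub>m i \<in> H" "minv a ^\<^sub>m i \<in> H" using subgroup_pow[OF H] w ma by auto
    have p\<Gamma>: "w ^\<^sub>m i \<in> \<Gamma>" "minv a ^\<^sub>m i \<in> \<Gamma>" "w \<in> \<Gamma>" "minv a \<in> \<Gamma>" using p w ma H\<Gamma> by blast+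
    have av: "R (minv a) *\<^sub>v v \<in> Y" by (rule stY[OF ma Suc.prems])
    have "R (w ^\<^sub>m Suc i) *\<^sub>v v = R (w ^\<^sub>m i) *\<^sub>v (r \<cdot>\<^sub>v (R (minv a) *\<^sub>v v))"
     using rep_vec[OF R p\<Gamma>(1,3) vc] Rw[OF Suc.prems] by simp
    also have "\<dots> = r \<cdot>\<^sub>v (R (w ^\<^sub>m i) *\<^sub>v (R (minv a) *\<^sub>v v))"
     by (rule mult_mat_vec[OF Rc[OF p(1)] subsp_carrier[OF Ys av]])
    also have "\<dots> = r \<cdot>\<^sub>v (r ^ i \<cdot>\<^sub>v (R (minv a ^\<^sub>m i) *\<^sub>v (R (minv a) *\<^sub>v v)))" using Suc.IH[OF av] by simp
    also have "R (minv a ^\<^sub>m i) *\<^sub>v (R (minv a) *\<^sub>v v) = R (minv a ^\<^sub>m Suc i) *\<^sub>v v"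
     using rep_vec[OF R p\<Gamma>(2,4) vc] by simp
    finally show ?case by (simp add: smult_smult_assoc)
   qed
   have "w ^\<^sub>m N = b * minv a ^\<^sub>m N * minv b" unfolding w_def
    by (rule pow_mat_conj[of _ n]) (use G[OF a] G[OF b] in simp_all)
   then have "w ^\<^sub>m N = 1\<^sub>m n" unfolding N(2) using G[OF b] by simp
   then have "1 \<cdot>\<^sub>v v0 = r ^ N \<cdot>\<^sub>v v0" using pw[OF v0Y, of N] N(2) repD(4)[OF R] v0c by simp
   then show ?thesis unfolding r_def[symmetric] using smult_vec_eqD[OF _ v0c v0(2)] by metis
  qed
  have "\<chi> (a * b * minv a * minv b) = \<chi> (a * 1\<^sub>m n * minv a * minv (1\<^sub>m n))"
   by (rule rep_scalar_const[OF R Suc.prems(3) continuous_commutator[OF G[OF a]] _ v0c v0(2) _ N(1) root b one])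
    (use comD[OF a] DH H\<Gamma> v0(3) in blast)+
  moreover have "a * 1\<^sub>m n * minv a * minv (1\<^sub>m n) = 1\<^sub>m n" using G[OF a] by simp
  moreover have "\<chi> (1\<^sub>m n) \<cdot>\<^sub>v v0 = 1 \<cdot>\<^sub>v v0"
   using v0(3)[OF subgroup_one[OF D]] repD(4)[OF R] v0c by simp
  then have "\<chi> (1\<^sub>m n) = 1" using smult_vec_eqD v0c v0(2) by blast
  ultimately show ?thesis by simp
 qed
 have "\<exists>v\<in>Y. v \<noteq> 0\<^sub>v d \<and> (\<forall>h\<in>H. \<exists>c. R h *\<^sub>v v = c \<cdot>\<^sub>v v)"
 proof (rule commuting_eigenvector[OF R Ys v0Y v0(2) stY H\<Gamma>])
  fix a b v assume ab: "a \<in> H" "b \<in> H" and v: "v \<in> Y"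
  have in\<Gamma>: "a \<in> \<Gamma>" "b \<in> \<Gamma>" "b * a \<in> \<Gamma>" "a * b * minv a * minv b \<in> \<Gamma>"
   using ab subgroup_mult[OF H ab(2,1)] comD[OF ab] DH H\<Gamma> by auto
  have vc: "v \<in> carrier_vec d" by (rule subsp_carrier[OF Ys v])
  have bv: "R (b * a) *\<^sub>v v \<in> Y" by (rule stY[OF subgroup_mult[OF H ab(2,1)] v])
  have "R a *\<^sub>v (R b *\<^sub>v v) = R (a * b) *\<^sub>v v" using rep_vec[OF R in\<Gamma>(1,2) vc] by simp
  also have "a * b = (a * b * minv a * minv b) * (b * a)" using G[OF ab(1)] G[OF ab(2)] by simp
  also have "R ((a * b * minv a * minv b) * (b * a)) *\<^sub>v v = R (a * b * minv a * minv b) *\<^sub>v (R (b * a) *\<^sub>v v)"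
   by (rule rep_vec[OF R in\<Gamma>(4,3) vc])
  also have "\<dots> = \<chi> (a * b * minv a * minv b) \<cdot>\<^sub>v (R (b * a) *\<^sub>v v)" using bv comD[OF ab] unfolding Y_def by blast
  also have "\<dots> = R (b * a) *\<^sub>v v" unfolding chi_comm[OF ab] by simp
  also have "\<dots> = R b *\<^sub>v (R a *\<^sub>v v)" by (rule rep_vec[OF R in\<Gamma>(2,1) vc])
  finally show "R a *\<^sub>v (R b *\<^sub>v v) = R b *\<^sub>v (R a *\<^sub>v v)" .
 qed
 then show ?case unfolding Y_def by blast
qed

end

section \<open>Borel subgroups and maximal tori\<close>

text \<open>Matrices whose first \<open>j\<close> columns are upper triangular, that is, those that stabilise the first
 \<open>j\<close> steps of the standard flag.\<close>

definition Ut :: "nat \<Rightarrow> nat \<Rightarrow> 'a::field mat set" where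
 "Ut n j = {g \<in> GLm n. \<forall>a<n. \<forall>b<n. b < j \<longrightarrow> b < a \<longrightarrow> g $$ (a, b) = 0}"

lemma Ut_0: "Ut n 0 = GLm n" unfolding Ut_def by auto
lemma Ut_n: "Ut n n = Up n" unfolding Ut_def Fil_def by auto
lemma Ut_GLm: "g \<in> Ut n j \<Longrightarrow> g \<in> GLm n" unfolding Ut_def by simp

lemma Ut_mult: assumes g: "g \<in> Ut n j" and h: "h \<in> Ut n j" shows "g * h \<in> Ut n j"
proof -
 have c: "g \<in> GLm n" "h \<in> GLm n" using g h Ut_GLm by auto
 have "(g * h) $$ (a, b) = 0" if ab: "a < n" "b < n" "b < j" "b < a" for a b
 proof -
  have "(g * h) $$ (a, b) = (\<Sum>s<n. g $$ (a, s) * h $$ (s, b))"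
   using c ab by (intro mult_mat_index[of _ n n _ n]) auto
  also have "\<dots> = 0"
  proof (rule sum.neutral, rule ballI)
   fix s assume "s \<in> {..<n}"
   then show "g $$ (a, s) * h $$ (s, b) = 0" using g h ab unfolding Ut_def by (cases "s \<le> b") auto
  qed
  finally show ?thesis .
 qed
 then show ?thesis using c unfolding Ut_def by auto
qed

text \<open>The action on the quotient by step \<open>j\<close> of the flag, the lower right block, written as a
 polynomial in the entries.\<close>

definition quot_rep :: "nat \<Rightarrow> nat \<Rightarrow> 'a::field mat \<Rightarrow> 'a mat \<Rightarrow> 'a mat" where
 "quot_rep n j P g = mat (n - j) (n - j) (\<lambda>(a, b).
  \<Sum>s<n. \<Sum>t<n. (P $$ (j + a, s) * minv P $$ (t, j + b)) * g $$ (s, t))"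

lemma quot_rep_index: assumes "P \<in> GLm n" "g \<in> carrier_mat n n" "a < n - j" "b < n - j"
 shows "quot_rep n j P g $$ (a, b) = (P * (g * minv P)) $$ (j + a, j + b)"
 using conj_index[OF assms(1,2), of "j + a" "j + b"] assms(3,4) by (simp add: quot_rep_def)

lemma sum_shift: "j \<le> n \<Longrightarrow> (\<Sum>s\<in>{j..<n}. f s) = (\<Sum>s<n - j. f (j + s :: nat) :: 'a::comm_monoid_add)"
 using sum.shift_bounds_nat_ivl[of f 0 j "n - j"] by (simp add: lessThan_atLeast0 add.commute)

lemma quot_vec: assumes M: "M \<in> Ut n j" and j: "j \<le> n" and a: "a < n - j" and w: "w \<in> carrier_vec n"
 shows "(M *\<^sub>v w) $ (j + a) = (\<Sum>s<n - j. M $$ (j + a, j + s) * w $ (j + s))"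
proof -
 have c: "M \<in> carrier_mat n n" using Ut_GLm[OF M] by simp
 have "(M *\<^sub>v w) $ (j + a) = (\<Sum>s<n. M $$ (j + a, s) * w $ s)"
  using a by (intro mult_mat_vec_index[OF c w]) simp
 also have "\<dots> = (\<Sum>s\<in>{j..<n}. M $$ (j + a, s) * w $ s)"
  by (rule sum.mono_neutral_right) (use M a in \<open>auto simp: Ut_def\<close>)
 finally show ?thesis using sum_shift[OF j] by simp
qed

context frob_closure
begin

lemma Ut_subgroup: "subgroup (Ut n j) (GL n :: 'k mat monoid)"
proof (rule subgroup_of_monoid)
 show "1\<^sub>m n \<in> Ut n j" unfolding Ut_def by auto
qed (auto intro: Ut_mult Ut_GLm)

lemma quot_rep_rep: assumes P: "P \<in> GLm n" and j: "j \<le> n"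
 shows "rep n (n - j) (cj n P (Ut n j)) (quot_rep n j P :: 'k mat \<Rightarrow> 'k mat)"
 unfolding rep_def
proof (intro conjI ballI allI impI)
 show "subgroup (cj n P (Ut n j)) (GL n)" by (rule cj_subgroup[OF Ut_subgroup P])
 show "quot_rep n j P g \<in> carrier_mat (n - j) (n - j)" for g by (simp add: quot_rep_def)
 show "quot_rep n j P (1\<^sub>m n) = 1\<^sub>m (n - j)"
 proof (rule eq_matI)
  fix a b assume "a < dim_row (1\<^sub>m (n - j) :: 'k mat)" "b < dim_col (1\<^sub>m (n - j) :: 'k mat)"
  then have ab: "a < n - j" "b < n - j" by auto
  have "quot_rep n j P (1\<^sub>m n) $$ (a, b) = (P * (1\<^sub>m n * minv P)) $$ (j + a, j + b)"
   by (rule quot_rep_index[OF P _ ab]) simp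
  also have "P * (1\<^sub>m n * minv P) = 1\<^sub>m n" using P by simp
  finally show "quot_rep n j P (1\<^sub>m n) $$ (a, b) = 1\<^sub>m (n - j) $$ (a, b)" using ab by simp
 qed (simp_all add: quot_rep_def)
next
 fix a b assume ab: "a < n - j" "b < n - j"
 have "(\<lambda>g. (\<Sum>s<n. \<Sum>t<n. (P $$ (j + a, s) * minv P $$ (t, j + b)) * g $$ (s, t))) \<in> (poly_fun n :: ('k mat \<Rightarrow> 'k) set)"
  by (intro poly_fun_sum poly_fun.mult poly_fun.const poly_fun.entry) auto
 then show "(\<lambda>g. quot_rep n j P g $$ (a, b)) \<in> poly_fun n" using ab by (simp add: quot_rep_def)
next
 fix g h assume gh: "g \<in> cj n P (Ut n j)" "h \<in> cj n P (Ut n j)"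
 have G: "g \<in> GLm n" "h \<in> GLm n" using gh cj_GLm by auto
 define g' h' where "g' = P * (g * minv P)" and "h' = P * (h * minv P)"
 have g': "g' \<in> Ut n j" and h': "h' \<in> Ut n j" using gh unfolding g'_def h'_def cj_def by auto
 have m: "P * ((g * h) * minv P) = g' * h'" unfolding g'_def h'_def using G P by simp
 show "quot_rep n j P (g * h) = quot_rep n j P g * quot_rep n j P h"
 proof (rule eq_matI)
  fix a b assume "a < dim_row (quot_rep n j P g * quot_rep n j P h)" "b < dim_col (quot_rep n j P g * quot_rep n j P h)"
  then have ab: "a < n - j" "b < n - j" by (auto simp: quot_rep_def)
  have h'c: "h' \<in> carrier_mat n n" using Ut_GLm[OF h'] by simp
  have "quot_rep n j P (g * h) $$ (a, b) = (g' * h') $$ (j + a, j + b)"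
   using quot_rep_index[OF P _ ab, of "g * h"] G unfolding m by simp
  also have "\<dots> = (\<Sum>s<n. g' $$ (j + a, s) * h' $$ (s, j + b))"
   using Ut_GLm[OF g'] Ut_GLm[OF h'] ab by (intro mult_mat_index[of _ n n _ n]) auto
  also have "\<dots> = (\<Sum>s\<in>{j..<n}. g' $$ (j + a, s) * h' $$ (s, j + b))"
   by (rule sum.mono_neutral_right) (use g' ab in \<open>auto simp: Ut_def\<close>)
  also have "\<dots> = (\<Sum>s<n - j. g' $$ (j + a, j + s) * h' $$ (j + s, j + b))" by (rule sum_shift[OF j])
  also have "\<dots> = (\<Sum>s<n - j. quot_rep n j P g $$ (a, s) * quot_rep n j P h $$ (s, b))"
   using quot_rep_index[OF P GLm_carrier[OF G(1)] ab(1)] quot_rep_index[OF P GLm_carrier[OF G(2)] _ ab(2)]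
   unfolding g'_def h'_def by simp
  also have "\<dots> = (quot_rep n j P g * quot_rep n j P h) $$ (a, b)"
   using ab by (intro mult_mat_index[symmetric, of _ "n - j" "n - j" _ "n - j"]) (auto simp: quot_rep_def)
  finally show "quot_rep n j P (g * h) $$ (a, b) = (quot_rep n j P g * quot_rep n j P h) $$ (a, b)" .
 qed (simp_all add: quot_rep_def)
qed

text \<open>A common eigenvector in the quotient by the first \<open>j\<close> steps of the flag extends the flag by one
 step.\<close>

lemma flag_step:
 assumes H: "subgroup H (GL n)" "connectedin (zariski n) H" "(derived (GL n) ^^ m) H = {1\<^sub>m n :: 'k mat}"
  and P: "P \<in> GLm n" "H \<subseteq> cj n P (Ut n j)" and j: "j < n"
 shows "\<exists>P'\<in>GLm n. H \<subseteq> cj n P' (Ut n (Suc j))"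
proof -
 define d where "d = n - j"
 have d: "d > 0" using j by (simp add: d_def)
 have R: "rep n d (cj n P (Ut n j)) (quot_rep n j P)" unfolding d_def by (rule quot_rep_rep[OF P(1)]) (use j in simp)
 have "subsp d (carrier_vec d :: 'k vec set)" unfolding subsp_def by auto
 moreover have "unit_vec d 0 \<noteq> (0\<^sub>v d :: 'k vec)" using d by (metis index_unit_vec(1) index_zero_vec(1) zero_neq_one)
 moreover have "quot_rep n j P h *\<^sub>v v \<in> carrier_vec d" if "h \<in> H" for h v by (simp add: quot_rep_def d_def)
 ultimately obtain v where v: "v \<in> carrier_vec d" "v \<noteq> 0\<^sub>v d" "\<forall>h\<in>H. \<exists>c. quot_rep n j P h *\<^sub>v v = c \<cdot>\<^sub>v v"
  using lie_kolchin[OF R H(1) P(2) H(2,3), of "carrier_vec d" "unit_vec d 0"] by auto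
 obtain i0 where i0: "i0 < d" "v $ i0 \<noteq> 0" using v(1,2) by (metis eq_vecI carrier_vecD index_zero_vec)
 define y where "y = vec n (\<lambda>i. if i < j then 0 else v $ (i - j))"
 have yc: "y \<in> carrier_vec n" by (simp add: y_def)
 have yi: "y $ (j + a) = v $ a" if "a < d" for a using that by (simp add: y_def d_def)
 obtain E where E: "E \<in> GLm n" "\<And>s. s < j \<Longrightarrow> col E s = unit_vec n s" "col E j = y"
  by (rule extend_to_invertible[OF yc, of "j + i0" j]) (use i0 yi[OF i0(1)] in \<open>auto simp: d_def\<close>)
 have Ec: "E \<in> carrier_mat n n" using E(1) by simp
 have fixE: "minv E *\<^sub>v w = w" if w: "w \<in> carrier_vec n" "\<And>i. j \<le> i \<Longrightarrow> i < n \<Longrightarrow> w $ i = 0" for w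
 proof -
  have "E *\<^sub>v w = w"
  proof (rule eq_vecI)
   fix r assume "r < dim_vec w"
   then have r: "r < n" using w(1) by simp
   have e: "E $$ (r, s) = unit_vec n s $ r" if "s < j" for s
    using arg_cong[OF E(2)[OF that], of "\<lambda>x. x $ r"] r j that Ec by simp
   have "(E *\<^sub>v w) $ r = (\<Sum>s<n. E $$ (r, s) * w $ s)" by (rule mult_mat_vec_index[OF Ec w(1) r])
   also have "\<dots> = (\<Sum>s<n. if s = r then w $ s else 0)"
   proof (rule sum.cong)
    fix s assume "s \<in> {..<n}"
    then show "E $$ (r, s) * w $ s = (if s = r then w $ s else 0)"
     using e[of s] w(2)[of s] r by (cases "s < j") auto
   qed simp
   finally show "(E *\<^sub>v w) $ r = w $ r" using r by simp
  qed (use Ec w(1) in auto)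
  then have "minv E *\<^sub>v w = minv E *\<^sub>v (E *\<^sub>v w)" by simp
  also have "\<dots> = w" by (rule mult_vec_minv(2)[OF E(1) w(1)])
  finally show ?thesis .
 qed
 have Ej: "minv E *\<^sub>v y = unit_vec n j"
 proof -
  have "minv E *\<^sub>v y = minv E *\<^sub>v (E *\<^sub>v unit_vec n j)" using E(3) mult_unit_vec[OF j, of E] Ec by simp
  also have "\<dots> = unit_vec n j" by (rule mult_vec_minv(2)[OF E(1)]) simp
  finally show ?thesis .
 qed
 define P' where "P' = minv E * P"
 have P': "P' \<in> GLm n" unfolding P'_def using E(1) P(1) by simp
 have "h \<in> cj n P' (Ut n (Suc j))" if h: "h \<in> H" for h
 proof -
  have hG: "h \<in> GLm n" by (rule subgroup_GLm[OF H(1) h])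
  define M where "M = P * (h * minv P)"
  have M: "M \<in> Ut n j" using h P(2) unfolding M_def cj_def by blast
  have Mc: "M \<in> carrier_mat n n" using Ut_GLm[OF M] by simp
  have e: "P' * (h * minv P') = minv E * (M * E)"
   unfolding P'_def M_def using hG P(1) E(1) by (simp add: minv_mult[of _ n])
  have G: "minv E * (M * E) \<in> GLm n" using Ut_GLm[OF M] E(1) by simp
  have colE: "col (minv E * (M * E)) s = minv E *\<^sub>v (M *\<^sub>v col E s)" if "s < n" for s
  proof -
   have "col (minv E * (M * E)) s = minv E *\<^sub>v col (M * E) s"
    by (rule col_mult2[of _ n n _ n]) (use that Ec Mc in auto)
   also have "col (M * E) s = M *\<^sub>v col E s" by (rule col_mult2[of _ n n _ n]) (use that Ec Mc in auto)
   finally show ?thesis .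
  qed
  have "(minv E * (M * E)) $$ (a, b) = 0" if ab: "a < n" "b < n" "b < Suc j" "b < a" for a b
  proof -
   have idx: "(minv E * (M * E)) $$ (a, b) = (minv E *\<^sub>v (M *\<^sub>v col E b)) $ a"
    using arg_cong[OF colE[OF ab(2)], of "\<lambda>x. x $ a"] ab Ec Mc by simp
   show ?thesis
   proof (cases "b < j")
    case True
    have "M *\<^sub>v col E b = col M b" unfolding E(2)[OF True] by (rule mult_unit_vec) (use ab Mc in auto)
    moreover have "minv E *\<^sub>v col M b = col M b"
    proof (rule fixE)
     show "col M b \<in> carrier_vec n" using Mc by (intro carrier_vecI) simp
    qed (use M ab True Mc in \<open>auto simp: Ut_def\<close>)
    moreover have "col M b $ a = 0" using M ab True Mc by (auto simp: Ut_def)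
    ultimately show ?thesis using idx by simp
   next
    case False
    then have b: "b = j" using ab by simp
    obtain c where c: "quot_rep n j P h *\<^sub>v v = c \<cdot>\<^sub>v v" using v(3) h by blast
    define w where "w = M *\<^sub>v y - c \<cdot>\<^sub>v y"
    have wc: "w \<in> carrier_vec n" unfolding w_def using Mc yc by simp
    have w0: "w $ i = 0" if i: "j \<le> i" "i < n" for i
    proof -
     define a where "a = i - j"
     have a: "a < d" "i = j + a" using i by (auto simp: a_def d_def)
     have "(M *\<^sub>v y) $ (j + a) = (\<Sum>s<d. M $$ (j + a, j + s) * y $ (j + s))"
      using quot_vec[OF M, of a y] a j yc by (simp add: d_def)
     also have "\<dots> = (\<Sum>s<d. quot_rep n j P h $$ (a, s) * v $ s)"
      using quot_rep_index[OF P(1) GLm_carrier[OF hG], of a j] a yi by (auto simp: M_def d_def)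
     also have "\<dots> = (quot_rep n j P h *\<^sub>v v) $ a"
      by (rule mult_mat_vec_index[symmetric, OF _ v(1) a(1)]) (simp add: quot_rep_def d_def)
     also have "\<dots> = c * y $ (j + a)" unfolding c using a v(1) yi by simp
     finally show ?thesis unfolding w_def using a i yc Mc by simp
    qed
    have "M *\<^sub>v y = w + c \<cdot>\<^sub>v y" unfolding w_def using Mc yc by (intro eq_vecI) auto
    then have "minv E *\<^sub>v (M *\<^sub>v y) = minv E *\<^sub>v w + c \<cdot>\<^sub>v (minv E *\<^sub>v y)"
     using mult_add_distrib_mat_vec[OF minv_carrier[OF Ec] wc, of "c \<cdot>\<^sub>v y"] mult_mat_vec[OF minv_carrier[OF Ec] yc] yc by simp
    also have "\<dots> = w + c \<cdot>\<^sub>v unit_vec n j" using fixE[OF wc w0] Ej by simp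
    finally have "(minv E *\<^sub>v (M *\<^sub>v y)) $ a = w $ a + c * (if a = j then 1 else 0)" using ab wc j by simp
    then show ?thesis using idx b E(3) w0[of a] ab by simp
   qed
  qed
  then have "minv E * (M * E) \<in> Ut n (Suc j)" unfolding Ut_def using G by blast
  then have "P' * (h * minv P') \<in> Ut n (Suc j)" unfolding e .
  then show ?thesis unfolding cj_def using hG by blast
 qed
 then show ?thesis using P' by blast
qed

theorem solvable_triangularisable:
 assumes "connected_solvable n H"
 shows "\<exists>P\<in>GLm n. H \<subseteq> cj n P (Up n :: 'k mat set)"
proof -
 have H: "subgroup H (GL n)" "connectedin (zariski n) H" "solvable ((GL n)\<lparr>carrier := H\<rparr>)"
  using assms unfolding connected_solvable_def closed_connected_subgroup_def by auto
 obtain m where m: "(derived (GL n) ^^ m) H = {1\<^sub>m n}" using H(3) unfolding solvable_GL_iff[OF H(1)] by blast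
 have "\<exists>P\<in>GLm n. H \<subseteq> cj n P (Ut n j)" if "j \<le> n" for j using that
 proof (induction j)
  case 0
  show ?case using subgroup_GLm[OF H(1)] by (intro bexI[of _ "1\<^sub>m n"]) (auto simp: Ut_0 cj_def)
 next
  case (Suc j)
  then obtain P where P: "P \<in> GLm n" "H \<subseteq> cj n P (Ut n j)" by auto
  show ?case using flag_step[OF H(1,2) m P] Suc.prems by simp
 qed
 from this[of n] show ?thesis by (simp add: Ut_n)
qed

text \<open>Let \<open>Q\<close> be the inverse of \<open>P\<close>. The hypothesis says that the flag of \<open>Q\<close> is stable under the
 triangular group. Given that the columns before column \<open>j\<close> of \<open>Q\<close> are triangular, column \<open>j\<close>
 is modulo the earlier steps an eigenvector of the transvection with entry at \<open>(j, i)\<close>, which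
 forces its entry at \<open>i > j\<close> to vanish.\<close>

lemma Up_self_normalising:
 assumes P: "P \<in> GLm n" and N: "\<And>u. u \<in> Up n \<Longrightarrow> P * (u * minv P) \<in> (Up n :: 'k mat set)"
 shows "P \<in> Up n"
proof -
 define Q where "Q = minv P"
 have Q: "Q \<in> GLm n" unfolding Q_def using P by simp
 have "\<forall>i<n. j < i \<longrightarrow> Q $$ (i, j) = 0" for j
 proof (induction j rule: less_induct)
  case (less j)
  show ?case
  proof (intro allI impI)
   fix i assume i: "i < n" "j < i"
   \<comment> \<open>the transvection that adds entry \<open>i\<close> to entry \<open>j\<close>\<close>
   define u :: "'k mat" where "u = mat n n (\<lambda>(a, b). if a = b \<or> (a = j \<and> b = i) then 1 else 0)"
   have uc: "u \<in> carrier_mat n n" by (simp add: u_def)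
   have "upper_triangular u" unfolding upper_triangular_def u_def using i by auto
   moreover have "diag_mat u = replicate n 1" unfolding diag_mat_def u_def by (intro nth_equalityI) auto
   ultimately have "det u = 1" using det_upper_triangular[OF _ uc] by simp
   then have uG: "u \<in> GLm n" by (intro GLmI[OF uc]) simp
   have u: "u \<in> Up n" unfolding Fil_def using uG i by (auto simp: u_def)
   define b where "b = P * (u * minv P)"
   have b: "b \<in> Up n" unfolding b_def by (rule N[OF u])
   have eq: "u * Q = Q * b" unfolding b_def Q_def using P uc by simp
   have col: "(Q * b) $$ (a, j) = Q $$ (a, j) * b $$ (j, j)" if a: "j \<le> a" "a < n" for a
   proof -
    have "(Q * b) $$ (a, j) = (\<Sum>s\<in>{..j}. Q $$ (a, s) * b $$ (s, j))"
     by (rule upper_mult_index[OF _ b]) (use Q a in auto)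
    also have "\<dots> = (\<Sum>s\<in>{j}. Q $$ (a, s) * b $$ (s, j))"
     by (rule sum.mono_neutral_right) (use less a in auto)
    finally show ?thesis by simp
   qed
   have row: "(u * Q) $$ (a, j) = Q $$ (a, j) + (if a = j then Q $$ (i, j) else 0)" if a: "a < n" for a
   proof -
    have "(u * Q) $$ (a, j) = (\<Sum>s<n. u $$ (a, s) * Q $$ (s, j))"
     using uc Q a i by (intro mult_mat_index[of _ n n _ n]) auto
    also have "\<dots> = (\<Sum>s<n. (if s = a then Q $$ (s, j) else 0) + (if s = i then if a = j then Q $$ (s, j) else 0 else 0))"
     by (rule sum.cong) (use a i in \<open>auto simp: u_def\<close>)
    also have "\<dots> = Q $$ (a, j) + (if a = j then Q $$ (i, j) else 0)"
     using a i by (simp add: sum.distrib)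
    finally show ?thesis .
   qed
   have 1: "Q $$ (i, j) = Q $$ (i, j) * b $$ (j, j)" using row[of i] col[of i] eq i by simp
   have 2: "Q $$ (j, j) + Q $$ (i, j) = Q $$ (j, j) * b $$ (j, j)" using row[of j] col[of j] eq i by simp
   show "Q $$ (i, j) = 0"
   proof (cases "b $$ (j, j) = 1")
    case True then show ?thesis using 2 by simp
   next
    case False then show ?thesis using 1 by simp
   qed
  qed
 qed
 then have "Q \<in> Up n" unfolding Fil_def using Q by auto
 then have "minv Q \<in> Up n" by (rule subgroup_minv[OF Fil_subgroup])
 then show ?thesis unfolding Q_def using P by simp
qed

lemma cj_inv: assumes "P \<in> GLm n" "u \<in> GLm n" shows "minv P * (u * P) \<in> cj n P H \<longleftrightarrow> u \<in> H"
proof -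
 have "P * ((minv P * (u * P)) * minv P) = u" using assms by simp
 then show ?thesis unfolding cj_def using assms by simp
qed

lemma cj_Up_subset: assumes P: "P \<in> GLm n" and Q: "Q \<in> GLm n" and sub: "cj n Q (Up n) \<subseteq> cj n P (Up n :: 'k mat set)"
 shows "cj n P (Up n) = (cj n Q (Up n) :: 'k mat set)"
proof
 define W where "W = P * minv Q"
 have W: "W \<in> GLm n" unfolding W_def using P Q by simp
 have "W \<in> Up n"
 proof (rule Up_self_normalising[OF W])
  fix u assume u: "u \<in> (Up n :: 'k mat set)"
  have uG: "u \<in> GLm n" by (rule Fil_GLm[OF u])
  have "minv Q * (u * Q) \<in> cj n P (Up n)" using cj_inv[OF Q uG] u sub by blast
  then have "P * ((minv Q * (u * Q)) * minv P) \<in> Up n" unfolding cj_def by blast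
  also have "P * ((minv Q * (u * Q)) * minv P) = W * (u * minv W)"
   unfolding W_def using P Q uG by (simp add: minv_mult[of _ n])
  finally show "W * (u * minv W) \<in> Up n" .
 qed
 show "cj n P (Up n) \<subseteq> cj n Q (Up n)"
 proof
  fix g assume g: "g \<in> cj n P (Up n)"
  have gG: "g \<in> GLm n" by (rule cj_GLm[OF g])
  have "minv W * ((P * (g * minv P)) * W) \<in> Up n"
   using g subgroup_mult[OF Fil_subgroup] subgroup_minv[OF Fil_subgroup \<open>W \<in> Up n\<close>] \<open>W \<in> Up n\<close> unfolding cj_def by blast
  also have "minv W * ((P * (g * minv P)) * W) = Q * (g * minv Q)"
   unfolding W_def using P Q gG by (simp add: minv_mult[of _ n])
  finally show "g \<in> cj n Q (Up n)" unfolding cj_def using gG by simp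
 qed
qed (rule sub)

lemma is_borel_iff: "is_borel n B \<longleftrightarrow> (\<exists>P\<in>GLm n. B = cj n P (Up n :: 'k mat set))"
proof
 have cs: "connected_solvable n (cj n P (Up n :: 'k mat set))" if "P \<in> GLm n" for P
  unfolding connected_solvable_def by (intro conjI cj_closed_connected(1)[OF that] cj_Up_solvable[OF that])
 {
  assume B: "is_borel n B"
  then have B1: "connected_solvable n B" and B2: "\<And>B'. connected_solvable n B' \<Longrightarrow> B \<subseteq> B' \<Longrightarrow> B' = B"
   unfolding is_borel_def by simp_all
  obtain P where P: "P \<in> GLm n" "B \<subseteq> cj n P (Up n)"
   using solvable_triangularisable[OF B1] by (elim bexE)
  have "cj n P (Up n) = B" by (rule B2[OF cs[OF P(1)] P(2)])
  then show "\<exists>P\<in>GLm n. B = cj n P (Up n)" using P by blast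
 next
  assume "\<exists>P\<in>GLm n. B = cj n P (Up n)"
  then obtain P where P: "P \<in> GLm n" "B = cj n P (Up n)" by blast
  have "B' = B" if B': "connected_solvable n B'" "B \<subseteq> B'" for B'
  proof -
   obtain Q where Q: "Q \<in> GLm n" "B' \<subseteq> cj n Q (Up n)" using solvable_triangularisable[OF B'(1)] by (elim bexE)
   have "cj n Q (Up n) = cj n P (Up n)" by (rule cj_Up_subset[OF Q(1) P(1)]) (use B'(2) P(2) Q(2) in simp)
   then show ?thesis using Q(2) B'(2) P(2) by simp
  qed
  then show "is_borel n B" unfolding is_borel_def using cs[OF P(1)] P(2) by simp
 }
qed

lemma is_torus_iff: "is_torus n T \<longleftrightarrow> closed_connected_subgroup n T \<and> (\<exists>P\<in>GLm n. T \<subseteq> cj n P (Dg n :: 'k mat set))"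
proof -
 have "(\<forall>t\<in>T. diagonal_mat (P * t * inv\<^bsub>GL n\<^esub> P)) \<longleftrightarrow> T \<subseteq> cj n P (Dg n)"
  if T: "T \<subseteq> GLm n" and P: "P \<in> GLm n" for P :: "'k mat"
 proof -
  have "diagonal_mat (P * t * inv\<^bsub>GL n\<^esub> P) \<longleftrightarrow> t \<in> cj n P (Dg n)" if t: "t \<in> T" for t
  proof -
   have tG: "t \<in> GLm n" using t T by blast
   have e: "P * t * inv\<^bsub>GL n\<^esub> P = P * (t * minv P)" using inv_GL[OF P] P tG by simp
   have G: "P * (t * minv P) \<in> GLm n" using P tG by simp
   show ?thesis unfolding e cj_def Dg_def diagonal_mat_def using tG G GLm_dims[OF G] by auto
  qed
  then show ?thesis by blast
 qed
 moreover have "T \<subseteq> GLm n" if "closed_connected_subgroup n T"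
  using that subgroup_GLm unfolding closed_connected_subgroup_def by blast
 ultimately show ?thesis unfolding is_torus_def carrier_GL by blast
qed

text \<open>Compare with the diagonal matrix that has one entry \<open>- 1\<close> and otherwise 1.\<close>

lemma centraliser_Dg:
 assumes g: "g \<in> GLm n" and c: "\<And>t. t \<in> Dg n \<Longrightarrow> t * g = g * (t :: 'k mat)" shows "g \<in> Dg n"
proof -
 have "g $$ (a, b) = 0" if ab: "a < n" "b < n" "a \<noteq> b" for a b
 proof -
  define t :: "'k mat" where "t = diagm n (\<lambda>i. if i = a then - 1 else 1)"
  have "t \<in> GLm n" unfolding t_def by (rule diagm_GLm) simp
  then have "t \<in> Dg n" unfolding Dg_def by (auto simp: t_def)
  then have "(t * g) $$ (a, b) = (g * t) $$ (a, b)" using c by simp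
  then have "- g $$ (a, b) = g $$ (a, b)"
   unfolding t_def using diagm_mult_left[OF GLm_carrier[OF g] ab(1,2)] diagm_mult_right[OF GLm_carrier[OF g] ab(1,2)] ab(3) by simp
  then have "2 * g $$ (a, b) = 0" by (simp add: eq_neg_iff_add_eq_0 flip: mult_2)
  then show ?thesis using two_neq_0 by simp
 qed
 then show ?thesis unfolding Dg_def using g by blast
qed

lemma cj_Dg_centraliser: assumes P: "P \<in> GLm n" and g: "g \<in> GLm n"
 and c: "\<And>t. t \<in> cj n P (Dg n) \<Longrightarrow> t * g = g * (t :: 'k mat)"
 shows "g \<in> cj n P (Dg n)"
proof -
 have "P * (g * minv P) \<in> Dg n"
 proof (rule centraliser_Dg)
  fix t assume t: "t \<in> (Dg n :: 'k mat set)"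
  have tG: "t \<in> GLm n" by (rule Dg_GLm[OF t])
  have "(minv P * (t * P)) * g = g * (minv P * (t * P))" by (rule c) (use cj_inv[OF P tG] t in blast)
  then have "P * (((minv P * (t * P)) * g) * minv P) = P * ((g * (minv P * (t * P))) * minv P)" by simp
  then show "t * (P * (g * minv P)) = P * (g * minv P) * t" using P g tG by simp
 qed (use P g in simp)
 then show ?thesis unfolding cj_def using g by simp
qed

lemma Dg_commute: assumes "g \<in> Dg n" "h \<in> Dg n" shows "g * h = h * (g :: 'k mat)"
proof -
 have "diagm n (\<lambda>i. g $$ (i, i)) * diagm n (\<lambda>i. h $$ (i, i)) = diagm n (\<lambda>i. h $$ (i, i)) * diagm n (\<lambda>i. g $$ (i, i))"
  unfolding diagm_mult by (simp add: mult.commute)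
 then show ?thesis using Dg_diagm[OF assms(1)] Dg_diagm[OF assms(2)] by simp
qed

lemma cj_Dg_commute: assumes P: "P \<in> GLm n" and "s \<in> cj n P (Dg n)" "t \<in> cj n P (Dg n)" shows "s * t = t * (s :: 'k mat)"
proof -
 have G: "s \<in> GLm n" "t \<in> GLm n" using assms(2,3) cj_GLm by auto
 let ?s = "P * (s * minv P)" and ?t = "P * (t * minv P)"
 have "?s \<in> Dg n" "?t \<in> Dg n" using assms(2,3) unfolding cj_def by auto
 then have "?s * ?t = ?t * ?s" by (rule Dg_commute)
 then have "minv P * ((?s * ?t) * P) = minv P * ((?t * ?s) * P)" by simp
 then show ?thesis using P G by simp
qed

lemma is_maximal_torus_iff: "is_maximal_torus n T \<longleftrightarrow> (\<exists>P\<in>GLm n. T = cj n P (Dg n :: 'k mat set))"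
proof
 have tor: "is_torus n (cj n P (Dg n :: 'k mat set))" if "P \<in> GLm n" for P
  unfolding is_torus_iff using cj_closed_connected(2)[OF that] that by blast
 {
  assume T: "is_maximal_torus n T"
  then obtain P where P: "P \<in> GLm n" "T \<subseteq> cj n P (Dg n)"
   unfolding is_maximal_torus_def is_torus_iff by blast
  then have "cj n P (Dg n) = T" using T tor[OF P(1)] unfolding is_maximal_torus_def by blast
  then show "\<exists>P\<in>GLm n. T = cj n P (Dg n)" using P by blast
 next
  assume "\<exists>P\<in>GLm n. T = cj n P (Dg n)"
  then obtain P where P: "P \<in> GLm n" "T = cj n P (Dg n)" by blast
  have "T' = T" if T': "is_torus n T'" "T \<subseteq> T'" for T'
  proof -
   obtain Q where Q: "Q \<in> GLm n" "T' \<subseteq> cj n Q (Dg n)" using T'(1) unfolding is_torus_iff by blast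
   have "g \<in> T" if g: "g \<in> T'" for g unfolding P(2)
   proof (rule cj_Dg_centraliser[OF P(1)])
    show "g \<in> GLm n" using g Q(2) cj_GLm by blast
    fix t assume "t \<in> cj n P (Dg n)"
    then show "t * g = g * t" using cj_Dg_commute[OF Q(1)] g Q(2) T'(2) P(2) by blast
   qed
   then show ?thesis using T'(2) by blast
  qed
  then show "is_maximal_torus n T" unfolding is_maximal_torus_def using tor[OF P(1)] P(2) by blast
 }
qed

end

section \<open>Stable tori and Borel subgroups\<close>

text \<open>The automorphism of the general linear group defined by \<open>x\<close>.\<close>

definition theta :: "'a::field mat \<Rightarrow> 'a mat \<Rightarrow> 'a mat" where
 "theta x h = x * (minv (h\<^sup>T) * minv x)"

lemma theta_GLm: "x \<in> GLm n \<Longrightarrow> h \<in> GLm n \<Longrightarrow> theta x h \<in> GLm n"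
 unfolding theta_def by simp

lemma theta_inverse: assumes x: "x \<in> GLm n" and h: "h \<in> GLm n" shows "theta x (theta (x\<^sup>T) h) = h"
proof -
 let ?X = "x\<^sup>T" and ?H = "minv (h\<^sup>T)"
 have G: "?X \<in> GLm n" "?H \<in> GLm n" using x h by auto
 have "(theta ?X h)\<^sup>T = minv x * (minv h * x)"
  unfolding theta_def using x h G by (simp add: mtranspose_mult minv_transpose[of _ n])
 then have "minv ((theta ?X h)\<^sup>T) = minv x * (h * x)"
  using x h by (simp add: minv_mult[of _ n])
 then show ?thesis unfolding theta_def[of x] using x h by simp
qed

lemma theta_theta: assumes x: "x \<in> GLm n" and h: "h \<in> GLm n"
 shows "theta x (theta x h) = (x * minv (x\<^sup>T)) * (h * minv (x * minv (x\<^sup>T)))"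
proof -
 have "(theta x h)\<^sup>T = minv (x\<^sup>T) * (minv h * x\<^sup>T)"
  unfolding theta_def using x h by (simp add: mtranspose_mult minv_transpose[of _ n])
 then have "minv ((theta x h)\<^sup>T) = minv (x\<^sup>T) * (h * x\<^sup>T)"
  using x h minv_mult[of "minv (x\<^sup>T)" n "minv h * x\<^sup>T"] minv_mult[of "minv h" n "x\<^sup>T"]
   minv_minv[OF transpose_GLm[OF x]] by simp
 then show ?thesis unfolding theta_def[of x "theta x h"]
  using x h minv_mult[of x n "minv (x\<^sup>T)"] minv_minv[OF transpose_GLm[OF x]] by simp
qed

lemma theta_conj: assumes x: "x \<in> GLm n" and S: "S \<in> GLm n" and g: "g \<in> GLm n"
 shows "S * (theta x g * minv S) = theta (S * (x * S\<^sup>T)) (S * (g * minv S))"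
proof -
 have "(S * (g * minv S))\<^sup>T = minv (S\<^sup>T) * (g\<^sup>T * S\<^sup>T)"
  using S g by (simp add: mtranspose_mult minv_transpose[of _ n])
 then have "minv ((S * (g * minv S))\<^sup>T) = minv (S\<^sup>T) * (minv (g\<^sup>T) * S\<^sup>T)"
  using S g minv_mult[of "minv (S\<^sup>T)" n "g\<^sup>T * S\<^sup>T"] minv_mult[of "g\<^sup>T" n "S\<^sup>T"]
   minv_minv[OF transpose_GLm[OF S]] by simp
 moreover have "minv (S * (x * S\<^sup>T)) = minv (S\<^sup>T) * (minv x * minv S)"
  using S x minv_mult[of S n "x * S\<^sup>T"] minv_mult[of x n "S\<^sup>T"] by simp
 ultimately show ?thesis unfolding theta_def using S x g by simp
qed

text \<open>For an antidiagonal \<open>x\<close> the automorphism reflects the inverse matrix in the antidiagonal, up to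
 nonzero factors, and so preserves triangularity and diagonality.\<close>

lemma theta_antidiagonal_index:
 assumes c: "\<And>i. i < n \<Longrightarrow> c i \<noteq> 0" and h: "h \<in> GLm n" and ab: "a < n" "b < n"
 shows "theta (diagm n c * J_mat n) h $$ (a, b) = c a / c b * minv h $$ (n - 1 - b, n - 1 - (a :: nat))"
  (is "theta ?x h $$ _ = _")
proof -
 define d where "d i = 1 / c i" for i
 have D: "diagm n c \<in> GLm n" using c by (intro diagm_GLm)
 have Di: "minv (diagm n c) = diagm n d"
  by (rule minv_unique(2)[of _ n]) (use c in \<open>auto simp: diagm_mult d_def intro!: eq_matI\<close>)
 have J: "J_mat n \<in> GLm n" and Ji: "minv (J_mat n) = (J_mat n :: 'a mat)"
  using minv_unique[OF J_carrier J_carrier J_J] by auto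
 define L where "L = (minv h)\<^sup>T"
 have L: "L \<in> carrier_mat n n" unfolding L_def using h by simp
 have "theta ?x h = diagm n c * ((J_mat n * (L * J_mat n)) * diagm n d)"
  unfolding theta_def L_def using D J h by (simp add: minv_mult[of _ n] Di Ji minv_transpose[of _ n])
 also have "\<dots> $$ (a, b) = c a * (((J_mat n * (L * J_mat n)) * diagm n d) $$ (a, b))"
  by (rule diagm_mult_left[of _ n n]) (use L ab in auto)
 also have "((J_mat n * (L * J_mat n)) * diagm n d) $$ (a, b) = (J_mat n * (L * J_mat n)) $$ (a, b) * d b"
  by (rule diagm_mult_right[of _ n n]) (use L ab in auto)
 also have "(J_mat n * (L * J_mat n)) $$ (a, b) = (L * J_mat n) $$ (n - 1 - a, b)"
  by (rule J_mult_left[of _ n n]) (use L ab in auto)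
 also have "\<dots> = L $$ (n - 1 - a, n - 1 - b)" by (rule J_mult_right[of _ n n]) (use L ab in auto)
 also have "\<dots> = minv h $$ (n - 1 - b, n - 1 - a)" unfolding L_def using h ab by simp
 finally show ?thesis by (simp add: d_def)
qed

context frob_closure
begin

lemma theta_antidiagonal:
 assumes c: "\<And>i. i < n \<Longrightarrow> c i \<noteq> 0"
 shows "h \<in> Up n \<Longrightarrow> theta (diagm n c * J_mat n) h \<in> (Up n :: 'k mat set)"
  "h \<in> Dg n \<Longrightarrow> theta (diagm n c * J_mat n) h \<in> (Dg n :: 'k mat set)"
proof -
 have x: "diagm n c * J_mat n \<in> (GLm n :: 'k mat set)"
  using diagm_GLm[of n c] c minv_unique(1)[OF J_carrier J_carrier J_J] by simp
 show "theta (diagm n c * J_mat n) h \<in> (Up n :: 'k mat set)" if h: "h \<in> Up n"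
 proof -
  have hG: "h \<in> GLm n" by (rule Fil_GLm[OF h])
  have m: "minv h \<in> Up n" by (rule subgroup_minv[OF Fil_subgroup h])
  have "theta (diagm n c * J_mat n) h $$ (a, b) = 0" if ab: "a < n" "b < n" "b < a" for a b
  proof -
   have "minv h $$ (n - 1 - b, n - 1 - a) = 0" by (rule Fil_upper[OF m]) (use ab in auto)
   then show ?thesis using theta_antidiagonal_index[of n c h a b] c hG ab by simp
  qed
  then show ?thesis unfolding Fil_def using theta_GLm[OF x hG] by auto
 qed
 show "theta (diagm n c * J_mat n) h \<in> (Dg n :: 'k mat set)" if h: "h \<in> Dg n"
 proof -
  have hG: "h \<in> GLm n" by (rule Dg_GLm[OF h])
  have m: "minv h \<in> Dg n" by (rule subgroup_minv[OF Dg_subgroup h])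
  have "theta (diagm n c * J_mat n) h $$ (a, b) = 0" if ab: "a < n" "b < n" "a \<noteq> b" for a b
  proof -
   have "n - 1 - b < n" "n - 1 - a < n" "n - 1 - b \<noteq> n - 1 - a" using ab by auto
   then have "minv h $$ (n - 1 - b, n - 1 - a) = 0" using m unfolding Dg_def by blast
   then show ?thesis using theta_antidiagonal_index[of n c h a b] c hG ab by simp
  qed
  then show ?thesis unfolding Dg_def using theta_GLm[OF x hG] by auto
 qed
qed

lemma theta_image_cj:
 assumes x: "x \<in> GLm n" and S: "S \<in> GLm n" and H: "H \<subseteq> GLm n"
  and st: "\<And>h. h \<in> H \<Longrightarrow> theta (S * (x * S\<^sup>T)) h \<in> H"
   "\<And>h. h \<in> H \<Longrightarrow> theta (S * (x\<^sup>T * S\<^sup>T)) h \<in> (H :: 'k mat set)"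
 shows "theta x ` cj n S H = cj n S H"
proof -
 have m: "theta y g \<in> cj n S H"
  if y: "y \<in> GLm n" and s: "\<And>h. h \<in> H \<Longrightarrow> theta (S * (y * S\<^sup>T)) h \<in> H" and g: "g \<in> cj n S H" for y g
 proof -
  have gG: "g \<in> GLm n" and gH: "S * (g * minv S) \<in> H" using g unfolding cj_def by auto
  have "S * (theta y g * minv S) \<in> H" unfolding theta_conj[OF y S gG] by (rule s[OF gH])
  then show ?thesis unfolding cj_def using theta_GLm[OF y gG] by blast
 qed
 show ?thesis
 proof (intro equalityI subsetI)
  fix g assume "g \<in> theta x ` cj n S H" then show "g \<in> cj n S H" using m[OF x st(1)] by blast
 next
  fix g assume g: "g \<in> cj n S H"
  have "theta (x\<^sup>T) g \<in> cj n S H" by (rule m[OF transpose_GLm[OF x] st(2) g])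
  then show "g \<in> theta x ` cj n S H" using theta_inverse[OF x cj_GLm[OF g]] by force
 qed
qed

text \<open>The leading entry, from below, of an eigenvector of a unitriangular matrix shows that its
 eigenvalue is 1.\<close>

lemma unipotent_diagonalisable:
 assumes W: "W \<in> GLm n" and U: "U \<in> Fil n 1" and D: "D \<in> Dg n" and e: "U * W = W * (D :: 'k mat)"
 shows "D = 1\<^sub>m n"
proof -
 have D1: "D $$ (i, i) = 1" if i: "i < n" for i
 proof -
  have Wc: "W \<in> carrier_mat n n" using W by simp
  define A where "A = {a. a < n \<and> W $$ (a, i) \<noteq> 0}"
  have "A \<noteq> {}"
  proof
   assume "A = {}"
   then have "W *\<^sub>v unit_vec n i = 0\<^sub>v n" using mult_unit_vec[OF i, of W] Wc i unfolding A_def by (intro eq_vecI) auto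
   then have "minv W *\<^sub>v (0\<^sub>v n) = unit_vec n i" using mult_vec_minv(2)[OF W, of "unit_vec n i"] by simp
   moreover have "minv W *\<^sub>v (0\<^sub>v n) = (0\<^sub>v n :: 'k vec)" using W by (intro eq_vecI) (auto simp: scalar_prod_def)
   ultimately have "unit_vec n i = (0\<^sub>v n :: 'k vec)" by simp
   then show False using i by (metis index_unit_vec(1) index_zero_vec(1) zero_neq_one)
  qed
  moreover have fA: "finite A" unfolding A_def by simp
  ultimately have a: "Max A \<in> A" by simp
  define a where "a = Max A"
  have a: "a < n" "W $$ (a, i) \<noteq> 0" using a unfolding a_def A_def by auto
  have az: "W $$ (s, i) = 0" if "s < n" "a < s" for s
  proof (rule ccontr)
   assume "W $$ (s, i) \<noteq> 0"
   then have "s \<le> a" unfolding a_def using that(1) by (intro Max_ge[OF fA]) (simp add: A_def)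
   then show False using that(2) by simp
  qed
  have Uc: "U \<in> carrier_mat n n" using Fil_GLm[OF U] by simp
  have "(U * W) $$ (a, i) = (\<Sum>s<n. U $$ (a, s) * W $$ (s, i))"
   by (rule mult_mat_index[OF Uc Wc a(1) i])
  also have "\<dots> = (\<Sum>s<n. if s = a then W $$ (s, i) else 0)"
  proof (rule sum.cong)
   fix s assume "s \<in> {..<n}"
   then have s: "s < n" by simp
   show "U $$ (a, s) * W $$ (s, i) = (if s = a then W $$ (s, i) else 0)"
    using Fil_upper[OF U a(1), of s] az[OF s] U a(1) s unfolding Fil_def by (cases s a rule: linorder_cases) auto
  qed simp
  also have "\<dots> = W $$ (a, i)" using a by simp
  also have "(U * W) $$ (a, i) = W $$ (a, i) * D $$ (i, i)"
  proof -
   have "W * D = W * diagm n (\<lambda>i. D $$ (i, i))" using Dg_diagm[OF D] by simp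
   then show ?thesis unfolding e using diagm_mult_right[OF Wc a(1) i] by simp
  qed
  finally show ?thesis using a(2) by simp
 qed
 show ?thesis by (rule eq_matI) (use D D1 Dg_GLm[OF D] in \<open>auto simp: Dg_def\<close>)
qed

text \<open>With \<open>y\<close> the transpose of the asymmetry, conjugation by \<open>y\<close> is the square of the automorphism,
 so \<open>y\<close> normalises a stable Borel subgroup, hence lies in it, and its commutators with a stable
 torus are both diagonalisable and unipotent. So \<open>y\<close> centralises the torus and is
 diagonalisable. Conversely antidiagonal forms provide stable tori and Borel subgroups.\<close>

theorem stable_torus_borel_iff:
 assumes x: "x \<in> GLm n"
 shows "(\<exists>T B. is_maximal_torus n T \<and> is_borel n B \<and> T \<subseteq> B \<and> theta x ` T = T \<and> theta x ` B = B) \<longleftrightarrow> ss (asymmetry x)"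
proof
 define y where "y = x * minv (x\<^sup>T)"
 have yG: "y \<in> GLm n" unfolding y_def using x by simp
 have ya: "y\<^sup>T = asymmetry x"
  unfolding y_def asymmetry_def using x by (simp add: mtranspose_mult minv_transpose[of _ n])
 assume "\<exists>T B. is_maximal_torus n T \<and> is_borel n B \<and> T \<subseteq> B \<and> theta x ` T = T \<and> theta x ` B = B"
 then obtain P R where P: "P \<in> GLm n" and R: "R \<in> GLm n" and sub: "cj n R (Dg n) \<subseteq> cj n P (Up n)"
  and st: "theta x ` cj n R (Dg n) = cj n R (Dg n)" "theta x ` cj n P (Up n) = cj n P (Up n)"
  unfolding is_borel_iff is_maximal_torus_iff by blast
 have conjy: "y * (h * minv y) \<in> H" if H: "theta x ` H = H" and h: "h \<in> H" "h \<in> GLm n" for h H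
 proof -
  have "theta x (theta x h) \<in> H" using H h(1) by blast
  then show ?thesis unfolding theta_theta[OF x h(2)] y_def .
 qed
 have "P * (y * minv P) \<in> Up n"
 proof (rule Up_self_normalising)
  show "P * (y * minv P) \<in> GLm n" using P yG by simp
  fix u assume u: "u \<in> (Up n :: 'k mat set)"
  have uG: "u \<in> GLm n" by (rule Fil_GLm[OF u])
  have "minv P * (u * P) \<in> cj n P (Up n)" using cj_inv[OF P uG] u by blast
  then have "y * ((minv P * (u * P)) * minv y) \<in> cj n P (Up n)"
   by (rule conjy[OF st(2)]) (use P uG in simp)
  then have "P * ((y * ((minv P * (u * P)) * minv y)) * minv P) \<in> Up n" unfolding cj_def by blast
  also have "P * ((y * ((minv P * (u * P)) * minv y)) * minv P) = P * (y * minv P) * (u * minv (P * (y * minv P)))"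
   unfolding minv_conj[OF P yG] using P yG uG by simp
  finally show "P * (y * minv P) * (u * minv (P * (y * minv P))) \<in> Up n" .
 qed
 note yU = this
 have "y \<in> cj n R (Dg n)"
 proof (rule cj_Dg_centraliser[OF R yG])
  fix t assume t: "t \<in> cj n R (Dg n)"
  have tG: "t \<in> GLm n" by (rule cj_GLm[OF t])
  have S: "subgroup (cj n R (Dg n)) (GL n)" by (rule cj_subgroup[OF Dg_subgroup R])
  \<comment> \<open>the commutator is in the torus, and in the unipotent radical of the Borel subgroup\<close>
  define c where "c = y * (t * (minv y * minv t))"
  have cG: "c \<in> GLm n" unfolding c_def using yG tG by simp
  have "(y * (t * minv y)) * minv t \<in> cj n R (Dg n)"
   by (rule subgroup_mult[OF S conjy[OF st(1) t tG] subgroup_minv[OF S t]])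
  then have c: "c \<in> cj n R (Dg n)" unfolding c_def using yG tG by simp
  have tU: "P * (t * minv P) \<in> Up n" using sub t unfolding cj_def by blast
  have "P * (y * minv P) * (P * (t * minv P) * (minv (P * (y * minv P)) * minv (P * (t * minv P)))) \<in> Fil n (Suc 0)"
   by (rule Fil_commutator[OF yU tU])
  also have "P * (y * minv P) * (P * (t * minv P) * (minv (P * (y * minv P)) * minv (P * (t * minv P)))) = P * (c * minv P)"
   unfolding minv_conj[OF P yG] minv_conj[OF P tG] c_def using P yG tG by simp
  finally have cU: "P * (c * minv P) \<in> Fil n 1" by (simp only: One_nat_def)
  have "R * (c * minv R) = 1\<^sub>m n"
  proof (rule unipotent_diagonalisable[OF _ cU])
   show "P * minv R \<in> GLm n" using P R by simp
   show "R * (c * minv R) \<in> Dg n" using c unfolding cj_def by blast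
   show "P * (c * minv P) * (P * minv R) = P * minv R * (R * (c * minv R))" using P R cG by simp
  qed
  then have "minv R * ((R * (c * minv R)) * R) = 1\<^sub>m n" using R by simp
  then have "c = 1\<^sub>m n" using R cG by simp
  then have "c * (t * y) = t * y" using tG yG by simp
  then show "t * y = y * t" unfolding c_def using tG yG by simp
 qed
 then have "R * (y * minv R) \<in> Dg n" unfolding cj_def by blast
 then have "R * (y * minv R) = diagm n (\<lambda>i. (R * (y * minv R)) $$ (i, i))" by (rule Dg_diagm)
 then obtain d where d: "R * (y * minv R) = diagm n d" by blast
 have "minv R * ((R * (y * minv R))) = minv R * diagm n d" unfolding d ..
 then have "y * minv R = minv R * diagm n d" using R yG by simp
 then have "ss y" by (rule diag_ss[OF GLm_carrier[OF yG] minv_GLm[OF R]])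
 then show "ss (asymmetry x)" using ss_transpose[OF GLm_carrier[OF yG]] ya by simp
next
 assume "ss (asymmetry x)"
 then obtain c where c: "\<forall>i<n. c i \<noteq> 0" "cg n False x (diagm n c * J_mat n)" using cg_antidiagonal[OF x] by blast
 then obtain h where h: "h \<in> GLm n" "diagm n c * J_mat n = act h x" unfolding cg_def by blast
 \<comment> \<open>the basis in which the form is antidiagonal gives the torus and the Borel subgroup\<close>
 define S where "S = h\<^sup>T"
 have S: "S \<in> GLm n" unfolding S_def using h by simp
 have x1: "S * (x * S\<^sup>T) = diagm n c * J_mat n" unfolding h(2) act_def S_def by simp
 define c' where "c' i = c (n - 1 - i)" for i
 have x2: "S * (x\<^sup>T * S\<^sup>T) = diagm n c' * J_mat n"
 proof -
  have "S * (x\<^sup>T * S\<^sup>T) = (S * (x * S\<^sup>T))\<^sup>T"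
   using S x by (simp add: mtranspose_mult)
  also have "\<dots> = J_mat n * diagm n c" unfolding x1 by (simp add: mtranspose_mult)
  finally show ?thesis unfolding J_diagm c'_def .
 qed
 have c': "c' i \<noteq> 0" if "i < n" for i using c(1) that by (simp add: c'_def)
 have cc: "\<And>i. i < n \<Longrightarrow> c i \<noteq> 0" using c(1) by blast
 have "theta x ` cj n S (Dg n) = cj n S (Dg n)"
  by (rule theta_image_cj[OF x S]) (use theta_antidiagonal(2)[OF cc] theta_antidiagonal(2)[OF c'] Dg_GLm in \<open>auto simp: x1 x2\<close>)
 moreover have "theta x ` cj n S (Up n) = cj n S (Up n)"
  by (rule theta_image_cj[OF x S]) (use theta_antidiagonal(1)[OF cc] theta_antidiagonal(1)[OF c'] Fil_GLm in \<open>auto simp: x1 x2\<close>)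
 moreover have "cj n S (Dg n) \<subseteq> cj n S (Up n)" using Dg_Up unfolding cj_def by blast
 ultimately show "\<exists>T B. is_maximal_torus n T \<and> is_borel n B \<and> T \<subseteq> B \<and> theta x ` T = T \<and> theta x ` B = B"
  unfolding is_borel_iff is_maximal_torus_iff using S by blast
qed

end

section \<open>Extensions by an involution\<close>

locale involution_group = group G for G :: "('a, 'b) monoid_scheme" (structure) +
 fixes \<tau> :: "'a \<Rightarrow> 'a"
 assumes tau_closed: "g \<in> carrier G \<Longrightarrow> \<tau> g \<in> carrier G"
  and tau_mult: "g \<in> carrier G \<Longrightarrow> h \<in> carrier G \<Longrightarrow> \<tau> (g \<otimes> h) = \<tau> g \<otimes> \<tau> h"
  and tau_tau: "g \<in> carrier G \<Longrightarrow> \<tau> (\<tau> g) = g"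
begin

abbreviation "E \<equiv> semidirect2 G \<tau>"

lemma E_carrier: "x \<in> carrier E \<longleftrightarrow> fst x \<in> carrier G" by (cases x) (simp add: semidirect2_def)
lemma E_mult: "(g, a) \<otimes>\<^bsub>E\<^esub> (h, b) = (g \<otimes> (if a then \<tau> h else h), a \<noteq> b)" by (simp add: semidirect2_def)
lemma E_one: "\<one>\<^bsub>E\<^esub> = (\<one>, False)" by (simp add: semidirect2_def)

lemma tau_one: "\<tau> \<one> = \<one>"
 using tau_mult[of \<one> \<one>] tau_closed[of \<one>] by (metis one_closed r_one r_cancel_one)

lemma group_E: "group E"
proof (rule groupI)
 fix x y assume "x \<in> carrier E" "y \<in> carrier E"
 then show "x \<otimes>\<^bsub>E\<^esub> y \<in> carrier E"
  by (cases x; cases y) (auto simp: E_carrier E_mult tau_closed)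
next
 show "\<one>\<^bsub>E\<^esub> \<in> carrier E" by (simp add: E_one E_carrier)
next
 fix x y z assume xyz: "x \<in> carrier E" "y \<in> carrier E" "z \<in> carrier E"
 obtain g a h b k c where e: "x = (g, a)" "y = (h, b)" "z = (k, c)" by (cases x, cases y, cases z) blast
 have "g \<in> carrier G" "h \<in> carrier G" "k \<in> carrier G" using xyz by (auto simp: E_carrier e)
 then show "x \<otimes>\<^bsub>E\<^esub> y \<otimes>\<^bsub>E\<^esub> z = x \<otimes>\<^bsub>E\<^esub> (y \<otimes>\<^bsub>E\<^esub> z)"
  unfolding e E_mult by (auto simp: tau_closed tau_mult tau_tau m_assoc)
next
 fix x assume "x \<in> carrier E"
 then show "\<one>\<^bsub>E\<^esub> \<otimes>\<^bsub>E\<^esub> x = x" by (cases x) (auto simp: E_carrier E_one E_mult)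
next
 fix x assume x: "x \<in> carrier E"
 obtain g a where e: "x = (g, a)" by (cases x)
 have g: "g \<in> carrier G" using x by (simp add: e E_carrier)
 let ?i = "(if a then \<tau> (inv g) else inv g, a)"
 have "?i \<in> carrier E" using g by (auto simp: E_carrier tau_closed)
 moreover have "?i \<otimes>\<^bsub>E\<^esub> x = \<one>\<^bsub>E\<^esub>"
  unfolding e E_mult E_one using g tau_mult[of "inv g" g] by (auto simp: tau_one)
 ultimately show "\<exists>y\<in>carrier E. y \<otimes>\<^bsub>E\<^esub> x = \<one>\<^bsub>E\<^esub>" by blast
qed

lemma inv_E: assumes "g \<in> carrier G"
 shows "inv\<^bsub>E\<^esub> (g, True) = (\<tau> (inv g), True)" "inv\<^bsub>E\<^esub> (g, False) = (inv g, False)"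
proof -
 interpret E: group E by (rule group_E)
 show "inv\<^bsub>E\<^esub> (g, True) = (\<tau> (inv g), True)"
  by (rule E.inv_equality) (use assms tau_mult[of "inv g" g] in \<open>auto simp: E_mult E_one E_carrier tau_one tau_closed\<close>)
 show "inv\<^bsub>E\<^esub> (g, False) = (inv g, False)"
  by (rule E.inv_equality) (use assms in \<open>auto simp: E_mult E_one E_carrier\<close>)
qed

lemma conj_E: assumes "g \<in> carrier G" "h \<in> carrier G"
 shows "conj_by E (g, True) (base h) = base (g \<otimes> \<tau> h \<otimes> inv g)"
  "conj_by E (base h) (g, True) = (h \<otimes> g \<otimes> \<tau> (inv h), True)"
 using assms by (simp_all add: conj_by_def base_def inv_E E_mult tau_closed tau_tau)

end

context frob_closure
begin

section \<open>The outer coset as a set of bilinear forms\<close>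

lemma theta_mult: assumes x: "x \<in> GLm n" and g: "g \<in> GLm n" and h: "h \<in> GLm n"
 shows "theta x (g * h) = theta x g * theta x (h :: 'k mat)"
proof -
 have "minv ((g * h)\<^sup>T) = minv (g\<^sup>T) * minv (h\<^sup>T)"
  using g h minv_mult[of "h\<^sup>T" n "g\<^sup>T"] by (simp add: mtranspose_mult)
 then show ?thesis unfolding theta_def using x g h by simp
qed

lemma theta_uminus: assumes x: "x \<in> GLm n" and h: "h \<in> GLm n" shows "theta (- x) h = theta x (h :: 'k mat)"
proof -
 have m: "minv (- x) = - minv x"
  by (rule minv_unique(2)[of _ n]) (use x in auto)
 show ?thesis unfolding theta_def m
  using uminus_mult_right_mat[of "minv (h\<^sup>T)" "minv x"]
   uminus_mult_left_mat[of x "- (minv (h\<^sup>T) * minv x)"]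
   uminus_mult_right_mat[of x "minv (h\<^sup>T) * minv x"] x h by simp
qed

text \<open>Matrices like \<open>J\<close> and \<open>scriptJ\<close>: being symmetric or alternating, such a matrix defines an
 automorphism of order two.\<close>

definition form_mat :: "nat \<Rightarrow> 'k mat \<Rightarrow> bool" where
 "form_mat n M \<longleftrightarrow> M \<in> GLm n \<and> rat M \<and> (M\<^sup>T = M \<or> M\<^sup>T = - M)"

lemma tit_theta: assumes "M \<in> GLm n" "g \<in> GLm n" shows "twisted_inverse_transpose n M g = theta M g"
 unfolding twisted_inverse_transpose_def theta_def using assms inv_GL[OF assms(1)] inv_GL[OF assms(2)]
 by (simp add: minv_transpose[of _ n])

lemma involution_group_GL: assumes M: "form_mat n M"
 shows "involution_group (GL n) (twisted_inverse_transpose n M)"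
proof -
 have MG: "M \<in> GLm n" using M by (simp add: form_mat_def)
 interpret group "GL n :: 'k mat monoid" by (rule group_GL)
 show ?thesis
 proof unfold_locales
  fix g h :: "'k mat" assume g: "g \<in> carrier (GL n)"
  then have gG: "g \<in> GLm n" by (simp add: carrier_GL)
  have t: "theta M g \<in> GLm n" by (rule theta_GLm[OF MG gG])
  then show "twisted_inverse_transpose n M g \<in> carrier (GL n)" unfolding tit_theta[OF MG gG] carrier_GL .
  have "theta M (theta M g) = theta M (theta (M\<^sup>T) g)"
   using M theta_uminus[OF MG gG] unfolding form_mat_def by auto
  then show "twisted_inverse_transpose n M (twisted_inverse_transpose n M g) = g"
   unfolding tit_theta[OF MG gG] tit_theta[OF MG t] theta_inverse[OF MG gG] .
  assume "h \<in> carrier (GL n)"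
  then have hG: "h \<in> GLm n" by (simp add: carrier_GL)
  show "twisted_inverse_transpose n M (g \<otimes>\<^bsub>GL n\<^esub> h) = twisted_inverse_transpose n M g \<otimes>\<^bsub>GL n\<^esub> twisted_inverse_transpose n M h"
   unfolding mult_GL tit_theta[OF MG gG] tit_theta[OF MG hG] tit_theta[OF MG mult_GLm[OF gG hG]]
   by (rule theta_mult[OF MG gG hG])
 qed
qed

lemma quasi_semisimple_iff: assumes M: "form_mat n M" and g: "g \<in> GLm n"
 shows "quasi_semisimple n (semidirect2 (GL n) (twisted_inverse_transpose n M)) (g, True) \<longleftrightarrow> ss (asymmetry (g * M))"
proof -
 have MG: "M \<in> GLm n" using M by (simp add: form_mat_def)
 interpret involution_group "GL n" "twisted_inverse_transpose n M" by (rule involution_group_GL[OF M])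
 have c: "conj_by E (g, True) (base h) = base (theta (g * M) h)" if h: "h \<in> GLm n" for h
 proof -
  have "conj_by E (g, True) (base h) = base (g * theta M h * minv g)"
   using conj_E(1)[of g h] g h unfolding carrier_GL mult_GL tit_theta[OF MG h] inv_GL[OF g] by simp
  also have "g * theta M h * minv g = theta (g * M) h"
   unfolding theta_def using g h MG by (simp add: minv_mult[of _ n])
  finally show ?thesis .
 qed
 have st: "stabilises E (g, True) H \<longleftrightarrow> theta (g * M) ` H = H" if H: "H \<subseteq> GLm n" for H
 proof -
  have "conj_by E (g, True) ` base ` H = base ` theta (g * M) ` H"
   unfolding image_image using c H by (intro image_cong) auto
  moreover have "inj (base :: 'k mat \<Rightarrow> _)" by (auto simp: inj_def base_def)
  ultimately show ?thesis unfolding stabilises_def by (simp add: inj_image_eq_iff)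
 qed
 have "T \<subseteq> GLm n" if "is_maximal_torus n T" for T :: "'k mat set"
  using that unfolding is_maximal_torus_iff cj_def by blast
 moreover have "B \<subseteq> GLm n" if "is_borel n B" for B :: "'k mat set" using that unfolding is_borel_iff cj_def by blast
 moreover have "(g, True) \<in> carrier E" using g by (simp add: E_carrier carrier_GL)
 ultimately have "quasi_semisimple n E (g, True) \<longleftrightarrow>
  (\<exists>T B. is_maximal_torus n T \<and> is_borel n B \<and> T \<subseteq> B \<and> theta (g * M) ` T = T \<and> theta (g * M) ` B = B)"
  unfolding quasi_semisimple_def using st by (metis (no_types, lifting))
 then show ?thesis using stable_torus_borel_iff[OF mult_GLm[OF g MG]] by simp
qed

lemma rat_J: "rat (J_mat n)"
 unfolding rat_iff using q_gt_1 by (auto simp: J_index)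

lemma t0_diagm: "t0_mat n = diagm n (\<lambda>i. if i < n div 2 then 1 else - 1)"
 by (rule eq_matI) (auto simp: t0_mat_def)

lemma t0_GLm: "t0_mat n \<in> (GLm n :: 'k mat set)" unfolding t0_diagm by (rule diagm_GLm) auto

lemma rat_t0: "rat (t0_mat n)"
 unfolding rat_iff using q_gt_1 odd_q by (auto simp: t0_diagm)

lemma form_mat_J: "form_mat n (J_mat n)"
 unfolding form_mat_def using J_GLm rat_J by simp

lemma form_mat_scriptJ: "form_mat n (scriptJ_mat n)"
proof (cases "odd n")
 case True then show ?thesis using form_mat_J by (simp add: scriptJ_mat_def)
next
 case False
 define d :: "nat \<Rightarrow> 'k" where "d i = (if i < n div 2 then 1 else - 1)" for i
 have "(t0_mat n * J_mat n)\<^sup>T = J_mat n * diagm n d"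
  unfolding t0_diagm d_def by (simp add: mtranspose_mult)
 also have "\<dots> = diagm n (\<lambda>i. d (n - 1 - i)) * J_mat n" by (rule J_diagm)
 also have "diagm n (\<lambda>i. d (n - 1 - i)) = - diagm n d"
  by (rule eq_matI) (use False in \<open>auto simp: d_def elim!: evenE\<close>)
 also have "- diagm n d * J_mat n = - (t0_mat n * J_mat n)" unfolding t0_diagm d_def by (rule eq_matI) (auto simp: mult_mat_index[of _ n n _ n] sum_negf)
 finally have "(t0_mat n * J_mat n)\<^sup>T = - (t0_mat n * J_mat n :: 'k mat)" .
 moreover have "rat (t0_mat n * J_mat n)" by (rule rat_mult[OF rat_t0 rat_J]) (simp add: t0_diagm)
 ultimately show ?thesis using False t0_GLm J_GLm unfolding form_mat_def scriptJ_mat_def by simp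
qed

definition forms :: "nat \<Rightarrow> 'k mat set" where
 "forms n = {x \<in> GLm n. rat x \<and> ss (asymmetry x)}"

lemma rat_one: "rat (1\<^sub>m n)" unfolding rat_iff using q_gt_1 by auto

text \<open>The identification of the elements of the coset with forms carries conjugacy to congruence, so a
 complete invariant of rational congruence, such as \<open>f\<close>, labels the classes.\<close>

lemma class_bijection:
 assumes M: "form_mat n M" and s: "s = (t, True)" "t \<in> GLm n" "rat t"
  and G: "Gbar = semidirect2 (GL n) (twisted_inverse_transpose n M)"
  and f: "\<And>x x'. x \<in> forms n \<Longrightarrow> x' \<in> forms n \<Longrightarrow> f x = f x' \<longleftrightarrow> cg n True x x'"
 shows "\<exists>\<Phi>. bij_betw \<Phi> (qss_classes n q Gbar s) (f ` forms n)"
proof -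
 have MG: "M \<in> GLm n" and Mr: "rat M" using M by (simp_all add: form_mat_def)
 interpret involution_group "GL n" "twisted_inverse_transpose n M" by (rule involution_group_GL[OF M])
 have coset: "fixed_coset n q Gbar s = {(g, True) | g. g \<in> GLm n \<and> rat g}"
 proof (intro equalityI subsetI)
  fix x assume "x \<in> fixed_coset n q Gbar s"
  then obtain g where g: "g \<in> GLm n" "rat g" "x = base g \<otimes>\<^bsub>E\<^esub> s" unfolding fixed_coset_def GL_fixed_iff G by blast
  then have "x = (g * t, True)" unfolding s(1) base_def E_mult mult_GL by simp
  moreover have "rat (g * t)" by (rule rat_mult[OF g(2) s(3)]) (use g s in simp)
  ultimately show "x \<in> {(g, True) | g. g \<in> GLm n \<and> rat g}" using g(1) s(2) by simp
 next
  fix x assume "x \<in> {(g, True) | g. g \<in> GLm n \<and> rat g}"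
  then obtain g where g: "g \<in> GLm n" "rat g" "x = (g, True)" by blast
  have "rat (g * minv t)" by (rule rat_mult[OF g(2) rat_minv[OF s(3,2)]]) (use g s in simp)
  moreover have "x = base (g * minv t) \<otimes>\<^bsub>E\<^esub> s" unfolding s(1) base_def E_mult mult_GL using g s by simp
  ultimately show "x \<in> fixed_coset n q Gbar s" unfolding fixed_coset_def GL_fixed_iff G using g(1) s(2)
   by (intro CollectI exI[of _ "g * minv t"]) simp
 qed
 have conj: "conj_by E (base h) (g, True) = (h * g * theta M (minv h), True)"
  "h * g * theta M (minv h) * M = act (h\<^sup>T) (g * M)" if "g \<in> GLm n" "h \<in> GLm n" for g h
 proof -
  show "conj_by E (base h) (g, True) = (h * g * theta M (minv h), True)"
   using conj_E(2)[of g h] that unfolding carrier_GL mult_GL inv_GL[OF that(2)] tit_theta[OF MG minv_GLm[OF that(2)]] by simp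
  have "minv ((minv h)\<^sup>T) = h\<^sup>T" using that minv_transpose[OF minv_GLm[OF that(2)]] by simp
  then show "h * g * theta M (minv h) * M = act (h\<^sup>T) (g * M)"
   unfolding theta_def act_def using that MG by simp
 qed
 define cl where "cl g = fixed_conj_class n q Gbar (g, True)" for g
 have cl_iff: "y \<in> cl g \<longleftrightarrow> (\<exists>g'. y = (g', True) \<and> g' \<in> GLm n \<and> cg n True (g * M) (g' * M))" if g: "g \<in> GLm n" for y g
 proof
  assume "y \<in> cl g"
  then obtain h where h: "h \<in> GLm n" "rat h" "y = conj_by E (base h) (g, True)"
   unfolding cl_def fixed_conj_class_def GL_fixed_iff G by blast
  have "h * g * theta M (minv h) \<in> GLm n" using g h theta_GLm[OF MG minv_GLm[OF h(1)]] by simp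
  moreover have "cg n True (g * M) (h * g * theta M (minv h) * M)"
   unfolding cg_def conj(2)[OF g h(1)] using h rat_transpose by (intro bexI[of _ "h\<^sup>T"]) auto
  ultimately show "\<exists>g'. y = (g', True) \<and> g' \<in> GLm n \<and> cg n True (g * M) (g' * M)"
   using h(3) conj(1)[OF g h(1)] by blast
 next
  assume "\<exists>g'. y = (g', True) \<and> g' \<in> GLm n \<and> cg n True (g * M) (g' * M)"
  then obtain g' h where g': "y = (g', True)" "g' \<in> GLm n" and h: "h \<in> GLm n" "rat h" "g' * M = act h (g * M)"
   unfolding cg_def by blast
  have hT: "h\<^sup>T \<in> GLm n" using h by simp
  have "h\<^sup>T * g * theta M (minv (h\<^sup>T)) * M = g' * M"
   using conj(2)[OF g hT] h(3) by simp
  then have "h\<^sup>T * g * theta M (minv (h\<^sup>T)) * M * minv M = g' * M * minv M" by simp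
  then have "h\<^sup>T * g * theta M (minv (h\<^sup>T)) = g'"
   using MG g g' hT theta_GLm[OF MG minv_GLm[OF hT]] by simp
  then have "y = conj_by E (base (h\<^sup>T)) (g, True)" using conj(1)[OF g hT] g'(1) by simp
  then show "y \<in> cl g" unfolding cl_def fixed_conj_class_def GL_fixed_iff G using hT rat_transpose[OF h(2)] by blast
 qed
 define X where "X = {g \<in> GLm n. g * M \<in> forms n}"
 have ratM: "rat (g * M) \<longleftrightarrow> rat g" if g: "g \<in> GLm n" for g
 proof
  assume r: "rat (g * M)"
  have "rat (g * M * minv M)" by (rule rat_mult[OF r rat_minv[OF Mr MG]]) (use MG in simp)
  then show "rat g" using g MG by simp
 next
  assume "rat g" then show "rat (g * M)" by (rule rat_mult[OF _ Mr]) (use g MG in simp)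
 qed
 have qc: "qss_classes n q Gbar s = cl ` X"
 proof (intro equalityI subsetI)
  fix C assume "C \<in> qss_classes n q Gbar s"
  then obtain y where C: "C \<subseteq> fixed_coset n q Gbar s" "quasi_semisimple n Gbar y" "C = fixed_conj_class n q Gbar y"
   unfolding qss_classes_def by blast
  have yE: "y \<in> carrier E" using C(2) unfolding quasi_semisimple_def G by blast
  interpret Eg: group E by (rule group_E)
  have "conj_by E (base (1\<^sub>m n)) y = y"
   using yE Eg.inv_one unfolding conj_by_def base_def one_GL[symmetric] E_one[symmetric] by simp
  then have "y \<in> C" unfolding C(3) fixed_conj_class_def GL_fixed_iff G
   using one_GLm[of n] rat_one[of n] by (intro CollectI exI[of _ "1\<^sub>m n"]) simp
  then obtain g where g: "y = (g, True)" "g \<in> GLm n" "rat g" using C(1) unfolding coset by blast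
  have "ss (asymmetry (g * M))" using C(2) unfolding g(1) G quasi_semisimple_iff[OF M g(2)] .
  then have "g \<in> X" unfolding X_def forms_def using g MG ratM by simp
  then show "C \<in> cl ` X" unfolding cl_def C(3) g(1) by blast
 next
  fix C assume "C \<in> cl ` X"
  then obtain g where g: "g \<in> X" "C = cl g" by blast
  then have g': "g \<in> GLm n" "rat (g * M)" "ss (asymmetry (g * M))" unfolding X_def forms_def by auto
  have "quasi_semisimple n Gbar (g, True)" unfolding G quasi_semisimple_iff[OF M g'(1)] by (rule g'(3))
  moreover have "C \<subseteq> fixed_coset n q Gbar s"
  proof
   fix y assume "y \<in> C"
   then obtain k where k: "y = (k, True)" "k \<in> GLm n" "cg n True (g * M) (k * M)"
    unfolding g(2) cl_iff[OF g'(1)] by blast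
   have "rat (k * M)" by (rule cg_rat[OF k(3) _ g'(2)]) (use g' MG in simp)
   then show "y \<in> fixed_coset n q Gbar s" unfolding coset using k ratM by simp
  qed
  ultimately show "C \<in> qss_classes n q Gbar s" unfolding qss_classes_def g(2) cl_def by blast
 qed
 define \<Phi> where "\<Phi> C = f (fst (SOME y. y \<in> C) * M)" for C :: "('k mat \<times> bool) set"
 have eqv: "f (g' * M) = f (g * M)" if g: "g \<in> X" and y: "(g', True) \<in> cl g" for g g'
 proof -
  have gG: "g \<in> GLm n" "g * M \<in> forms n" using g unfolding X_def by auto
  have c: "cg n True (g * M) (g' * M)" using y unfolding cl_iff[OF gG(1)] by blast
  have "g' * M \<in> GLm n" "rat (g' * M)" "ss (asymmetry (g' * M))"
   using cg_GLm[OF c] cg_rat[OF c] cg_ss[OF c] gG(2) unfolding forms_def by auto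
  then have "g' * M \<in> forms n" unfolding forms_def by blast
  from f[OF gG(2) this] show ?thesis using c by simp
 qed
 have self: "(g, True) \<in> cl g" if "g \<in> X" for g
  using that cl_iff[of g "(g, True)"] cg_refl[of "g * M" n True] MG unfolding X_def by auto
 have Phi: "\<Phi> (cl g) = f (g * M)" if g: "g \<in> X" for g
 proof -
  have "(SOME y. y \<in> cl g) \<in> cl g" using self[OF g] by (rule someI)
  moreover obtain k where "(SOME y. y \<in> cl g) = (k, True)" using calculation cl_iff[of g] g unfolding X_def by blast
  ultimately show ?thesis unfolding \<Phi>_def using eqv[OF g] by simp
 qed
 have "inj_on \<Phi> (cl ` X)"
 proof (rule inj_onI)
  fix C C' assume "C \<in> cl ` X" "C' \<in> cl ` X" and e: "\<Phi> C = \<Phi> C'"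
  then obtain g g' where g: "g \<in> X" "C = cl g" "g' \<in> X" "C' = cl g'" by blast
  have G': "g \<in> GLm n" "g' \<in> GLm n" "g * M \<in> forms n" "g' * M \<in> forms n" using g unfolding X_def by auto
  have c: "cg n True (g * M) (g' * M)" using e Phi g f[OF G'(3,4)] by simp
  have xG: "g * M \<in> GLm n" "g' * M \<in> GLm n" using G' MG by auto
  have "cg n True (g * M) (k * M) \<longleftrightarrow> cg n True (g' * M) (k * M)" for k
   using cg_trans[OF xG(1) c] cg_trans[OF xG(2) cg_sym[OF xG(1) c]] by blast
  then have "y \<in> cl g \<longleftrightarrow> y \<in> cl g'" for y unfolding cl_iff[OF G'(1)] cl_iff[OF G'(2)] by blast
  then show "C = C'" unfolding g(2,4) by blast
 qed
 moreover have "\<Phi> ` (cl ` X) = f ` forms n"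
 proof -
  have "(\<lambda>g. g * M) ` X = forms n"
  proof (intro equalityI subsetI)
   fix x assume x: "x \<in> forms n"
   then have xG: "x \<in> GLm n" by (simp add: forms_def)
   have "x * minv M \<in> X" unfolding X_def using x xG MG by simp
   moreover have "x = (x * minv M) * M" using xG MG by simp
   ultimately show "x \<in> (\<lambda>g. g * M) ` X" by (rule rev_image_eqI)
  qed (auto simp: X_def)
  then have "f ` forms n = (\<lambda>g. f (g * M)) ` X" by (metis image_image)
  also have "\<dots> = \<Phi> ` (cl ` X)" unfolding image_image using Phi by (intro image_cong) auto
  finally show ?thesis by simp
 qed
 ultimately show ?thesis unfolding qc bij_betw_def by blast
qed

end

section \<open>Spectra and combinatorial data\<close>

lemma count_image_mset_inj: "inj f \<Longrightarrow> count (image_mset f M) (f x) = count M x"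
 by (induction M) (auto dest: injD)

context frob_closure
begin

text \<open>The class in \<open>khat\<close> whose members have square \<open>x\<close> or \<open>1 / x\<close>; indexing the classes by \<open>x\<close> avoids
 the choice of a square root.\<close>

definition hs :: "'k \<Rightarrow> 'k set" where "hs x = {b. b ^ 2 = x \<or> b ^ 2 = inverse x}"

definition orb :: "'k \<Rightarrow> 'k set set" where "orb x = hat_orbit q (hs x)"

lemma ex_sqrt: "\<exists>a. a ^ 2 = (x::'k)"
 using alg_closed_imp_poly_has_root[of "[:- x, 0, 1:]"] by (auto simp: power2_eq_square)

lemma hat_hs: "hat a = hs (a ^ 2)"
proof -
 have "inverse (a ^ 2) = (inverse a) ^ 2" by (simp add: power_inverse)
 then show ?thesis unfolding hat_def hs_def by (auto simp: power2_eq_iff)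
qed

lemma hs_eq_iff: "hs x = hs y \<longleftrightarrow> y = x \<or> y = inverse x"
proof
 assume e: "hs x = hs y"
 obtain a where a: "a ^ 2 = y" using ex_sqrt by blast
 then have "a \<in> hs y" by (simp add: hs_def)
 then have "a \<in> hs x" unfolding e .
 then have "a ^ 2 = x \<or> a ^ 2 = inverse x" by (simp only: hs_def mem_Collect_eq)
 then show "y = x \<or> y = inverse x" unfolding a .
qed (auto simp: hs_def)

lemma frob_hs: "(frob_hat q ^^ m) (hs x) = hs (x ^ (q ^ m))"
proof (induction m)
 case (Suc m)
 obtain a where a: "a ^ 2 = x ^ (q ^ m)" using ex_sqrt by blast
 have "frob_hat q (hs (x ^ (q ^ m))) = hs ((a ^ q) ^ 2)"
  unfolding a[symmetric] hat_hs[symmetric] frob_hat_hat[OF odd_q] ..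
 also have "(a ^ q) ^ 2 = (a ^ 2) ^ q" by (simp only: power_mult[symmetric] mult.commute)
 also have "\<dots> = x ^ (q ^ Suc m)" unfolding a by (simp only: power_mult[symmetric] power_Suc2)
 finally show ?case using Suc by simp
qed simp

lemma orb_range: "orb x = range (\<lambda>m. hs (x ^ (q ^ m)))"
 unfolding orb_def hat_orbit_def by (simp add: frob_hs)

lemma hat_orbits_orb: "hat_orbits q = orb ` {x. x \<noteq> 0}"
proof -
 have "hat_orbits q = (\<lambda>a. orb (a ^ 2)) ` {a. a \<noteq> 0}"
  unfolding hat_orbits_def khat_def orb_def hat_hs by blast
 also have "\<dots> = orb ` {x. x \<noteq> 0}"
 proof (intro equalityI subsetI)
  fix A assume "A \<in> orb ` {x. x \<noteq> 0}"
  then obtain x where x: "x \<noteq> 0" "A = orb x" by blast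
  obtain a where a: "a ^ 2 = x" using ex_sqrt by blast
  then have "a \<noteq> 0" using x by auto
  then show "A \<in> (\<lambda>a. orb (a ^ 2)) ` {a. a \<noteq> 0}" using a x by blast
 qed auto
 finally show ?thesis .
qed

lemma orb_frob: "orb (x ^ (q ^ m)) = orb x"
proof (intro equalityI subsetI)
 fix h assume "h \<in> orb (x ^ (q ^ m))"
 then obtain j where "h = hs (x ^ (q ^ (m + j)))" unfolding orb_range frob_frob by blast
 then show "h \<in> orb x" unfolding orb_range by blast
next
 fix h assume "h \<in> orb x"
 then obtain j where j: "h = hs (x ^ (q ^ j))" unfolding orb_range by blast
 obtain P where P: "P > 0" "x ^ (q ^ P) = x" using ex_period by blast
 have per: "x ^ (q ^ (P * i)) = x" for i
 proof (induction i)
  case (Suc i)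
  have "x ^ (q ^ (P * Suc i)) = (x ^ (q ^ P)) ^ (q ^ (P * i))" unfolding frob_frob by simp
  then show ?case using Suc P by simp
 qed simp
 have "m \<le> P * m + j" using P(1) by (simp add: trans_le_add1)
 then have "(x ^ (q ^ m)) ^ (q ^ (P * m + j - m)) = x ^ (q ^ (P * m + j))" unfolding frob_frob by simp
 also have "\<dots> = (x ^ (q ^ (P * m))) ^ (q ^ j)" unfolding frob_frob ..
 finally have "h = hs ((x ^ (q ^ m)) ^ (q ^ (P * m + j - m)))" unfolding j per by simp
 then show "h \<in> orb (x ^ (q ^ m))" unfolding orb_range by blast
qed

lemma orb_inverse: "orb (inverse x) = orb x"
proof -
 have "hs (inverse x ^ i) = hs (x ^ i)" for i using hs_eq_iff[of "inverse (x ^ i)" "x ^ i"] by (simp add: power_inverse)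
 then show ?thesis unfolding orb_range by simp
qed

lemma orb_eq_iff: "orb x = orb y \<longleftrightarrow> (\<exists>m. y = x ^ (q ^ m) \<or> y = inverse (x ^ (q ^ m)))"
proof
 assume e: "orb x = orb y"
 have "hs y \<in> orb y" unfolding orb_range by (rule range_eqI[of _ _ 0]) simp
 then have "hs y \<in> orb x" unfolding e .
 then obtain m where "hs (x ^ (q ^ m)) = hs y" unfolding orb_range by auto
 then show "\<exists>m. y = x ^ (q ^ m) \<or> y = inverse (x ^ (q ^ m))" unfolding hs_eq_iff by blast
next
 assume "\<exists>m. y = x ^ (q ^ m) \<or> y = inverse (x ^ (q ^ m))"
 then obtain m where m: "y = x ^ (q ^ m) \<or> y = inverse (x ^ (q ^ m))" by (elim exE)
 have "orb (inverse (x ^ (q ^ m))) = orb x" unfolding orb_inverse by (rule orb_frob)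
 with m show "orb x = orb y" using orb_frob[of x m] by (elim disjE) simp_all
qed

lemma pow_one_iff: "x ^ (q ^ m) = 1 \<longleftrightarrow> x = (1::'k)" "x ^ (q ^ m) = - 1 \<longleftrightarrow> x = (- 1::'k)" "x ^ (q ^ m) = 0 \<longleftrightarrow> x = (0::'k)"
proof -
 show "x ^ (q ^ m) = 1 \<longleftrightarrow> x = 1" using frob_inj[of x m 1] by simp
 show "x ^ (q ^ m) = - 1 \<longleftrightarrow> x = - 1" using frob_inj[of x m "-1"] odd_q by simp
 show "x ^ (q ^ m) = 0 \<longleftrightarrow> x = 0" using q_pow_pos[of m] by simp
qed

lemma orb_special: "orb 1 = {hat 1}" "\<iota> ^ 2 = - 1 \<Longrightarrow> orb (- 1) = {hat \<iota>}"
 "x \<noteq> 0 \<Longrightarrow> orb x = orb 1 \<longleftrightarrow> x = 1" "x \<noteq> 0 \<Longrightarrow> orb x = orb (- 1) \<longleftrightarrow> x = - 1"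
proof -
 show "orb 1 = {hat 1}" unfolding orb_range hat_hs by auto
 show "orb (- 1) = {hat \<iota>}" if "\<iota> ^ 2 = - 1" unfolding orb_range hat_hs that using odd_q by auto
 show "orb x = orb 1 \<longleftrightarrow> x = 1" if "x \<noteq> 0"
 proof -
  have "1 = inverse (x ^ (q ^ m)) \<longleftrightarrow> x ^ (q ^ m) = 1" for m by (auto simp: inverse_eq_1_iff)
  then show ?thesis unfolding orb_eq_iff using pow_one_iff(1)[of x] by auto
 qed
 then show "orb x = orb (- 1) \<longleftrightarrow> x = - 1" if "x \<noteq> 0"
 proof -
  have a: "- 1 = x ^ (q ^ m) \<longleftrightarrow> x = - 1" for m using pow_one_iff(2)[of x m] by (simp only: eq_commute[of "- 1"])
  have b: "- 1 = inverse (x ^ (q ^ m)) \<longleftrightarrow> x = - 1" for m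
   using inverse_eq_iff_eq[of "x ^ (q ^ m)" "- 1"] a[of m] by (simp only: inverse_minus_eq inverse_1 eq_commute[of "- 1"])
  show ?thesis unfolding orb_eq_iff a b by simp
 qed
qed

text \<open>The nonzero elements whose square roots have their class in the orbit \<open>A\<close>.\<close>

definition fibre :: "'k set set \<Rightarrow> 'k set" where "fibre A = {x. x \<noteq> 0 \<and> orb x = A}"

lemma fibre_finite: "finite (fibre A)"
proof (cases "fibre A = {}")
 case False
 then obtain x where x: "x \<noteq> 0" "orb x = A" unfolding fibre_def by blast
 obtain P where P: "P > 0" "x ^ (q ^ P) = x" using ex_period by blast
 have "y ^ (q ^ P) = y" if y: "y \<in> fibre A" for y
 proof -
  obtain m where m: "y = x ^ (q ^ m) \<or> y = inverse (x ^ (q ^ m))" using y x orb_eq_iff[of x y] unfolding fibre_def by auto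
  have "(x ^ (q ^ m)) ^ (q ^ P) = x ^ (q ^ m)" using P(2) frob_frob[of x m P] frob_frob[of x P m] by (simp add: add.commute)
  then show ?thesis using m by (auto simp: power_inverse)
 qed
 then have "fibre A \<subseteq> {y. y ^ (q ^ P) = y}" by blast
 then show ?thesis using finite_fixed[OF P(1)] finite_subset by blast
qed simp

text \<open>Sending \<open>x\<close> to its class is two to one: only \<open>1\<close> and \<open>- 1\<close> are their own inverses.\<close>

lemma fibre_card: assumes "A \<in> hat_orbits q" "A \<noteq> orb 1" "A \<noteq> orb (- 1)"
 shows "card (fibre A) = 2 * card A"
proof -
 obtain x where x: "x \<noteq> 0" "A = orb x" using assms(1) unfolding hat_orbits_orb by blast
 have im: "hs ` fibre A = A"
 proof (intro equalityI subsetI)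
  fix h assume "h \<in> hs ` fibre A"
  then obtain y where "h = hs y" "orb y = A" unfolding fibre_def by blast
  then show "h \<in> A" unfolding orb_range by (metis range_eqI power_0 power_one_right)
 next
  fix h assume "h \<in> A"
  then obtain m where m: "h = hs (x ^ (q ^ m))" unfolding x(2) orb_range by blast
  have "x ^ (q ^ m) \<in> fibre A" unfolding fibre_def using x orb_frob pow_one_iff(3) by simp
  then show "h \<in> hs ` fibre A" using m by blast
 qed
 have two: "card {y \<in> fibre A. hs y = h} = 2" if "h \<in> A" for h
 proof -
  have "h \<in> hs ` fibre A" unfolding im by (rule that)
  then obtain z where z: "z \<in> fibre A" "h = hs z" by (elim imageE)
  have z0: "z \<noteq> 0" "orb z = A" using z unfolding fibre_def by auto
  have "{y \<in> fibre A. hs y = h} = {z, inverse z}"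
   unfolding z(2) hs_eq_iff using z0 orb_inverse[of z] by (auto simp: fibre_def)
  moreover have "z \<noteq> inverse z"
  proof
   assume "z = inverse z"
   then have "z * z = 1" using z0 by (metis right_inverse)
   then have "z = 1 \<or> z = - 1" by (simp add: square_eq_1_iff)
   then show False using z0(2) assms by auto
  qed
  ultimately show ?thesis by simp
 qed
 have "card (fibre A) = (\<Sum>h\<in>hs ` fibre A. card {y \<in> fibre A. hs y = h})"
  using sum.image_gen[OF fibre_finite, of "\<lambda>_. 1 :: nat" A hs] by simp
 also have "\<dots> = (\<Sum>h\<in>A. 2)" unfolding im using two by simp
 finally show ?thesis by simp
qed

definition spectra :: "nat \<Rightarrow> 'k multiset set" where
 "spectra n = {M. size M = n \<and> image_mset inverse M = M \<and> 0 \<notin># M \<and> prod_mset M = 1 \<and> image_mset (\<lambda>z. z ^ q) M = M}"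

definition spec_datum :: "nat \<Rightarrow> 'k multiset \<Rightarrow> 'k datum" where
 "spec_datum n M = (count M (if odd n then 1 else - 1), count M (if odd n then - 1 else 1),
   (\<lambda>x. (count M x, orb x)) ` (set_mset M - {1, - 1}))"

lemma count_invariant_iff:
 "image_mset inverse M = M \<longleftrightarrow> (\<forall>x::'k. count M (inverse x) = count M x)"
 "image_mset (\<lambda>z. z ^ q) M = M \<longleftrightarrow> (\<forall>x::'k. count M (x ^ q) = count M x)"
proof -
 have i: "inj (inverse :: 'k \<Rightarrow> 'k)" by (simp add: inj_def)
 have "inj (\<lambda>z::'k. z ^ q)" using frob_inj[of _ 1] by (simp add: inj_def)
 note f = this
 have sur: "\<exists>x. x ^ q = (y::'k)" for y
 proof -
  obtain P where P: "P > 0" "y ^ (q ^ P) = y" using ex_period by blast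
  have "(y ^ (q ^ (P - 1))) ^ (q ^ 1) = y ^ (q ^ P)" unfolding frob_frob using P(1) by simp
  then show ?thesis using P(2) by auto
 qed
 show "image_mset inverse M = M \<longleftrightarrow> (\<forall>x::'k. count M (inverse x) = count M x)"
 proof
  assume e: "image_mset inverse M = M"
  have "count (image_mset inverse M) (inverse x) = count M x" for x :: 'k by (rule count_image_mset_inj[OF i])
  then show "\<forall>x. count M (inverse x) = count M x" unfolding e by blast
 next
  assume e: "\<forall>x. count M (inverse x) = count M x"
  show "image_mset inverse M = M"
  proof (rule multiset_eqI)
   fix y :: 'k
   have "count (image_mset inverse M) (inverse (inverse y)) = count M (inverse y)" by (rule count_image_mset_inj[OF i])
   then show "count (image_mset inverse M) y = count M y" using e by simp
  qed
 qed
 show "image_mset (\<lambda>z. z ^ q) M = M \<longleftrightarrow> (\<forall>x::'k. count M (x ^ q) = count M x)"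
 proof
  assume e: "image_mset (\<lambda>z. z ^ q) M = M"
  have "count (image_mset (\<lambda>z. z ^ q) M) (x ^ q) = count M x" for x :: 'k by (rule count_image_mset_inj[OF f])
  then show "\<forall>x. count M (x ^ q) = count M x" unfolding e by blast
 next
  assume e: "\<forall>x. count M (x ^ q) = count M x"
  show "image_mset (\<lambda>z. z ^ q) M = M"
  proof (rule multiset_eqI)
   fix y :: 'k
   obtain x where x: "x ^ q = y" using sur by blast
   have "count (image_mset (\<lambda>z. z ^ q) M) (x ^ q) = count M x" by (rule count_image_mset_inj[OF f])
   then show "count (image_mset (\<lambda>z. z ^ q) M) y = count M y" using e x by metis
  qed
 qed
qed

lemma count_orb: assumes M: "image_mset inverse M = M" "image_mset (\<lambda>z. z ^ q) M = M" and e: "orb x = orb y"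
 shows "count M x = count M (y::'k)"
proof -
 have p: "count M (z ^ (q ^ m)) = count M z" for z m
 proof (induction m)
  case (Suc m)
  have "z ^ (q ^ Suc m) = (z ^ (q ^ m)) ^ q" by (simp only: power_mult[symmetric] power_Suc2)
  then show ?case using Suc M(2)[unfolded count_invariant_iff(2)] by simp
 qed simp
 obtain m where "y = x ^ (q ^ m) \<or> y = inverse (x ^ (q ^ m))" using e unfolding orb_eq_iff by (elim exE)
 then show ?thesis using p[of x m] M(1)[unfolded count_invariant_iff(1)] by (elim disjE) simp_all
qed

lemma size_by_orbits:
 assumes M0: "0 \<notin># M" and fin: "finite A" and A: "A \<subseteq> hat_orbits q - {orb 1, orb (- 1)}"
  and N: "\<And>x. x \<noteq> 0 \<Longrightarrow> x \<noteq> 1 \<Longrightarrow> x \<noteq> - 1 \<Longrightarrow> count M x = (if orb x \<in> A then N (orb x) else 0)"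
 shows "size M = count M 1 + count M (- 1) + (\<Sum>\<alpha>\<in>A. 2 * N \<alpha> * card \<alpha>)"
proof -
 have spec: "x \<noteq> 0 \<and> x \<noteq> 1 \<and> x \<noteq> - 1" if "\<alpha> \<in> A" "x \<in> fibre \<alpha>" for x \<alpha>
  using that A unfolding fibre_def by auto
 define U where "U = (\<Union>\<alpha>\<in>A. fibre \<alpha>)"
 have finU: "finite U" unfolding U_def using fin fibre_finite by blast
 have sub: "set_mset M \<subseteq> U \<union> {1, - 1}"
 proof
  fix x assume x: "x \<in># M"
  then have x0: "x \<noteq> 0" using M0 by auto
  show "x \<in> U \<union> {1, - 1}"
  proof (cases "x = 1 \<or> x = - 1")
   case False
   then have "orb x \<in> A" using N[OF x0] x by (metis count_greater_zero_iff less_irrefl)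
   then show ?thesis unfolding U_def fibre_def using x0 by blast
  qed auto
 qed
 have disj: "U \<inter> {1, - 1} = {}" unfolding U_def using spec by blast
 have "size M = (\<Sum>x\<in>set_mset M. count M x)" by (simp add: size_multiset_overloaded_eq)
 also have "\<dots> = (\<Sum>x\<in>U \<union> {1, - 1}. count M x)"
  by (rule sum.mono_neutral_left) (use finU sub in \<open>auto simp: not_in_iff\<close>)
 also have "\<dots> = (\<Sum>x\<in>U. count M x) + (\<Sum>x\<in>{1, - 1}. count M x)"
  by (rule sum.union_disjoint) (use finU disj in auto)
 also have "(\<Sum>x\<in>{1, - 1}. count M x) = count M 1 + count M (- 1)" using one_neq_minus_one by simp
 also have "(\<Sum>x\<in>U. count M x) = (\<Sum>\<alpha>\<in>A. \<Sum>x\<in>fibre \<alpha>. count M x)"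
  unfolding U_def by (rule sum.UNION_disjoint) (use fin fibre_finite in \<open>auto simp: fibre_def\<close>)
 also have "\<dots> = (\<Sum>\<alpha>\<in>A. 2 * N \<alpha> * card \<alpha>)"
 proof (rule sum.cong)
  fix \<alpha> assume \<alpha>: "\<alpha> \<in> A"
  have "count M x = N \<alpha>" if x: "x \<in> fibre \<alpha>" for x using N[of x] spec[OF \<alpha> x] x \<alpha> unfolding fibre_def by auto
  then have "(\<Sum>x\<in>fibre \<alpha>. count M x) = card (fibre \<alpha>) * N \<alpha>" by simp
  also have "card (fibre \<alpha>) = 2 * card \<alpha>" by (rule fibre_card) (use A \<alpha> in auto)
  finally show "(\<Sum>x\<in>fibre \<alpha>. count M x) = 2 * N \<alpha> * card \<alpha>" by simp
 qed simp
 finally show ?thesis by simp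
qed

text \<open>Families may be indexed by their orbits, as these are distinct.\<close>

lemma TCs_iff: assumes \<iota>: "\<iota> ^ 2 = (- 1 :: 'k)"
 shows "(np, nm, D) \<in> TCs n q \<iota> \<longleftrightarrow> (\<exists>A N. finite A \<and> D = (\<lambda>\<alpha>. (N \<alpha>, \<alpha>)) ` A \<and> np mod 2 = n mod 2 \<and>
  (\<forall>\<alpha>\<in>A. N \<alpha> > 0) \<and> A \<subseteq> hat_orbits q - {orb 1, orb (- 1)} \<and> np + nm + (\<Sum>\<alpha>\<in>A. 2 * N \<alpha> * card \<alpha>) = n)"
  (is "_ \<longleftrightarrow> ?R")
proof
 assume "(np, nm, D) \<in> TCs n q \<iota>"
 then obtain N \<alpha> and \<Lambda> :: "nat set" where L: "finite \<Lambda>" "D = (\<lambda>i. (N i, \<alpha> i)) ` \<Lambda>" "np mod 2 = n mod 2"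
  "\<forall>i\<in>\<Lambda>. N i > 0" "\<forall>i\<in>\<Lambda>. \<alpha> i \<in> hat_orbits q \<and> \<alpha> i \<noteq> {hat 1} \<and> \<alpha> i \<noteq> {hat \<iota>}" "inj_on \<alpha> \<Lambda>"
  "np + nm + (\<Sum>i\<in>\<Lambda>. 2 * N i * card (\<alpha> i)) = n" unfolding TCs_def by auto
 define N' where "N' = N \<circ> the_inv_into \<Lambda> \<alpha>"
 have N': "N' (\<alpha> i) = N i" if "i \<in> \<Lambda>" for i unfolding N'_def using the_inv_into_f_f[OF L(6) that] by simp
 have "(\<Sum>a\<in>\<alpha> ` \<Lambda>. 2 * N' a * card a) = (\<Sum>i\<in>\<Lambda>. 2 * N i * card (\<alpha> i))"
  using L(6) N' by (simp add: sum.reindex)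
 moreover have "D = (\<lambda>a. (N' a, a)) ` (\<alpha> ` \<Lambda>)" unfolding L(2) image_image using N' by (intro image_cong) auto
 moreover have "\<forall>a\<in>\<alpha> ` \<Lambda>. N' a > 0" using N' L(4) by auto
 moreover have "\<alpha> ` \<Lambda> \<subseteq> hat_orbits q - {orb 1, orb (- 1)}" using L(5) unfolding orb_special(1) orb_special(2)[OF \<iota>] by blast
 ultimately show ?R using L(1,3,7) by (intro exI[of _ "\<alpha> ` \<Lambda>"] exI[of _ N']) auto
next
 assume ?R
 then obtain A N where A: "finite A" "D = (\<lambda>\<alpha>. (N \<alpha>, \<alpha>)) ` A" "np mod 2 = n mod 2"
  "\<forall>\<alpha>\<in>A. N \<alpha> > 0" "A \<subseteq> hat_orbits q - {orb 1, orb (- 1)}" "np + nm + (\<Sum>\<alpha>\<in>A. 2 * N \<alpha> * card \<alpha>) = n" by blast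
 obtain f where f: "bij_betw f {0..<card A} A" using ex_bij_betw_nat_finite[OF A(1)] by blast
 have fA: "f ` {0..<card A} = A" "inj_on f {0..<card A}" using f by (auto simp: bij_betw_def)
 have "(\<Sum>i\<in>{0..<card A}. 2 * N (f i) * card (f i)) = (\<Sum>\<alpha>\<in>A. 2 * N \<alpha> * card \<alpha>)"
  by (rule sum.reindex_bij_betw[OF f])
 moreover have D: "D = (\<lambda>i. (N (f i), f i)) ` {0..<card A}"
 proof -
  have "D = (\<lambda>\<alpha>. (N \<alpha>, \<alpha>)) ` f ` {0..<card A}" using A(2) fA(1) by simp
  then show ?thesis unfolding image_image .
 qed
 moreover have fi: "f i \<in> A" if "i \<in> {0..<card A}" for i using imageI[OF that, of f] unfolding fA(1) .
 have "\<forall>i\<in>{0..<card A}. N (f i) > 0" using A(4) fi by simp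
 moreover have "\<forall>i\<in>{0..<card A}. f i \<in> hat_orbits q \<and> f i \<noteq> {hat 1} \<and> f i \<noteq> {hat \<iota>}"
 proof
  fix i assume "i \<in> {0..<card A}"
  then have "f i \<in> hat_orbits q - {orb 1, orb (- 1)}" by (rule subsetD[OF A(5) fi])
  then show "f i \<in> hat_orbits q \<and> f i \<noteq> {hat 1} \<and> f i \<noteq> {hat \<iota>}"
   unfolding orb_special(1) orb_special(2)[OF \<iota>] by simp
 qed
 ultimately show "(np, nm, D) \<in> TCs n q \<iota>"
  unfolding TCs_def using A(3,6) fA(2)
  by (intro CollectI exI[of _ np] exI[of _ nm] exI[of _ "\<lambda>i. N (f i)"] exI[of _ f] exI[of _ "{0..<card A}"]) simp
qed

text \<open>Pairs of inverse elements other than \<open>1\<close> and \<open>- 1\<close> contribute an even number to the size, and 1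
 to the product.\<close>

lemma spectra_parity: assumes M: "size M = n" "image_mset inverse M = M" "0 \<notin># M" and n: "n = count M 1 + count M (- 1) + 2 * k"
 shows "prod_mset M = (1::'k) \<longleftrightarrow> count M (if odd n then 1 else - 1) mod 2 = n mod 2"
proof -
 have "prod_mset M = (- 1) ^ count M (- 1)" by (rule prod_inverse_invariant[OF M(2,3) one_neq_minus_one])
 also have "\<dots> = 1 \<longleftrightarrow> even (count M (- 1))" using one_neq_minus_one by (cases "even (count M (- 1))") auto
 also have "\<dots> \<longleftrightarrow> count M (if odd n then 1 else - 1) mod 2 = n mod 2"
 proof (cases "odd n")
  case True
  then have "even (count M (- 1)) \<longleftrightarrow> count M 1 mod 2 = n mod 2" using n by presburger
  then show ?thesis using True by simp
 next
  case False
  then show ?thesis by (simp add: even_iff_mod_2_eq_zero)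
 qed
 finally show ?thesis .
qed

text \<open>Invariance under inversion and Frobenius says that multiplicities are constant on the fibres, so
 the data record the multiplicity function, and conversely prescribe it.\<close>

theorem spec_datum_bij: assumes \<iota>: "\<iota> ^ 2 = (- 1 :: 'k)"
 shows "bij_betw (spec_datum n) (spectra n) (TCs n q \<iota>)"
 unfolding bij_betw_def
proof
 show "inj_on (spec_datum n) (spectra n)"
 proof (rule inj_onI)
  fix M M' assume M: "M \<in> spectra n" and M': "M' \<in> spectra n" and e: "spec_datum n M = spec_datum n M'"
  have imp: "count M' x = count M x"
   if M: "M \<in> spectra n" and M': "M' \<in> spectra n" and e: "spec_datum n M = spec_datum n M'"
    and x: "x \<in># M" "x \<noteq> 1" "x \<noteq> - 1" for M M' x
  proof -
   have "(count M x, orb x) \<in> (\<lambda>x. (count M' x, orb x)) ` (set_mset M' - {1, - 1})"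
    using x e unfolding spec_datum_def by auto
   then obtain y where y: "y \<in># M'" "count M x = count M' y" "orb x = orb y" by auto
   then show ?thesis using count_orb[of M' x y] M' unfolding spectra_def by simp
  qed
  show "M = M'"
  proof (rule multiset_eqI)
   fix x
   consider "x = 1 \<or> x = - 1" | "x \<noteq> 1" "x \<noteq> - 1" "x \<in># M" | "x \<noteq> 1" "x \<noteq> - 1" "x \<in># M'" | "x \<notin># M" "x \<notin># M'" by blast
   then show "count M x = count M' x"
   proof cases
    case 1 then show ?thesis using e unfolding spec_datum_def by (auto split: if_splits)
   next
    case 2 then show ?thesis using imp[OF M M' e] by simp
   next
    case 3 then show ?thesis using imp[OF M' M e[symmetric]] by simp
   next
    case 4 then show ?thesis by (simp add: not_in_iff)
   qed
  qed
 qed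
next
 show "spec_datum n ` spectra n = TCs n q \<iota>"
 proof (intro equalityI subsetI)
  fix d assume "d \<in> spec_datum n ` spectra n"
  then obtain M where M: "size M = n" "image_mset inverse M = M" "0 \<notin># M" "prod_mset M = 1" "image_mset (\<lambda>z. z ^ q) M = M"
   and d: "d = spec_datum n M" unfolding spectra_def by blast
  define A where "A = orb ` (set_mset M - {1, - 1})"
  define N where "N \<alpha> = count M (SOME x. x \<in># M \<and> orb x = \<alpha>)" for \<alpha>
  have N: "N (orb x) = count M x" if "x \<in># M" for x
  proof -
   have "(SOME y. y \<in># M \<and> orb y = orb x) \<in># M \<and> orb (SOME y. y \<in># M \<and> orb y = orb x) = orb x"
    by (rule someI[of _ x]) (use that in simp)
   then show ?thesis unfolding N_def using count_orb[OF M(2,5)] by blast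
  qed
  have A: "A \<subseteq> hat_orbits q - {orb 1, orb (- 1)}"
  proof
   fix \<alpha> assume "\<alpha> \<in> A"
   then obtain x where x: "x \<in># M" "x \<noteq> 1" "x \<noteq> - 1" "\<alpha> = orb x" unfolding A_def by blast
   have x0: "x \<noteq> 0" using x M(3) by auto
   then show "\<alpha> \<in> hat_orbits q - {orb 1, orb (- 1)}" unfolding hat_orbits_orb x(4) using x orb_special(3,4)[OF x0] by auto
  qed
  have cN: "count M x = (if orb x \<in> A then N (orb x) else 0)" if x: "x \<noteq> 0" "x \<noteq> 1" "x \<noteq> - 1" for x
  proof (cases "x \<in># M")
   case True
   then have "orb x \<in> A" unfolding A_def using x by blast
   then show ?thesis using N[OF True] by simp
  next
   case False
   have "orb x \<notin> A"
   proof
    assume "orb x \<in> A"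
    then obtain y where y: "y \<in># M" "orb x = orb y" unfolding A_def by blast
    then have "count M x = count M y" using count_orb[OF M(2,5)] by blast
    then show False using y(1) False by (simp flip: count_greater_zero_iff)
   qed
   then show ?thesis using False by (simp add: not_in_iff)
  qed
  have fin: "finite A" unfolding A_def by simp
  have s: "n = count M 1 + count M (- 1) + (\<Sum>\<alpha>\<in>A. 2 * N \<alpha> * card \<alpha>)"
   using size_by_orbits[OF M(3) fin A cN] M(1) by simp
  also have "(\<Sum>\<alpha>\<in>A. 2 * N \<alpha> * card \<alpha>) = 2 * (\<Sum>\<alpha>\<in>A. N \<alpha> * card \<alpha>)" by (simp add: sum_distrib_left mult.assoc)
  finally have par: "count M (if odd n then 1 else - 1) mod 2 = n mod 2"
   using spectra_parity[OF M(1-3)] M(4) by blast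
  have D: "(\<lambda>x. (count M x, orb x)) ` (set_mset M - {1, - 1}) = (\<lambda>\<alpha>. (N \<alpha>, \<alpha>)) ` A"
   unfolding A_def image_image using N by (intro image_cong) auto
  have pos: "\<forall>\<alpha>\<in>A. N \<alpha> > 0" unfolding A_def using N by auto
  have "count M (if odd n then 1 else - 1) + count M (if odd n then - 1 else 1) + (\<Sum>\<alpha>\<in>A. 2 * N \<alpha> * card \<alpha>) = n"
   using s by auto
  then show "d \<in> TCs n q \<iota>" unfolding d spec_datum_def D TCs_iff[OF \<iota>] using fin par pos A by blast
 next
  fix d assume d: "d \<in> TCs n q \<iota>"
  obtain np nm D where dd: "d = (np, nm, D)" by (cases d) auto
  obtain A N where A: "finite A" "D = (\<lambda>\<alpha>. (N \<alpha>, \<alpha>)) ` A" "np mod 2 = n mod 2"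
   "\<forall>\<alpha>\<in>A. N \<alpha> > 0" "A \<subseteq> hat_orbits q - {orb 1, orb (- 1)}" "np + nm + (\<Sum>\<alpha>\<in>A. 2 * N \<alpha> * card \<alpha>) = n"
   using d unfolding dd TCs_iff[OF \<iota>] by blast
  \<comment> \<open>the multiplicity function that the datum prescribes\<close>
  define c where "c x = (if x = 1 then if odd n then np else nm else if x = - 1 then if odd n then nm else np
   else if x \<noteq> 0 \<and> orb x \<in> A then N (orb x) else 0)" for x
  have "{x. c x > 0} \<subseteq> {1, - 1} \<union> (\<Union>\<alpha>\<in>A. fibre \<alpha>)" unfolding c_def fibre_def by auto
  then have "finite {x. c x > 0}" using A(1) fibre_finite finite_subset[of "{x. c x > 0}"] by blast
  then have c_abs: "count (Abs_multiset c) = c" using Abs_multiset_inverse[of c] by simp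
  define M where "M = Abs_multiset c"
  have cM: "count M = c" unfolding M_def by (rule c_abs)
  have M0: "0 \<notin># M" unfolding not_in_iff cM c_def by simp
  have inv1: "inverse x = 1 \<longleftrightarrow> x = 1" "inverse x = - 1 \<longleftrightarrow> x = - 1" for x :: 'k
   using inverse_eq_iff_eq[of x "- 1"] by simp_all
  have Mi: "image_mset inverse M = M"
   unfolding count_invariant_iff(1) cM c_def by (simp add: inv1 orb_inverse)
  have frob1: "x ^ q = 1 \<longleftrightarrow> x = 1" "x ^ q = - 1 \<longleftrightarrow> x = - 1" "x ^ q = 0 \<longleftrightarrow> x = 0" "orb (x ^ q) = orb x" for x
   using pow_one_iff[of x 1] orb_frob[of x 1] by simp_all
  have Mq: "image_mset (\<lambda>z. z ^ q) M = M"
   unfolding count_invariant_iff(2) cM c_def frob1 by simp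
  have s: "size M = count M 1 + count M (- 1) + (\<Sum>\<alpha>\<in>A. 2 * N \<alpha> * card \<alpha>)"
   by (rule size_by_orbits[OF M0 A(1,5)]) (simp add: cM c_def)
  have c1: "count M 1 = (if odd n then np else nm)" "count M (- 1) = (if odd n then nm else np)"
   unfolding cM c_def using one_neq_minus_one by auto
  have sn: "size M = n" using s c1 A(6) by auto
  have "n = count M 1 + count M (- 1) + 2 * (\<Sum>\<alpha>\<in>A. N \<alpha> * card \<alpha>)"
   using s sn by (simp add: sum_distrib_left mult.assoc)
  then have "prod_mset M = 1" using spectra_parity[OF sn Mi M0] c1 A(3) by auto
  then have "M \<in> spectra n" unfolding spectra_def using sn Mi M0 Mq by blast
  moreover have "spec_datum n M = d"
  proof -
   have "(\<lambda>x. (count M x, orb x)) ` (set_mset M - {1, - 1}) = D"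
   proof (intro equalityI subsetI)
    fix z assume "z \<in> (\<lambda>x. (count M x, orb x)) ` (set_mset M - {1, - 1})"
    then obtain x where x: "c x > 0" "x \<noteq> 1" "x \<noteq> - 1" "z = (c x, orb x)"
     unfolding cM[symmetric] count_greater_zero_iff by blast
    then show "z \<in> D" unfolding A(2) c_def by (auto split: if_splits)
   next
    fix z assume "z \<in> D"
    then obtain \<alpha> where \<alpha>: "\<alpha> \<in> A" "z = (N \<alpha>, \<alpha>)" unfolding A(2) by blast
    obtain x where x: "x \<noteq> 0" "\<alpha> = orb x" using \<alpha> A(5) unfolding hat_orbits_orb by blast
    have x1: "x \<noteq> 1" "x \<noteq> - 1" using x \<alpha> A(5) by auto
    have "count M x = N \<alpha>" unfolding cM c_def using x x1 \<alpha> by simp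
    moreover have "x \<in># M" using calculation A(4) \<alpha>(1) by (simp flip: count_greater_zero_iff)
    ultimately show "z \<in> (\<lambda>x. (count M x, orb x)) ` (set_mset M - {1, - 1})"
     unfolding \<alpha>(2) using x1 x(2) by (intro image_eqI[of _ _ x]) auto
   qed
   then show ?thesis unfolding dd spec_datum_def using c1 by simp
  qed
  ultimately show "d \<in> spec_datum n ` spectra n" by blast
 qed
qed

end

context frob_closure
begin

section \<open>The classification\<close>

text \<open>Trivial if 1 is not an eigenvalue, since then the determinant is not an independent invariant.\<close>

definition sign_of :: "'k mat \<Rightarrow> int" where
 "sign_of x = (if 1 \<in># eigs (asymmetry x) \<and> (\<forall>s\<in>Fq. s ^ 2 \<noteq> det x) then - 1 else 1)"

definition class_param :: "nat \<Rightarrow> 'k mat \<Rightarrow> int \<times> 'k datum" where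
 "class_param n x = (sign_of x, spec_datum n (eigs (asymmetry x)))"

lemma forms_spectra: assumes "x \<in> forms n" shows "eigs (asymmetry x) \<in> spectra n"
proof -
 have x: "x \<in> GLm n" "rat x" "ss (asymmetry x)" using assms by (auto simp: forms_def)
 have "size (eigs (asymmetry x)) = n" by (rule eigs_size) (use x in simp_all)
 then show ?thesis unfolding spectra_def
  using spectrum_asymmetry[OF x(1,3)] spectrum_rational[OF x] by blast
qed

lemma det_Fq: assumes "x \<in> forms n" shows "det x \<in> Fq" "det x \<noteq> 0"
 using assms rat_det[of x] GLm_det[of x n] unfolding forms_def by auto

lemma square_ratio: assumes x: "x \<in> Fq" "x \<noteq> 0" and y: "y \<in> Fq" "y \<noteq> 0"
 shows "(\<exists>s\<in>Fq. s \<noteq> 0 \<and> y = s ^ 2 * x) \<longleftrightarrow> ((\<exists>s\<in>Fq. s ^ 2 = x) \<longleftrightarrow> (\<exists>s\<in>Fq. s ^ 2 = y))"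
proof
 assume "\<exists>s\<in>Fq. s \<noteq> 0 \<and> y = s ^ 2 * x"
 then obtain s where s: "s \<in> Fq" "s \<noteq> 0" "y = s ^ 2 * x" by blast
 show "(\<exists>s\<in>Fq. s ^ 2 = x) \<longleftrightarrow> (\<exists>s\<in>Fq. s ^ 2 = y)"
 proof
  assume "\<exists>s\<in>Fq. s ^ 2 = x"
  then obtain t where "t \<in> Fq" "t ^ 2 = x" by blast
  then have "s * t \<in> Fq" "(s * t) ^ 2 = y" using s by (auto simp: power_mult_distrib)
  then show "\<exists>s\<in>Fq. s ^ 2 = y" by blast
 next
  assume "\<exists>s\<in>Fq. s ^ 2 = y"
  then obtain t where "t \<in> Fq" "t ^ 2 = y" by blast
  then have "t / s \<in> Fq" "(t / s) ^ 2 = x" using s by (auto simp: power_divide)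
  then show "\<exists>s\<in>Fq. s ^ 2 = x" by blast
 qed
next
 assume e: "(\<exists>s\<in>Fq. s ^ 2 = x) \<longleftrightarrow> (\<exists>s\<in>Fq. s ^ 2 = y)"
 have "\<exists>t\<in>Fq. t ^ 2 = x * y"
 proof (cases "\<exists>s\<in>Fq. s ^ 2 = x")
  case True
  then obtain s t where "s \<in> Fq" "s ^ 2 = x" "t \<in> Fq" "t ^ 2 = y" using e by blast
  then have "s * t \<in> Fq" "(s * t) ^ 2 = x * y" by (auto simp: power_mult_distrib)
  then show ?thesis by blast
 next
  case False
  then show ?thesis using e nonsquare_mult[OF x _ y] by blast
 qed
 then obtain t where t: "t \<in> Fq" "t ^ 2 = x * y" by blast
 have "t / x \<in> Fq" using t x by (simp add: power_divide)
 moreover have "t \<noteq> 0" using t x y by auto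
 then have "t / x \<noteq> 0" using x by simp
 moreover have "(t / x) ^ 2 * x = y" using t x by (simp add: power_divide power2_eq_square)
 ultimately show "\<exists>s\<in>Fq. s \<noteq> 0 \<and> y = s ^ 2 * x" by (intro bexI[of _ "t / x"]) auto
qed

lemma class_param_eq_iff: assumes n: "n < q" and \<iota>: "\<iota> ^ 2 = (- 1 :: 'k)" and x: "x \<in> forms n" and x': "x' \<in> forms n"
 shows "class_param n x = class_param n x' \<longleftrightarrow> cg n True x x'"
proof -
 have X: "x \<in> GLm n" "rat x" "ss (asymmetry x)" using x by (auto simp: forms_def)
 have X': "x' \<in> GLm n" "rat x'" "ss (asymmetry x')" using x' by (auto simp: forms_def)
 have ratio: "(\<exists>s\<in>Fq. s \<noteq> 0 \<and> det x' = s ^ 2 * det x) \<longleftrightarrow> ((\<exists>s\<in>Fq. s ^ 2 = det x) \<longleftrightarrow> (\<exists>s\<in>Fq. s ^ 2 = det x'))"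
  by (rule square_ratio[OF det_Fq[OF x] det_Fq[OF x']])
 have inj: "spec_datum n (eigs (asymmetry x)) = spec_datum n (eigs (asymmetry x')) \<longleftrightarrow> eigs (asymmetry x) = eigs (asymmetry x')"
  by (rule inj_on_eq_iff[OF bij_betw_imp_inj_on[OF spec_datum_bij[OF \<iota>]] forms_spectra[OF x] forms_spectra[OF x']])
 show ?thesis
 proof
  assume "class_param n x = class_param n x'"
  then have e: "sign_of x = sign_of x'" "eigs (asymmetry x) = eigs (asymmetry x')"
   unfolding class_param_def using inj by auto
  have "1 \<in># eigs (asymmetry x) \<longrightarrow> (\<exists>s\<in>Fq. s \<noteq> 0 \<and> det x' = s ^ 2 * det x)"
   unfolding ratio using e unfolding sign_of_def by (auto split: if_splits)
  then show "cg n True x x'" using fq_class[of n x x'] n X X' e(2) by blast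
 next
  assume c: "cg n True x x'"
  have e: "eigs (asymmetry x') = eigs (asymmetry x)" by (rule cg_eigs[OF c X(1)])
  have "(\<exists>s\<in>Fq. s ^ 2 = det x) \<longleftrightarrow> (\<exists>s\<in>Fq. s ^ 2 = det x')" using cg_det[OF c X(1)] unfolding ratio .
  then show "class_param n x = class_param n x'" unfolding class_param_def sign_of_def e by auto
 qed
qed

lemma class_param_image: assumes \<iota>: "\<iota> ^ 2 = (- 1 :: 'k)"
 shows "class_param n ` forms n = class_parameters n q \<iota>"
proof (intro equalityI subsetI)
 have allowed: "(even n \<and> nm > 0 \<or> odd n \<and> np > 0) \<longleftrightarrow> 1 \<in># M" if "spec_datum n M = (np, nm, D)" for np nm D M
  using that unfolding spec_datum_def by (cases "odd n") (auto simp flip: count_greater_zero_iff)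
 have bij: "spec_datum n ` spectra n = TCs n q \<iota>" using spec_datum_bij[OF \<iota>] by (simp add: bij_betw_def)
 {
  fix c assume "c \<in> class_param n ` forms n"
  then obtain x where x: "x \<in> forms n" "c = class_param n x" by blast
  obtain np nm D where d: "spec_datum n (eigs (asymmetry x)) = (np, nm, D)" by (metis prod_cases3)
  have "(np, nm, D) \<in> TCs n q \<iota>" unfolding bij[symmetric] d[symmetric] using forms_spectra[OF x(1)] by blast
  moreover have "sign_of x = - 1 \<longrightarrow> even n \<and> nm > 0 \<or> odd n \<and> np > 0"
   unfolding allowed[OF d] sign_of_def by auto
  moreover have "sign_of x \<in> {1, - 1}" unfolding sign_of_def by auto
  ultimately show "c \<in> class_parameters n q \<iota>" unfolding x(2) class_param_def d class_parameters_def by blast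
 next
  fix c assume "c \<in> class_parameters n q \<iota>"
  then obtain \<eta> np nm D where c: "c = (\<eta>, (np, nm, D))" "\<eta> \<in> {1, - 1}" "(np, nm, D) \<in> TCs n q \<iota>"
   "\<eta> = - 1 \<longrightarrow> even n \<and> nm > 0 \<or> odd n \<and> np > 0" unfolding class_parameters_def by blast
  obtain M where M: "M \<in> spectra n" "spec_datum n M = (np, nm, D)" using c(3) unfolding bij[symmetric] by force
  have M': "size M = n" "image_mset inverse M = M" "0 \<notin># M" "prod_mset M = 1" "image_mset (\<lambda>z. z ^ q) M = M"
   using M(1) unfolding spectra_def by auto
  obtain x where x: "x \<in> GLm n" "rat x" "ss (asymmetry x)" "eigs (asymmetry x) = M"
   using exists_form[OF M'(2-5)] unfolding M'(1) by blast
  have xf: "x \<in> forms n" using x unfolding forms_def by blast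
  have "\<exists>y\<in>forms n. eigs (asymmetry y) = M \<and> sign_of y = \<eta>"
  proof (cases "1 \<in># M")
   case False
   then have "\<eta> = 1" using c(2,4) allowed[OF M(2)] by auto
   moreover have "sign_of x = 1" unfolding sign_of_def x(4) using False by simp
   ultimately show ?thesis using xf x(4) by blast
  next
   case True
   obtain \<delta> where \<delta>: "\<delta> \<in> Fq" "\<delta> \<noteq> 0" "\<forall>s\<in>Fq. s ^ 2 \<noteq> \<delta>" using ex_nonsquare by blast
   obtain y s where y: "y \<in> GLm n" "rat y" "ss (asymmetry y)" "eigs (asymmetry y) = M"
    and s: "s \<in> Fq" "s \<noteq> 0" "det y = \<delta> * (s ^ 2 * det x)"
    using exists_form_det[OF x(1-3) _ \<delta>(1,2)] True x(4) by auto
   have yf: "y \<in> forms n" using y unfolding forms_def by blast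
   have ne: "\<not> (\<exists>t\<in>Fq. t \<noteq> 0 \<and> det y = t ^ 2 * det x)"
   proof
    assume "\<exists>t\<in>Fq. t \<noteq> 0 \<and> det y = t ^ 2 * det x"
    then obtain t where t: "t \<in> Fq" "det y = t ^ 2 * det x" by blast
    have "\<delta> * s ^ 2 = t ^ 2" using t(2) s(3) det_Fq(2)[OF xf] by simp
    then have "(t / s) ^ 2 = \<delta>" using s(2) by (simp add: power_divide field_simps)
    moreover have "t / s \<in> Fq" using t(1) s(1) by (simp add: power_divide)
    ultimately show False using \<delta>(3) by blast
   qed
   then have "sign_of x \<noteq> sign_of y"
    unfolding square_ratio[OF det_Fq[OF xf] det_Fq[OF yf]] sign_of_def x(4) y(4) using True by auto
   moreover have "sign_of x \<in> {1, - 1}" "sign_of y \<in> {1, - 1}" unfolding sign_of_def by auto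
   ultimately have "sign_of x = \<eta> \<or> sign_of y = \<eta>" using c(2) by auto
   then show ?thesis using xf yf x(4) y(4) by blast
  qed
  then obtain y where y: "y \<in> forms n" "eigs (asymmetry y) = M" "sign_of y = \<eta>" by blast
  have "c = class_param n y" unfolding class_param_def y(2,3) M(2) c(1) ..
  then show "c \<in> class_param n ` forms n" using y(1) by blast
 }
qed

end

theorem proposition6p2p2:
 fixes p e q n :: nat
  and \<iota> :: "'k::alg_closed_field"
  and Gbar :: "('k mat \<times> bool) monoid"
  and s :: "'k mat \<times> bool"
 assumes "prime p" and "odd p"
  and "e > 0" and "q = p ^ e" and "q > n"
  and "CHAR('k) = p"
  and algebraic_over_Fq:
   "\<forall>x::'k. \<exists>f::'k poly. f \<noteq> 0 \<and> (\<forall>m. coeff f m \<in> {a. a ^ q = a}) \<and> poly f x = 0"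
  and "\<iota>\<^sup>2 = - 1"
  and "is_extension n Gbar s"
 shows "\<exists>\<Phi>. bij_betw \<Phi> (qss_classes n q Gbar s) (class_parameters n q \<iota>)"
proof -
 interpret frob_closure p e q "TYPE('k)"
  by unfold_locales (use assms in auto)
 obtain M t where M: "form_mat n M" "Gbar = semidirect2 (GL n) (twisted_inverse_transpose n M)"
  and t: "s = (t, True)" "t \<in> GLm n" "rat t"
 proof (rule disjE[OF assms(9)[unfolded is_extension_def]])
  assume "Gbar = semidirect2 (GL n) (sigma_aut n) \<and> s = (1\<^sub>m n, True)"
  then show thesis
   using that[OF form_mat_scriptJ _ _ one_GLm rat_one] unfolding sigma_aut_def by blast
 next
  assume "even n \<and> Gbar = semidirect2 (GL n) (sigma'_aut n) \<and> s = (t0_mat n, True)"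
  then show thesis
   using that[OF form_mat_J _ _ t0_GLm rat_t0] unfolding sigma'_aut_def by blast
 qed
 show ?thesis
  unfolding class_param_image[OF assms(8), of n, symmetric]
  by (rule class_bijection[OF M(1) t M(2)]) (rule class_param_eq_iff[OF assms(5,8)])
qed

end
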